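(* Let $U,V$ be real Banach spaces and let $\mathfrak{F}\in\mathcal{C}^1(\mathbb{R}\times U,V)$ satisfy: (F1) $\mathfrak{F}$ is orientable, i.e. $D_u\mathfrak{F}:\mathbb{R}\times U\to\Phi_0(U,V)$ is an orientable map; (F2) $\mathfrak{F}(\lambda,0)=0$ for all $\lambda\in\mathbb{R}$; (F3) $D_u\mathfrak{F}(\lambda,u)\in\Phi_0(U,V)$ for all $(\lambda,u)\in\mathbb{R}\times U$; (F4) $\mathfrak{F}$ is proper on bounded and closed subsets of $\mathbb{R}\times U$. Put $\mathfrak{L}(\lambda):=D_u\mathfrak{F}(\lambda,0)$, let $\mathcal{J}=\{J_n\}_{n=r}^s$ be an admissible ordered family of intervals for $\Sigma(\mathfrak{L})$, and suppose that $\mathfrak{C}$ is a bounded component (connected component) of the set of non-trivial solutions $\mathcal{S}_{\mathcal{J}}$. Then $$\sum_{n\in\mathcal{B}(\mathfrak{C})}\mathcal{P}(I_n)=0,$$ where $\mathcal{P}$ is the $\mathcal{J}$-parity map.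
   Context: $\Phi_0(U,V)$: bounded linear Fredholm operators of index zero; $GL(U,V)$: topological isomorphisms; $\Sigma(\mathfrak{L})=\{\lambda\in\mathbb{R}:\mathfrak{L}(\lambda)\notin GL(U,V)\}$. Parity: for a continuous $\mathfrak{L}:[a,b]\to\Phi_0(U,V)$ with $\mathfrak{L}(a),\mathfrak{L}(b)\in GL(U,V)$, choose a parametrix, i.e. a continuous $\mathfrak{P}:[a,b]\to GL(V,U)$ with $\mathfrak{P}(\lambda)\mathfrak{L}(\lambda)-I_U$ compact for all $\lambda$ (it always exists), and put $\sigma(\mathfrak{L},[a,b])=\deg_{LS}(\mathfrak{P}(a)\mathfrak{L}(a))\cdot\deg_{LS}(\mathfrak{P}(b)\mathfrak{L}(b))\in\{-1,1\}$, with $\deg_{LS}(T)$ the Leray--Schauder degree of $T$ on a small ball centred at $0$; this is independent of $\mathfrak{P}$. Orientability: a continuous $h:X\to\Phi_0(U,V)$, $X$ path-connected, is orientable if there is $\varepsilon:\{x: h(x)\in GL(U,V)\}\to\{-1,1\}$ with $\sigma(h\circ\gamma,[a,b])=\varepsilon(\gamma(a))\varepsilon(\gamma(b))$ for every continuous $\gamma:[a,b]\to X$ with $h(\gamma(a)),h(\gamma(b))\in GL(U,V)$. Admissible ordered family: a non-empty locally finite family $\mathcal{J}=\{J_n\}_{n=r}^s$ ($r\leq s$ in $\mathbb{Z}\cup\{\pm\infty\}$, $n\in\mathbb{Z}\cap[r,s]$) of disjoint non-empty open intervals of $\mathbb{R}$ with $J_n\cap\Sigma(\mathfrak{L})=\emptyset$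 for all $n$ and $J_{n-1}<J_n$ (each point of $J_{n-1}$ is less than each point of $J_n$) for $n\in\mathbb{Z}\cap[r+1,s]$. Set $I_n:=[\sup J_{n-1},\inf J_n]$ for $n\in\mathbb{Z}\cap[r+1,s]$ (possibly a single point). $\mathcal{J}$-parity map: choose $\lambda_n\in J_n$ for each $n$ and define signs $a_n\in\{-1,1\}$ by $a_r=1$ and $a_n=a_{n-1}\cdot\sigma(\mathfrak{L},[\lambda_{n-1},\lambda_n])$ for $n\in\mathbb{Z}\cap[r+1,s]$ (if $r=-\infty$, the sequence is any one satisfying this recursion; it is unique up to a global sign). Then $\mathcal{P}(I_n):=\frac{a_n-a_{n-1}}{2}\in\{-1,0,1\}$. Non-trivial solutions: $\mathcal{S}_{\mathcal{J}}:=\big(\mathfrak{F}^{-1}(0)\cap[\mathbb{R}\times(U\setminus\{0\})]\big)\cup\big[(\mathbb{R}\setminus\bigcup_{n=r}^sJ_n)\times\{0\}\big]$. For a component $\mathfrak{C}$ of $\mathcal{S}_{\mathcal{J}}$, $\mathcal{B}(\mathfrak{C}):=\{n\in\mathbb{Z}\cap[r+1,s]:(I_n\times\{0\})\cap\mathfrak{C}\neq\emptyset\}$; this set is finite when $\mathfrak{C}$ is bounded. *)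

theory Defs
  imports "HOL-Analysis.Analysis" "HOL-Homology.Homology" "HOL-Library.Extended"
begin

subsection \<open>Fredholm operators of index zero, isomorphisms, compact operators\<close>

definition GL :: "('a::banach \<Rightarrow>\<^sub>L 'b::banach) set" where
  "GL = {T. \<exists>S. S o\<^sub>L T = id_blinfun \<and> T o\<^sub>L S = id_blinfun}"

definition ker_op :: "('a::banach \<Rightarrow>\<^sub>L 'b::banach) \<Rightarrow> 'a set" where
  "ker_op T = {x. blinfun_apply T x = 0}"

definition finite_dimensional :: "'a::real_vector set \<Rightarrow> bool" where
  "finite_dimensional W \<longleftrightarrow> (\<exists>B. finite B \<and> span B = W)"

definition finite_codimensional :: "'a::real_vector set \<Rightarrow> bool" where
  "finite_codimensional R \<longleftrightarrow> (\<exists>B. finite B \<and> span (R \<union> B) = UNIV)"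

text \<open>The dimension of the quotient by the subspace \<open>R\<close>: the least size of a spanning set
  modulo \<open>R\<close>.\<close>

definition codim :: "'a::real_vector set \<Rightarrow> nat" where
  "codim R = (LEAST n. \<exists>B. finite B \<and> card B = n \<and> span (R \<union> B) = UNIV)"

definition fredholm :: "('a::banach \<Rightarrow>\<^sub>L 'b::banach) \<Rightarrow> bool" where
  "fredholm T \<longleftrightarrow> finite_dimensional (ker_op T) \<and> closed (range (blinfun_apply T)) \<and>
     finite_codimensional (range (blinfun_apply T))"

definition fredholm_index :: "('a::banach \<Rightarrow>\<^sub>L 'b::banach) \<Rightarrow> int" where
  "fredholm_index T = int (dim (ker_op T)) - int (codim (range (blinfun_apply T)))"

definition Fredholm0 :: "('a::banach \<Rightarrow>\<^sub>L 'b::banach) set" where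
  "Fredholm0 = {T. fredholm T \<and> fredholm_index T = 0}"

definition compact_op :: "('a::banach \<Rightarrow>\<^sub>L 'b::banach) \<Rightarrow> bool" where
  "compact_op K \<longleftrightarrow> (\<forall>S. bounded S \<longrightarrow> compact (closure (blinfun_apply K ` S)))"

definition spectrum_family :: "(real \<Rightarrow> ('a::banach \<Rightarrow>\<^sub>L 'b::banach)) \<Rightarrow> real set" where
  "spectrum_family L = {t. L t \<notin> GL}"


subsection \<open>Leray--Schauder degree on balls centred at the origin\<close>

text \<open>Let \<open>b 0, \<dots>, b p\<close> be a basis of a subspace \<open>W\<close> and \<open>g\<close> a self-map of \<open>W\<close> without zeros on
  the sphere of radius \<open>r\<close>. In the coordinates given by \<open>b\<close>, \<open>boundary_sphere_map\<close> is the map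
  \<open>g / \<bar>g\<bar>\<close> on that sphere, which is identified with the Euclidean unit sphere by radial
  projection.\<close>

definition lin_comb :: "(nat \<Rightarrow> 'a::real_vector) \<Rightarrow> nat \<Rightarrow> (nat \<Rightarrow> real) \<Rightarrow> 'a" where
  "lin_comb b p x = (\<Sum>i\<le>p. x i *\<^sub>R b i)"

definition coords :: "(nat \<Rightarrow> 'a::real_vector) \<Rightarrow> nat \<Rightarrow> 'a \<Rightarrow> nat \<Rightarrow> real" where
  "coords b p v = (\<lambda>i. if i \<le> p then representation (b ` {..p}) v (b i) else 0)"

definition boundary_sphere_map ::
  "(nat \<Rightarrow> 'a::real_normed_vector) \<Rightarrow> nat \<Rightarrow> real \<Rightarrow> ('a \<Rightarrow> 'a) \<Rightarrow> (nat \<Rightarrow> real) \<Rightarrow> nat \<Rightarrow> real"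
  where
  "boundary_sphere_map b p r g x =
     (let v = lin_comb b p x; y = coords b p (g ((r / norm v) *\<^sub>R v))
      in (\<lambda>i. y i / sqrt (\<Sum>j\<le>p. (y j)\<^sup>2)))"

text \<open>The Brouwer degree at \<open>0\<close> of \<open>g\<close> on \<open>W \<inter> ball 0 r\<close>, i.e. the degree of the normalised
  boundary map; it does not depend on the basis.\<close>

definition brouwer_degree_ball :: "'a::real_normed_vector set \<Rightarrow> real \<Rightarrow> ('a \<Rightarrow> 'a) \<Rightarrow> int" where
  "brouwer_degree_ball W r g =
     (if W = {0} then 1
      else THE d. \<exists>p b. inj_on b {..p} \<and> independent (b ` {..p}) \<and> span (b ` {..p}) = W \<and>
                        d = Brouwer_degree2 p (boundary_sphere_map b p r g))"

text \<open>The Leray--Schauder degree at \<open>0\<close> of the compact perturbation of the identity \<open>f\<close> on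
  \<open>ball 0 r\<close>: the compact map \<open>\<lambda>x. x - f x\<close> is approximated by a continuous map \<open>k\<close> into a
  finite-dimensional subspace \<open>W\<close>, closer than the distance of \<open>0\<close> to the image of the sphere.\<close>

definition LS_degree_ball :: "('a::banach \<Rightarrow> 'a) \<Rightarrow> real \<Rightarrow> int" where
  "LS_degree_ball f r =
     (THE d. \<exists>\<delta>>0. (\<forall>x\<in>sphere 0 r. \<delta> \<le> norm (f x)) \<and>
        (\<exists>W k. finite_dimensional W \<and> continuous_on (cball 0 r) k \<and> k ` cball 0 r \<subseteq> W \<and>
               (\<forall>x\<in>cball 0 r. norm ((x - f x) - k x) < \<delta>) \<and>
               d = brouwer_degree_ball W r (\<lambda>x. x - k x)))"

definition deg_LS :: "('a::banach \<Rightarrow>\<^sub>L 'a) \<Rightarrow> int" where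
  "deg_LS T = (THE d. \<forall>\<^sub>F r in at_right 0. LS_degree_ball (blinfun_apply T) r = d)"


subsection \<open>Parity and orientability\<close>

definition parametrix ::
  "(real \<Rightarrow> ('a::banach \<Rightarrow>\<^sub>L 'b::banach)) \<Rightarrow> real \<Rightarrow> real \<Rightarrow> (real \<Rightarrow> ('b \<Rightarrow>\<^sub>L 'a)) \<Rightarrow> bool" where
  "parametrix L a b P \<longleftrightarrow> continuous_on {a..b} P \<and>
     (\<forall>t\<in>{a..b}. P t \<in> GL \<and> compact_op ((P t o\<^sub>L L t) - id_blinfun))"

definition path_parity :: "(real \<Rightarrow> ('a::banach \<Rightarrow>\<^sub>L 'b::banach)) \<Rightarrow> real \<Rightarrow> real \<Rightarrow> int" where
  "path_parity L a b =
     (THE d. \<exists>P. parametrix L a b P \<and> d = deg_LS (P a o\<^sub>L L a) * deg_LS (P b o\<^sub>L L b))"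

definition orientable_on :: "'x::topological_space set \<Rightarrow> ('x \<Rightarrow> ('a::banach \<Rightarrow>\<^sub>L 'b::banach)) \<Rightarrow> bool"
  where
  "orientable_on X h \<longleftrightarrow> path_connected X \<and> continuous_on X h \<and> h ` X \<subseteq> Fredholm0 \<and>
     (\<exists>\<epsilon> :: 'x \<Rightarrow> int. (\<forall>x\<in>X. h x \<in> GL \<longrightarrow> \<epsilon> x \<in> {-1, 1}) \<and>
        (\<forall>a b \<gamma>. a < b \<and> continuous_on {a..b} \<gamma> \<and> \<gamma> ` {a..b} \<subseteq> X \<and>
                 h (\<gamma> a) \<in> GL \<and> h (\<gamma> b) \<in> GL \<longrightarrow>
                 path_parity (h \<circ> \<gamma>) a b = \<epsilon> (\<gamma> a) * \<epsilon> (\<gamma> b)))"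


subsection \<open>Nonlinear maps on \<open>\<real> \<times> U\<close>\<close>

definition C1_map :: "('a::real_normed_vector \<Rightarrow> 'b::real_normed_vector) \<Rightarrow> bool" where
  "C1_map F \<longleftrightarrow> (\<exists>F' :: 'a \<Rightarrow> ('a \<Rightarrow>\<^sub>L 'b). continuous_on UNIV F' \<and>
     (\<forall>x. (F has_derivative blinfun_apply (F' x)) (at x)))"

definition D_u :: "(real \<times> 'a::banach \<Rightarrow> 'b::banach) \<Rightarrow> real \<times> 'a \<Rightarrow> ('a \<Rightarrow>\<^sub>L 'b)" where
  "D_u F = (\<lambda>(t, u). THE D. ((\<lambda>w. F (t, w)) has_derivative blinfun_apply D) (at u))"

definition proper_on_bounded_closed ::
  "('a::real_normed_vector \<Rightarrow> 'b::real_normed_vector) \<Rightarrow> bool" where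
  "proper_on_bounded_closed F \<longleftrightarrow>
     (\<forall>M. bounded M \<and> closed M \<longrightarrow> (\<forall>K. compact K \<longrightarrow> compact {x \<in> M. F x \<in> K}))"


subsection \<open>Ordered families of intervals and the parity map\<close>

definition indices :: "int extended \<Rightarrow> int extended \<Rightarrow> int set" where
  "indices r s = {n. r \<le> Fin n \<and> Fin n \<le> s}"

definition admissible_family ::
  "(real \<Rightarrow> ('a::banach \<Rightarrow>\<^sub>L 'b::banach)) \<Rightarrow> int extended \<Rightarrow> int extended \<Rightarrow> (int \<Rightarrow> real set) \<Rightarrow> bool"
  where
  "admissible_family L r s J \<longleftrightarrow>
     r \<le> s \<and> indices r s \<noteq> {} \<and>
     locally_finite_in euclidean (J ` indices r s) \<and>
     disjoint_family_on J (indices r s) \<and>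
     (\<forall>n\<in>indices r s. J n \<noteq> {} \<and> open (J n) \<and> is_interval (J n) \<and> J n \<inter> spectrum_family L = {}) \<and>
     (\<forall>n\<in>indices (r + 1) s. \<forall>x\<in>J (n - 1). \<forall>y\<in>J n. x < y)"

definition gap :: "(int \<Rightarrow> real set) \<Rightarrow> int \<Rightarrow> real set" where
  "gap J n = {Sup (J (n - 1))..Inf (J n)}"

text \<open>\<open>a\<close> is a sequence of signs obtained from the base points \<open>\<mu> n \<in> J n\<close>; it is normalised only
  if the family has a first interval, and is otherwise determined up to a global sign.\<close>

definition parity_signs ::
  "(real \<Rightarrow> ('a::banach \<Rightarrow>\<^sub>L 'b::banach)) \<Rightarrow> int extended \<Rightarrow> int extended \<Rightarrow> (int \<Rightarrow> real set) \<Rightarrow>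
   (int \<Rightarrow> real) \<Rightarrow> (int \<Rightarrow> int) \<Rightarrow> bool" where
  "parity_signs L r s J \<mu> a \<longleftrightarrow>
     (\<forall>n\<in>indices r s. \<mu> n \<in> J n \<and> a n \<in> {-1, 1}) \<and>
     (\<forall>m. r = Fin m \<longrightarrow> a m = 1) \<and>
     (\<forall>n\<in>indices (r + 1) s. a n = a (n - 1) * path_parity L (\<mu> (n - 1)) (\<mu> n))"

definition parity_map :: "(int \<Rightarrow> int) \<Rightarrow> int \<Rightarrow> real" where
  "parity_map a n = real_of_int (a n - a (n - 1)) / 2"


subsection \<open>Non-trivial solutions\<close>

definition nontrivial_solutions ::
  "(real \<times> 'a::banach \<Rightarrow> 'b::banach) \<Rightarrow> int extended \<Rightarrow> int extended \<Rightarrow> (int \<Rightarrow> real set) \<Rightarrow>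
   (real \<times> 'a) set" where
  "nontrivial_solutions F r s J =
     (F -` {0} \<inter> (UNIV \<times> (UNIV - {0}))) \<union> ((UNIV - (\<Union>n\<in>indices r s. J n)) \<times> {0})"

definition bifurcation_indices ::
  "int extended \<Rightarrow> int extended \<Rightarrow> (int \<Rightarrow> real set) \<Rightarrow> (real \<times> 'a::banach) set \<Rightarrow> int set" where
  "bifurcation_indices r s J C = {n \<in> indices (r + 1) s. (gap J n \<times> {0}) \<inter> C \<noteq> {}}"

lemma indices_succ: "n \<in> indices (r + 1) s \<Longrightarrow> n \<in> indices r s \<and> n - 1 \<in> indices r s"
  by (cases r; cases s) (auto simp: indices_def one_extended_def)

lemma admissible_family_less:
  assumes adm: "admissible_family L r s J"
    and "m \<in> indices r s" "n \<in> indices r s" "m < n" "x \<in> J m" "y \<in> J n"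
  shows "x < y"
proof -
  have "n \<in> indices r s \<longrightarrow> (\<forall>y\<in>J n. x < y)"
    using \<open>m < n\<close>
  proof (induction n rule: int_gr_induct)
    case base
    have "m + 1 \<in> indices r s \<Longrightarrow> m + 1 \<in> indices (r + 1) s"
      using assms(2) by (cases r; cases s) (auto simp: indices_def one_extended_def)
    then show ?case
      using adm \<open>x \<in> J m\<close> by (fastforce simp: admissible_family_def)
  next
    case (step i)
    show ?case
    proof (intro impI ballI)
      fix y assume i1: "i + 1 \<in> indices r s" and y: "y \<in> J (i + 1)"
      have i: "i \<in> indices r s" "i + 1 \<in> indices (r + 1) s"
        using assms(2) i1 step.hyps
        by (cases r; cases s; auto simp: indices_def one_extended_def)+
      obtain z where z: "z \<in> J i"
        using adm i(1) unfolding admissible_family_def by (meson all_not_in_conv)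
      have "x < z" using step.IH i(1) z by blast
      moreover have "z < y" using adm i(2) z y by (fastforce simp: admissible_family_def)
      ultimately show "x < y" by simp
    qed
  qed
  then show ?thesis using assms by blast
qed

text \<open>Sums over \<open>bifurcation_indices r s J C\<close> with bounded \<open>C\<close> are genuine finite sums.\<close>

lemma finite_bifurcation_indices:
  assumes adm: "admissible_family L r s J" and "bounded C"
  shows "finite (bifurcation_indices r s J C)"
proof -
  let ?I = "indices r s" and ?B = "bifurcation_indices r s J C"
  obtain R where R: "\<And>p. p \<in> C \<Longrightarrow> norm p \<le> R"
    using \<open>bounded C\<close> by (auto simp: bounded_iff)
  have fst_bd: "\<bar>t\<bar> \<le> R" if "(t, u) \<in> C" for t u
    using norm_fst_le[of t u] R[OF that] by simp
  have ne: "J n \<noteq> {}" if "n \<in> ?I" for n using adm that by (auto simp: admissible_family_def)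
  have inj: "inj_on J ?I"
    using adm ne unfolding admissible_family_def disjoint_family_on_def inj_on_def
    by (metis Int_absorb)
  define M where "M = {n \<in> ?I. J n \<inter> {-R..R} \<noteq> {}}"
  have "\<forall>x. \<exists>V. open V \<and> x \<in> V \<and> finite {A \<in> J ` ?I. A \<inter> V \<noteq> {}}"
    using adm by (auto simp: admissible_family_def locally_finite_in_def)
  then obtain V where V: "\<And>x. open (V x)" "\<And>x. x \<in> V x"
      "\<And>x. finite {A \<in> J ` ?I. A \<inter> V x \<noteq> {}}"
    by metis
  have cov: "{-R..R} \<subseteq> \<Union> (V ` {-R..R})" using V(2) by auto
  obtain D where D: "finite D" "{-R..R} \<subseteq> \<Union> (V ` D)"
    using compactE_image[of "{-R..R}" "{-R..R}" V] V(1) cov compact_Icc by metis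
  have "J ` M \<subseteq> (\<Union>x\<in>D. {A \<in> J ` ?I. A \<inter> V x \<noteq> {}})"
    using D(2) by (fastforce simp: M_def)
  then have "finite (J ` M)"
    using D(1) V(3) by (meson finite_UN_I finite_subset)
  moreover have "inj_on J M" using inj by (auto simp: M_def intro: inj_on_subset)
  ultimately have finM: "finite M" using finite_imageD by blast
  have key: "n \<in> M" if nm: "n \<in> ?B" "m \<in> ?B" "n < m" for n m
  proof -
    have n: "n \<in> ?I" "n - 1 \<in> ?I" and m: "m \<in> ?I" "m - 1 \<in> ?I"
      using nm indices_succ by (auto simp: bifurcation_indices_def)
    obtain t where t: "Inf (J n) \<ge> t" "\<bar>t\<bar> \<le> R"
      using nm(1) fst_bd by (fastforce simp: bifurcation_indices_def gap_def)
    obtain t' where t': "Sup (J (m - 1)) \<le> t'" "\<bar>t'\<bar> \<le> R"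
      using nm(2) fst_bd by (fastforce simp: bifurcation_indices_def gap_def)
    obtain y where y: "y \<in> J n" using ne n by auto
    obtain w where w: "w \<in> J (n - 1)" using ne n by auto
    obtain w' where w': "w' \<in> J m" using ne m by auto
    obtain z where z: "z \<in> J (m - 1)" using ne m by auto
    have "bdd_below (J n)"
      using admissible_family_less[OF adm n(2) n(1) _ w] by (intro bdd_belowI[of _ w]) force
    then have "t \<le> y" using t(1) cInf_lower[OF y] by linarith
    have bd: "bdd_above (J (m - 1))"
      using admissible_family_less[OF adm m(2) m(1) _ _ w'] by (intro bdd_aboveI[of _ w']) force
    have "y \<le> Sup (J (m - 1))"
    proof (cases "n = m - 1")
      case True
      then show ?thesis using cSup_upper[OF _ bd] y by auto
    next
      case False
      then have "y < z" using admissible_family_less[OF adm n(1) m(2) _ y z] nm(3) by simp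
      then show ?thesis using cSup_upper[OF z bd] by linarith
    qed
    then have "y \<in> {-R..R}" using t t' \<open>t \<le> y\<close> by auto
    then show ?thesis using y n by (auto simp: M_def)
  qed
  have "finite (?B - M)"
  proof (cases "?B - M = {}")
    case False
    then obtain n where "n \<in> ?B - M" by blast
    then have "?B - M \<subseteq> {n}" using key by (metis DiffD1 DiffD2 insertI1 linorder_neqE_linordered_idom subsetI)
    then show ?thesis using finite_subset by blast
  next
    case True
    then show ?thesis by (metis finite.emptyI)
  qed
  then show ?thesis using finM by (meson finite_Diff2)
qed

end

theory Submission
  imports Defs "HOL-Combinatorics.Permutations"
begin

text \<open>Let \<open>A\<close> be a compact open neighbourhood of \<open>C\<close> in the closed set of non-trivial solutions.
  Since \<open>\<real> \<times> U\<close> is contractible, the Fredholm family \<open>D\<^sub>uF\<close> has finite-rank corrections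
  \<open>B(\<lambda>, x)\<close>, depending continuously on the point, that make it invertible on a compact set of
  zeros. Solving \<open>F(\<lambda>, u) + B(\<lambda>, x)(u - x) = 0\<close> for \<open>u = k(\<lambda>, x)\<close> turns the zeros of \<open>F\<close> near
  that set into the fixed points of a compact map \<open>k\<close>, whose linearisation at \<open>(\<lambda>, 0)\<close> is
  \<open>x - P(\<lambda>) L(\<lambda>) x\<close> for a parametrix \<open>P\<close>; hence the index of the trivial solution is
  \<open>\<sigma>(\<lambda>) = deg (P(\<lambda>) L(\<lambda>))\<close>. On a bounded neighbourhood \<open>\<Omega>\<close> of \<open>A\<close> and the gaps in \<open>\<B>(C)\<close>, the degree
  of the slices is constant across those gaps; with a small ball around the axis removed it is
  constant across the remaining ones and vanishes far out. The difference of the two degrees is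
  \<open>\<sigma>\<close>, so \<open>\<Sum> \<sigma>(\<mu>\<^sub>n) - \<sigma>(\<mu>\<^sub>n\<^sub>-\<^sub>1) = 0\<close> over \<open>\<B>(C)\<close>, and \<open>a\<^sub>n = \<plusminus>\<sigma>(\<mu>\<^sub>n)\<close> with a
  fixed sign. The degree of finite-dimensional maps on slices is counted on Kuhn triangulations;
  for linear maps it agrees with the Brouwer degree because both are determined by a path of
  nonsingular matrices to a diagonal one.\<close>

subsection \<open>Brouwer degree and suspension\<close>

text \<open>The homological degree behind \<open>deg_LS\<close> is defined on balls only, while the
  slices of a neighbourhood of the component are arbitrary bounded sets whose shape changes with the
  parameter. A second degree is therefore counted on grids: as a sum over lattice points it is
  additive in the domain by construction, its homotopy invariance tolerates moving domains, and it
  has to be compared with the first one for invertible linear maps only. Signs at different base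
  points are comparable only if they come from one parametrix. This is why the correctors are
  constructed over a compact set that also contains the axis segment from the first to the last base
  point, and why an invertible family over a set of arbitrary shape is needed instead of one over an
  interval. The correcting operator is frozen at (\<lambda>, x) and acts on u - x, so it vanishes at
  u = x and no zeros are gained or lost. It is a combination of finitely many fixed finite-rank
  operators, because then it takes bounded sets into a compact set and properness yields compactness
  of k.\<close>

lemma Brouwer_degree2_suspension:
  assumes cmS: "continuous_map (nsphere (Suc n)) (nsphere (Suc n)) g"
    and cm: "continuous_map (nsphere n) (nsphere n) g"
    and up: "\<And>x. x \<in> topspace (nsphere (Suc n)) \<Longrightarrow> 0 \<le> x (Suc n) \<Longrightarrow> 0 \<le> g x (Suc n)"
    and lo: "\<And>x. x \<in> topspace (nsphere (Suc n)) \<Longrightarrow> x (Suc n) \<le> 0 \<Longrightarrow> g x (Suc n) \<le> 0"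
  shows "Brouwer_degree2 (Suc n) g = Brouwer_degree2 n g"
proof -
  \<comment> \<open>Nothing is known about \<open>g\<close> off the sphere, whereas the half spaces
    below are sets of arbitrary sequences; extending by the identity makes \<open>h\<close> preserve
    them everywhere.\<close>
  define h where "h = (\<lambda>x. if x \<in> topspace (nsphere (Suc n)) then g x else x)"
  let ?U = "{x::nat\<Rightarrow>real. 0 \<le> x (Suc n)}" and ?D = "{x::nat\<Rightarrow>real. x (Suc n) \<le> 0}"
    and ?E = "{x::nat\<Rightarrow>real. x (Suc n) = 0}"
  have hS: "continuous_map (nsphere (Suc n)) (nsphere (Suc n)) h"
    by (rule continuous_map_eq [OF cmS]) (simp add: h_def)
  have sub: "topspace (nsphere n) \<subseteq> topspace (nsphere (Suc n))"
    by (auto simp: nsphere)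
  have hn: "continuous_map (nsphere n) (nsphere n) h"
    by (rule continuous_map_eq [OF cm]) (use sub in \<open>auto simp: h_def\<close>)
  have hU: "h \<in> ?U \<rightarrow> ?U" and hD: "h \<in> ?D \<rightarrow> ?D"
    using up lo by (auto simp: h_def)
  have hE: "h \<in> ?E \<rightarrow> ?E"
    using hU hD by (auto simp: Pi_iff intro: antisym)
  \<comment> \<open>The suspension isomorphism as a zigzag: the boundary map of (upper hemisphere,
    equator), the inclusion of this pair into (sphere, lower hemisphere), and the map from the
    absolute group of the sphere. All three are natural in \<open>h\<close>, so acting as a power
    map is passed from one group to the next.\<close>
  let ?X = "subtopology (nsphere (Suc n)) ?U"
  let ?p = "1 + int n"
  let ?R = "relative_homology_group ?p ?X ?E" and ?Q = "relative_homology_group ?p (nsphere (Suc n)) ?D"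
  let ?G = "reduced_homology_group (int n) (nsphere n)"
    and ?H = "reduced_homology_group ?p (nsphere (Suc n))"
  let ?b = "hom_boundary ?p ?X ?E"
  let ?i = "hom_induced ?p ?X ?E (nsphere (Suc n)) ?D id"
  let ?j = "hom_induced ?p (nsphere (Suc n)) {} (nsphere (Suc n)) ?D id"
  let ?hR = "hom_induced ?p ?X ?E ?X ?E h"
    and ?hQ = "hom_induced ?p (nsphere (Suc n)) ?D (nsphere (Suc n)) ?D h"
    and ?hG = "hom_induced (int n) (nsphere n) {} (nsphere n) {} h"
    and ?hH = "hom_induced ?p (nsphere (Suc n)) {} (nsphere (Suc n)) {} h"
  have hX: "continuous_map ?X ?X h"
    using hS hU by (auto simp: continuous_map_in_subtopology continuous_map_from_subtopology Pi_iff)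
  have b: "?b \<in> iso ?R ?G"
    using iso_upper_hemisphere_reduced_homology_group by blast
  have i: "?i \<in> iso ?R ?Q"
    by (rule iso_relative_homology_group_upper_hemisphere)
  have j: "?j \<in> iso ?H ?Q"
    using iso_reduced_homology_group_lower_hemisphere by blast
  have "subtopology ?X ?E = nsphere n"
    using subtopology_nsphere_equator [of n]
    by (simp add: subtopology_subtopology flip: Collect_conj_eq cong: rev_conj_cong)
  then have nat_b: "?hG (?b c) = ?b (?hR c)" for c
    using naturality_hom_induced [OF hX hE, of ?p] by (simp add: fun_eq_iff)
  have nat_i: "?hQ (?i c) = ?i (?hR c)" for c
  proof -
    have "?hQ (?i c) = hom_induced ?p ?X ?E (nsphere (Suc n)) ?D (h \<circ> id) c"
      by (rule hom_induced_compose') (use hS hD in \<open>auto simp: continuous_map_from_subtopology\<close>)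
    moreover have "?i (?hR c) = hom_induced ?p ?X ?E (nsphere (Suc n)) ?D (id \<circ> h) c"
      by (rule hom_induced_compose') (use hX hE in \<open>auto simp: continuous_map_from_subtopology\<close>)
    ultimately show ?thesis by simp
  qed
  have nat_j: "?hQ (?j c) = ?j (?hH c)" for c
  proof -
    have "?hQ (?j c) = hom_induced ?p (nsphere (Suc n)) {} (nsphere (Suc n)) ?D (h \<circ> id) c"
      by (rule hom_induced_compose') (use hS hD in auto)
    moreover have "?j (?hH c) = hom_induced ?p (nsphere (Suc n)) {} (nsphere (Suc n)) ?D (id \<circ> h) c"
      by (rule hom_induced_compose') (use hS in auto)
    ultimately show ?thesis by simp
  qed
  let ?d = "Brouwer_degree2 n h"
  have hR: "?hR c = c [^]\<^bsub>?R\<^esub> ?d" if c: "c \<in> carrier ?R" for c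
  proof -
    interpret group_hom ?R ?G ?b
      using b by (simp add: group_hom_def group_hom_axioms_def iso_def)
    have "?b c \<in> carrier ?G" using c by simp
    then have "?b (?hR c) = ?b (c [^]\<^bsub>?R\<^esub> ?d)"
      using c by (simp add: Brouwer_degree2 hom_int_pow flip: nat_b)
    moreover have "?hR c \<in> carrier ?R"
      using hom_induced_carrier by blast
    ultimately show ?thesis
      using b c by (auto simp: iso_def bij_betw_def inj_on_def)
  qed
  have hQ: "?hQ c = c [^]\<^bsub>?Q\<^esub> ?d" if c: "c \<in> carrier ?Q" for c
  proof -
    interpret group_hom ?R ?Q ?i
      using i by (simp add: group_hom_def group_hom_axioms_def iso_def)
    obtain e where "e \<in> carrier ?R" "c = ?i e"
      using i c by (auto simp: iso_def bij_betw_def)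
    then show ?thesis
      by (simp add: nat_i hR hom_int_pow)
  qed
  have "?hH c = c [^]\<^bsub>?H\<^esub> ?d" if c: "c \<in> carrier ?H" for c
  proof -
    interpret group_hom ?H ?Q ?j
      using j by (simp add: group_hom_def group_hom_axioms_def iso_def)
    have "?j c \<in> carrier ?Q" using c by simp
    then have "?j (?hH c) = ?j (c [^]\<^bsub>?H\<^esub> ?d)"
      using c by (simp add: hQ hom_int_pow flip: nat_j)
    moreover have "?hH c \<in> carrier ?H"
      using c by (rule hom_induced_reduced)
    ultimately show ?thesis
      using j c by (auto simp: iso_def bij_betw_def inj_on_def)
  qed
  then have "Brouwer_degree2 (Suc n) h = ?d"
    by (intro Brouwer_degree2_unique [OF hS]) simp
  moreover have "Brouwer_degree2 (Suc n) h = Brouwer_degree2 (Suc n) g"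
    by (rule Brouwer_degree2_eq) (simp add: h_def)
  moreover have "Brouwer_degree2 n h = Brouwer_degree2 n g"
    by (rule Brouwer_degree2_eq) (use sub in \<open>auto simp: h_def\<close>)
  ultimately show ?thesis by simp
qed

subsection \<open>Degree of a labelling of the Kuhn triangulation\<close>

text \<open>Vertices of a Kuhn (Freudenthal) simplex: a monotone lattice path from \<open>z\<close>
  that takes its unit steps in the order \<open>\<pi>\<close>.\<close>

definition kuhn_vertex :: "(nat \<Rightarrow> int) \<Rightarrow> (nat \<Rightarrow> nat) \<Rightarrow> nat \<Rightarrow> nat \<Rightarrow> int" where
  "kuhn_vertex z \<pi> k = (\<lambda>i. z i + (if \<exists>j<k. \<pi> j = i then 1 else 0))"

text \<open>The cup product of the coboundaries of the label coordinates, evaluated on the ordered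
  simplex \<open>v\<close>. It vanishes as soon as one label coordinate is constant on the
  simplex.\<close>

definition label_cochain :: "nat \<Rightarrow> ((nat \<Rightarrow> int) \<Rightarrow> nat \<Rightarrow> int) \<Rightarrow> (nat \<Rightarrow> nat \<Rightarrow> int) \<Rightarrow> int" where
  "label_cochain N s v = (\<Prod>i<N. s (v (Suc i)) i - s (v i) i)"

definition lattice_degree :: "nat \<Rightarrow> ((nat \<Rightarrow> int) \<Rightarrow> nat \<Rightarrow> int) \<Rightarrow> (nat \<Rightarrow> int) set \<Rightarrow> int" where
  "lattice_degree N s Z =
     (\<Sum>z\<in>Z. \<Sum>\<pi> | \<pi> permutes {..<N}. sign \<pi> * label_cochain N s (kuhn_vertex z \<pi>))"

text \<open>The simplicial coface map: composing with it drops vertex \<open>j\<close>.\<close>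

definition skip :: "nat \<Rightarrow> nat \<Rightarrow> nat" where
  "skip j k = (if k < j then k else Suc k)"

definition int_lattice :: "nat \<Rightarrow> (nat \<Rightarrow> int) set" where
  "int_lattice N = {z. \<forall>i\<ge>N. z i = 0}"

lemma label_cochain_cong:
  "(\<And>k. k \<le> N \<Longrightarrow> v k = w k) \<Longrightarrow> label_cochain N s v = label_cochain N s w"
  unfolding label_cochain_def by (intro prod.cong) auto

text \<open>A product of coboundaries is a cocycle. Concretely, dropping an inner vertex merges two
  consecutive increments in one factor, and the alternating sum over the faces telescopes.\<close>

lemma label_cochain_cocycle:
  "(\<Sum>j\<le>Suc N. (-1)^j * label_cochain N s (\<lambda>k. v (skip j k))) = 0"
proof -
  define e where "e i k = s (v (Suc k)) i - s (v k) i" for i k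
  \<comment> \<open>In \<open>P j\<close> the edge from \<open>j\<close> to \<open>Suc j\<close> is
    left out; an inner face is the sum of two neighbouring products of this kind.\<close>
  define P where "P j = (\<Prod>i<N. if i < j then e i i else e i (Suc i))" for j
  have c0: "label_cochain N s (\<lambda>k. v (skip 0 k)) = P 0"
    by (simp add: label_cochain_def P_def e_def skip_def)
  have cN: "label_cochain N s (\<lambda>k. v (skip (Suc N) k)) = P N"
    unfolding label_cochain_def P_def by (intro prod.cong) (auto simp: e_def skip_def)
  have cj: "label_cochain N s (\<lambda>k. v (skip (Suc j) k)) = P (Suc j) + P j" if "j < N" for j
  proof -
    let ?R = "\<Prod>i\<in>{..<N}-{j}. if i < j then e i i else e i (Suc i)"
    have "label_cochain N s (\<lambda>k. v (skip (Suc j) k)) = (e j j + e j (Suc j)) *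
      (\<Prod>i\<in>{..<N}-{j}. s (v (skip (Suc j) (Suc i))) i - s (v (skip (Suc j) i)) i)"
      unfolding label_cochain_def
      by (subst prod.remove [of _ j]) (use that in \<open>auto simp: e_def skip_def\<close>)
    also have "(\<Prod>i\<in>{..<N}-{j}. s (v (skip (Suc j) (Suc i))) i - s (v (skip (Suc j) i)) i) = ?R"
      by (intro prod.cong) (auto simp: e_def skip_def)
    finally have 1: "label_cochain N s (\<lambda>k. v (skip (Suc j) k)) = (e j j + e j (Suc j)) * ?R" .
    have "P (Suc j) = e j j * (\<Prod>i\<in>{..<N}-{j}. if i < Suc j then e i i else e i (Suc i))"
      unfolding P_def by (subst prod.remove [of _ j]) (use that in auto)
    also have "(\<Prod>i\<in>{..<N}-{j}. if i < Suc j then e i i else e i (Suc i)) = ?R"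
      by (intro prod.cong) auto
    finally have 2: "P (Suc j) = e j j * ?R" .
    have 3: "P j = e j (Suc j) * ?R"
      unfolding P_def by (subst prod.remove [of _ j]) (use that in auto)
    show ?thesis by (simp add: 1 2 3 algebra_simps)
  qed
  have "(\<Sum>j\<le>M. (-1)^j * label_cochain N s (\<lambda>k. v (skip j k))) = (-1)^M * P M" if "M \<le> N" for M
    using that
  proof (induction M)
    case (Suc M)
    then show ?case using cj [of M] by (simp add: algebra_simps)
  qed (simp add: c0)
  then show ?thesis by (simp add: cN)
qed

fun rotation :: "nat \<Rightarrow> nat \<Rightarrow> nat" where
  "rotation N k = (if k < N then Suc k else if k = N then 0 else k)"
declare rotation.simps [simp del]

lemma rotation_Suc: "rotation (Suc N) = rotation N \<circ> Transposition.transpose N (Suc N)"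
  by (auto simp: fun_eq_iff rotation.simps Transposition.transpose_def)

lemma rotation_permutes: "rotation N permutes {..<Suc N}"
  and sign_rotation: "sign (rotation N) = (-1)^N"
proof -
  have *: "rotation N permutes {..<Suc N} \<and> sign (rotation N) = (-1)^N"
  proof (induction N)
    case 0
    have "rotation 0 = id" by (auto simp: fun_eq_iff rotation.simps)
    then show ?case by (metis permutes_id sign_id power_0)
  next
    case (Suc N)
    have t: "Transposition.transpose N (Suc N) permutes {..<Suc (Suc N)}"
      by (intro permutes_swap_id) auto
    have r: "rotation N permutes {..<Suc (Suc N)}"
      by (rule permutes_subset) (use Suc in auto)
    have "sign (rotation N \<circ> Transposition.transpose N (Suc N)) = sign (rotation N) * sign (Transposition.transpose N (Suc N))"
      by (rule sign_compose) (use r t permutation_permutes in blast)+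
    moreover have "sign (Transposition.transpose N (Suc N)) = - 1"
      by (simp add: sign_swap_id)
    ultimately show ?case
      using Suc permutes_compose [OF t r] unfolding rotation_Suc [of N] by (metis mult_minus1_right power_Suc mult_minus1)
  qed
  then show "rotation N permutes {..<Suc N}" "sign (rotation N) = (-1)^N" by auto
qed

lemma kuhn_vertex_0 [simp]: "kuhn_vertex z \<pi> 0 = z"
  by (simp add: kuhn_vertex_def)

text \<open>The face opposite to vertex 0 starts at vertex 1 and continues with the same steps; the
  step already taken moves to the end of the order. So this face is also the face without the last
  vertex of a neighbouring simplex.\<close>

lemma kuhn_vertex_Suc_rotation:
  assumes "inj \<pi>" "k \<le> N"
  shows "kuhn_vertex z \<pi> (Suc k) = kuhn_vertex (kuhn_vertex z \<pi> 1) (\<pi> \<circ> rotation N) k"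
proof
  fix i
  have a: "(\<exists>j<Suc k. \<pi> j = i) \<longleftrightarrow> \<pi> 0 = i \<or> (\<exists>j<k. \<pi> (Suc j) = i)"
    by (metis Suc_less_eq not0_implies_Suc zero_less_Suc)
  have b: "\<not> (\<pi> 0 = i \<and> (\<exists>j<k. \<pi> (Suc j) = i))"
    using assms by (auto simp: inj_def)
  have c: "(\<exists>j<k. (\<pi> \<circ> rotation N) j = i) \<longleftrightarrow> (\<exists>j<k. \<pi> (Suc j) = i)"
  proof -
    have "(\<pi> \<circ> rotation N) j = \<pi> (Suc j)" if "j < k" for j
      using that assms(2) by (simp add: rotation.simps)
    then show ?thesis by metis
  qed
  have d: "(\<exists>j<1. \<pi> j = i) \<longleftrightarrow> \<pi> 0 = i" by auto
  show "kuhn_vertex z \<pi> (Suc k) i = kuhn_vertex (kuhn_vertex z \<pi> 1) (\<pi> \<circ> rotation N) k i"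
    unfolding kuhn_vertex_def a c d using b by auto
qed

text \<open>Exchanging two consecutive steps changes only the vertex between them. The two simplices
  share the face without it, while their permutations have opposite signs.\<close>

lemma kuhn_vertex_transpose:
  assumes "inj \<pi>" "k \<noteq> Suc j"
  shows "kuhn_vertex z (\<pi> \<circ> Transposition.transpose j (Suc j)) k = kuhn_vertex z \<pi> k"
proof -
  have "(\<exists>l<k. (\<pi> \<circ> Transposition.transpose j (Suc j)) l = i) \<longleftrightarrow> (\<exists>l<k. \<pi> l = i)" for i
  proof
    assume "\<exists>l<k. (\<pi> \<circ> Transposition.transpose j (Suc j)) l = i"
    then obtain l where l: "l < k" "\<pi> (Transposition.transpose j (Suc j) l) = i" by auto
    have "Transposition.transpose j (Suc j) l < k" using l assms by (auto simp: Transposition.transpose_def)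
    then show "\<exists>l<k. \<pi> l = i" using l by blast
  next
    assume "\<exists>l<k. \<pi> l = i"
    then obtain l where l: "l < k" "\<pi> l = i" by auto
    have "Transposition.transpose j (Suc j) l < k" using l assms by (auto simp: Transposition.transpose_def)
    moreover have "(\<pi> \<circ> Transposition.transpose j (Suc j)) (Transposition.transpose j (Suc j) l) = i" using l by simp
    ultimately show "\<exists>l<k. (\<pi> \<circ> Transposition.transpose j (Suc j)) l = i" by blast
  qed
  then show ?thesis by (simp add: kuhn_vertex_def)
qed

lemma finite_lattice_box: "finite {z \<in> int_lattice N. \<forall>i<N. \<bar>z i\<bar> \<le> M}"
proof -
  have "{z \<in> int_lattice N. \<forall>i<N. \<bar>z i\<bar> \<le> M} \<subseteq> {z. \<forall>i. (i \<in> {..<N} \<longrightarrow> z i \<in> {-M..M}) \<and> (i \<notin> {..<N} \<longrightarrow> z i = 0)}"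
    by (force simp: int_lattice_def abs_le_iff)
  moreover have "finite {z. \<forall>i. (i \<in> {..<N} \<longrightarrow> z i \<in> {-M..M}) \<and> (i \<notin> {..<N} \<longrightarrow> z i = 0)}"
    by (rule finite_set_of_finite_funs) auto
  ultimately show ?thesis by (rule finite_subset)
qed

text \<open>The Kuhn triangulation of the slab between the levels \<open>0\<close> and \<open>1\<close> of the last coordinate
  is a chain whose boundary is the difference of the two levels; \<open>label_cochain\<close> is a cocycle.
  The cut-off by \<open>Z0\<close>, \<open>Z1\<close> is harmless if every simplex that it cuts carries a constant label.\<close>

lemma lattice_degree_slab:
  fixes s0 s1 :: "(nat \<Rightarrow> int) \<Rightarrow> nat \<Rightarrow> int" and N :: nat and Z0 Z1 :: "(nat \<Rightarrow> int) set"
  defines "S \<equiv> (\<lambda>w. if w N = 0 then s0 (w(N:=0)) else s1 (w(N:=0)))"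
  assumes fin: "finite Z0" "finite Z1" and lat: "Z0 \<subseteq> int_lattice N" "Z1 \<subseteq> int_lattice N"
  defines "X \<equiv> (\<lambda>w. if w N = 0 then w(N:=0) \<in> Z0 else w(N:=0) \<in> Z1)"
  assumes cut: "\<And>z \<pi> k l. z \<in> int_lattice N \<Longrightarrow> \<pi> permutes {..<Suc N} \<Longrightarrow> k \<le> Suc N \<Longrightarrow> l \<le> Suc N \<Longrightarrow>
      X (kuhn_vertex z \<pi> k) \<Longrightarrow> \<not> X (kuhn_vertex z \<pi> l) \<Longrightarrow>
      \<exists>i<N. \<forall>k\<le>Suc N. S (kuhn_vertex z \<pi> k) i = S z i"
  shows "lattice_degree N s0 Z0 = lattice_degree N s1 Z1"
proof -

  \<comment> \<open>Faces of the slab simplices with the cut-off\<close>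
  let ?P = "{\<pi>. \<pi> permutes {..<Suc N}}"
  define G where "G w \<pi> = (if X w then label_cochain N S (kuhn_vertex w \<pi>) else 0)" for w \<pi>
  \<comment> \<open>The cut-off is tested at the first vertex of the face, not of the simplex:
    \<open>f\<close> then depends on the face alone, and shared faces can cancel.\<close>
  define f where "f j z \<pi> = (if X (kuhn_vertex z \<pi> (skip j 0))
      then label_cochain N S (\<lambda>k. kuhn_vertex z \<pi> (skip j k)) else 0)" for j z \<pi>
  have finP: "finite ?P" by (rule finite_permutations) simp
  \<comment> \<open>A simplex split by the cut-off has a constant label coordinate, which kills each
    of its faces; on any other simplex the cut-off is constant and the cocycle identity
    applies.\<close>
  have f_sum: "(\<Sum>j\<le>Suc N. (-1)^j * f j z \<pi>) = 0" if z: "z \<in> int_lattice N" and pi: "\<pi> \<in> ?P" for z \<pi>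
  proof (cases "\<exists>k\<le>Suc N. \<exists>l\<le>Suc N. X (kuhn_vertex z \<pi> k) \<and> \<not> X (kuhn_vertex z \<pi> l)")
    case True
    then obtain i where i: "i < N" "\<And>k. k \<le> Suc N \<Longrightarrow> S (kuhn_vertex z \<pi> k) i = S z i"
      using cut z pi by (metis mem_Collect_eq)
    have "label_cochain N S (\<lambda>k. kuhn_vertex z \<pi> (skip j k)) = 0" for j
      unfolding label_cochain_def
      by (rule prod_zero) (use i in \<open>auto simp: skip_def intro!: bexI [of _ i]\<close>)
    then have "f j z \<pi> = 0" for j unfolding f_def by (metis (full_types))
    then show ?thesis by simp
  next
    case False
    have sk: "skip j 0 \<le> Suc N" for j by (simp add: skip_def)
    have "f j z \<pi> = (if X z then 1 else 0) * label_cochain N S (\<lambda>k. kuhn_vertex z \<pi> (skip j k))" for j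
    proof -
      have "X (kuhn_vertex z \<pi> (skip j 0)) \<longleftrightarrow> X (kuhn_vertex z \<pi> 0)"
        using False sk [of j] by blast
      then show ?thesis by (simp add: f_def)
    qed
    then have "(\<Sum>j\<le>Suc N. (-1)^j * f j z \<pi>) =
       (if X z then 1 else 0) * (\<Sum>j\<le>Suc N. (-1)^j * label_cochain N S (\<lambda>k. kuhn_vertex z \<pi> (skip j k)))"
      by (simp add: sum_distrib_left mult_ac)
    then show ?thesis by (simp only: label_cochain_cocycle mult_zero_right)
  qed
  have f_mid: "(\<Sum>\<pi>\<in>?P. sign \<pi> * f (Suc j) z \<pi>) = 0" if "j < N" for j z
  proof -
    let ?t = "Transposition.transpose j (Suc j)"
    have t: "?t permutes {..<Suc N}" by (rule permutes_swap_id) (use that in auto)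
    have "(\<Sum>\<pi>\<in>?P. sign \<pi> * f (Suc j) z \<pi>) = (\<Sum>\<pi>\<in>?P. sign (\<pi> \<circ> ?t) * f (Suc j) z (\<pi> \<circ> ?t))"
      by (rule sum_permutations_compose_right [OF t])
    also have "\<dots> = (\<Sum>\<pi>\<in>?P. - (sign \<pi> * f (Suc j) z \<pi>))"
    proof (rule sum.cong [OF refl])
      fix \<pi> assume pi: "\<pi> \<in> ?P"
      then have "inj \<pi>" by (simp add: permutes_inj)
      then have "kuhn_vertex z (\<pi> \<circ> ?t) (skip (Suc j) k) = kuhn_vertex z \<pi> (skip (Suc j) k)" for k
        by (intro kuhn_vertex_transpose) (auto simp: skip_def)
      then have "f (Suc j) z (\<pi> \<circ> ?t) = f (Suc j) z \<pi>"
        unfolding f_def by (simp only:)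
      moreover have "sign (\<pi> \<circ> ?t) = - sign \<pi>"
        using pi t by (subst sign_compose)
          (auto simp: sign_swap_id permutation_permutes intro: exI [of _ "{..<Suc N}"])
      ultimately show "sign (\<pi> \<circ> ?t) * f (Suc j) z (\<pi> \<circ> ?t) = - (sign \<pi> * f (Suc j) z \<pi>)" by simp
    qed
    finally show ?thesis by (simp add: sum_negf)
  qed

  \<comment> \<open>Matching the faces opposite to vertex 0 with last faces\<close>
  have "\<exists>M. \<forall>z\<in>Z0 \<union> Z1. \<forall>i<N. \<bar>z i\<bar> \<le> M"
  proof -
    have "finite ((\<lambda>(z,i). \<bar>z i\<bar>) ` ((Z0 \<union> Z1) \<times> {..<N}))" using fin by auto
    then obtain M where "\<And>x. x \<in> (\<lambda>(z,i). \<bar>z i\<bar>) ` ((Z0 \<union> Z1) \<times> {..<N}) \<Longrightarrow> x \<le> M"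
      by (meson bdd_above_finite bdd_above_def)
    then show ?thesis by (intro exI [of _ M]) force
  qed
  then obtain M where M: "\<And>z i. z \<in> Z0 \<union> Z1 \<Longrightarrow> i < N \<Longrightarrow> \<bar>z i\<bar> \<le> M" by blast
  \<comment> \<open>One unit larger than the supports, so that a shift by a unit step loses no
    nonzero term.\<close>
  define A where "A = {z \<in> int_lattice N. \<forall>i<N. \<bar>z i\<bar> \<le> M + 1}"
  have finA: "finite A" unfolding A_def by (rule finite_lattice_box)
  have ZA: "Z0 \<subseteq> A" "Z1 \<subseteq> A" using M lat by (force simp: A_def)+
  have GA: "G w \<pi> = 0" if "w \<in> int_lattice N" "w \<notin> Z0" for w \<pi>
  proof -
    have "w N = 0" using that by (simp add: int_lattice_def)
    then have "w(N:=0) = w" by (simp add: fun_eq_iff)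
    then show ?thesis using that \<open>w N = 0\<close> by (simp add: G_def X_def)
  qed
  have f0: "f 0 z \<pi> = G (kuhn_vertex z \<pi> 1) (\<pi> \<circ> rotation N)" if "\<pi> \<in> ?P" for z \<pi>
  proof -
    have "inj \<pi>" using that by (simp add: permutes_inj)
    then have "label_cochain N S (\<lambda>k. kuhn_vertex z \<pi> (skip 0 k)) =
          label_cochain N S (kuhn_vertex (kuhn_vertex z \<pi> 1) (\<pi> \<circ> rotation N))"
      by (intro label_cochain_cong)
        (use kuhn_vertex_Suc_rotation [of \<pi> _ N z] in \<open>simp only: skip_def if_False not_less_zero\<close>)
    then show ?thesis by (simp add: f_def G_def skip_def)
  qed
  have fN: "f (Suc N) z \<pi> = G z \<pi>" for z \<pi>
  proof -
    have "label_cochain N S (\<lambda>k. kuhn_vertex z \<pi> (skip (Suc N) k)) = label_cochain N S (kuhn_vertex z \<pi>)"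
      by (intro label_cochain_cong) (simp add: skip_def)
    then show ?thesis by (simp add: f_def G_def skip_def)
  qed
  \<comment> \<open>The faces opposite to vertex 0 with order \<open>\<rho>\<close>. If
    \<open>N\<close> comes last in \<open>\<rho>\<close>, the step left out was the vertical one and
    the faces lie at level 1; otherwise a horizontal shift brings them back to the index
    set.\<close>
  define K where "K \<rho> = (if \<rho> N = N then \<Sum>z\<in>A. G (z(N:=1)) \<rho> else \<Sum>z\<in>A. G z \<rho>)" for \<rho> :: "nat \<Rightarrow> nat"
  have shift: "(\<Sum>z\<in>A. f 0 z \<pi>) = K (\<pi> \<circ> rotation N)" if pi: "\<pi> \<in> ?P" for \<pi>
  proof (cases "\<pi> 0 = N")
    case True
    have "kuhn_vertex z \<pi> (Suc 0) = z(N:=1)" if "z \<in> A" for z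
      using that True by (auto simp: kuhn_vertex_def A_def int_lattice_def fun_eq_iff)
    then show ?thesis using True pi by (auto simp: K_def rotation.simps f0 intro!: sum.cong)
  next
    case False
    have lt: "\<pi> 0 < N"
    proof -
      have "\<pi> 0 \<in> {..<Suc N}" using pi permutes_in_image by fastforce
      then show ?thesis using False by simp
    qed
    have kv: "kuhn_vertex z \<pi> (Suc 0) = z(\<pi> 0 := z (\<pi> 0) + 1)" for z
      by (auto simp: kuhn_vertex_def fun_eq_iff)
    have "(\<Sum>z\<in>A. f 0 z \<pi>) = (\<Sum>z\<in>A. G (z(\<pi> 0 := z (\<pi> 0) + 1)) (\<pi> \<circ> rotation N))"
      using pi by (intro sum.cong) (simp_all add: f0 kv)
    also have "\<dots> = (\<Sum>z\<in>A. G z (\<pi> \<circ> rotation N))"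
    proof (rule sum.reindex_bij_witness_not_neutral
        [where S' = "{z\<in>A. z(\<pi> 0 := z (\<pi> 0) + 1) \<notin> Z0}" and T' = "{z\<in>A. z \<notin> Z0}"
          and i = "\<lambda>z. z(\<pi> 0 := z (\<pi> 0) - 1)" and j = "\<lambda>z. z(\<pi> 0 := z (\<pi> 0) + 1)"])
      fix z assume "z \<in> A - {z\<in>A. z(\<pi> 0 := z (\<pi> 0) + 1) \<notin> Z0}"
      then have z: "z(\<pi> 0 := z (\<pi> 0) + 1) \<in> Z0" by auto
      then show "z(\<pi> 0 := z (\<pi> 0) + 1) \<in> A - {z\<in>A. z \<notin> Z0}" using ZA by auto
    next
      fix z assume "z \<in> A - {z\<in>A. z \<notin> Z0}"
      then have z: "z \<in> Z0" by auto
      have "\<bar>(z(\<pi> 0 := z (\<pi> 0) - 1)) i\<bar> \<le> M + 1" if "i < N" for i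
        using M [of z i] z that by auto
      moreover have "z(\<pi> 0 := z (\<pi> 0) - 1) \<in> int_lattice N" using z lat lt by (auto simp: int_lattice_def)
      ultimately show "z(\<pi> 0 := z (\<pi> 0) - 1) \<in> A - {z\<in>A. z(\<pi> 0 := z (\<pi> 0) + 1) \<notin> Z0}"
        using z by (auto simp: A_def)
    next
      fix z assume "z \<in> {z\<in>A. z(\<pi> 0 := z (\<pi> 0) + 1) \<notin> Z0}"
      then show "G (z(\<pi> 0 := z (\<pi> 0) + 1)) (\<pi> \<circ> rotation N) = 0"
        using lt by (intro GA) (auto simp: A_def int_lattice_def)
    next
      fix z assume "z \<in> {z\<in>A. z \<notin> Z0}"
      then show "G z (\<pi> \<circ> rotation N) = 0" by (intro GA) (auto simp: A_def)
    qed (use finA in auto)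
    also have "\<dots> = K (\<pi> \<circ> rotation N)" using False by (simp add: K_def rotation.simps)
    finally show ?thesis .
  qed
  have T0: "(\<Sum>\<pi>\<in>?P. sign \<pi> * (\<Sum>z\<in>A. f 0 z \<pi>)) = (-1)^N * (\<Sum>\<rho>\<in>?P. sign \<rho> * K \<rho>)"
  proof -
    have "(\<Sum>\<rho>\<in>?P. sign \<rho> * K \<rho>) = (\<Sum>\<pi>\<in>?P. sign (\<pi> \<circ> rotation N) * K (\<pi> \<circ> rotation N))"
      by (rule sum_permutations_compose_right [OF rotation_permutes])
    also have "\<dots> = (\<Sum>\<pi>\<in>?P. (-1)^N * (sign \<pi> * (\<Sum>z\<in>A. f 0 z \<pi>)))"
    proof (rule sum.cong [OF refl])
      fix \<pi> assume pi: "\<pi> \<in> ?P"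
      have "sign (\<pi> \<circ> rotation N) = sign \<pi> * sign (rotation N)"
        using pi rotation_permutes by (intro sign_compose) (auto simp: permutation_permutes)
      then show "sign (\<pi> \<circ> rotation N) * K (\<pi> \<circ> rotation N) = (-1)^N * (sign \<pi> * (\<Sum>z\<in>A. f 0 z \<pi>))"
        using shift [OF pi] by (simp add: sign_rotation)
    qed
    finally have "(\<Sum>\<rho>\<in>?P. sign \<rho> * K \<rho>) = (-1)^N * (\<Sum>\<pi>\<in>?P. sign \<pi> * (\<Sum>z\<in>A. f 0 z \<pi>))"
      by (simp add: sum_distrib_left)
    moreover have "(-1)^N * ((-1)^N * x) = x" for x :: int
      by (cases "even N") auto
    ultimately show ?thesis by simp
  qed

  \<comment> \<open>Summation of the boundary\<close>
  have "0 = (\<Sum>z\<in>A. \<Sum>\<pi>\<in>?P. sign \<pi> * (\<Sum>j\<le>Suc N. (-1)^j * f j z \<pi>))"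
    by (intro sum.neutral [symmetric] ballI) (use f_sum in \<open>auto simp: A_def simp del: sum.atMost_Suc\<close>)
  also have "\<dots> = (\<Sum>z\<in>A. \<Sum>\<pi>\<in>?P. \<Sum>j\<le>Suc N. (-1)^j * (sign \<pi> * f j z \<pi>))"
    by (simp add: sum_distrib_left mult.left_commute del: sum.atMost_Suc)
  also have "\<dots> = (\<Sum>z\<in>A. \<Sum>j\<le>Suc N. \<Sum>\<pi>\<in>?P. (-1)^j * (sign \<pi> * f j z \<pi>))"
    by (rule sum.cong [OF refl], rule sum.swap)
  also have "\<dots> = (\<Sum>j\<le>Suc N. \<Sum>z\<in>A. \<Sum>\<pi>\<in>?P. (-1)^j * (sign \<pi> * f j z \<pi>))"
    by (rule sum.swap)
  also have "\<dots> = (\<Sum>j\<le>Suc N. (-1)^j * (\<Sum>z\<in>A. \<Sum>\<pi>\<in>?P. sign \<pi> * f j z \<pi>))"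
    by (simp add: sum_distrib_left del: sum.atMost_Suc)
  also have "\<dots> = (\<Sum>j\<in>{0, Suc N}. (-1)^j * (\<Sum>z\<in>A. \<Sum>\<pi>\<in>?P. sign \<pi> * f j z \<pi>))"
  proof (rule sum.mono_neutral_right)
    show "\<forall>j\<in>{..Suc N} - {0, Suc N}. (-1)^j * (\<Sum>z\<in>A. \<Sum>\<pi>\<in>?P. sign \<pi> * f j z \<pi>) = 0"
    proof
      fix j assume "j \<in> {..Suc N} - {0, Suc N}"
      then obtain l where "j = Suc l" "l < N" by (cases j) auto
      then show "(-1)^j * (\<Sum>z\<in>A. \<Sum>\<pi>\<in>?P. sign \<pi> * f j z \<pi>) = 0" by (simp add: f_mid)
    qed
  qed auto
  also have "\<dots> = (\<Sum>z\<in>A. \<Sum>\<pi>\<in>?P. sign \<pi> * f 0 z \<pi>) - (-1)^N * (\<Sum>z\<in>A. \<Sum>\<pi>\<in>?P. sign \<pi> * G z \<pi>)"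
    by (simp add: fN)
  also have "(\<Sum>z\<in>A. \<Sum>\<pi>\<in>?P. sign \<pi> * f 0 z \<pi>) = (\<Sum>\<pi>\<in>?P. sign \<pi> * (\<Sum>z\<in>A. f 0 z \<pi>))"
    by (subst sum.swap) (simp add: sum_distrib_left)
  also have "(\<Sum>z\<in>A. \<Sum>\<pi>\<in>?P. sign \<pi> * G z \<pi>) = (\<Sum>\<pi>\<in>?P. sign \<pi> * (\<Sum>z\<in>A. G z \<pi>))"
    by (subst sum.swap) (simp add: sum_distrib_left)
  finally have "0 = (-1)^N * ((\<Sum>\<rho>\<in>?P. sign \<rho> * K \<rho>) - (\<Sum>\<rho>\<in>?P. sign \<rho> * (\<Sum>z\<in>A. G z \<rho>)))"
    by (simp add: T0 algebra_simps)
  then have "0 = (\<Sum>\<rho>\<in>?P. sign \<rho> * (K \<rho> - (\<Sum>z\<in>A. G z \<rho>)))"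
    by (simp add: sum_subtractf algebra_simps)
  \<comment> \<open>For an order that does not end with the vertical step the two kinds of faces
    cancel; the orders fixing \<open>N\<close> triangulate the two levels.\<close>
  also have "\<dots> = (\<Sum>\<rho> | \<rho> permutes {..<N}. sign \<rho> * (K \<rho> - (\<Sum>z\<in>A. G z \<rho>)))"
  proof (rule sum.mono_neutral_right [OF finP])
    show "{\<rho>. \<rho> permutes {..<N}} \<subseteq> ?P"
      by (auto intro: permutes_subset)
    have "\<rho> permutes {..<N}" if "\<rho> \<in> ?P" "\<rho> N = N" for \<rho>
      using that permutes_superset [of \<rho> "{..<Suc N}" "{..<N}"] by (auto simp: less_Suc_eq)
    then show "\<forall>\<rho>\<in>?P - {\<rho>. \<rho> permutes {..<N}}. sign \<rho> * (K \<rho> - (\<Sum>z\<in>A. G z \<rho>)) = 0"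
      by (auto simp: K_def)
  qed
  also have "\<dots> = (\<Sum>\<rho> | \<rho> permutes {..<N}. sign \<rho> * ((\<Sum>z\<in>Z1. label_cochain N s1 (kuhn_vertex z \<rho>))
       - (\<Sum>z\<in>Z0. label_cochain N s0 (kuhn_vertex z \<rho>))))"
  proof (rule sum.cong [OF refl])
    fix \<rho> assume "\<rho> \<in> {\<rho>. \<rho> permutes {..<N}}"
    then have rho: "\<rho> permutes {..<N}" by simp
    have rN: "\<rho> N = N" using rho by (simp add: permutes_not_in)
    have rlt: "\<rho> j < N" if "j < N" for j using rho that permutes_in_image by fastforce
    have nex: "\<not> (\<exists>j<k. \<rho> j = N)" if "k \<le> N" for k
      using rlt that by (metis less_le_trans less_irrefl)
    have kN: "kuhn_vertex z \<rho> k N = 0" if "z \<in> int_lattice N" "k \<le> N" for z k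
      using that nex [of k] by (simp add: kuhn_vertex_def int_lattice_def)
    have k1: "kuhn_vertex (z(N:=1)) \<rho> k N = 1" "(kuhn_vertex (z(N:=1)) \<rho> k)(N:=0) = kuhn_vertex z \<rho> k"
      if "z \<in> int_lattice N" "k \<le> N" for z k
      using that nex [of k] by (auto simp: kuhn_vertex_def int_lattice_def fun_eq_iff)
    have "(\<Sum>z\<in>A. G (z(N:=1)) \<rho>) = (\<Sum>z\<in>Z1. G (z(N:=1)) \<rho>)"
    proof (rule sum.mono_neutral_right [OF finA ZA(2)], rule ballI)
      fix z assume z: "z \<in> A - Z1"
      then have "z(N:=0) = z" by (auto simp: A_def int_lattice_def fun_eq_iff)
      then show "G (z(N:=1)) \<rho> = 0" using z by (simp add: G_def X_def)
    qed
    also have "\<dots> = (\<Sum>z\<in>Z1. label_cochain N s1 (kuhn_vertex z \<rho>))"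
    proof (rule sum.cong [OF refl])
      fix z assume z: "z \<in> Z1"
      then have zl: "z \<in> int_lattice N" using lat by auto
      then have "z(N:=0) = z" by (auto simp: int_lattice_def fun_eq_iff)
      then have "X (z(N:=1))" using z by (simp add: X_def)
      moreover have "label_cochain N S (kuhn_vertex (z(N:=1)) \<rho>) = label_cochain N s1 (kuhn_vertex z \<rho>)"
        unfolding label_cochain_def by (intro prod.cong) (auto simp: S_def k1 zl)
      ultimately show "G (z(N:=1)) \<rho> = label_cochain N s1 (kuhn_vertex z \<rho>)" by (simp add: G_def)
    qed
    finally have 1: "K \<rho> = (\<Sum>z\<in>Z1. label_cochain N s1 (kuhn_vertex z \<rho>))" using rN by (simp add: K_def)
    have "(\<Sum>z\<in>A. G z \<rho>) = (\<Sum>z\<in>Z0. G z \<rho>)"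
      by (rule sum.mono_neutral_right [OF finA ZA(1)]) (auto simp: GA A_def)
    also have "\<dots> = (\<Sum>z\<in>Z0. label_cochain N s0 (kuhn_vertex z \<rho>))"
    proof (rule sum.cong [OF refl])
      fix z assume z: "z \<in> Z0"
      then have zl: "z \<in> int_lattice N" using lat by auto
      then have "z(N:=0) = z" "z N = 0" by (auto simp: int_lattice_def fun_eq_iff)
      then have "X z" using z by (simp add: X_def)
      moreover have "(kuhn_vertex z \<rho> k)(N:=0) = kuhn_vertex z \<rho> k" if "k \<le> N" for k
        using kN [OF zl that] by (auto simp: fun_eq_iff)
      then have "label_cochain N S (kuhn_vertex z \<rho>) = label_cochain N s0 (kuhn_vertex z \<rho>)"
        unfolding label_cochain_def by (intro prod.cong) (auto simp: S_def kN zl)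
      ultimately show "G z \<rho> = label_cochain N s0 (kuhn_vertex z \<rho>)" by (simp add: G_def)
    qed
    finally show "sign \<rho> * (K \<rho> - (\<Sum>z\<in>A. G z \<rho>)) =
      sign \<rho> * ((\<Sum>z\<in>Z1. label_cochain N s1 (kuhn_vertex z \<rho>)) - (\<Sum>z\<in>Z0. label_cochain N s0 (kuhn_vertex z \<rho>)))"
      by (simp add: 1)
  qed
  also have "\<dots> = lattice_degree N s1 Z1 - lattice_degree N s0 Z0"
  proof -
    have "lattice_degree N s Z = (\<Sum>\<rho> | \<rho> permutes {..<N}. sign \<rho> * (\<Sum>z\<in>Z. label_cochain N s (kuhn_vertex z \<rho>)))" for s Z
      unfolding lattice_degree_def by (subst sum.swap) (simp add: sum_distrib_left)
    then show ?thesis by (simp add: sum_subtractf right_diff_distrib)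
  qed
  finally show ?thesis by simp
qed

subsection \<open>Paths of nonsingular matrices\<close>

definition nonsing :: "nat \<Rightarrow> (nat \<Rightarrow> nat \<Rightarrow> real) \<Rightarrow> bool" where
  "nonsing N a \<longleftrightarrow> (\<forall>x. (\<forall>i<N. (\<Sum>j<N. a i j * x j) = 0) \<longrightarrow> (\<forall>i<N. x i = 0))"

definition nonsing_path :: "nat \<Rightarrow> (nat \<Rightarrow> nat \<Rightarrow> real) \<Rightarrow> (nat \<Rightarrow> nat \<Rightarrow> real) \<Rightarrow> bool" where
  "nonsing_path N a c \<longleftrightarrow> (\<exists>\<gamma>. (\<forall>i<N. \<forall>j<N. continuous_on {0..1::real} (\<lambda>t. \<gamma> t i j)) \<and>
     (\<forall>t\<in>{0..1}. nonsing N (\<gamma> t)) \<and> (\<forall>i<N. \<forall>j<N. \<gamma> 0 i j = a i j \<and> \<gamma> 1 i j = c i j))"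

lemma nonsing_cong:
  assumes "\<And>i j. i < N \<Longrightarrow> j < N \<Longrightarrow> a i j = c i j"
  shows "nonsing N a \<longleftrightarrow> nonsing N c"
proof -
  have "(\<Sum>j<N. a i j * x j) = (\<Sum>j<N. c i j * x j)" if "i < N" for i x
    using that assms by (intro sum.cong) auto
  then show ?thesis unfolding nonsing_def by metis
qed

lemma nonsing_path_nonsing:
  assumes "nonsing_path N a c" shows "nonsing N c"
proof -
  obtain \<gamma> where "\<forall>t\<in>{0..1::real}. nonsing N (\<gamma> t)" "\<forall>i<N. \<forall>j<N. \<gamma> 1 i j = c i j"
    using assms unfolding nonsing_path_def by blast
  then show ?thesis using nonsing_cong [of N "\<gamma> 1" c] by simp
qed

lemma nonsing_path_trans:
  assumes "nonsing_path N a b" "nonsing_path N b c"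
  shows "nonsing_path N a c"
proof -
  obtain \<gamma> where \<gamma>: "\<And>i j. i < N \<Longrightarrow> j < N \<Longrightarrow> continuous_on {0..1::real} (\<lambda>t. \<gamma> t i j)"
    "\<And>t. t \<in> {0..1} \<Longrightarrow> nonsing N (\<gamma> t)" "\<And>i j. i < N \<Longrightarrow> j < N \<Longrightarrow> \<gamma> 0 i j = a i j \<and> \<gamma> 1 i j = b i j"
    using assms(1) unfolding nonsing_path_def by blast
  obtain \<delta> where \<delta>: "\<And>i j. i < N \<Longrightarrow> j < N \<Longrightarrow> continuous_on {0..1::real} (\<lambda>t. \<delta> t i j)"
    "\<And>t. t \<in> {0..1} \<Longrightarrow> nonsing N (\<delta> t)" "\<And>i j. i < N \<Longrightarrow> j < N \<Longrightarrow> \<delta> 0 i j = b i j \<and> \<delta> 1 i j = c i j"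
    using assms(2) unfolding nonsing_path_def by blast
  define \<eta> where "\<eta> t i j = ((\<lambda>t. \<gamma> t i j) +++ (\<lambda>t. \<delta> t i j)) t" for t i j
  have eta: "\<eta> t = (if t \<le> 1/2 then \<gamma> (2 * t) else \<delta> (2 * t - 1))" for t
    by (auto simp: \<eta>_def joinpaths_def fun_eq_iff)
  have "continuous_on {0..1} (\<lambda>t. \<eta> t i j)" if "i < N" "j < N" for i j
  proof -
    have "path ((\<lambda>t. \<gamma> t i j) +++ (\<lambda>t. \<delta> t i j))"
      using \<gamma>(1,3) \<delta>(1,3) that by (intro path_join_imp) (auto simp: path_def pathstart_def pathfinish_def)
    then show ?thesis by (simp add: path_def \<eta>_def [abs_def])
  qed
  moreover have "nonsing N (\<eta> t)" if "t \<in> {0..1}" for t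
    using that \<gamma>(2) \<delta>(2) by (auto simp: eta)
  moreover have "\<eta> 0 i j = a i j \<and> \<eta> 1 i j = c i j" if "i < N" "j < N" for i j
    using that \<gamma>(3) \<delta>(3) by (simp add: eta)
  ultimately show ?thesis unfolding nonsing_path_def by blast
qed

text \<open>Row \<open>k\<close> stays fixed because \<open>d k = 0\<close>, so every matrix on the
  segment has the kernel of \<open>a\<close>.\<close>

lemma nonsing_path_row_shear:
  assumes "nonsing N a" "k < N" "d k = 0"
  shows "nonsing_path N a (\<lambda>i j. a i j + d i * a k j)"
  unfolding nonsing_path_def
proof (intro exI [of _ "\<lambda>t i j. a i j + t * d i * a k j"] conjI ballI allI impI)
  fix t :: real assume "t \<in> {0..1}"
  show "nonsing N (\<lambda>i j. a i j + t * d i * a k j)"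
    unfolding nonsing_def
  proof (rule allI, rule impI)
    fix x assume x: "\<forall>i<N. (\<Sum>j<N. (a i j + t * d i * a k j) * x j) = 0"
    have eq: "(\<Sum>j<N. (a i j + t * d i * a k j) * x j) = (\<Sum>j<N. a i j * x j) + t * d i * (\<Sum>j<N. a k j * x j)" for i
      by (simp add: sum.distrib algebra_simps sum_distrib_left)
    have k: "(\<Sum>j<N. a k j * x j) = 0" using x assms(2,3) unfolding eq by force
    then have "(\<Sum>j<N. a i j * x j) = 0" if "i < N" for i
      using x that unfolding eq by simp
    then show "\<forall>i<N. x i = 0" using assms(1) unfolding nonsing_def by blast
  qed
qed (auto intro!: continuous_intros)

lemma nonsing_path_row_scale:
  assumes "nonsing N a" "k < N" "0 < s"
  shows "nonsing_path N a (\<lambda>i j. (if i = k then s else 1) * a i j)"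
  unfolding nonsing_path_def
proof (intro exI [of _ "\<lambda>t i j. (if i = k then (1 - t) + t * s else 1) * a i j"] conjI ballI allI impI)
  fix t :: real assume t: "t \<in> {0..1}"
  then have pos: "0 < (1 - t) + t * s"
    using assms(3) by (cases "t = 1") (auto intro!: add_pos_nonneg)
  show "nonsing N (\<lambda>i j. (if i = k then (1 - t) + t * s else 1) * a i j)"
    unfolding nonsing_def
  proof (rule allI, rule impI)
    fix x assume x: "\<forall>i<N. (\<Sum>j<N. (if i = k then (1 - t) + t * s else 1) * a i j * x j) = 0"
    have "(\<Sum>j<N. a i j * x j) = 0" if "i < N" for i
    proof -
      have "(if i = k then (1 - t) + t * s else 1) * (\<Sum>j<N. a i j * x j) = 0"
        using x that unfolding sum_distrib_left mult.assoc [symmetric] by blast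
      then show ?thesis using pos by (auto split: if_splits)
    qed
    then show "\<forall>i<N. x i = 0" using assms(1) unfolding nonsing_def by blast
  qed
next
  show "continuous_on {0..1} (\<lambda>t. (if i = k then (1 - t) + t * s else 1) * a i j)" for i j
    by (cases "i = k") (auto intro!: continuous_intros)
qed auto

text \<open>A block matrix with corner 1 and zeros above it. The last row \<open>c\<close> has no
  influence on nonsingularity and can be contracted to 0.\<close>

definition bordered :: "nat \<Rightarrow> (nat \<Rightarrow> nat \<Rightarrow> real) \<Rightarrow> (nat \<Rightarrow> real) \<Rightarrow> nat \<Rightarrow> nat \<Rightarrow> real" where
  "bordered N b c i j = (if i < N \<and> j < N then b i j else if i = N \<and> j < N then c j else if i = j then 1 else 0)"

lemma nonsing_bordered: "nonsing (Suc N) (bordered N b c) \<longleftrightarrow> nonsing N b"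
proof -
  have row: "(\<Sum>j<Suc N. bordered N b c i j * x j) = (\<Sum>j<N. b i j * x j)" if "i < N" for i x
    using that by (simp add: bordered_def)
  have last: "(\<Sum>j<Suc N. bordered N b c N j * x j) = (\<Sum>j<N. c j * x j) + x N" for x
    by (simp add: bordered_def)
  show ?thesis
  proof
    assume R: "nonsing (Suc N) (bordered N b c)"
    show "nonsing N b"
      unfolding nonsing_def
    proof (rule allI, rule impI)
      fix x assume x: "\<forall>i<N. (\<Sum>j<N. b i j * x j) = 0"
      define y where "y = x(N := - (\<Sum>j<N. c j * x j))"
      have yx: "(\<Sum>j<N. d j * y j) = (\<Sum>j<N. d j * x j)" for d
        by (intro sum.cong) (auto simp: y_def)
      have "(\<Sum>j<Suc N. bordered N b c i j * y j) = 0" if "i < Suc N" for i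
      proof (cases "i = N")
        case True
        have "(\<Sum>j<Suc N. bordered N b c N j * y j) = 0"
          unfolding last yx by (simp add: y_def)
        then show ?thesis unfolding True .
      next
        case False
        then show ?thesis using that x by (subst row) (simp_all add: yx)
      qed
      then have "\<forall>i<Suc N. y i = 0" using R unfolding nonsing_def by blast
      then show "\<forall>i<N. x i = 0" by (metis fun_upd_apply less_SucI less_irrefl y_def)
    qed
  next
    assume R: "nonsing N b"
    show "nonsing (Suc N) (bordered N b c)"
      unfolding nonsing_def
    proof (rule allI, rule impI)
      fix x assume x: "\<forall>i<Suc N. (\<Sum>j<Suc N. bordered N b c i j * x j) = 0"
      have "(\<Sum>j<N. b i j * x j) = 0" if "i < N" for i
        using x row [OF that, of x] that less_SucI by metis
      then have z: "\<forall>i<N. x i = 0" using R unfolding nonsing_def by blast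
      moreover have "(\<Sum>j<N. c j * x j) + x N = 0" using x last [of x] by (metis lessI)
      moreover have "(\<Sum>j<N. c j * x j) = 0" using z by simp
      ultimately show "\<forall>i<Suc N. x i = 0" by (simp add: less_Suc_eq)
    qed
  qed
qed

lemma nonsing_path_bordered:
  assumes "nonsing_path N b c"
  shows "nonsing_path (Suc N) (bordered N b (\<lambda>_. 0)) (bordered N c (\<lambda>_. 0))"
proof -
  obtain \<gamma> where \<gamma>: "\<And>i j. i < N \<Longrightarrow> j < N \<Longrightarrow> continuous_on {0..1::real} (\<lambda>t. \<gamma> t i j)"
    "\<And>t. t \<in> {0..1} \<Longrightarrow> nonsing N (\<gamma> t)" "\<And>i j. i < N \<Longrightarrow> j < N \<Longrightarrow> \<gamma> 0 i j = b i j \<and> \<gamma> 1 i j = c i j"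
    using assms(1) unfolding nonsing_path_def by blast
  show ?thesis
    unfolding nonsing_path_def
  proof (intro exI [of _ "\<lambda>t. bordered N (\<gamma> t) (\<lambda>_. 0)"] conjI ballI allI impI)
    show "continuous_on {0..1} (\<lambda>t. bordered N (\<gamma> t) (\<lambda>_. 0) i j)" for i j
      using \<gamma>(1) by (cases "i < N \<and> j < N") (auto simp: bordered_def)
  qed (use \<gamma> in \<open>auto simp: nonsing_bordered bordered_def\<close>)
qed

text \<open>Gaussian elimination along paths: shears produce a positive corner and clear the rest of
  the last column, a positive scaling turns the corner into 1, and the last row is contracted.
  \<open>0 < N\<close> provides a further row for the case that the corner is the only nonzero entry
  of its column.\<close>

lemma nonsing_path_to_bordered:
  assumes a: "nonsing (Suc N) a" and N: "0 < N"
  obtains b where "nonsing N b" "nonsing_path (Suc N) a (bordered N b (\<lambda>_. 0))"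
proof -
  have shear: "nonsing (Suc N) c \<Longrightarrow> k < Suc N \<Longrightarrow> d k = 0 \<Longrightarrow>
      nonsing_path (Suc N) c (\<lambda>i j. c i j + d i * c k j)" for c k d
    by (rule nonsing_path_row_shear)
  have offdiag: "\<exists>c. nonsing_path (Suc N) a c \<and> 0 < c N N"
    if a: "nonsing (Suc N) a" and k: "k < N" "a k N \<noteq> 0" for a k
  proof -
    \<comment> \<open>Chosen so that the new corner equals 1.\<close>
    define d where "d i = (if i = N then (1 - a N N) / a k N else 0)" for i
    have "nonsing_path (Suc N) a (\<lambda>i j. a i j + d i * a k j)"
      using k a by (intro shear) (auto simp: d_def)
    then show ?thesis using k by (intro exI conjI) (auto simp: d_def)
  qed
  have "\<exists>c. nonsing_path (Suc N) a c \<and> 0 < c N N"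
  proof (cases "\<exists>k<N. a k N \<noteq> 0")
    case True
    then show ?thesis using offdiag a by blast
  next
    case False
    have aN: "a N N \<noteq> 0"
    proof
      assume 0: "a N N = 0"
      have "\<forall>i<Suc N. (\<Sum>j<Suc N. a i j * (if j = N then 1 else 0)) = 0"
        using False 0 by (auto simp: less_Suc_eq)
      then have "\<forall>i<Suc N. (if i = N then 1 else 0::real) = 0"
        using a unfolding nonsing_def by (elim allE [of _ "\<lambda>j. if j = N then 1 else 0"]) blast
      then show False by auto
    qed
    \<comment> \<open>The corner may be negative here; copying it into row 0 leads back to the
      previous case.\<close>
    define d where "d i = (if i = 0 then 1 else 0::real)" for i :: nat
    let ?c = "\<lambda>i j. a i j + d i * a N j"
    have c: "nonsing_path (Suc N) a ?c"
      using N a by (intro shear) (auto simp: d_def)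
    have "\<exists>e. nonsing_path (Suc N) ?c e \<and> 0 < e N N"
      using offdiag [OF nonsing_path_nonsing [OF c], of 0] N aN False by (auto simp: d_def)
    then show ?thesis using c nonsing_path_trans by blast
  qed
  then obtain c where c: "nonsing_path (Suc N) a c" "0 < c N N" by blast
  define d where "d i = (if i = N then 0 else - c i N / c N N)" for i
  define e where "e i j = c i j + d i * c N j" for i j
  have e: "nonsing_path (Suc N) c e"
    unfolding e_def [abs_def] by (rule shear) (use c nonsing_path_nonsing in \<open>auto simp: d_def\<close>)
  have eN: "e i N = (if i = N then c N N else 0)" for i
    using c(2) by (simp add: e_def d_def)
  define f where "f i j = (if i = N then 1 / c N N else 1) * e i j" for i j
  have f: "nonsing_path (Suc N) e f"
    unfolding f_def [abs_def] by (rule nonsing_path_row_scale) (use e c nonsing_path_nonsing in auto)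
  have fN: "f i N = (if i = N then 1 else 0)" for i
    using c(2) by (simp add: f_def eN)
  have fb: "f i j = bordered N f (f N) i j" if "i < Suc N" "j < Suc N" for i j
    using that by (auto simp: bordered_def fN less_Suc_eq)
  have ns: "nonsing N f"
  proof -
    have "nonsing (Suc N) f" using f nonsing_path_nonsing by blast
    then have "nonsing (Suc N) (bordered N f (f N))" using fb nonsing_cong by blast
    then show ?thesis by (simp add: nonsing_bordered)
  qed
  have g: "nonsing_path (Suc N) f (bordered N f (\<lambda>_. 0))"
    unfolding nonsing_path_def
  proof (intro exI [of _ "\<lambda>t. bordered N f (\<lambda>j. (1 - t) * f N j)"] conjI ballI allI impI)
    have "bordered N f (\<lambda>j. (1 - t) * f N j) i j =
        bordered N f (\<lambda>_. 0) i j + (1 - t) * (if i = N \<and> j < N then f N j else 0)" for t i j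
      by (auto simp: bordered_def)
    then show "continuous_on {0..1} (\<lambda>t. bordered N f (\<lambda>j. (1 - t) * f N j) i j)" for i j
      by (simp only:) (intro continuous_intros)
  qed (use ns fb in \<open>auto simp: nonsing_bordered\<close>)
  show thesis
    using that [OF ns] c(1) e f g nonsing_path_trans by meson
qed

definition diag_sign :: "real \<Rightarrow> nat \<Rightarrow> nat \<Rightarrow> real" where
  "diag_sign s i j = (if i = j then if i = 0 then s else 1 else 0)"

text \<open>Splitting off one coordinate at a time leaves a 1 x 1 matrix, where a positive scaling
  keeps the sign; hence the sign ends up in entry 0.\<close>

lemma nonsing_path_diag_sign:
  assumes "nonsing (Suc p) a"
  obtains s where "s \<in> {1, -1}" "nonsing_path (Suc p) a (diag_sign s)"
proof -
  have "\<exists>s. s \<in> {1, -1} \<and> nonsing_path (Suc p) a (diag_sign s)"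
    using assms
  proof (induction p arbitrary: a)
    case 0
    have a0: "a 0 0 \<noteq> 0"
    proof
      assume "a 0 0 = 0"
      then have "\<forall>i<Suc 0. (\<Sum>j<Suc 0. a i j * 1) = 0" by simp
      then have "\<forall>i<Suc 0. (1::real) = 0"
        using 0 unfolding nonsing_def by (elim allE [of _ "\<lambda>j. 1"]) blast
      then show False by auto
    qed
    have "nonsing_path (Suc 0) a (\<lambda>i j. (if i = 0 then 1 / \<bar>a 0 0\<bar> else 1) * a i j)"
      by (rule nonsing_path_row_scale) (use 0 a0 in auto)
    then have "nonsing_path (Suc 0) a (diag_sign (sgn (a 0 0)))"
      unfolding nonsing_path_def by (simp add: diag_sign_def sgn_div_norm abs_real_def divide_simps split: if_splits)
    then show ?case using a0 by (intro exI [of _ "sgn (a 0 0)"]) (auto simp: sgn_if)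
  next
    case (Suc p)
    obtain b where b: "nonsing (Suc p) b" "nonsing_path (Suc (Suc p)) a (bordered (Suc p) b (\<lambda>_. 0))"
      using nonsing_path_to_bordered [OF Suc.prems] by blast
    obtain s where s: "s \<in> {1,-1}" "nonsing_path (Suc p) b (diag_sign s)"
      using Suc.IH [OF b(1)] by blast
    have "nonsing_path (Suc (Suc p)) a (bordered (Suc p) (diag_sign s) (\<lambda>_. 0))"
      using nonsing_path_trans [OF b(2) nonsing_path_bordered [OF s(2)]] .
    moreover have "bordered (Suc p) (diag_sign s) (\<lambda>_. 0) = diag_sign s"
      by (auto simp: fun_eq_iff bordered_def diag_sign_def)
    ultimately show ?case using s(1) by auto
  qed
  then show ?thesis using that by blast
qed

subsection \<open>Coordinates in finite-dimensional subspaces\<close>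

definition basis_seq :: "(nat \<Rightarrow> 'a::real_vector) \<Rightarrow> nat \<Rightarrow> bool" where
  "basis_seq b p \<longleftrightarrow> inj_on b {..p} \<and> independent (b ` {..p})"

lemma lin_comb_add: "lin_comb b p (\<lambda>i. x i + y i) = lin_comb b p x + lin_comb b p y"
  by (simp add: lin_comb_def sum.distrib scaleR_left_distrib)

lemma lin_comb_scale: "lin_comb b p (\<lambda>i. c * x i) = c *\<^sub>R lin_comb b p x"
  by (simp add: lin_comb_def scaleR_sum_right)

lemma lin_comb_diff: "lin_comb b p (\<lambda>i. x i - y i) = lin_comb b p x - lin_comb b p y"
  by (simp add: lin_comb_def sum_subtractf scaleR_left_diff_distrib)

lemma lin_comb_cong: "(\<And>i. i \<le> p \<Longrightarrow> x i = y i) \<Longrightarrow> lin_comb b p x = lin_comb b p y"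
  by (simp add: lin_comb_def)

lemma lin_comb_in_span: "lin_comb b p x \<in> span (b ` {..p})"
  unfolding lin_comb_def by (intro span_sum span_scale span_base) auto

lemma lin_comb_coords:
  assumes "basis_seq b p" "v \<in> span (b ` {..p})"
  shows "lin_comb b p (coords b p v) = v"
proof -
  have "(\<Sum>w\<in>b ` {..p}. representation (b ` {..p}) v w *\<^sub>R w) = v"
    using assms by (intro sum_representation_eq) (auto simp: basis_seq_def)
  then show ?thesis
    using assms by (simp add: lin_comb_def coords_def sum.reindex basis_seq_def)
qed

lemma lin_comb_inj:
  assumes "basis_seq b p" "lin_comb b p x = lin_comb b p y" "i \<le> p"
  shows "x i = y i"
proof -
  have inj: "inj_on b {..p}" and ind: "independent (b ` {..p})" using assms by (auto simp: basis_seq_def)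
  let ?u = "\<lambda>w. x (inv_into {..p} b w) - y (inv_into {..p} b w)"
  have "(\<Sum>w\<in>b ` {..p}. ?u w *\<^sub>R w) = lin_comb b p x - lin_comb b p y"
    by (simp add: sum.reindex inj lin_comb_def sum_subtractf scaleR_left_diff_distrib)
  then have sum0: "(\<Sum>w\<in>b ` {..p}. ?u w *\<^sub>R w) = 0" using assms(2) by simp
  have "?u w = 0" if w: "w \<in> b ` {..p}" for w
  proof (rule ccontr)
    assume "?u w \<noteq> 0"
    then have "\<exists>u. (\<exists>v\<in>b ` {..p}. u v \<noteq> 0) \<and> (\<Sum>v\<in>b ` {..p}. u v *\<^sub>R v) = 0"
      using w sum0 by (intro exI [of _ ?u]) blast
    then have "dependent (b ` {..p})" by (subst dependent_finite) auto
    then show False using ind by simp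
  qed
  from this [of "b i"] show ?thesis using assms(3) inj by simp
qed

lemma coords_lin_comb:
  assumes "basis_seq b p" "i \<le> p"
  shows "coords b p (lin_comb b p x) i = x i"
  using lin_comb_inj [OF assms(1) _ assms(2)] lin_comb_coords [OF assms(1) lin_comb_in_span] by blast

lemma coords_beyond: "p < i \<Longrightarrow> coords b p v i = 0"
  by (simp add: coords_def)

lemma closed_span_if_coords_bound:
  fixes b :: "nat \<Rightarrow> 'a::banach"
  assumes basis: "basis_seq b q" and e: "e > 0"
    and bound: "\<And>x i. i \<le> q \<Longrightarrow> \<bar>x i\<bar> \<le> e * norm (lin_comb b q x)"
  shows "closed (span (b ` {..q}))"
  unfolding closed_sequential_limits
proof (intro allI impI)
  fix w l assume w: "(\<forall>n. w n \<in> span (b ` {..q})) \<and> w \<longlonglongrightarrow> l"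
  let ?x = "\<lambda>n. coords b q (w n)"
  have xw: "lin_comb b q (?x n) = w n" for n
    using lin_comb_coords [OF basis] w by blast
  have "Cauchy (\<lambda>n. ?x n i)" if i: "i \<le> q" for i
  proof (rule metric_CauchyI)
    fix r :: real assume r: "r > 0"
    have "Cauchy w" using w LIMSEQ_imp_Cauchy by blast
    then obtain M where M: "\<And>m n. m \<ge> M \<Longrightarrow> n \<ge> M \<Longrightarrow> dist (w m) (w n) < r / e"
      using r e unfolding Cauchy_def by (meson divide_pos_pos)
    have "dist (?x m i) (?x n i) < r" if "m \<ge> M" "n \<ge> M" for m n
    proof -
      have "\<bar>?x m i - ?x n i\<bar> \<le> e * norm (lin_comb b q (\<lambda>i. ?x m i - ?x n i))"
        using bound [OF i, of "\<lambda>i. ?x m i - ?x n i"] .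
      also have "\<dots> = e * dist (w m) (w n)" by (simp add: lin_comb_diff xw dist_norm)
      also have "\<dots> < r" using M [OF that] e by (simp add: field_simps)
      finally show ?thesis by (simp add: dist_real_def)
    qed
    then show "\<exists>M. \<forall>m\<ge>M. \<forall>n\<ge>M. dist (?x m i) (?x n i) < r" by blast
  qed
  then have "\<exists>y. \<forall>i\<le>q. (\<lambda>n. ?x n i) \<longlonglongrightarrow> y i"
    by (meson Cauchy_convergent convergent_LIMSEQ_iff)
  then obtain y where "\<And>i. i \<le> q \<Longrightarrow> (\<lambda>n. ?x n i) \<longlonglongrightarrow> y i" by blast
  then have "(\<lambda>n. lin_comb b q (?x n)) \<longlonglongrightarrow> lin_comb b q y"
    unfolding lin_comb_def by (intro tendsto_sum tendsto_scaleR tendsto_const) auto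
  then have "l = lin_comb b q y" using w LIMSEQ_unique by (simp add: xw) blast
  then show "l \<in> span (b ` {..q})" using lin_comb_in_span by blast
qed

text \<open>The two claims feed each other in the induction: closedness of the smaller span keeps
  the new basis vector at a positive distance from it, which bounds the new coordinate, and the
  coordinate bound makes the larger span closed.\<close>

lemma coords_bound_and_closed:
  fixes b :: "nat \<Rightarrow> 'a::banach"
  assumes "basis_seq b p"
  shows "(\<exists>c>0. \<forall>x. \<forall>i\<le>p. \<bar>x i\<bar> \<le> c * norm (lin_comb b p x)) \<and> closed (span (b ` {..p}))"
  using assms
proof (induction p)
  case (0)
  have b0: "b 0 \<noteq> 0"
    using 0 by (auto simp: basis_seq_def dependent_zero)
  have "\<bar>x i\<bar> \<le> 1 / norm (b 0) * norm (lin_comb b 0 x)" if "i \<le> 0" for x i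
    using b0 that by (simp add: lin_comb_def)
  then show ?case
    using closed_span_if_coords_bound [OF 0, of "1 / norm (b 0)"] b0 by (metis zero_less_divide_1_iff zero_less_norm_iff)
next
  case (Suc p)
  have bp: "basis_seq b p"
    using Suc.prems unfolding basis_seq_def
    by (metis atMost_Suc image_insert independent_insert inj_on_insert)
  obtain c where c: "c > 0" "\<And>x i. i \<le> p \<Longrightarrow> \<bar>x i\<bar> \<le> c * norm (lin_comb b p x)" and cl: "closed (span (b ` {..p}))"
    using Suc.IH [OF bp] by blast
  have notin: "b (Suc p) \<notin> span (b ` {..p})"
  proof -
    have "b (Suc p) \<notin> b ` {..p}"
      using Suc.prems inj_on_image_mem_iff [of b "{..Suc p}" "Suc p" "{..p}"] by (simp add: basis_seq_def)
    then show ?thesis using Suc.prems by (auto simp: basis_seq_def atMost_Suc independent_insert)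
  qed
  have "open (- span (b ` {..p}))" using cl by (simp add: open_Compl)
  then obtain d where d: "d > 0" "ball (b (Suc p)) d \<subseteq> - span (b ` {..p})"
    using notin open_contains_ball by blast
  have dist: "d \<le> norm (b (Suc p) + w)" if "w \<in> span (b ` {..p})" for w
  proof (rule ccontr)
    assume "\<not> d \<le> norm (b (Suc p) + w)"
    then have "- w \<in> ball (b (Suc p)) d" by (simp add: dist_norm)
    then show False using d that span_neg by blast
  qed
  have last: "\<bar>x (Suc p)\<bar> * d \<le> norm (lin_comb b (Suc p) x)" for x
  proof (cases "x (Suc p) = 0")
    case False
    have "lin_comb b (Suc p) x = x (Suc p) *\<^sub>R (b (Suc p) + (1 / x (Suc p)) *\<^sub>R lin_comb b p x)"
      using False by (simp add: lin_comb_def scaleR_right_distrib)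
    then have "norm (lin_comb b (Suc p) x) = \<bar>x (Suc p)\<bar> * norm (b (Suc p) + (1 / x (Suc p)) *\<^sub>R lin_comb b p x)"
      by simp
    moreover have "d \<le> norm (b (Suc p) + (1 / x (Suc p)) *\<^sub>R lin_comb b p x)"
      by (intro dist span_scale lin_comb_in_span)
    ultimately show ?thesis by (simp add: mult_left_mono)
  qed simp
  \<comment> \<open>The first entry bounds the last coordinate through the distance
    \<open>d\<close>; the second bounds the others after the last term has been subtracted.\<close>
  define e where "e = max (1 / d) (c * (1 + norm (b (Suc p)) / d))"
  have bound: "\<bar>x i\<bar> \<le> e * norm (lin_comb b (Suc p) x)" if "i \<le> Suc p" for x i
  proof (cases "i = Suc p")
    case True
    have "\<bar>x i\<bar> \<le> (1 / d) * norm (lin_comb b (Suc p) x)"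
      using last [of x] d(1) True by (simp add: field_simps)
    also have "\<dots> \<le> e * norm (lin_comb b (Suc p) x)"
      by (intro mult_right_mono) (auto simp: e_def)
    finally show ?thesis .
  next
    case False
    have l: "\<bar>x (Suc p)\<bar> \<le> norm (lin_comb b (Suc p) x) / d"
      using last [of x] d(1) by (simp add: field_simps)
    have "lin_comb b p x = lin_comb b (Suc p) x - x (Suc p) *\<^sub>R b (Suc p)"
      by (simp add: lin_comb_def)
    then have "norm (lin_comb b p x) \<le> norm (lin_comb b (Suc p) x) + \<bar>x (Suc p)\<bar> * norm (b (Suc p))"
      using norm_triangle_ineq4 [of "lin_comb b (Suc p) x" "x (Suc p) *\<^sub>R b (Suc p)"] by simp
    also have "\<dots> \<le> norm (lin_comb b (Suc p) x) + norm (lin_comb b (Suc p) x) / d * norm (b (Suc p))"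
      using l by (intro add_left_mono mult_right_mono) auto
    finally have n: "norm (lin_comb b p x) \<le> (1 + norm (b (Suc p)) / d) * norm (lin_comb b (Suc p) x)"
      by (simp add: algebra_simps)
    have "\<bar>x i\<bar> \<le> c * norm (lin_comb b p x)" using c(2) False that by simp
    also have "\<dots> \<le> c * ((1 + norm (b (Suc p)) / d) * norm (lin_comb b (Suc p) x))"
      using n c(1) by (intro mult_left_mono) auto
    also have "\<dots> \<le> e * norm (lin_comb b (Suc p) x)"
      unfolding mult.assoc [symmetric] by (intro mult_right_mono) (auto simp: e_def)
    finally show ?thesis .
  qed
  have e: "e > 0" using d by (auto simp: e_def less_max_iff_disj)
  have "closed (span (b ` {..Suc p}))"
    using closed_span_if_coords_bound [OF Suc.prems e bound] .
  then show ?case using e bound by blast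
qed

lemma coords_bound:
  fixes b :: "nat \<Rightarrow> 'a::banach"
  assumes "basis_seq b p"
  obtains c where "c > 0" "\<And>x i. i \<le> p \<Longrightarrow> \<bar>x i\<bar> \<le> c * norm (lin_comb b p x)"
proof -
  from conjunct1 [OF coords_bound_and_closed [OF assms]]
  obtain c where c: "c > 0 \<and> (\<forall>x. \<forall>i\<le>p. \<bar>x i\<bar> \<le> c * norm (lin_comb b p x))" by (rule exE)
  show thesis by (rule that [of c]) (use c in auto)
qed

lemma closed_span_basis_seq:
  fixes b :: "nat \<Rightarrow> 'a::banach"
  assumes "basis_seq b p" shows "closed (span (b ` {..p}))"
  by (rule conjunct2 [OF coords_bound_and_closed [OF assms]])

lemma compact_lin_comb_box:
  fixes b :: "nat \<Rightarrow> 'a::real_normed_vector"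
  shows "compact {lin_comb b p x | x. \<forall>i\<le>p. \<bar>x i\<bar> \<le> M}"
proof (induction p)
  case 0
  have "{lin_comb b 0 x | x. \<forall>i\<le>0. \<bar>x i\<bar> \<le> M} = (\<lambda>t. t *\<^sub>R b 0) ` {-M..M}"
    by (force simp: lin_comb_def abs_le_iff image_iff)
  then show ?case by (auto intro!: compact_continuous_image continuous_intros)
next
  case (Suc p)
  have "{lin_comb b (Suc p) x | x. \<forall>i\<le>Suc p. \<bar>x i\<bar> \<le> M} =
     (\<lambda>(v, t). v + t *\<^sub>R b (Suc p)) ` ({lin_comb b p x | x. \<forall>i\<le>p. \<bar>x i\<bar> \<le> M} \<times> {-M..M})" (is "?L = ?R")
  proof
    show "?L \<subseteq> ?R"
    proof clarify
      fix x assume "\<forall>i\<le>Suc p. \<bar>x i\<bar> \<le> M"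
      then show "lin_comb b (Suc p) x \<in> ?R"
        by (intro image_eqI [of _ _ "(lin_comb b p x, x (Suc p))"]) (auto simp: lin_comb_def abs_le_iff)
    qed
    show "?R \<subseteq> ?L"
    proof clarify
      fix x t assume x: "\<forall>i\<le>p. \<bar>x i\<bar> \<le> M" and t: "t \<in> {-M..M}"
      have "lin_comb b (Suc p) (x(Suc p := t)) = lin_comb b p x + t *\<^sub>R b (Suc p)"
        by (simp add: lin_comb_def)
      moreover have "\<forall>i\<le>Suc p. \<bar>(x(Suc p := t)) i\<bar> \<le> M" using x t by (auto simp: le_Suc_eq)
      ultimately show "\<exists>x'. lin_comb b p x + t *\<^sub>R b (Suc p) = lin_comb b (Suc p) x' \<and> (\<forall>i\<le>Suc p. \<bar>x' i\<bar> \<le> M)"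
        by metis
    qed
  qed
  moreover have "compact ?R"
    by (intro compact_continuous_image compact_Times Suc compact_Icc)
       (auto simp: case_prod_beta intro!: continuous_intros)
  ultimately show ?case by simp
qed

lemma compact_in_span:
  fixes b :: "nat \<Rightarrow> 'a::banach"
  assumes b: "basis_seq b p" and "closed S" "bounded S" "S \<subseteq> span (b ` {..p})"
  shows "compact S"
proof -
  obtain c where c: "c > 0" "\<And>x i. i \<le> p \<Longrightarrow> \<bar>x i\<bar> \<le> c * norm (lin_comb b p x)"
    using coords_bound [OF b] by blast
  obtain R where R: "\<And>v. v \<in> S \<Longrightarrow> norm v \<le> R" using assms by (auto simp: bounded_iff)
  have "S \<subseteq> {lin_comb b p x | x. \<forall>i\<le>p. \<bar>x i\<bar> \<le> c * R}"
  proof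
    fix v assume v: "v \<in> S"
    have "\<bar>coords b p v i\<bar> \<le> c * R" if "i \<le> p" for i
    proof -
      have "\<bar>coords b p v i\<bar> \<le> c * norm v"
        using c(2) [OF that, of "coords b p v"] lin_comb_coords [OF b] assms v by auto
      also have "\<dots> \<le> c * R" using R [OF v] c(1) by (intro mult_left_mono) auto
      finally show ?thesis .
    qed
    then show "v \<in> {lin_comb b p x | x. \<forall>i\<le>p. \<bar>x i\<bar> \<le> c * R}"
      using lin_comb_coords [OF b, of v] assms v by (auto intro!: exI [of _ "coords b p v"])
  qed
  then show ?thesis
    using compact_Int_closed [OF compact_lin_comb_box \<open>closed S\<close>, of b p "c * R"] by (simp add: Int_absorb1)
qed

lemma continuous_on_coords:
  fixes b :: "nat \<Rightarrow> 'a::banach"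
  assumes b: "basis_seq b p"
  shows "continuous_on (span (b ` {..p})) (\<lambda>v. coords b p v i)"
proof (cases "i \<le> p")
  case True
  obtain c where c: "c > 0" "\<And>x i. i \<le> p \<Longrightarrow> \<bar>x i\<bar> \<le> c * norm (lin_comb b p x)"
    using coords_bound [OF b] by blast
  have "dist (coords b p v i) (coords b p w i) \<le> c * dist v w"
    if "v \<in> span (b ` {..p})" "w \<in> span (b ` {..p})" for v w
  proof -
    have "\<bar>coords b p v i - coords b p w i\<bar> \<le> c * norm (lin_comb b p (\<lambda>i. coords b p v i - coords b p w i))"
      using c(2) [OF True, of "\<lambda>i. coords b p v i - coords b p w i"] .
    then show ?thesis using lin_comb_coords [OF b] that by (simp add: lin_comb_diff dist_norm)
  qed
  then show ?thesis
    by (intro lipschitz_on_continuous_on [of c] lipschitz_onI) (use c in auto)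
qed (simp add: coords_beyond)

lemma coords_linear:
  assumes b: "basis_seq b p" and "v \<in> span (b ` {..p})" "w \<in> span (b ` {..p})"
  shows "coords b p (s *\<^sub>R v + t *\<^sub>R w) i = s * coords b p v i + t * coords b p w i"
proof (cases "i \<le> p")
  case True
  have "s *\<^sub>R v + t *\<^sub>R w = lin_comb b p (\<lambda>i. s * coords b p v i + t * coords b p w i)"
    by (simp add: lin_comb_add lin_comb_scale lin_comb_coords assms)
  then show ?thesis using coords_lin_comb [OF b True] by simp
qed (simp add: coords_beyond)

lemma coords_nonzero:
  assumes b: "basis_seq b p" and "v \<in> span (b ` {..p})" "v \<noteq> 0"
  obtains i where "i \<le> p" "coords b p v i \<noteq> 0"
proof -
  have "lin_comb b p (coords b p v) \<noteq> 0" using lin_comb_coords [OF b] assms by auto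
  moreover have "lin_comb b p (coords b p v) = 0" if "\<forall>i\<le>p. coords b p v i = 0"
    using that by (simp add: lin_comb_def)
  ultimately have "\<not> (\<forall>i\<le>p. coords b p v i = 0)" by blast
  then show ?thesis using that by blast
qed

lemma basis_seq_of_span:
  fixes G :: "'a::real_vector set"
  assumes "finite G" "span G \<noteq> {0}"
  obtains b p where "basis_seq b p" "span (b ` {..p}) = span G"
proof -
  obtain B where B: "B \<subseteq> G" "independent B" "G \<subseteq> span B"
    using maximal_independent_subset by blast
  have fin: "finite B" using B assms finite_subset by blast
  have sp: "span B = span G" 
    by (rule antisym [OF span_mono [OF B(1)] span_minimal [OF B(3) subspace_span]])
  have "B \<noteq> {}" using sp assms(2) span_empty by metis
  then obtain p where p: "card B = Suc p" using fin by (cases "card B") auto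
  obtain b where "bij_betw b {0..<card B} B" using ex_bij_betw_nat_finite [OF fin] by blast
  then have "bij_betw b {..<Suc p} B" by (simp add: p atLeast0LessThan)
  then have "bij_betw b {..p} B" by (simp add: lessThan_Suc_atMost)
  then show ?thesis using that [of b p] B sp by (simp add: basis_seq_def bij_betw_def)
qed

subsection \<open>Brouwer degree on balls of finite-dimensional subspaces\<close>

definition nsph :: "nat \<Rightarrow> (nat \<Rightarrow> real) set" where
  "nsph p = {x. (\<Sum>i\<le>p. (x i)\<^sup>2) = 1 \<and> (\<forall>i>p. x i = 0)}"

lemma nsphere_nsph: "nsphere p = top_of_set (nsph p)"
  by (simp add: nsphere nsph_def euclidean_product_topology)

definition normalize_vec :: "nat \<Rightarrow> (nat \<Rightarrow> real) \<Rightarrow> nat \<Rightarrow> real" where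
  "normalize_vec p y i = y i / sqrt (\<Sum>j\<le>p. (y j)\<^sup>2)"

definition radial :: "(nat \<Rightarrow> 'a::real_normed_vector) \<Rightarrow> nat \<Rightarrow> real \<Rightarrow> (nat \<Rightarrow> real) \<Rightarrow> 'a" where
  "radial b p r x = (r / norm (lin_comb b p x)) *\<^sub>R lin_comb b p x"

text \<open>\<open>boundary_sphere_map\<close> with different bases \<open>b\<close> in the target and \<open>c\<close> in the source.\<close>

definition sphere_map :: "(nat \<Rightarrow> 'a::real_normed_vector) \<Rightarrow> (nat \<Rightarrow> 'a) \<Rightarrow> nat \<Rightarrow> real \<Rightarrow> ('a \<Rightarrow> 'a) \<Rightarrow>
    (nat \<Rightarrow> real) \<Rightarrow> nat \<Rightarrow> real" where
  "sphere_map b c p r g x = normalize_vec p (coords b p (g (radial c p r x)))"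

lemma boundary_sphere_map_eq: "boundary_sphere_map b p r g = sphere_map b b p r g"
  by (simp add: fun_eq_iff boundary_sphere_map_def sphere_map_def normalize_vec_def radial_def Let_def)

lemma normalize_vec_scale: "c > 0 \<Longrightarrow> normalize_vec p (\<lambda>i. c * y i) = normalize_vec p y"
  by (simp add: fun_eq_iff normalize_vec_def power_mult_distrib real_sqrt_mult flip: sum_distrib_left)

lemma normalize_vec_nsph: "x \<in> nsph p \<Longrightarrow> normalize_vec p x = x"
  by (simp add: fun_eq_iff normalize_vec_def nsph_def)

lemma sum_squares_pos: "(i::nat) \<le> p \<Longrightarrow> y i \<noteq> 0 \<Longrightarrow> 0 < (\<Sum>j\<le>p. (y j :: real)\<^sup>2)"
  by (rule sum_pos2 [of _ i]) auto

lemma normalize_vec_in_nsph: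
  assumes "i \<le> p" "y i \<noteq> 0" "\<And>i. p < i \<Longrightarrow> y i = 0"
  shows "normalize_vec p y \<in> nsph p"
proof -
  have s: "0 < (\<Sum>j\<le>p. (y j)\<^sup>2)" by (rule sum_squares_pos [of i]) (use assms in auto)
  have "(\<Sum>j\<le>p. (normalize_vec p y j)\<^sup>2) = (\<Sum>j\<le>p. (y j)\<^sup>2) / (\<Sum>j\<le>p. (y j)\<^sup>2)"
    using s by (simp add: normalize_vec_def power_divide flip: sum_divide_distrib)
  then show ?thesis using s assms(3) by (simp add: nsph_def normalize_vec_def)
qed

lemma lin_comb_nonzero:
  assumes "basis_seq b p" "x \<in> nsph p" shows "lin_comb b p x \<noteq> 0"
proof
  assume "lin_comb b p x = 0"
  then have "lin_comb b p x = lin_comb b p (\<lambda>_. 0)" by (simp add: lin_comb_def)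
  then have "\<forall>i\<le>p. x i = 0" using lin_comb_inj [OF assms(1)] by blast
  then show False using assms(2) by (simp add: nsph_def)
qed

lemma radial_in:
  assumes "basis_seq b p" "x \<in> nsph p" "0 < r"
  shows "radial b p r x \<in> span (b ` {..p}) \<inter> sphere 0 r"
  using lin_comb_nonzero [OF assms(1,2)] assms(3)
  by (auto simp: radial_def intro: span_scale lin_comb_in_span)

lemma continuous_on_lin_comb:
  fixes b :: "nat \<Rightarrow> 'a::real_normed_vector" shows "continuous_on S (lin_comb b p)"
  unfolding lin_comb_def [abs_def]
  by (intro continuous_on_sum continuous_on_scaleR continuous_on_const
       continuous_on_subset [OF continuous_on_product_coordinates]) auto

lemma continuous_on_radial:
  assumes "basis_seq b p" shows "continuous_on (nsph p) (radial b p r)"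
  unfolding radial_def [abs_def]
  using lin_comb_nonzero [OF assms]
  by (intro continuous_on_scaleR continuous_on_divide continuous_on_const continuous_on_norm
      continuous_on_lin_comb) auto

lemma sphere_map_homotopic:
  fixes b c :: "nat \<Rightarrow> 'a::banach"
  assumes b: "basis_seq b p" and c: "basis_seq c p" and bc: "span (b ` {..p}) = W" "span (c ` {..p}) = W"
    and r: "0 < r" and cont: "continuous_on ({0..1::real} \<times> (W \<inter> sphere 0 r)) (\<lambda>(t, x). g t x)"
    and into: "\<And>t x. t \<in> {0..1} \<Longrightarrow> x \<in> W \<inter> sphere 0 r \<Longrightarrow> g t x \<in> W - {0}"
  shows "homotopic_with (\<lambda>_. True) (nsphere p) (nsphere p) (sphere_map b c p r (g 0)) (sphere_map b c p r (g 1))"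
proof -
  let ?D = "{0..1::real} \<times> nsph p"
  define y where "y z = coords b p (g (fst z) (radial c p r (snd z)))" for z
  have rad: "radial c p r (snd z) \<in> W \<inter> sphere 0 r" if "z \<in> ?D" for z
    using radial_in [OF c _ r, of "snd z"] that unfolding bc by (simp add: mem_Times_iff)
  have yc: "continuous_on ?D (\<lambda>z. y z i)" for i
  proof -
    have 1: "continuous_on ?D (\<lambda>z. (fst z, radial c p r (snd z)))"
      by (intro continuous_on_Pair continuous_on_fst continuous_on_id
          continuous_on_compose2 [OF continuous_on_radial [OF c] continuous_on_snd [OF continuous_on_id]]) auto
    have "continuous_on ?D (\<lambda>z. case (fst z, radial c p r (snd z)) of (t, x) \<Rightarrow> g t x)"
      by (rule continuous_on_compose2 [OF cont 1]) (use rad in auto)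
    then have "continuous_on ?D (\<lambda>z. g (fst z) (radial c p r (snd z)))" by simp
    then show ?thesis unfolding y_def
      by (rule continuous_on_compose2 [OF continuous_on_coords [OF b]]) (use rad into bc in auto)
  qed
  have y0: "\<exists>i\<le>p. y z i \<noteq> 0" if "z \<in> ?D" for z
  proof -
    have "g (fst z) (radial c p r (snd z)) \<in> W - {0}"
      by (rule into [OF _ rad [OF that]]) (use that in \<open>simp add: mem_Times_iff\<close>)
    then have "g (fst z) (radial c p r (snd z)) \<in> span (b ` {..p})" "g (fst z) (radial c p r (snd z)) \<noteq> 0"
      unfolding bc by auto
    from coords_nonzero [OF b this] show ?thesis unfolding y_def by blast
  qed
  have pos: "sqrt (\<Sum>j\<le>p. (y z j)\<^sup>2) \<noteq> 0" if "z \<in> ?D" for z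
    using y0 [OF that] sum_squares_pos [of _ p "y z"] by force
  define h where "h z = normalize_vec p (y z)" for z
  have "continuous_on ?D h"
    unfolding h_def
    by (rule continuous_on_coordinatewise_then_product)
       (simp only: normalize_vec_def, intro continuous_intros yc, use pos in blast)
  moreover have "h z \<in> nsph p" if z: "z \<in> ?D" for z
  proof -
    obtain i where "i \<le> p" "y z i \<noteq> 0" using y0 [OF z] by blast
    then show ?thesis unfolding h_def by (rule normalize_vec_in_nsph) (simp add: y_def coords_beyond)
  qed
  ultimately have "continuous_map (prod_topology (top_of_set {0..1}) (nsphere p)) (nsphere p) h"
    by (auto simp: nsphere_nsph prod_topology_subtopology subtopology_subtopology continuous_map_in_subtopology Times_Int_Times)
  then show ?thesis
    unfolding homotopic_with_def by (intro exI [of _ h]) (auto simp: h_def y_def sphere_map_def)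
qed

lemma sphere_map_continuous:
  fixes b c :: "nat \<Rightarrow> 'a::banach"
  assumes "basis_seq b p" "basis_seq c p" "span (b ` {..p}) = W" "span (c ` {..p}) = W"
    and "0 < r" "continuous_on (W \<inter> sphere 0 r) g" "\<And>x. x \<in> W \<inter> sphere 0 r \<Longrightarrow> g x \<in> W - {0}"
  shows "continuous_map (nsphere p) (nsphere p) (sphere_map b c p r g)"
proof -
  have "continuous_on ({0..1::real} \<times> (W \<inter> sphere 0 r)) (\<lambda>(t, x). g x)"
    unfolding case_prod_beta
    by (rule continuous_on_compose2 [OF assms(6) continuous_on_snd]) (auto intro: continuous_intros)
  then have "homotopic_with (\<lambda>_. True) (nsphere p) (nsphere p) (sphere_map b c p r g) (sphere_map b c p r g)"
    using sphere_map_homotopic [OF assms(1-5), of "\<lambda>_. g"] assms(7) by auto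
  then show ?thesis by simp
qed

text \<open>The basis \<open>b\<close> in the middle cancels: passing to coordinates and back only
  rescales the intermediate vector \<open>w\<close> to the radius \<open>s\<close>.\<close>

lemma sphere_map_compose:
  fixes a b c :: "nat \<Rightarrow> 'a::banach"
  assumes b: "basis_seq b p" and c: "basis_seq c p" and bc: "span (b ` {..p}) = W" "span (c ` {..p}) = W"
    and r: "0 < r" and s: "0 < s" and g: "\<And>x. x \<in> W \<inter> sphere 0 r \<Longrightarrow> g x \<in> W - {0}" and x: "x \<in> nsph p"
  defines "w \<equiv> g (radial c p r x)"
  shows "sphere_map a b p s f (sphere_map b c p r g x) = normalize_vec p (coords a p (f ((s / norm w) *\<^sub>R w)))"
proof -
  have w: "w \<in> W" "w \<noteq> 0" unfolding w_def using g radial_in [OF c x r] bc by auto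
  obtain i where "i \<le> p" "coords b p w i \<noteq> 0" using coords_nonzero [OF b] w bc by blast
  then have n: "0 < sqrt (\<Sum>j\<le>p. (coords b p w j)\<^sup>2)" using sum_squares_pos by simp
  have "lin_comb b p (sphere_map b c p r g x) = (1 / sqrt (\<Sum>j\<le>p. (coords b p w j)\<^sup>2)) *\<^sub>R lin_comb b p (coords b p w)"
    by (simp add: sphere_map_def w_def normalize_vec_def [abs_def] flip: lin_comb_scale)
  then have "lin_comb b p (sphere_map b c p r g x) = (1 / sqrt (\<Sum>j\<le>p. (coords b p w j)\<^sup>2)) *\<^sub>R w"
    using lin_comb_coords [OF b] w bc by simp
  then have "radial b p s (sphere_map b c p r g x) = (s / norm w) *\<^sub>R w"
    using n by (simp add: radial_def)
  then show ?thesis by (simp add: sphere_map_def)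
qed

text \<open>A positively homogeneous \<open>f\<close> commutes with the rescaling in the middle, and
  normalisation removes the factor.\<close>

lemma sphere_map_compose_homogeneous:
  fixes a b c :: "nat \<Rightarrow> 'a::banach"
  assumes a: "basis_seq a p" "span (a ` {..p}) = W"
    and b: "basis_seq b p" and c: "basis_seq c p" and bc: "span (b ` {..p}) = W" "span (c ` {..p}) = W"
    and r: "0 < r" and s: "0 < s" and g: "\<And>x. x \<in> W \<inter> sphere 0 r \<Longrightarrow> g x \<in> W - {0}" and x: "x \<in> nsph p"
    and f: "\<And>x t. x \<in> W \<Longrightarrow> 0 < t \<Longrightarrow> f (t *\<^sub>R x) = t *\<^sub>R f x" "\<And>x. x \<in> W \<Longrightarrow> f x \<in> W"
  shows "sphere_map a b p s f (sphere_map b c p r g x) = sphere_map a c p r (f \<circ> g) x"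
proof -
  let ?w = "g (radial c p r x)"
  have w: "?w \<in> W" "?w \<noteq> 0" using g radial_in [OF c x r] bc by auto
  have fw: "f ((s / norm ?w) *\<^sub>R ?w) = (s / norm ?w) *\<^sub>R f ?w"
    using w s by (intro f) auto
  have "coords a p ((s / norm ?w) *\<^sub>R f ?w) = (\<lambda>i. (s / norm ?w) * coords a p (f ?w) i)"
    using coords_linear [OF a(1), of "f ?w" 0 "s / norm ?w" 0] f(2) [OF w(1)] a span_0 by (auto simp: fun_eq_iff)
  then have "normalize_vec p (coords a p ((s / norm ?w) *\<^sub>R f ?w)) = normalize_vec p (coords a p (f ?w))"
    using w s by (simp only:) (rule normalize_vec_scale, simp)
  then show ?thesis
    using sphere_map_compose [where g = g and a = a and f = f, OF b c bc r s g x] fw by (simp add: sphere_map_def)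
qed

lemma sphere_map_compose_id:
  fixes a b c :: "nat \<Rightarrow> 'a::banach"
  assumes b: "basis_seq b p" and c: "basis_seq c p" and bc: "span (b ` {..p}) = W" "span (c ` {..p}) = W"
    and s: "0 < s" and x: "x \<in> nsph p"
  shows "sphere_map a b p s f (sphere_map b c p 1 id x) = sphere_map a c p s f x"
proof -
  have id_into: "id x \<in> W - {0}" if "x \<in> W \<inter> sphere 0 1" for x
    using that by auto
  have "sphere_map a b p s f (sphere_map b c p 1 id x) =
     normalize_vec p (coords a p (f ((s / norm (radial c p 1 x)) *\<^sub>R radial c p 1 x)))"
    using sphere_map_compose [where g = id and a = a and f = f, OF b c bc zero_less_one s id_into x] by simp
  also have "(s / norm (radial c p 1 x)) *\<^sub>R radial c p 1 x = radial c p s x"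
    using lin_comb_nonzero [OF c x] by (simp add: radial_def)
  finally show ?thesis by (simp add: sphere_map_def)
qed

lemma sphere_map_id:
  assumes b: "basis_seq b p" and x: "x \<in> nsph p" and "0 < r"
  shows "sphere_map b b p r id x = x"
proof -
  have "coords b p (radial b p r x) = (\<lambda>i. r / norm (lin_comb b p x) * x i)"
  proof
    fix i show "coords b p (radial b p r x) i = r / norm (lin_comb b p x) * x i"
    proof (cases "i \<le> p")
      case True
      then show ?thesis unfolding radial_def lin_comb_scale [symmetric]
        by (rule coords_lin_comb [OF b])
    qed (use x in \<open>simp add: coords_beyond nsph_def\<close>)
  qed
  then show ?thesis
    using lin_comb_nonzero [OF b x] assms(3)
    by (simp add: sphere_map_def normalize_vec_nsph x normalize_vec_scale [of "r / norm (lin_comb b p x)" p x, simplified])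
qed

text \<open>The two changes of basis are mutually inverse sphere maps. They conjugate one normalised
  map into the other, and by multiplicativity their degrees cancel.\<close>

lemma degree_basis_independent:
  fixes b c :: "nat \<Rightarrow> 'a::banach"
  assumes b: "basis_seq b p" and c: "basis_seq c p" and bc: "span (b ` {..p}) = W" "span (c ` {..p}) = W"
    and r: "0 < r" and g: "continuous_on (W \<inter> sphere 0 r) g" "\<And>x. x \<in> W \<inter> sphere 0 r \<Longrightarrow> g x \<in> W - {0}"
  shows "Brouwer_degree2 p (sphere_map c c p r g) = Brouwer_degree2 p (sphere_map b b p r g)"
proof -
  let ?bc = "sphere_map b c p 1 id" and ?cb = "sphere_map c b p 1 id" and ?g = "sphere_map b b p r g"
  have cm: "continuous_map (nsphere p) (nsphere p) ?bc" "continuous_map (nsphere p) (nsphere p) ?cb"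
    by (rule sphere_map_continuous [OF b c bc] sphere_map_continuous [OF c b bc(2,1)];
        auto intro: continuous_intros)+
  have cg: "continuous_map (nsphere p) (nsphere p) ?g"
    using sphere_map_continuous [OF b b bc(1) bc(1) r g] .
  have "?cb (?g (?bc x)) = sphere_map c c p r g x" if x: "x \<in> nsph p" for x
  proof -
    have "?g (?bc x) = sphere_map b c p r g x" by (rule sphere_map_compose_id [OF b c bc r x])
    moreover have "?cb (sphere_map b c p r g x) = sphere_map c c p r (id \<circ> g) x"
      by (rule sphere_map_compose_homogeneous [OF c bc(2) b c bc r _ g(2) x]) auto
    ultimately show ?thesis by simp
  qed
  then have "Brouwer_degree2 p (sphere_map c c p r g) = Brouwer_degree2 p (?cb \<circ> (?g \<circ> ?bc))"
    by (intro Brouwer_degree2_eq) (simp add: nsphere_nsph)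
  also have "\<dots> = Brouwer_degree2 p ?cb * (Brouwer_degree2 p ?g * Brouwer_degree2 p ?bc)"
    using cm cg by (simp add: Brouwer_degree2_compose continuous_map_compose [OF cm(1) cg])
  also have "\<dots> = Brouwer_degree2 p ?g * (Brouwer_degree2 p (?cb \<circ> ?bc))"
    using Brouwer_degree2_compose [OF cm] by (simp add: mult_ac)
  also have "Brouwer_degree2 p (?cb \<circ> ?bc) = Brouwer_degree2 p id"
  proof (rule Brouwer_degree2_eq)
    fix x assume "x \<in> topspace (nsphere p)"
    then have x: "x \<in> nsph p" by (simp add: nsphere_nsph)
    then show "(?cb \<circ> ?bc) x = id x"
      using sphere_map_compose_id [OF b c bc _ x, of 1 c id] sphere_map_id [OF c x, of 1] by simp
  qed
  finally show ?thesis by simp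
qed

text \<open>The description by \<open>THE\<close> is unambiguous: the dimension of \<open>W\<close>
  fixes \<open>p\<close>, and the choice of the basis does not affect the degree.\<close>

lemma brouwer_degree_ball_eq:
  fixes b :: "nat \<Rightarrow> 'a::banach"
  assumes b: "basis_seq b p" and W: "span (b ` {..p}) = W"
    and r: "0 < r" and g: "continuous_on (W \<inter> sphere 0 r) g" "\<And>x. x \<in> W \<inter> sphere 0 r \<Longrightarrow> g x \<in> W - {0}"
  shows "brouwer_degree_ball W r g = Brouwer_degree2 p (sphere_map b b p r g)"
proof -
  have ne: "W \<noteq> {0}"
  proof -
    have "b 0 \<in> W" using W by (auto intro: span_base)
    moreover have "b 0 \<noteq> 0" using b dependent_zero [of "b ` {..p}"] by (auto simp: basis_seq_def image_iff)
    ultimately show ?thesis by auto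
  qed
  have "(THE d. \<exists>p b. inj_on b {..p} \<and> independent (b ` {..p}) \<and> span (b ` {..p}) = W \<and>
           d = Brouwer_degree2 p (boundary_sphere_map b p r g)) = Brouwer_degree2 p (sphere_map b b p r g)"
  proof (rule the_equality)
    show "\<exists>q c. inj_on c {..q} \<and> independent (c ` {..q}) \<and> span (c ` {..q}) = W \<and>
           Brouwer_degree2 p (sphere_map b b p r g) = Brouwer_degree2 q (boundary_sphere_map c q r g)"
      using b W by (auto simp: basis_seq_def boundary_sphere_map_eq)
  next
    fix d assume "\<exists>q c. inj_on c {..q} \<and> independent (c ` {..q}) \<and> span (c ` {..q}) = W \<and>
           d = Brouwer_degree2 q (boundary_sphere_map c q r g)"
    then obtain q c where c: "basis_seq c q" "span (c ` {..q}) = W" "d = Brouwer_degree2 q (sphere_map c c q r g)"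
      unfolding basis_seq_def boundary_sphere_map_eq by blast
    have "dim W = Suc q" "dim W = Suc p"
      using b c(1) W c(2) dim_span_eq_card_independent [of "b ` {..p}"] dim_span_eq_card_independent [of "c ` {..q}"]
      by (auto simp: basis_seq_def card_image)
    then have "q = p" by simp
    then show "d = Brouwer_degree2 p (sphere_map b b p r g)"
      using degree_basis_independent [OF b _ W _ r g] c by blast
  qed
  then show ?thesis using ne by (simp add: brouwer_degree_ball_def)
qed

lemma brouwer_degree_ball_homotopy:
  fixes W :: "'a::banach set"
  assumes W: "finite_dimensional W" and r: "0 < r"
    and cont: "continuous_on ({0..1::real} \<times> (W \<inter> sphere 0 r)) (\<lambda>(t, x). g t x)"
    and into: "\<And>t x. t \<in> {0..1} \<Longrightarrow> x \<in> W \<inter> sphere 0 r \<Longrightarrow> g t x \<in> W - {0}"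
  shows "brouwer_degree_ball W r (g 0) = brouwer_degree_ball W r (g 1)"
proof (cases "W = {0}")
  case True
  then show ?thesis by (simp add: brouwer_degree_ball_def)
next
  case False
  obtain G where G: "finite G" "span G = W" using W by (auto simp: finite_dimensional_def)
  obtain b p where b: "basis_seq b p" "span (b ` {..p}) = W"
    using basis_seq_of_span [OF G(1)] G False by blast
  have c: "continuous_on (W \<inter> sphere 0 r) (g t)" if "t \<in> {0..1}" for t
  proof -
    have "continuous_on (W \<inter> sphere 0 r) (\<lambda>x. case (t, x) of (t, x) \<Rightarrow> g t x)"
      by (rule continuous_on_compose2 [OF cont]) (use that in \<open>auto intro!: continuous_intros\<close>)
    then show ?thesis by simp
  qed
  show ?thesis
    using Brouwer_degree2_homotopic [OF sphere_map_homotopic [OF b(1) b(1) b(2) b(2) r cont into]]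
      brouwer_degree_ball_eq [OF b r c into]
    by simp
qed

lemma brouwer_degree_ball_cong:
  fixes W :: "'a::banach set"
  assumes "finite_dimensional W" "0 < r" "continuous_on (W \<inter> sphere 0 r) f"
    "\<And>x. x \<in> W \<inter> sphere 0 r \<Longrightarrow> f x \<in> W - {0}" "\<And>x. x \<in> W \<inter> sphere 0 r \<Longrightarrow> f x = g x"
  shows "brouwer_degree_ball W r f = brouwer_degree_ball W r g"
proof -
  \<comment> \<open>A homotopy that switches at once from \<open>f\<close> to \<open>g\<close>; it
    is continuous because the two agree on the sphere.\<close>
  have "continuous_on ({0..1::real} \<times> (W \<inter> sphere 0 r)) (\<lambda>(t, x). if t = 0 then f x else g x)"
  proof (rule continuous_on_eq)
    show "continuous_on ({0..1::real} \<times> (W \<inter> sphere 0 r)) (\<lambda>z. f (snd z))"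
      by (rule continuous_on_compose2 [OF assms(3)]) (auto intro: continuous_intros)
  qed (use assms(5) in auto)
  then show ?thesis
    using brouwer_degree_ball_homotopy [OF assms(1,2), of "\<lambda>t x. if t = 0 then f x else g x"] assms(4,5) by auto
qed

text \<open>The outer map is taken homogeneous because boundary maps compose only up to a rescaling
  of the intermediate vector.\<close>

lemma brouwer_degree_ball_compose:
  fixes W :: "'a::banach set"
  assumes W: "finite_dimensional W" and r: "0 < r"
    and g: "continuous_on (W \<inter> sphere 0 r) g" "\<And>x. x \<in> W \<inter> sphere 0 r \<Longrightarrow> g x \<in> W - {0}"
    and f: "continuous_on W f" "\<And>x. x \<in> W - {0} \<Longrightarrow> f x \<in> W - {0}"
      "\<And>x t. x \<in> W \<Longrightarrow> 0 < t \<Longrightarrow> f (t *\<^sub>R x) = t *\<^sub>R f x" "f 0 = 0"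
  shows "brouwer_degree_ball W r (f \<circ> g) = brouwer_degree_ball W r f * brouwer_degree_ball W r g"
proof (cases "W = {0}")
  case True
  then show ?thesis by (simp add: brouwer_degree_ball_def)
next
  case False
  obtain G where G: "finite G" "span G = W" using W by (auto simp: finite_dimensional_def)
  obtain b p where b: "basis_seq b p" "span (b ` {..p}) = W"
    using basis_seq_of_span [OF G(1)] G False by blast
  have fW: "f x \<in> W" if "x \<in> W" for x using f(2,4) that by (cases "x = 0") auto
  have f': "continuous_on (W \<inter> sphere 0 r) f" "\<And>x. x \<in> W \<inter> sphere 0 r \<Longrightarrow> f x \<in> W - {0}"
    using continuous_on_subset [OF f(1)] f(2) r by auto
  have fg: "continuous_on (W \<inter> sphere 0 r) (f \<circ> g)" "\<And>x. x \<in> W \<inter> sphere 0 r \<Longrightarrow> (f \<circ> g) x \<in> W - {0}"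
    using g f(2) by (auto simp: comp_def intro!: continuous_on_compose2 [OF f(1) g(1)])
  have "Brouwer_degree2 p (sphere_map b b p r (f \<circ> g)) =
      Brouwer_degree2 p (sphere_map b b p r f \<circ> sphere_map b b p r g)"
    using sphere_map_compose_homogeneous [OF b b(1) b(1) b(2) b(2) r r g(2) _ f(3) fW]
    by (intro Brouwer_degree2_eq) (auto simp: nsphere_nsph)
  also have "\<dots> = Brouwer_degree2 p (sphere_map b b p r f) * Brouwer_degree2 p (sphere_map b b p r g)"
    by (intro Brouwer_degree2_compose sphere_map_continuous [OF b(1) b(1) b(2) b(2) r] f' g)
  finally show ?thesis
    using brouwer_degree_ball_eq [OF b r] f' fg g by simp
qed

lemma brouwer_degree_ball_id:
  fixes W :: "'a::banach set"
  assumes W: "finite_dimensional W" and r: "0 < r"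
  shows "brouwer_degree_ball W r (\<lambda>x. x) = 1"
proof (cases "W = {0}")
  case True
  then show ?thesis by (simp add: brouwer_degree_ball_def)
next
  case False
  obtain G where G: "finite G" "span G = W" using W by (auto simp: finite_dimensional_def)
  obtain b p where b: "basis_seq b p" "span (b ` {..p}) = W"
    using basis_seq_of_span [OF G(1)] G False by blast
  have "brouwer_degree_ball W r (\<lambda>x. x) = Brouwer_degree2 p (sphere_map b b p r (\<lambda>x. x))"
    by (rule brouwer_degree_ball_eq [OF b r]) (use r in \<open>auto intro: continuous_intros\<close>)
  also have "\<dots> = Brouwer_degree2 p id"
    by (rule Brouwer_degree2_eq) (use sphere_map_id [OF b(1) _ r] in \<open>auto simp: nsphere_nsph id_def\<close>)
  finally show ?thesis by simp
qed

subsection \<open>Invertible operators and compact operators\<close>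

lemma GL_I:
  fixes T :: "'a::banach \<Rightarrow>\<^sub>L 'b::banach"
  assumes inj: "\<And>x. c * norm x \<le> norm (T x)" "0 < c" and surj: "\<And>y. \<exists>x. T x = y"
  shows "T \<in> GL"
proof -
  define g where "g y = (SOME x. T x = y)" for y
  have Tg: "T (g y) = y" for y unfolding g_def using surj [of y] by (rule someI_ex)
  have injT: "x = y" if "T x = T y" for x y
  proof -
    have "c * norm (x - y) \<le> norm (T (x - y))" by (rule inj(1))
    then show ?thesis using that assms(2) by (simp add: blinfun.diff_right mult_le_0_iff)
  qed
  have gT: "g (T x) = x" for x by (rule injT) (simp add: Tg)
  have "bounded_linear g"
  proof (rule bounded_linear_intro [where K = "1 / c"])
    show "g (x + y) = g x + g y" for x y by (rule injT) (simp add: Tg blinfun.add_right)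
    show "g (r *\<^sub>R x) = r *\<^sub>R g x" for r x by (rule injT) (simp add: Tg blinfun.scaleR_right)
    show "norm (g x) \<le> norm x * (1 / c)" for x
      using inj(1) [of "g x"] assms(2) by (simp add: Tg field_simps)
  qed
  then have "Blinfun g o\<^sub>L T = id_blinfun" "T o\<^sub>L Blinfun g = id_blinfun"
    by (auto intro!: blinfun_eqI simp: bounded_linear_Blinfun_apply gT Tg)
  then show ?thesis unfolding GL_def by blast
qed

definition inv_op :: "('a::banach \<Rightarrow>\<^sub>L 'b::banach) \<Rightarrow> ('b \<Rightarrow>\<^sub>L 'a)" where
  "inv_op T = (SOME S. S o\<^sub>L T = id_blinfun \<and> T o\<^sub>L S = id_blinfun)"

lemma inv_op:
  assumes "T \<in> GL"
  shows "inv_op T o\<^sub>L T = id_blinfun" "T o\<^sub>L inv_op T = id_blinfun"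
  using someI_ex [of "\<lambda>S. S o\<^sub>L T = id_blinfun \<and> T o\<^sub>L S = id_blinfun"] assms
  by (auto simp: inv_op_def GL_def)

lemma inv_op_apply [simp]:
  assumes "T \<in> GL"
  shows "inv_op T (T x) = x" "T (inv_op T y) = y"
  using inv_op [OF assms] by (metis blinfun_apply_blinfun_compose blinfun_apply_id_blinfun id_apply)+

lemma inv_op_GL: "T \<in> GL \<Longrightarrow> inv_op T \<in> GL"
  using inv_op unfolding GL_def by blast

lemma GL_compose:
  assumes "S \<in> GL" "T \<in> GL" shows "S o\<^sub>L T \<in> GL"
proof -
  have "(inv_op T o\<^sub>L inv_op S) o\<^sub>L (S o\<^sub>L T) = id_blinfun" "(S o\<^sub>L T) o\<^sub>L (inv_op T o\<^sub>L inv_op S) = id_blinfun"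
    by (auto intro!: blinfun_eqI simp: assms)
  then show ?thesis unfolding GL_def by blast
qed

lemma GL_lower_bound:
  fixes T :: "'a::banach \<Rightarrow>\<^sub>L 'b::banach"
  assumes "T \<in> GL" obtains m where "m > 0" "\<And>x. m * norm x \<le> norm (T x)"
proof -
  let ?S = "inv_op T"
  have "norm x \<le> (norm ?S + 1) * norm (T x)" for x
  proof -
    have "norm x = norm (?S (T x))" using assms by simp
    also have "\<dots> \<le> norm ?S * norm (T x)" by (rule norm_blinfun)
    also have "\<dots> \<le> (norm ?S + 1) * norm (T x)" by (intro mult_right_mono) auto
    finally show ?thesis .
  qed
  then have "1 / (norm ?S + 1) * norm x \<le> norm (T x)" for x
    by (simp add: divide_le_eq mult.commute add_nonneg_pos)
  then show ?thesis using that [of "1 / (norm ?S + 1)"] by (simp add: add_nonneg_pos)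
qed

lemma GL_perturb:
  fixes T T' :: "'a::banach \<Rightarrow>\<^sub>L 'b::banach"
  assumes T: "T \<in> GL" and m: "m > 0" "\<And>x. m * norm x \<le> norm (T x)" and d: "norm (T' - T) < m"
  shows "T' \<in> GL" "\<And>x. (m - norm (T' - T)) * norm x \<le> norm (T' x)"
proof -
  let ?e = "norm (T' - T)"
  have diff: "norm (T' x - T x) \<le> ?e * norm x" for x
    using norm_blinfun [of "T' - T" x] by (simp add: blinfun.diff_left)
  show lb: "(m - ?e) * norm x \<le> norm (T' x)" for x
  proof -
    have "norm (T x) \<le> norm (T' x) + norm (T' x - T x)"
      by (metis norm_minus_commute norm_triangle_sub)
    then show ?thesis using m(2) [of x] diff [of x] by (simp add: algebra_simps)
  qed
  have "\<exists>x. T' x = y" for y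
  proof -
    \<comment> \<open>\<open>T' x = y\<close> as a fixed point problem; it is a contraction because
      \<open>T' - T\<close> is smaller than the lower bound \<open>m\<close> of
      \<open>T\<close>.\<close>
    define h where "h x = inv_op T (y - (T' x - T x))" for x
    have S: "norm (inv_op T v) \<le> norm v / m" for v
      using m(2) [of "inv_op T v"] m(1) T by (simp add: field_simps)
    have "dist (h x) (h z) \<le> (?e / m) * dist x z" for x z
    proof -
      have "h x - h z = inv_op T ((T' - T) (z - x))"
        by (simp add: h_def blinfun.diff_right blinfun.diff_left)
      then have "norm (h x - h z) \<le> norm ((T' - T) (z - x)) / m" using S by simp
      also have "\<dots> \<le> ?e * norm (z - x) / m"
        using m(1) norm_blinfun by (intro divide_right_mono) auto
      finally show ?thesis by (simp add: dist_norm norm_minus_commute)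
    qed
    moreover have "0 \<le> ?e / m" "?e / m < 1" using m d by auto
    ultimately have "\<exists>!x. h x = x" by (intro banach_fix_type) auto
    then obtain x where "h x = x" by blast
    then have "T x = y - (T' x - T x)" unfolding h_def by (metis T inv_op_apply(2))
    then show ?thesis by (intro exI [of _ x]) simp
  qed
  then show "T' \<in> GL" using lb d by (intro GL_I [of "m - ?e"]) auto
qed

lemma open_GL: "open (GL :: ('a::banach \<Rightarrow>\<^sub>L 'b::banach) set)"
  unfolding open_dist
proof
  fix T :: "'a \<Rightarrow>\<^sub>L 'b" assume T: "T \<in> GL"
  obtain m where m: "m > 0" "\<And>x. m * norm x \<le> norm (T x)" using GL_lower_bound [OF T] by blast
  then show "\<exists>e>0. \<forall>y. dist y T < e \<longrightarrow> y \<in> GL"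
    using GL_perturb(1) [OF T m] by (auto simp: dist_norm)
qed

lemma continuous_on_inv_op: "continuous_on GL (inv_op :: ('a::banach \<Rightarrow>\<^sub>L 'b::banach) \<Rightarrow> _)"
  unfolding continuous_on_iff
proof (intro ballI allI impI)
  fix T :: "'a \<Rightarrow>\<^sub>L 'b" and e :: real assume T: "T \<in> GL" and e: "0 < e"
  obtain m where m: "m > 0" "\<And>x. m * norm x \<le> norm (T x)" using GL_lower_bound [OF T] by blast
  \<comment> \<open>The first bound keeps \<open>m / 2\<close> as a lower bound for
    \<open>T'\<close>; the second absorbs the factor \<open>2 / (m * m)\<close> from the resolvent
    identity.\<close>
  define d where "d = min (m / 2) (e * m * m / 4)"
  have "dist (inv_op T') (inv_op T) < e" if T': "T' \<in> GL" and "dist T' T < d" for T'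
  proof -
    have n: "norm (T' - T) < m / 2" "norm (T' - T) < e * m * m / 4" using that by (auto simp: d_def dist_norm)
    have lb: "m / 2 * norm x \<le> norm (T' x)" for x
    proof -
      have "(m - norm (T' - T)) * norm x \<le> norm (T' x)" using n m by (intro GL_perturb(2) [OF T m]) auto
      moreover have "m / 2 * norm x \<le> (m - norm (T' - T)) * norm x" using n by (intro mult_right_mono) auto
      ultimately show ?thesis by simp
    qed
    have "norm ((inv_op T' - inv_op T) y) \<le> (norm (T' - T) * 2 / (m * m)) * norm y" for y
    proof -
      let ?w = "inv_op T y"
      have eq: "(inv_op T' - inv_op T) y = inv_op T' ((T - T') ?w)"
        using T T' by (simp add: blinfun.diff_left blinfun.diff_right)
      have "m / 2 * norm (inv_op T' ((T - T') ?w)) \<le> norm ((T - T') ?w)"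
        using lb [of "inv_op T' ((T - T') ?w)"] T' by simp
      also have "\<dots> \<le> norm (T' - T) * norm ?w" using norm_blinfun [of "T - T'"] by (simp add: norm_minus_commute)
      also have "\<dots> \<le> norm (T' - T) * (norm y / m)"
        using m(2) [of ?w] m(1) T by (intro mult_left_mono) (auto simp: field_simps)
      finally show ?thesis using m(1) unfolding eq by (simp add: field_simps)
    qed
    then have "norm (inv_op T' - inv_op T) \<le> norm (T' - T) * 2 / (m * m)"
      by (intro norm_blinfun_bound) (use m in auto)
    also have "\<dots> < e"
    proof -
      have "4 * norm (T' - T) < e * (m * m)" using n(2) by simp
      then have "2 * norm (T' - T) < e * (m * m)" using norm_ge_zero [of "T' - T"] by linarith
      then show ?thesis using m(1) by (simp add: divide_less_eq mult_ac)
    qed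
    finally show ?thesis by (simp add: dist_norm)
  qed
  moreover have "d > 0" using m(1) e by (simp add: d_def)
  ultimately show "\<exists>d>0. \<forall>T'\<in>GL. dist T' T < d \<longrightarrow> dist (inv_op T') (inv_op T) < e" by blast
qed

lemma compact_op_subset:
  assumes "\<And>S. bounded S \<Longrightarrow> \<exists>C. compact C \<and> blinfun_apply K ` S \<subseteq> C"
  shows "compact_op K"
  unfolding compact_op_def
proof (intro allI impI)
  fix S :: "'a set" assume "bounded S"
  then obtain C where C: "compact C" "blinfun_apply K ` S \<subseteq> C" using assms by blast
  then have "closure (blinfun_apply K ` S) \<subseteq> C" by (simp add: closure_minimal compact_imp_closed)
  then show "compact (closure (blinfun_apply K ` S))"
    using C(1) by (metis closed_closure compact_Int_closed inf.absorb_iff2)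
qed

lemma compact_op_compose_left:
  assumes "compact_op K" shows "compact_op (T o\<^sub>L K)"
proof (rule compact_op_subset)
  fix S :: "'a set" assume "bounded S"
  then have c: "compact (closure (blinfun_apply K ` S))" using assms by (simp add: compact_op_def)
  have "compact (blinfun_apply T ` closure (blinfun_apply K ` S))"
    by (rule compact_continuous_image [OF _ c]) (intro continuous_intros)
  moreover have "blinfun_apply (T o\<^sub>L K) ` S \<subseteq> blinfun_apply T ` closure (blinfun_apply K ` S)"
    using closure_subset by fastforce
  ultimately show "\<exists>C. compact C \<and> blinfun_apply (T o\<^sub>L K) ` S \<subseteq> C" by blast
qed

lemma compact_op_add:
  assumes "compact_op K" "compact_op L" shows "compact_op (K + L)"
proof (rule compact_op_subset)
  fix S :: "'a set" assume "bounded S"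
  then have c: "compact (closure (blinfun_apply K ` S))" "compact (closure (blinfun_apply L ` S))"
    using assms by (auto simp: compact_op_def)
  have "compact {x + y | x y. x \<in> closure (blinfun_apply K ` S) \<and> y \<in> closure (blinfun_apply L ` S)}"
    by (rule compact_sums [OF c])
  moreover have "blinfun_apply (K + L) ` S \<subseteq> {x + y | x y. x \<in> closure (blinfun_apply K ` S) \<and> y \<in> closure (blinfun_apply L ` S)}"
    using closure_subset [of "blinfun_apply K ` S"] closure_subset [of "blinfun_apply L ` S"]
    by (fastforce simp: blinfun.add_left)
  ultimately show "\<exists>C. compact C \<and> blinfun_apply (K + L) ` S \<subseteq> C" by blast
qed

lemma compact_op_uminus: "compact_op K \<Longrightarrow> compact_op (- K)"
  using compact_op_compose_left [of K "- id_blinfun"]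
  by (metis (no_types, lifting) blinfun_apply_blinfun_compose blinfun_apply_id_blinfun blinfun_eqI id_apply uminus_blinfun.rep_eq)

lemma compact_op_diff: "compact_op K \<Longrightarrow> compact_op L \<Longrightarrow> compact_op (K - L)"
  using compact_op_add [of K "- L"] compact_op_uminus [of L] by simp

text \<open>The group of invertible compact perturbations of the identity, on which
  \<open>deg_LS\<close> will be multiplicative with values \<plusminus>1.\<close>

definition GLc :: "('a::banach \<Rightarrow>\<^sub>L 'a) set" where
  "GLc = {T \<in> GL. compact_op (T - id_blinfun)}"

lemma GLc_inv:
  assumes "T \<in> GLc" shows "inv_op T \<in> GLc"
proof -
  have T: "T \<in> GL" using assms by (simp add: GLc_def)
  have eq: "inv_op T - id_blinfun = - (inv_op T o\<^sub>L (T - id_blinfun))"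
    by (rule blinfun_eqI) (simp add: blinfun.diff_left blinfun.diff_right blinfun.minus_left T)
  have "compact_op (inv_op T - id_blinfun)"
    unfolding eq by (intro compact_op_uminus compact_op_compose_left) (use assms in \<open>auto simp: GLc_def\<close>)
  then show ?thesis using T inv_op_GL by (auto simp: GLc_def)
qed

subsection \<open>Stability of the degree under adding dimensions\<close>

lemma coords_Suc:
  fixes b :: "nat \<Rightarrow> 'a::banach"
  assumes b: "basis_seq b (Suc p)" and b': "basis_seq b p" and w: "w \<in> span (b ` {..p})"
  shows "coords b (Suc p) w = coords b p w"
proof
  fix i
  have "lin_comb b (Suc p) (coords b p w) = lin_comb b p (coords b p w)"
    by (simp add: lin_comb_def coords_beyond)
  then have eq: "lin_comb b (Suc p) (coords b p w) = w" using lin_comb_coords [OF b' w] by simp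
  show "coords b (Suc p) w i = coords b p w i"
  proof (cases "i \<le> Suc p")
    case True
    then show ?thesis using coords_lin_comb [OF b True, of "coords b p w"] eq by simp
  qed (simp add: coords_beyond)
qed

lemma basis_seq_Suc: "basis_seq b (Suc p) \<Longrightarrow> basis_seq b p"
  unfolding basis_seq_def by (metis atMost_Suc image_insert independent_insert inj_on_insert)

text \<open>Since \<open>k\<close> takes values in the smaller span, subtracting it leaves the last
  coordinate unchanged. The normalised map therefore preserves both hemispheres and restricts on the
  equator to the lower-dimensional map, so the suspension lemma applies.\<close>

lemma sphere_map_stable_step:
  fixes b :: "nat \<Rightarrow> 'a::banach"
  assumes b: "basis_seq b (Suc p)" and r: "0 < r"
    and k: "continuous_on (span (b ` {..Suc p}) \<inter> cball 0 r) k"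
      "\<And>x. x \<in> span (b ` {..Suc p}) \<inter> cball 0 r \<Longrightarrow> k x \<in> span (b ` {..p})"
    and nz: "\<And>x. x \<in> span (b ` {..Suc p}) \<inter> sphere 0 r \<Longrightarrow> k x \<noteq> x"
  shows "Brouwer_degree2 (Suc p) (sphere_map b b (Suc p) r (\<lambda>x. x - k x)) =
         Brouwer_degree2 p (sphere_map b b p r (\<lambda>x. x - k x))"
proof -
  let ?E = "span (b ` {..Suc p})" and ?F = "span (b ` {..p})"
  have b0: "basis_seq b p" using b by (rule basis_seq_Suc)
  have sub: "?F \<subseteq> ?E" by (intro span_mono image_mono) auto
  define last where "last x = coords b (Suc p) x (Suc p)" for x
  \<comment> \<open>\<open>pr s\<close> removes the fraction \<open>s\<close> of the last
    coordinate. It need not preserve the ball, hence the radial retraction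
    \<open>ret\<close>.\<close>
  define pr where "pr s x = x - (s * last x) *\<^sub>R b (Suc p)" for s x
  define ret where "ret x = (r / max r (norm x)) *\<^sub>R x" for x :: 'a
  have bE: "b (Suc p) \<in> ?E" by (rule span_base, rule imageI, rule atMost_iff [THEN iffD2], rule order_refl)
  have ret_cball: "ret x \<in> cball 0 r" for x
    using r by (auto simp: ret_def max_def field_simps)
  have ret_id: "ret x = x" if "norm x \<le> r" for x using that r by (simp add: ret_def max_absorb1)
  have retE: "ret x \<in> ?E" if "x \<in> ?E" for x using that by (auto simp: ret_def intro: span_scale)
  have prE: "pr s x \<in> ?E" if "x \<in> ?E" for s x
    unfolding pr_def by (intro span_diff span_scale that bE)
  have last0: "last x = 0" if "x \<in> ?F" for x
    using coords_Suc [OF b b0 that] by (simp add: last_def coords_beyond)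
  define g where "g s x = x - k (ret (pr s x))" for s x
  have gW: "g s x \<in> ?E - {0}" if x: "x \<in> ?E \<inter> sphere 0 r" for s x
  proof -
    have kin: "k (ret (pr s x)) \<in> ?F" using k(2) retE prE ret_cball x by blast
    have "g s x \<noteq> 0"
    proof
      \<comment> \<open>A zero lies in the smaller span, where \<open>pr s\<close> is the identity,
        and so would be a fixed point of \<open>k\<close> on the sphere.\<close>
      assume "g s x = 0"
      then have xk: "x = k (ret (pr s x))" by (simp add: g_def)
      then have "x \<in> ?F" using kin by simp
      then have "last x = 0" by (rule last0)
      then have "pr s x = x" by (simp add: pr_def)
      then have "ret (pr s x) = x" using x ret_id [of x] by auto
      then show False using xk nz [OF x] by simp
    qed
    then show ?thesis using x kin sub by (auto simp: g_def intro: span_diff)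
  qed
  have contret: "continuous_on UNIV ret"
    unfolding ret_def using r by (intro continuous_intros) auto
  have cont: "continuous_on ({0..1::real} \<times> (?E \<inter> sphere 0 r)) (\<lambda>(t, x). g t x)"
  proof -
    let ?D = "{0..1::real} \<times> (?E \<inter> sphere 0 r)"
    have "continuous_on ?D (\<lambda>z. last (snd z))"
      unfolding last_def
      by (rule continuous_on_compose2 [OF continuous_on_coords [OF b] continuous_on_snd [OF continuous_on_id]]) auto
    then have "continuous_on ?D (\<lambda>z. pr (fst z) (snd z))"
      unfolding pr_def by (intro continuous_intros)
    then have "continuous_on ?D (\<lambda>z. ret (pr (fst z) (snd z)))"
      by (rule continuous_on_compose2 [OF contret]) auto
    then have "continuous_on ?D (\<lambda>z. k (ret (pr (fst z) (snd z))))"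
      by (rule continuous_on_compose2 [OF k(1)]) (use retE prE ret_cball in auto)
    then show ?thesis unfolding g_def case_prod_beta by (intro continuous_intros)
  qed
  have deg1: "Brouwer_degree2 (Suc p) (sphere_map b b (Suc p) r (g 0)) = Brouwer_degree2 (Suc p) (sphere_map b b (Suc p) r (g 1))"
    by (rule Brouwer_degree2_homotopic, rule sphere_map_homotopic [OF b b refl refl r cont]) (use gW in auto)
  have g0: "Brouwer_degree2 (Suc p) (sphere_map b b (Suc p) r (g 0)) = Brouwer_degree2 (Suc p) (sphere_map b b (Suc p) r (\<lambda>x. x - k x))"
  proof (rule Brouwer_degree2_eq)
    fix x assume "x \<in> topspace (nsphere (Suc p))"
    then have "radial b (Suc p) r x \<in> ?E \<inter> sphere 0 r" using radial_in [OF b _ r] by (simp add: nsphere_nsph)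
    then have "g 0 (radial b (Suc p) r x) = radial b (Suc p) r x - k (radial b (Suc p) r x)"
      by (simp add: g_def pr_def ret_id)
    then show "sphere_map b b (Suc p) r (g 0) x = sphere_map b b (Suc p) r (\<lambda>x. x - k x) x"
      by (simp add: sphere_map_def)
  qed
  let ?G = "sphere_map b b (Suc p) r (g 1)"
  have contg: "continuous_on (?E \<inter> sphere 0 r) (g 1)"
  proof -
    have "continuous_on (?E \<inter> sphere 0 r) (\<lambda>x. case (1, x) of (t, x) \<Rightarrow> g t x)"
      by (rule continuous_on_compose2 [OF cont]) (auto intro!: continuous_intros)
    then show ?thesis by simp
  qed
  have cmS: "continuous_map (nsphere (Suc p)) (nsphere (Suc p)) ?G"
    by (rule sphere_map_continuous [OF b b refl refl r contg gW])
  have cm0: "continuous_map (nsphere p) (nsphere p) (sphere_map b b p r (\<lambda>x. x - k x))"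
  proof (rule sphere_map_continuous [OF b0 b0 refl refl r])
    show "continuous_on (?F \<inter> sphere 0 r) (\<lambda>x. x - k x)"
      using sub by (intro continuous_intros continuous_on_subset [OF k(1)]) auto
    fix x assume x: "x \<in> ?F \<inter> sphere 0 r"
    then have xE: "x \<in> ?E \<inter> sphere 0 r" "x \<in> ?E \<inter> cball 0 r" using sub by auto
    show "x - k x \<in> ?F - {0}" using nz [OF xE(1)] k(2) [OF xE(2)] x by (auto intro: span_diff)
  qed
  have Geq: "?G x = sphere_map b b p r (\<lambda>x. x - k x) x" if x: "x \<in> nsph p" for x
  proof -
    have lc: "lin_comb b (Suc p) x = lin_comb b p x" using x by (simp add: lin_comb_def nsph_def)
    then have rad: "radial b (Suc p) r x = radial b p r x" by (simp add: radial_def)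
    let ?u = "radial b p r x"
    have u: "?u \<in> ?F \<inter> sphere 0 r" using radial_in [OF b0 x r] .
    then have "last ?u = 0" using last0 by auto
    then have g1: "g 1 ?u = ?u - k ?u" using u by (simp add: g_def pr_def ret_id)
    have uE: "?u \<in> ?E \<inter> cball 0 r" using u sub by auto
    have "?u - k ?u \<in> ?F" using u k(2) [OF uE] by (auto intro: span_diff)
    then have "coords b (Suc p) (?u - k ?u) = coords b p (?u - k ?u)" by (rule coords_Suc [OF b b0])
    then show ?thesis
      by (simp add: sphere_map_def rad g1 normalize_vec_def [abs_def] coords_beyond)
  qed
  have Glast: "\<exists>c>0. ?G x (Suc p) = c * x (Suc p)" if x: "x \<in> nsph (Suc p)" for x
  proof -
    let ?u = "radial b (Suc p) r x"
    have u: "?u \<in> ?E \<inter> sphere 0 r" using radial_in [OF b x r] .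
    have "k (ret (pr 1 ?u)) \<in> ?F" using k(2) retE prE ret_cball u by blast
    then have kl: "coords b (Suc p) (k (ret (pr 1 ?u))) (Suc p) = 0" "k (ret (pr 1 ?u)) \<in> ?E"
      using last0 sub by (auto simp: last_def)
    have lu: "coords b (Suc p) ?u (Suc p) = r / norm (lin_comb b (Suc p) x) * x (Suc p)"
      unfolding radial_def lin_comb_scale [symmetric] by (rule coords_lin_comb [OF b]) simp
    have "coords b (Suc p) (g 1 ?u) (Suc p) = r / norm (lin_comb b (Suc p) x) * x (Suc p)"
      using coords_linear [OF b, of ?u "k (ret (pr 1 ?u))" 1 "-1" "Suc p"] u kl lu by (simp add: g_def)
    moreover obtain i where "i \<le> Suc p" "coords b (Suc p) (g 1 ?u) i \<noteq> 0"
      using coords_nonzero [OF b, of "g 1 ?u"] gW [OF u] by auto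
    then have "0 < sqrt (\<Sum>j\<le>Suc p. (coords b (Suc p) (g 1 ?u) j)\<^sup>2)"
      using sum_squares_pos [of i "Suc p"] by (simp del: sum.atMost_Suc)
    ultimately show ?thesis
      using r lin_comb_nonzero [OF b x]
      by (intro exI [of _ "r / norm (lin_comb b (Suc p) x) / sqrt (\<Sum>j\<le>Suc p. (coords b (Suc p) (g 1 ?u) j)\<^sup>2)"])
         (simp add: sphere_map_def normalize_vec_def del: sum.atMost_Suc)
  qed
  have "Brouwer_degree2 (Suc p) ?G = Brouwer_degree2 p ?G"
  proof (rule Brouwer_degree2_suspension [OF cmS])
    show "continuous_map (nsphere p) (nsphere p) ?G"
      by (rule continuous_map_eq [OF cm0]) (simp add: nsphere_nsph Geq)
    fix x assume "x \<in> topspace (nsphere (Suc p))"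
    then obtain c where "c > 0" "?G x (Suc p) = c * x (Suc p)" using Glast by (auto simp: nsphere_nsph)
    then show "0 \<le> x (Suc p) \<Longrightarrow> 0 \<le> ?G x (Suc p)" "x (Suc p) \<le> 0 \<Longrightarrow> ?G x (Suc p) \<le> 0"
      by (auto simp: mult_nonneg_nonpos)
  qed
  also have "\<dots> = Brouwer_degree2 p (sphere_map b b p r (\<lambda>x. x - k x))"
    by (rule Brouwer_degree2_eq) (simp add: nsphere_nsph Geq)
  finally show ?thesis using deg1 g0 by simp
qed

text \<open>A trivial \<open>span G\<close> is treated apart, since it has no
  \<open>basis_seq\<close> and its degree is 1 by convention; otherwise \<open>v\<close> extends a
  basis and the suspension step applies.\<close>

lemma brouwer_degree_ball_insert:
  fixes G :: "'a::banach set"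
  assumes G: "finite G" and r: "0 < r"
    and k: "continuous_on (span (insert v G) \<inter> cball 0 r) k"
      "\<And>x. x \<in> span (insert v G) \<inter> cball 0 r \<Longrightarrow> k x \<in> span G"
    and nz: "\<And>x. x \<in> span (insert v G) \<inter> sphere 0 r \<Longrightarrow> k x \<noteq> x"
  shows "brouwer_degree_ball (span (insert v G)) r (\<lambda>x. x - k x) = brouwer_degree_ball (span G) r (\<lambda>x. x - k x)"
proof (cases "v \<in> span G")
  case True
  then show ?thesis by (simp add: span_redundant)
next
  case v: False
  let ?E = "span (insert v G)"
  have sub: "span G \<subseteq> ?E" by (intro span_mono) auto
  have fd: "finite_dimensional ?E" using G by (auto simp: finite_dimensional_def)
  have cont: "continuous_on (?E \<inter> sphere 0 r) (\<lambda>x. x - k x)"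
    by (intro continuous_intros continuous_on_subset [OF k(1)]) auto
  have into: "x - k x \<in> ?E - {0}" if "x \<in> ?E \<inter> sphere 0 r" for x
  proof -
    have "x \<in> ?E \<inter> cball 0 r" using that by auto
    then have "k x \<in> ?E" using k(2) sub by blast
    then show ?thesis using nz [OF that] that by (auto intro: span_diff)
  qed
  show ?thesis
  proof (cases "span G = {0}")
    case True
    have eq: "x - k x = x" if "x \<in> ?E \<inter> sphere 0 r" for x
    proof -
      have "x \<in> ?E \<inter> cball 0 r" using that by auto
      then show ?thesis using k(2) True by auto
    qed
    have "brouwer_degree_ball ?E r (\<lambda>x. x - k x) = brouwer_degree_ball ?E r (\<lambda>x. x)"
      by (rule brouwer_degree_ball_cong [OF fd r cont into eq])
    also have "\<dots> = 1" by (rule brouwer_degree_ball_id [OF fd r])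
    finally show ?thesis using True by (simp add: brouwer_degree_ball_def)
  next
    case False
    obtain b p where b: "basis_seq b p" "span (b ` {..p}) = span G"
      using basis_seq_of_span [OF G] False by blast
    define c where "c = b(Suc p := v)"
    have cb: "c ` {..p} = b ` {..p}" by (auto simp: c_def image_iff)
    have cS: "c ` {..Suc p} = insert v (b ` {..p})" by (simp add: atMost_Suc cb) (simp add: c_def)
    have "v \<notin> b ` {..p}" using v b(2) span_base [of v "b ` {..p}"] by auto
    have c: "basis_seq c (Suc p)"
    proof -
      have "inj_on c {..p}" using b(1) by (auto simp: basis_seq_def inj_on_def c_def)
      moreover have "c (Suc p) \<notin> c ` {..p}" unfolding cb using \<open>v \<notin> b ` {..p}\<close> by (simp add: c_def)
      ultimately have "inj_on c {..Suc p}" by (simp add: atMost_Suc)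
      moreover have "independent (insert v (b ` {..p}))"
        using b v by (intro independent_insertI) (auto simp: basis_seq_def)
      ultimately show ?thesis unfolding basis_seq_def cS by blast
    qed
    have spS: "span (c ` {..Suc p}) = ?E"
      unfolding cS using b(2) by (metis span_insert)
    have c0: "basis_seq c p" "span (c ` {..p}) = span G" using basis_seq_Suc [OF c] cb b by auto
    have "Brouwer_degree2 (Suc p) (sphere_map c c (Suc p) r (\<lambda>x. x - k x)) = Brouwer_degree2 p (sphere_map c c p r (\<lambda>x. x - k x))"
      by (rule sphere_map_stable_step [OF c r]) (use k nz spS c0 in auto)
    moreover have "brouwer_degree_ball ?E r (\<lambda>x. x - k x) = Brouwer_degree2 (Suc p) (sphere_map c c (Suc p) r (\<lambda>x. x - k x))"
      by (rule brouwer_degree_ball_eq [OF c spS r cont into])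
    moreover have "brouwer_degree_ball (span G) r (\<lambda>x. x - k x) = Brouwer_degree2 p (sphere_map c c p r (\<lambda>x. x - k x))"
    proof (rule brouwer_degree_ball_eq [OF c0 r])
      show "continuous_on (span G \<inter> sphere 0 r) (\<lambda>x. x - k x)"
        by (rule continuous_on_subset [OF cont]) (use sub in auto)
      fix x assume x: "x \<in> span G \<inter> sphere 0 r"
      then have "x \<in> ?E \<inter> sphere 0 r" "x \<in> ?E \<inter> cball 0 r" using sub by auto
      then show "x - k x \<in> span G - {0}" using into k(2) x by (auto intro: span_diff)
    qed
    ultimately show ?thesis by simp
  qed
qed

lemma brouwer_degree_ball_stable:
  fixes G G' :: "'a::banach set"
  assumes "finite G'" "finite G" and r: "0 < r"
    and "continuous_on (span (G' \<union> G) \<inter> cball 0 r) k"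
      "\<And>x. x \<in> span (G' \<union> G) \<inter> cball 0 r \<Longrightarrow> k x \<in> span G"
      "\<And>x. x \<in> span (G' \<union> G) \<inter> sphere 0 r \<Longrightarrow> k x \<noteq> x"
  shows "brouwer_degree_ball (span (G' \<union> G)) r (\<lambda>x. x - k x) = brouwer_degree_ball (span G) r (\<lambda>x. x - k x)"
  using assms(1,4-)
proof (induction G' rule: finite_induct)
  case (insert v G')
  have sub: "span (G' \<union> G) \<subseteq> span (insert v G' \<union> G)" "span G \<subseteq> span (G' \<union> G)" by (auto intro!: span_mono)
  have "brouwer_degree_ball (span (insert v (G' \<union> G))) r (\<lambda>x. x - k x) = brouwer_degree_ball (span (G' \<union> G)) r (\<lambda>x. x - k x)"
    by (rule brouwer_degree_ball_insert)
       (use insert.prems insert.hyps assms(2) r sub in auto)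
  also have "\<dots> = brouwer_degree_ball (span G) r (\<lambda>x. x - k x)"
  proof (rule insert.IH)
    show "continuous_on (span (G' \<union> G) \<inter> cball 0 r) k"
      by (rule continuous_on_subset [OF insert.prems(1)]) (use sub in auto)
  qed (use insert.prems sub in auto)
  finally show ?case by simp
qed simp

subsection \<open>The Leray--Schauder degree of linear maps and the parity\<close>

text \<open>The witnesses inside the description of \<open>LS_degree_ball\<close>, separated from
  the degree that they compute.\<close>

definition LS_approx :: "('a::banach \<Rightarrow> 'a) \<Rightarrow> real \<Rightarrow> 'a set \<Rightarrow> ('a \<Rightarrow> 'a) \<Rightarrow> bool" where
  "LS_approx f r W k \<longleftrightarrow> finite_dimensional W \<and> continuous_on (cball 0 r) k \<and> k ` cball 0 r \<subseteq> W \<and>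
     (\<exists>\<delta>>0. (\<forall>x\<in>sphere 0 r. \<delta> \<le> norm (f x)) \<and> (\<forall>x\<in>cball 0 r. norm ((x - f x) - k x) < \<delta>))"

text \<open>On the sphere both approximants are closer to \<open>x - f x\<close> than
  \<open>norm (f x)\<close>, and so are their convex combinations. The segment between them is a
  homotopy without zeros in the span of \<open>W1\<close> and \<open>W2\<close>, and the added
  dimensions do not change the degrees.\<close>

lemma LS_approx_unique:
  assumes r: "0 < r" and 1: "LS_approx f r W1 k1" and 2: "LS_approx f r W2 k2"
  shows "brouwer_degree_ball W1 r (\<lambda>x. x - k1 x) = brouwer_degree_ball W2 r (\<lambda>x. x - k2 x)"
proof -
  obtain G1 where G1: "finite G1" "span G1 = W1" using 1 by (auto simp: LS_approx_def finite_dimensional_def)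
  obtain G2 where G2: "finite G2" "span G2 = W2" using 2 by (auto simp: LS_approx_def finite_dimensional_def)
  define W where "W = span (G1 \<union> G2)"
  have W: "finite_dimensional W" using G1 G2 by (auto simp: finite_dimensional_def W_def)
  have sub: "W1 \<subseteq> W" "W2 \<subseteq> W" using G1(2) G2(2) by (auto simp: W_def intro: span_mono [THEN subsetD])
  have c: "continuous_on (cball 0 r) k1" "continuous_on (cball 0 r) k2" using 1 2 by (auto simp: LS_approx_def)
  have i1: "k1 x \<in> W1" if "x \<in> cball 0 r" for x using 1 that by (auto simp: LS_approx_def)
  have i2: "k2 x \<in> W2" if "x \<in> cball 0 r" for x using 2 that by (auto simp: LS_approx_def)
  have e1: "norm ((x - f x) - k1 x) < norm (f x)" and e2: "norm ((x - f x) - k2 x) < norm (f x)"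
    if x: "x \<in> sphere 0 r" for x
  proof -
    obtain d1 where d1: "\<forall>x\<in>sphere 0 r. d1 \<le> norm (f x)" "\<forall>x\<in>cball 0 r. norm ((x - f x) - k1 x) < d1"
      using 1 unfolding LS_approx_def by blast
    obtain d2 where d2: "\<forall>x\<in>sphere 0 r. d2 \<le> norm (f x)" "\<forall>x\<in>cball 0 r. norm ((x - f x) - k2 x) < d2"
      using 2 unfolding LS_approx_def by blast
    have xc: "x \<in> cball 0 r" using x by auto
    show "norm ((x - f x) - k1 x) < norm (f x)" using d1(1) [rule_format, OF x] d1(2) [rule_format, OF xc] by linarith
    show "norm ((x - f x) - k2 x) < norm (f x)" using d2(1) [rule_format, OF x] d2(2) [rule_format, OF xc] by linarith
  qed
  have conv: "x - ((1 - t) *\<^sub>R k1 x + t *\<^sub>R k2 x) \<noteq> 0" if x: "x \<in> sphere 0 r" and t: "t \<in> {0..1}" for x t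
  proof
    assume z: "x - ((1 - t) *\<^sub>R k1 x + t *\<^sub>R k2 x) = 0"
    have "- f x = (1 - t) *\<^sub>R ((x - f x) - k1 x) + t *\<^sub>R ((x - f x) - k2 x)"
      using z by (simp add: algebra_simps)
    then have "norm (f x) \<le> norm ((1 - t) *\<^sub>R ((x - f x) - k1 x)) + norm (t *\<^sub>R ((x - f x) - k2 x))"
      by (metis norm_minus_cancel norm_triangle_ineq)
    also have "\<dots> = (1 - t) * norm ((x - f x) - k1 x) + t * norm ((x - f x) - k2 x)" using t by simp
    also have "\<dots> < norm (f x)"
      using convex_bound_lt [OF e1 [OF x] e2 [OF x], of "1 - t" t] t by simp
    finally show False by simp
  qed
  have nz1: "k1 x \<noteq> x" if "x \<in> sphere 0 r" for x using conv [OF that, of 0] by auto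
  have nz2: "k2 x \<noteq> x" if "x \<in> sphere 0 r" for x using conv [OF that, of 1] by auto
  have kW: "k1 x \<in> W" "k2 x \<in> W" if "x \<in> cball 0 r" for x using i1 i2 sub that by auto
  have "brouwer_degree_ball W r ((\<lambda>t x. x - ((1 - t) *\<^sub>R k1 x + t *\<^sub>R k2 x)) 0) =
        brouwer_degree_ball W r ((\<lambda>t x. x - ((1 - t) *\<^sub>R k1 x + t *\<^sub>R k2 x)) 1)"
  proof (rule brouwer_degree_ball_homotopy [OF W r])
    have s: "continuous_on ({0..1::real} \<times> (W \<inter> sphere 0 r)) (\<lambda>z. k1 (snd z))" "continuous_on ({0..1::real} \<times> (W \<inter> sphere 0 r)) (\<lambda>z. k2 (snd z))"
      by (auto intro!: continuous_on_compose2 [OF c(1)] continuous_on_compose2 [OF c(2)] continuous_intros)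
    show "continuous_on ({0..1::real} \<times> (W \<inter> sphere 0 r)) (\<lambda>(t, x). x - ((1 - t) *\<^sub>R k1 x + t *\<^sub>R k2 x))"
      unfolding case_prod_beta by (intro continuous_intros s)
    fix t :: real and x assume t: "t \<in> {0..1}" and x: "x \<in> W \<inter> sphere 0 r"
    have "x \<in> cball 0 r" using x by auto
    then have "(1 - t) *\<^sub>R k1 x + t *\<^sub>R k2 x \<in> W"
      using kW unfolding W_def by (intro span_add span_scale) auto
    then show "x - ((1 - t) *\<^sub>R k1 x + t *\<^sub>R k2 x) \<in> W - {0}"
      using conv [OF _ t] x unfolding W_def by (auto intro: span_diff)
  qed
  then have "brouwer_degree_ball W r (\<lambda>x. x - k1 x) = brouwer_degree_ball W r (\<lambda>x. x - k2 x)" by simp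
  moreover have "brouwer_degree_ball (span (G2 \<union> G1)) r (\<lambda>x. x - k1 x) = brouwer_degree_ball (span G1) r (\<lambda>x. x - k1 x)"
    by (rule brouwer_degree_ball_stable [OF G2(1) G1(1) r])
       (use i1 nz1 G1 in \<open>auto intro: continuous_on_subset [OF c(1)]\<close>)
  moreover have "brouwer_degree_ball (span (G1 \<union> G2)) r (\<lambda>x. x - k2 x) = brouwer_degree_ball (span G2) r (\<lambda>x. x - k2 x)"
    by (rule brouwer_degree_ball_stable [OF G1(1) G2(1) r])
       (use i2 nz2 G2 in \<open>auto intro: continuous_on_subset [OF c(2)]\<close>)
  ultimately show ?thesis using G1 G2 by (simp add: W_def Un_commute)
qed

lemma LS_degree_ball_eq:
  assumes "0 < r" "LS_approx f r W k"
  shows "LS_degree_ball f r = brouwer_degree_ball W r (\<lambda>x. x - k x)"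
  unfolding LS_degree_ball_def
proof (rule the_equality)
  show "\<exists>\<delta>>0. (\<forall>x\<in>sphere 0 r. \<delta> \<le> norm (f x)) \<and>
        (\<exists>W' k'. finite_dimensional W' \<and> continuous_on (cball 0 r) k' \<and> k' ` cball 0 r \<subseteq> W' \<and>
               (\<forall>x\<in>cball 0 r. norm ((x - f x) - k' x) < \<delta>) \<and>
               brouwer_degree_ball W r (\<lambda>x. x - k x) = brouwer_degree_ball W' r (\<lambda>x. x - k' x))"
    using assms(2) unfolding LS_approx_def by blast
next
  fix d assume "\<exists>\<delta>>0. (\<forall>x\<in>sphere 0 r. \<delta> \<le> norm (f x)) \<and>
        (\<exists>W' k'. finite_dimensional W' \<and> continuous_on (cball 0 r) k' \<and> k' ` cball 0 r \<subseteq> W' \<and>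
               (\<forall>x\<in>cball 0 r. norm ((x - f x) - k' x) < \<delta>) \<and>
               d = brouwer_degree_ball W' r (\<lambda>x. x - k' x))"
  then obtain W' k' where "LS_approx f r W' k'" "d = brouwer_degree_ball W' r (\<lambda>x. x - k' x)"
    unfolding LS_approx_def by blast
  then show "d = brouwer_degree_ball W r (\<lambda>x. x - k x)"
    using LS_approx_unique [OF assms] by simp
qed

text \<open>The weights \<open>w g\<close> vanish outside the balls of radius \<open>e\<close>
  around a finite net, so \<open>s x\<close> is a convex combination of net points near
  \<open>x\<close>.\<close>

lemma schauder_projection:
  fixes K :: "'a::real_normed_vector set"
  assumes K: "compact K" and e: "0 < e"
  obtains G s where "finite G" "continuous_on K s" "\<And>x. x \<in> K \<Longrightarrow> s x \<in> span G \<and> norm (x - s x) < e"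
proof -
  obtain G where G: "finite G" "G \<subseteq> K" "K \<subseteq> (\<Union>x\<in>G. ball x e)"
  proof -
    have cov: "K \<subseteq> (\<Union>x\<in>K. ball x e)" using e by force
    show thesis by (rule compactE_image [OF K _ cov]) (auto intro: that)
  qed
  define w where "w g x = max 0 (e - dist x g)" for g x :: 'a
  define t where "t x = (\<Sum>g\<in>G. w g x)" for x
  have w0: "0 \<le> w g x" for g x by (simp add: w_def)
  have t0: "0 < t x" if x: "x \<in> K" for x
  proof -
    obtain g where "g \<in> G" "dist x g < e" using G(3) x by (auto simp: dist_commute)
    then show ?thesis unfolding t_def by (intro sum_pos2 [OF G(1), of g]) (auto simp: w_def)
  qed
  define s where "s x = (1 / t x) *\<^sub>R (\<Sum>g\<in>G. w g x *\<^sub>R g)" for x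
  have "continuous_on K s"
    unfolding s_def t_def w_def
    by (intro continuous_intros) (use t0 in \<open>force simp: t_def w_def\<close>)
  moreover have "s x \<in> span G \<and> norm (x - s x) < e" if x: "x \<in> K" for x
  proof
    show "s x \<in> span G" unfolding s_def by (intro span_scale span_sum) (auto intro: span_base)
    have "t x *\<^sub>R (x - s x) = (\<Sum>g\<in>G. w g x *\<^sub>R (x - g))"
      using t0 [OF x] by (simp add: s_def scaleR_right_diff_distrib sum_subtractf t_def scaleR_left.sum)
    then have "t x * norm (x - s x) = norm (\<Sum>g\<in>G. w g x *\<^sub>R (x - g))"
      using t0 [OF x] by (metis abs_of_pos norm_scaleR)
    also have "\<dots> \<le> (\<Sum>g\<in>G. w g x * norm (x - g))"
      using w0 by (intro order_trans [OF norm_sum]) (simp add: sum_mono)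
    also have "\<dots> < (\<Sum>g\<in>G. w g x * e)"
    proof (rule sum_strict_mono_ex1 [OF G(1)])
      show "\<forall>g\<in>G. w g x * norm (x - g) \<le> w g x * e"
        by (auto simp: w_def dist_norm max_def intro: mult_left_mono)
      obtain g where "g \<in> G" "dist x g < e" using G(3) x by (auto simp: dist_commute)
      then show "\<exists>g\<in>G. w g x * norm (x - g) < w g x * e" by (intro bexI [of _ g]) (auto simp: w_def dist_norm)
    qed
    finally have "t x * norm (x - s x) < t x * e" by (simp add: t_def sum_distrib_right)
    then show "norm (x - s x) < e" using t0 [OF x] by simp
  qed
  ultimately show ?thesis using that G(1) by blast
qed

text \<open>For linear operators the approximants can be chosen positively homogeneous, so that they
  compose.\<close>

definition cone_approx :: "('a::banach \<Rightarrow>\<^sub>L 'a) \<Rightarrow> real \<Rightarrow> 'a set \<Rightarrow> ('a \<Rightarrow> 'a) \<Rightarrow> bool" where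
  "cone_approx T \<eta> W \<phi> \<longleftrightarrow> finite_dimensional W \<and> continuous_on UNIV \<phi> \<and> range \<phi> \<subseteq> W \<and> \<phi> 0 = 0 \<and>
     (\<forall>x t. 0 < t \<longrightarrow> \<phi> (t *\<^sub>R x) = t *\<^sub>R \<phi> x) \<and> (\<forall>x. x \<noteq> 0 \<longrightarrow> norm ((x - T x) - \<phi> x) < \<eta> * norm x)"

text \<open>A Schauder projection of the image of the unit ball, extended positively homogeneously.
  Continuity at 0 comes from a linear bound on the norm.\<close>

lemma cone_approx_exists:
  fixes T :: "'a::banach \<Rightarrow>\<^sub>L 'a"
  assumes T: "compact_op (T - id_blinfun)" and eta: "0 < \<eta>"
  obtains W \<phi> where "cone_approx T \<eta> W \<phi>"
proof -
  let ?C = "id_blinfun - T"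
  have "compact_op ?C" using compact_op_uminus [OF T] by simp
  then have "compact (closure (blinfun_apply ?C ` cball 0 1))" by (simp add: compact_op_def)
  then obtain G s where G: "finite G" and s: "continuous_on (closure (blinfun_apply ?C ` cball 0 1)) s"
      "\<And>y. y \<in> closure (blinfun_apply ?C ` cball 0 1) \<Longrightarrow> s y \<in> span G \<and> norm (y - s y) < \<eta>"
    using schauder_projection eta by blast
  define \<phi> where "\<phi> x = norm x *\<^sub>R s (?C ((1 / norm x) *\<^sub>R x))" for x
  have inC: "?C ((1 / norm x) *\<^sub>R x) \<in> closure (blinfun_apply ?C ` cball 0 1)" for x
    by (rule subsetD [OF closure_subset], rule imageI) auto
  have hom: "\<phi> (t *\<^sub>R x) = t *\<^sub>R \<phi> x" if "0 < t" for t x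
    using that by (simp add: \<phi>_def)
  have err: "norm ((x - T x) - \<phi> x) < \<eta> * norm x" if "x \<noteq> 0" for x
  proof -
    have "x - T x = norm x *\<^sub>R ?C ((1 / norm x) *\<^sub>R x)"
      using that by (simp add: blinfun.diff_left blinfun.scaleR_right)
    then have "(x - T x) - \<phi> x = norm x *\<^sub>R (?C ((1 / norm x) *\<^sub>R x) - s (?C ((1 / norm x) *\<^sub>R x)))"
      by (simp add: \<phi>_def scaleR_right_diff_distrib)
    moreover have "norm (?C ((1 / norm x) *\<^sub>R x) - s (?C ((1 / norm x) *\<^sub>R x))) < \<eta>" using s(2) inC by blast
    ultimately show ?thesis using that by (simp add: mult.commute)
  qed
  have phi0: "\<phi> 0 = 0" by (simp add: \<phi>_def)
  have "continuous_on UNIV \<phi>"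
  proof -
    have "isCont \<phi> x" for x
    proof (cases "x = 0")
      case False
      have "continuous_on (- {0}) \<phi>"
        unfolding \<phi>_def
      proof (intro continuous_intros)
        show "continuous_on (- {0}) (\<lambda>x. s (?C ((1 / norm x) *\<^sub>R x)))"
          by (rule continuous_on_compose2 [OF s(1)]) (use inC in \<open>auto intro!: continuous_intros\<close>)
      qed
      then show ?thesis using False by (simp add: continuous_on_eq_continuous_at open_Compl)
    next
      case True
      have bd: "norm (\<phi> x) \<le> (norm ?C + \<eta>) * norm x" for x
      proof (cases "x = 0")
        case False
        have "norm (\<phi> x) \<le> norm (x - T x) + norm ((x - T x) - \<phi> x)"
          by (metis norm_triangle_sub norm_minus_commute)
        also have "norm (x - T x) \<le> norm ?C * norm x" using norm_blinfun [of ?C x] by (simp add: blinfun.diff_left)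
        finally show ?thesis using err [OF False] by (simp add: algebra_simps)
      qed (simp add: phi0)
      have "(\<phi> \<longlongrightarrow> 0) (at 0)"
      proof (rule tendsto_0_le [where f = "\<lambda>x. x" and K = "norm ?C + \<eta>"])
        show "\<forall>\<^sub>F x in at 0. norm (\<phi> x) \<le> norm x * (norm ?C + \<eta>)" using bd by (simp add: mult.commute)
      qed (rule tendsto_ident_at)
      then show ?thesis using True phi0 by (simp add: isCont_def)
    qed
    then show ?thesis by (simp add: continuous_on_eq_continuous_at)
  qed
  moreover have "range \<phi> \<subseteq> span G" using s(2) inC by (auto simp: \<phi>_def intro!: span_scale)
  ultimately have "cone_approx T \<eta> (span G) \<phi>"
    using G phi0 hom err by (auto simp: cone_approx_def finite_dimensional_def)
  then show ?thesis using that by blast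
qed

lemma LS_degree_cone_approx:
  assumes "cone_approx T \<eta> W \<phi>" and m: "0 < m" "\<And>x. m * norm x \<le> norm (T x)" "\<eta> \<le> m" and r: "0 < r"
  shows "LS_degree_ball (blinfun_apply T) r = brouwer_degree_ball W r (\<lambda>x. x - \<phi> x)"
proof (rule LS_degree_ball_eq [OF r])
  have "norm ((x - T x) - \<phi> x) < m * r" if "norm x \<le> r" for x
  proof (cases "x = 0")
    case False
    then have "norm ((x - T x) - \<phi> x) < \<eta> * norm x" using assms(1) by (simp add: cone_approx_def)
    also have "\<dots> \<le> m * r" using m that by (intro mult_mono) auto
    finally show ?thesis .
  qed (use assms in \<open>simp add: cone_approx_def\<close>)
  moreover have "m * r \<le> norm (T x)" if "norm x = r" for x using m(2) [of x] that by simp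
  ultimately show "LS_approx (blinfun_apply T) r W \<phi>"
    using assms unfolding LS_approx_def cone_approx_def
    by (auto intro!: exI [of _ "m * r"] continuous_on_subset [of UNIV \<phi>])
qed

lemma cone_approx_into:
  assumes "cone_approx T \<eta> W \<phi>" and m: "\<And>x. m * norm x \<le> norm (T x)" "\<eta> \<le> m"
  shows "x \<in> W - {0} \<Longrightarrow> x - \<phi> x \<in> W - {0}"
proof -
  assume x: "x \<in> W - {0}"
  have "norm ((x - T x) - \<phi> x) < norm (T x)"
  proof -
    have "norm ((x - T x) - \<phi> x) < \<eta> * norm x" using assms(1) x by (simp add: cone_approx_def)
    also have "\<dots> \<le> m * norm x" using m(2) by (intro mult_right_mono) auto
    also have "\<dots> \<le> norm (T x)" by (rule m(1))
    finally show ?thesis .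
  qed
  then have "x - \<phi> x \<noteq> 0" by (auto simp: algebra_simps)
  moreover have "subspace W" "\<phi> x \<in> W"
    using assms(1) by (auto simp: cone_approx_def finite_dimensional_def)
  ultimately show ?thesis using x by (auto intro: subspace_diff)
qed

text \<open>Homogeneity makes the degree independent of the radius, so the eventual value in
  \<open>deg_LS\<close> exists and can be read off at radius 1.\<close>

lemma deg_LS_cone_approx:
  assumes ca: "cone_approx T \<eta> W \<phi>" and m: "0 < m" "\<And>x. m * norm x \<le> norm (T x)" "\<eta> \<le> m"
  shows "deg_LS T = brouwer_degree_ball W 1 (\<lambda>x. x - \<phi> x)"
proof -
  have W: "finite_dimensional W" using ca by (simp add: cone_approx_def)
  let ?f = "\<lambda>x. x - \<phi> x"
  have cont: "continuous_on S ?f" for S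
    using ca by (auto simp: cone_approx_def intro!: continuous_intros intro: continuous_on_subset)
  have into: "x \<in> W - {0} \<Longrightarrow> ?f x \<in> W - {0}" for x by (rule cone_approx_into [OF ca m(2,3)])
  have hom: "?f (t *\<^sub>R x) = t *\<^sub>R ?f x" if "0 < t" for t x
    using ca that by (simp add: cone_approx_def scaleR_right_diff_distrib)
  have rad: "brouwer_degree_ball W r ?f = brouwer_degree_ball W 1 ?f" if r: "0 < r" for r
  proof (cases "W = {0}")
    case False
    obtain G where G: "finite G" "span G = W" using W by (auto simp: finite_dimensional_def)
    obtain b p where b: "basis_seq b p" "span (b ` {..p}) = W"
      using basis_seq_of_span [OF G(1)] G False by blast
    have eq: "brouwer_degree_ball W s ?f = Brouwer_degree2 p (sphere_map b b p s ?f)" if "0 < s" for s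
      by (rule brouwer_degree_ball_eq [OF b that cont]) (use into that in auto)
    have "sphere_map b b p r ?f x = sphere_map b b p 1 ?f x" if x: "x \<in> nsph p" for x
    proof -
      let ?u = "radial b p 1 x"
      have u: "?u \<in> W - {0}" using radial_in [OF b(1) x, of 1] b(2) by auto
      have "radial b p r x = r *\<^sub>R ?u" by (simp add: radial_def)
      then have "?f (radial b p r x) = r *\<^sub>R ?f ?u" using hom [OF r] by simp
      moreover have "coords b p (r *\<^sub>R ?f ?u) = (\<lambda>i. r * coords b p (?f ?u) i)"
        using coords_linear [OF b(1), of "?f ?u" 0 r 0] into [OF u] b(2) span_0 by (auto simp: fun_eq_iff)
      ultimately show ?thesis using normalize_vec_scale [OF r] by (simp add: sphere_map_def)
    qed
    then have "Brouwer_degree2 p (sphere_map b b p r ?f) = Brouwer_degree2 p (sphere_map b b p 1 ?f)"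
      by (intro Brouwer_degree2_eq) (simp add: nsphere_nsph)
    then show ?thesis using eq r by simp
  qed (simp add: brouwer_degree_ball_def)
  have ev: "\<forall>\<^sub>F r in at_right 0. LS_degree_ball (blinfun_apply T) r = brouwer_degree_ball W 1 ?f"
  proof -
    have "\<forall>\<^sub>F r in at_right (0::real). 0 < r" by (rule eventually_at_right_less)
    then show ?thesis
    proof eventually_elim
      case (elim r)
      then show ?case using LS_degree_cone_approx [OF ca m, of r] rad [of r] by simp
    qed
  qed
  show ?thesis
    unfolding deg_LS_def
  proof (rule the_equality, rule ev)
    fix d assume d: "\<forall>\<^sub>F r in at_right 0. LS_degree_ball (blinfun_apply T) r = d"
    have "\<forall>\<^sub>F r in at_right (0::real). d = brouwer_degree_ball W 1 ?f"
      using ev d by eventually_elim simp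
    then show "d = brouwer_degree_ball W 1 ?f"
      by (rule eventually_happens' [OF trivial_limit_at_right_real, elim_format]) simp
  qed
qed

lemma cone_approx_enlarge:
  assumes "cone_approx T \<eta> W \<phi>" "W \<subseteq> W'" "finite_dimensional W'" "\<eta> \<le> \<eta>'"
  shows "cone_approx T \<eta>' W' \<phi>"
proof -
  have "norm ((x - T x) - \<phi> x) < \<eta>' * norm x" if "x \<noteq> 0" for x
  proof -
    have "norm ((x - T x) - \<phi> x) < \<eta> * norm x" using assms(1) that by (simp add: cone_approx_def)
    also have "\<dots> \<le> \<eta>' * norm x" using assms(4) by (intro mult_right_mono) auto
    finally show ?thesis .
  qed
  then show ?thesis using assms by (auto simp: cone_approx_def)
qed

lemma deg_LS_id: "deg_LS id_blinfun = 1"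
proof -
  have "cone_approx (id_blinfun :: 'a \<Rightarrow>\<^sub>L 'a) 1 {0} (\<lambda>_. 0)"
    by (auto simp: cone_approx_def finite_dimensional_def intro!: exI [of _ "{}"])
  then have "deg_LS (id_blinfun :: 'a \<Rightarrow>\<^sub>L 'a) = brouwer_degree_ball {0::'a} 1 (\<lambda>x. x - 0)"
    by (rule deg_LS_cone_approx [where m = 1]) auto
  then show ?thesis by (simp add: brouwer_degree_ball_def)
qed

lemma deg_LS_compose:
  fixes S T :: "'a::banach \<Rightarrow>\<^sub>L 'a"
  assumes S: "S \<in> GLc" and T: "T \<in> GLc"
  shows "deg_LS (S o\<^sub>L T) = deg_LS S * deg_LS T"
proof -
  have ST: "S \<in> GL" "T \<in> GL" using S T by (auto simp: GLc_def)
  obtain mS where mS: "0 < mS" "\<And>x. mS * norm x \<le> norm (S x)" using GL_lower_bound [OF ST(1)] by blast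
  obtain mT where mT: "0 < mT" "\<And>x. mT * norm x \<le> norm (T x)" using GL_lower_bound [OF ST(2)] by blast
  have mST: "mS * mT * norm x \<le> norm ((S o\<^sub>L T) x)" for x
  proof -
    have "mS * (mT * norm x) \<le> mS * norm (T x)" using mS mT by (intro mult_left_mono) auto
    also have "\<dots> \<le> norm (S (T x))" by (rule mS)
    finally show ?thesis by (simp add: mult.assoc)
  qed
  \<comment> \<open>The error of the composed approximants is below
    \<open>\<eta>S * (norm T + mT + 1) + \<eta>T * (norm S + 1)\<close> times \<open>norm x\<close>;
    each summand is allotted half of the lower bound \<open>mS * mT\<close> of the
    composition.\<close>
  define \<eta>T where "\<eta>T = min mT (mS * mT / (2 * (norm S + 1)))"
  define \<eta>S where "\<eta>S = min mS (mS * mT / (2 * (norm T + mT + 1)))"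
  have pos: "0 < norm S + 1" "0 < norm T + mT + 1" using mT by (auto simp: add_nonneg_pos)
  have etaT: "0 < \<eta>T" "\<eta>T \<le> mT" "\<eta>T * (norm S + 1) \<le> mS * mT / 2"
  proof -
    show "0 < \<eta>T" "\<eta>T \<le> mT" using mS mT pos by (auto simp: \<eta>T_def)
    have "\<eta>T \<le> mS * mT / (2 * (norm S + 1))" by (simp add: \<eta>T_def)
    then show "\<eta>T * (norm S + 1) \<le> mS * mT / 2" using pos by (simp add: field_simps)
  qed
  have etaS: "0 < \<eta>S" "\<eta>S \<le> mS" "\<eta>S * (norm T + mT + 1) \<le> mS * mT / 2"
  proof -
    show "0 < \<eta>S" "\<eta>S \<le> mS" using mS mT pos by (auto simp: \<eta>S_def)
    have "\<eta>S \<le> mS * mT / (2 * (norm T + mT + 1))" by (simp add: \<eta>S_def)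
    then show "\<eta>S * (norm T + mT + 1) \<le> mS * mT / 2" using pos by (simp add: field_simps)
  qed
  have cST: "compact_op (S - id_blinfun)" "compact_op (T - id_blinfun)" using S T by (auto simp: GLc_def)
  obtain W1 \<phi> where "cone_approx S \<eta>S W1 \<phi>" using cone_approx_exists [OF cST(1) etaS(1)] by blast
  moreover obtain W2 \<psi> where "cone_approx T \<eta>T W2 \<psi>" using cone_approx_exists [OF cST(2) etaT(1)] by blast
  moreover obtain G1 where G1: "finite G1" "span G1 = W1" using calculation(1) by (auto simp: cone_approx_def finite_dimensional_def)
  moreover obtain G2 where G2: "finite G2" "span G2 = W2" using calculation(2) by (auto simp: cone_approx_def finite_dimensional_def)
  moreover define W where "W = span (G1 \<union> G2)"
  moreover have W: "finite_dimensional W" using G1 G2 by (auto simp: finite_dimensional_def W_def)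
  moreover have sub: "W1 \<subseteq> W" "W2 \<subseteq> W" using G1(2) G2(2) by (auto simp: W_def intro: span_mono [THEN subsetD])
  ultimately have \<phi>: "cone_approx S \<eta>S W \<phi>" and \<psi>: "cone_approx T \<eta>T W \<psi>"
    using cone_approx_enlarge by (metis order_refl)+
  let ?f = "\<lambda>x. x - \<phi> x" and ?g = "\<lambda>x. x - \<psi> x"
  have degS: "deg_LS S = brouwer_degree_ball W 1 ?f" by (rule deg_LS_cone_approx [OF \<phi> mS etaS(2)])
  have degT: "deg_LS T = brouwer_degree_ball W 1 ?g" by (rule deg_LS_cone_approx [OF \<psi> mT etaT(2)])
  have fin: "x \<in> W - {0} \<Longrightarrow> ?f x \<in> W - {0}" for x by (rule cone_approx_into [OF \<phi> mS(2) etaS(2)])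
  have gin: "x \<in> W - {0} \<Longrightarrow> ?g x \<in> W - {0}" for x by (rule cone_approx_into [OF \<psi> mT(2) etaT(2)])
  have contf: "continuous_on A ?f" for A
    using \<phi> by (auto simp: cone_approx_def intro!: continuous_intros intro: continuous_on_subset)
  have contg: "continuous_on A ?g" for A
    using \<psi> by (auto simp: cone_approx_def intro!: continuous_intros intro: continuous_on_subset)
  have fhom: "?f (t *\<^sub>R x) = t *\<^sub>R ?f x" if "0 < t" for t x
    using \<phi> that by (simp add: cone_approx_def scaleR_right_diff_distrib)
  have ghom: "?g (t *\<^sub>R x) = t *\<^sub>R ?g x" if "0 < t" for t x
    using \<psi> that by (simp add: cone_approx_def scaleR_right_diff_distrib)
  have eS: "norm (?f x - S x) \<le> \<eta>S * norm x" for x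
    using \<phi> by (cases "x = 0") (auto simp: cone_approx_def algebra_simps less_imp_le)
  have eT: "norm (?g x - T x) < \<eta>T * norm x" if "x \<noteq> 0" for x
    using \<psi> that by (auto simp: cone_approx_def algebra_simps)
  have err: "norm (?f (?g x) - S (T x)) < (mS * mT) * norm x" if x: "x \<noteq> 0" for x
  proof -
    have gx: "norm (?g x) \<le> (norm T + mT) * norm x"
    proof -
      have "norm (?g x) \<le> norm (T x) + norm (?g x - T x)" by (rule norm_triangle_sub)
      also have "\<dots> \<le> norm T * norm x + mT * norm x"
        using norm_blinfun [of T x] eT [OF x] etaT(2) mult_right_mono [OF etaT(2), of "norm x"] by auto
      finally show ?thesis by (simp add: algebra_simps)
    qed
    have "?f (?g x) - S (T x) = (?f (?g x) - S (?g x)) + S (?g x - T x)" by (simp add: blinfun.diff_right)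
    then have "norm (?f (?g x) - S (T x)) \<le> norm (?f (?g x) - S (?g x)) + norm (S (?g x - T x))"
      by (metis norm_triangle_ineq)
    also have "\<dots> \<le> \<eta>S * norm (?g x) + norm S * norm (?g x - T x)"
      by (intro add_mono eS norm_blinfun)
    also have "\<dots> \<le> \<eta>S * ((norm T + mT) * norm x) + norm S * (\<eta>T * norm x)"
      using gx etaS(1) eT [OF x] by (intro add_mono mult_left_mono) auto
    also have "\<dots> < \<eta>S * ((norm T + mT + 1) * norm x) + (norm S + 1) * (\<eta>T * norm x)"
    proof (rule add_strict_mono)
      have "(norm T + mT) * norm x < (norm T + mT + 1) * norm x"
        by (rule mult_strict_right_mono) (use x in auto)
      then show "\<eta>S * ((norm T + mT) * norm x) < \<eta>S * ((norm T + mT + 1) * norm x)"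
        using etaS(1) by (rule mult_strict_left_mono)
      show "norm S * (\<eta>T * norm x) < (norm S + 1) * (\<eta>T * norm x)"
        by (rule mult_strict_right_mono) (use x etaT(1) in auto)
    qed
    also have "\<dots> = (\<eta>S * (norm T + mT + 1) + \<eta>T * (norm S + 1)) * norm x" by (simp add: algebra_simps)
    also have "\<dots> \<le> (mS * mT) * norm x" using etaS(3) etaT(3) by (intro mult_right_mono) auto
    finally show ?thesis .
  qed
  have range: "x - ?f (?g x) \<in> W" for x
  proof -
    have "\<phi> (?g x) \<in> W" "\<psi> x \<in> W" using \<phi> \<psi> by (auto simp: cone_approx_def)
    then have "\<phi> (?g x) + \<psi> x \<in> W" unfolding W_def by (rule span_add)
    then show ?thesis by simp
  qed
  have "cone_approx (S o\<^sub>L T) (mS * mT) W (\<lambda>x. x - ?f (?g x))"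
    unfolding cone_approx_def
  proof (intro conjI allI impI W)
    show "continuous_on UNIV (\<lambda>x. x - ?f (?g x))"
      by (intro continuous_on_diff continuous_on_id continuous_on_compose2 [OF contf [of UNIV] contg]) auto
    show "range (\<lambda>x. x - ?f (?g x)) \<subseteq> W" using range by blast
    show "(0::'a) - ?f (?g 0) = 0" using \<phi> \<psi> by (simp add: cone_approx_def)
    fix x :: 'a
    show "t *\<^sub>R x - ?f (?g (t *\<^sub>R x)) = t *\<^sub>R (x - ?f (?g x))" if "0 < t" for t
      unfolding ghom [OF that] fhom [OF that] by (simp add: scaleR_right_diff_distrib scaleR_right_distrib)
    show "norm ((x - (S o\<^sub>L T) x) - (x - ?f (?g x))) < mS * mT * norm x" if "x \<noteq> 0"
      using err [OF that] by (simp add: norm_minus_commute algebra_simps)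
  qed
  then have "deg_LS (S o\<^sub>L T) = brouwer_degree_ball W 1 (\<lambda>x. x - (x - ?f (?g x)))"
    by (rule deg_LS_cone_approx [OF _ _ mST]) (use mS mT in auto)
  also have "(\<lambda>x. x - (x - ?f (?g x))) = ?f \<circ> ?g" by auto
  also have "brouwer_degree_ball W 1 (?f \<circ> ?g) = brouwer_degree_ball W 1 ?f * brouwer_degree_ball W 1 ?g"
  proof (rule brouwer_degree_ball_compose [OF W zero_less_one contg _ contf fin fhom])
    show "?g x \<in> W - {0}" if x: "x \<in> W \<inter> sphere 0 1" for x
    proof (rule gin)
      show "x \<in> W - {0}" using x by auto
    qed
    show "?f 0 = 0" using \<phi> by (simp add: cone_approx_def)
  qed
  finally show ?thesis by (simp add: degS degT)
qed

lemma deg_LS_sign: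
  assumes "T \<in> GLc" shows "deg_LS T \<in> {-1, 1}"
proof -
  have "deg_LS T * deg_LS (inv_op T) = 1"
    using deg_LS_compose [OF assms GLc_inv [OF assms]] inv_op(2) [of T] assms by (simp add: GLc_def deg_LS_id)
  then show ?thesis by (auto simp: zmult_eq_1_iff)
qed

text \<open>One approximant serves both operators: its error \<open>m / 4\<close> for
  \<open>T'\<close>, and this error plus the distance \<open>m / 4\<close> for \<open>T\<close>,
  stay within the lower bounds \<open>m / 2\<close> and \<open>m\<close>.\<close>

lemma deg_LS_locally_constant:
  fixes T :: "'a::banach \<Rightarrow>\<^sub>L 'a"
  assumes T: "T \<in> GLc"
  obtains d where "0 < d" "\<And>T'. T' \<in> GLc \<Longrightarrow> norm (T' - T) < d \<Longrightarrow> deg_LS T' = deg_LS T"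
proof -
  have TG: "T \<in> GL" using T by (simp add: GLc_def)
  obtain m where m: "0 < m" "\<And>x. m * norm x \<le> norm (T x)" using GL_lower_bound [OF TG] by blast
  have "deg_LS T' = deg_LS T" if T': "T' \<in> GLc" and d: "norm (T' - T) < m / 4" for T'
  proof -
    have lb: "m / 2 * norm x \<le> norm (T' x)" for x
    proof -
      have "(m - norm (T' - T)) * norm x \<le> norm (T' x)" using d m by (intro GL_perturb(2) [OF TG m]) auto
      moreover have "m / 2 * norm x \<le> (m - norm (T' - T)) * norm x" using d m(1) by (intro mult_right_mono) auto
      ultimately show ?thesis by simp
    qed
    have cT': "compact_op (T' - id_blinfun)" "0 < m / 4" using T' m(1) by (auto simp: GLc_def)
    obtain W \<phi> where \<phi>: "cone_approx T' (m / 4) W \<phi>" using cone_approx_exists [OF cT'] by blast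
    have "norm ((x - T x) - \<phi> x) < m / 2 * norm x" if "x \<noteq> 0" for x
    proof -
      have "(x - T x) - \<phi> x = ((x - T' x) - \<phi> x) + (T' - T) x" by (simp add: blinfun.diff_left)
      then have "norm ((x - T x) - \<phi> x) \<le> norm ((x - T' x) - \<phi> x) + norm ((T' - T) x)"
        by (metis norm_triangle_ineq)
      also have "norm ((T' - T) x) \<le> m / 4 * norm x"
        using norm_blinfun [of "T' - T" x] d mult_right_mono [of "norm (T' - T)" "m / 4" "norm x"] by simp
      also have "norm ((x - T' x) - \<phi> x) < m / 4 * norm x" using \<phi> that by (simp add: cone_approx_def)
      finally show ?thesis by simp
    qed
    then have \<phi>': "cone_approx T (m / 2) W \<phi>" using \<phi> by (simp add: cone_approx_def)
    show ?thesis
      using deg_LS_cone_approx [OF \<phi> _ lb] deg_LS_cone_approx [OF \<phi>' m] m(1) by simp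
  qed
  then show ?thesis using that [of "m / 4"] m(1) by auto
qed

lemma deg_LS_path:
  assumes cont: "continuous_on {a..b::real} T" and GLc: "\<And>t. t \<in> {a..b} \<Longrightarrow> T t \<in> GLc" and ab: "a \<le> b"
  shows "deg_LS (T a) = deg_LS (T b)"
proof -
  have "(\<lambda>t. deg_LS (T t)) constant_on {a..b}"
  proof (rule locally_constant_imp_constant)
    fix t assume t: "t \<in> {a..b}"
    obtain d where d: "0 < d" "\<And>T'. T' \<in> GLc \<Longrightarrow> norm (T' - T t) < d \<Longrightarrow> deg_LS T' = deg_LS (T t)"
      using deg_LS_locally_constant [OF GLc [OF t]] by blast
    obtain e where e: "0 < e" "\<And>s. s \<in> {a..b} \<Longrightarrow> dist s t < e \<Longrightarrow> dist (T s) (T t) < d"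
      using cont t d(1) unfolding continuous_on_iff by meson
    show "\<exists>U. openin (top_of_set {a..b}) U \<and> t \<in> U \<and> (\<forall>x\<in>U. deg_LS (T x) = deg_LS (T t))"
    proof (intro exI [of _ "{a..b} \<inter> ball t e"] conjI ballI)
      show "openin (top_of_set {a..b}) ({a..b} \<inter> ball t e)" by (rule openin_open_Int) simp
      show "t \<in> {a..b} \<inter> ball t e" using t e(1) by simp
      fix x assume "x \<in> {a..b} \<inter> ball t e"
      then have x: "x \<in> {a..b}" "dist x t < e" by (auto simp: dist_commute)
      show "deg_LS (T x) = deg_LS (T t)" using d(2) [OF GLc [OF x(1)]] e(2) [OF x] by (simp add: dist_norm)
    qed
  qed simp
  then obtain c where "\<And>t. t \<in> {a..b} \<Longrightarrow> deg_LS (T t) = c" by (auto simp: constant_on_def)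
  then show ?thesis using ab by simp
qed

text \<open>Two parametrices differ by a path \<open>S\<close> in \<open>GLc\<close>, along which
  \<open>deg_LS\<close> is constant. Changing the parametrix thus multiplies both endpoint degrees
  by the same sign, which cancels in the product.\<close>

lemma path_parity_eq:
  fixes L :: "real \<Rightarrow> ('a::banach \<Rightarrow>\<^sub>L 'b::banach)"
  assumes ab: "a \<le> b" and P: "parametrix L a b P" and La: "L a \<in> GL" and Lb: "L b \<in> GL"
  shows "path_parity L a b = deg_LS (P a o\<^sub>L L a) * deg_LS (P b o\<^sub>L L b)"
  unfolding path_parity_def
proof (rule the_equality)
  show "\<exists>Q. parametrix L a b Q \<and>
     deg_LS (P a o\<^sub>L L a) * deg_LS (P b o\<^sub>L L b) = deg_LS (Q a o\<^sub>L L a) * deg_LS (Q b o\<^sub>L L b)"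
    using P by blast
next
  fix d assume "\<exists>Q. parametrix L a b Q \<and> d = deg_LS (Q a o\<^sub>L L a) * deg_LS (Q b o\<^sub>L L b)"
  then obtain Q where Q: "parametrix L a b Q" and d: "d = deg_LS (Q a o\<^sub>L L a) * deg_LS (Q b o\<^sub>L L b)" by blast
  define S where "S t = Q t o\<^sub>L inv_op (P t)" for t
  have PQ: "P t \<in> GL" "Q t \<in> GL" "compact_op ((P t o\<^sub>L L t) - id_blinfun)" "compact_op ((Q t o\<^sub>L L t) - id_blinfun)"
    if "t \<in> {a..b}" for t using P Q that by (auto simp: parametrix_def)
  have SG: "S t \<in> GLc" if t: "t \<in> {a..b}" for t
  proof -
    have eq: "S t - id_blinfun = ((Q t o\<^sub>L L t) - id_blinfun) - (S t o\<^sub>L ((P t o\<^sub>L L t) - id_blinfun))"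
      by (rule blinfun_eqI) (simp add: S_def blinfun.diff_left blinfun.diff_right PQ [OF t])
    have "compact_op (S t - id_blinfun)"
      unfolding eq by (intro compact_op_diff compact_op_compose_left PQ t)
    then show ?thesis using PQ [OF t] by (simp add: GLc_def S_def GL_compose inv_op_GL)
  qed
  have "continuous_on {a..b} S"
  proof -
    have "continuous_on {a..b} (\<lambda>t. inv_op (P t))"
      by (rule continuous_on_compose2 [OF continuous_on_inv_op]) (use P PQ in \<open>auto simp: parametrix_def\<close>)
    moreover have "continuous_on {a..b} Q" using Q by (simp add: parametrix_def)
    ultimately show ?thesis
      unfolding S_def by (rule bounded_bilinear.continuous_on [OF bounded_bilinear_blinfun_compose, rotated])
  qed
  then have Sab: "deg_LS (S a) = deg_LS (S b)" using SG ab by (intro deg_LS_path) auto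
  have QS: "deg_LS (Q t o\<^sub>L L t) = deg_LS (S t) * deg_LS (P t o\<^sub>L L t)" if t: "t \<in> {a..b}" and Lt: "L t \<in> GL" for t
  proof -
    have "Q t o\<^sub>L L t = S t o\<^sub>L (P t o\<^sub>L L t)"
      by (rule blinfun_eqI) (simp add: S_def PQ [OF t])
    moreover have "P t o\<^sub>L L t \<in> GLc" using PQ [OF t] Lt by (simp add: GLc_def GL_compose)
    ultimately show ?thesis using deg_LS_compose SG [OF t] by metis
  qed
  have "deg_LS (S b) * deg_LS (S b) = 1" using deg_LS_sign [OF SG [of b]] ab by auto
  then show "d = deg_LS (P a o\<^sub>L L a) * deg_LS (P b o\<^sub>L L b)"
    unfolding d using QS [of a] QS [of b] La Lb ab Sab
    by (simp add: mult.assoc mult.left_commute)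
qed

text \<open>The deviation from the identity already takes values in \<open>W\<close>, so it is its
  own approximant.\<close>

lemma deg_LS_finite_rank:
  fixes T :: "'a::banach \<Rightarrow>\<^sub>L 'a"
  assumes T: "T \<in> GL" and W: "finite_dimensional W" "\<And>x. x - T x \<in> W"
  shows "deg_LS T = brouwer_degree_ball W 1 T"
proof -
  obtain m where m: "0 < m" "\<And>x. m * norm x \<le> norm (T x)" using GL_lower_bound [OF T] by blast
  have "cone_approx T m W (\<lambda>x. x - T x)"
    using W m(1) by (auto simp: cone_approx_def blinfun.scaleR_right scaleR_right_diff_distrib intro!: continuous_intros)
  then have "deg_LS T = brouwer_degree_ball W 1 (\<lambda>x. x - (x - T x))"
    by (rule deg_LS_cone_approx [OF _ m]) simp
  then show ?thesis by simp
qed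

subsection \<open>Finite-rank correctors of Fredholm operators of index zero\<close>

text \<open>Functionals are represented by their graphs, so that extending a functional means
  enlarging a subspace. The admissible values at \<open>x0\<close> lie between a supremum and an
  infimum, and \<open>key\<close> says that they leave room for \<xi>.\<close>

lemma functional_extension_step:
  fixes M :: "('a::real_normed_vector \<times> real) set"
  assumes M: "subspace M" "\<And>z. z \<in> M \<Longrightarrow> snd z \<le> c * norm (fst z)" and c: "0 \<le> c"
  obtains \<xi> where "\<And>z. z \<in> span (insert (x0, \<xi>) M) \<Longrightarrow> snd z \<le> c * norm (fst z)"
proof -
  have key: "snd z - c * norm (fst z - x0) \<le> c * norm (fst w + x0) - snd w" if "z \<in> M" "w \<in> M" for z w
  proof -
    have "snd (z + w) \<le> c * norm (fst (z + w))" using M that by (intro M(2) subspace_add) auto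
    also have "\<dots> = c * norm ((fst z - x0) + (fst w + x0))" by simp
    also have "\<dots> \<le> c * (norm (fst z - x0) + norm (fst w + x0))"
      using c by (intro mult_left_mono norm_triangle_ineq)
    finally show ?thesis by (simp add: algebra_simps)
  qed
  have M0: "0 \<in> M" using M(1) by (rule subspace_0)
  define \<xi> where "\<xi> = (SUP z\<in>M. snd z - c * norm (fst z - x0))"
  have bdd: "bdd_above ((\<lambda>z. snd z - c * norm (fst z - x0)) ` M)"
    by (rule bdd_aboveI2, rule key [OF _ M0])
  have lo: "snd z - c * norm (fst z - x0) \<le> \<xi>" if "z \<in> M" for z
    unfolding \<xi>_def using cSUP_upper [OF that bdd] .
  have hi: "\<xi> \<le> c * norm (fst z + x0) - snd z" if "z \<in> M" for z
    unfolding \<xi>_def by (rule cSUP_least) (use M0 key that in auto)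
  have "snd z \<le> c * norm (fst z)" if z: "z \<in> span (insert (x0, \<xi>) M)" for z
  proof -
    obtain t where t: "z - t *\<^sub>R (x0, \<xi>) \<in> span M"
      using z by (auto simp: span_insert)
    define w where "w = z - t *\<^sub>R (x0, \<xi>)"
    have w: "w \<in> M" using t M(1) by (simp add: w_def span_eq_iff [THEN iffD2])
    have zw: "fst z = fst w + t *\<^sub>R x0" "snd z = snd w + t * \<xi>" by (auto simp: w_def)
    consider "t = 0" | "t > 0" | "t < 0" by linarith
    then show ?thesis
    proof cases
      case 1
      then show ?thesis using M(2) [OF w] zw by simp
    next
      case 2
      have "(1/t) *\<^sub>R w \<in> M" using M(1) w by (rule subspace_scale)
      from hi [OF this] have "t * \<xi> \<le> t * (c * norm ((1/t) *\<^sub>R fst w + x0) - (1/t) * snd w)"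
        using 2 by (intro mult_left_mono) auto
      also have "\<dots> = c * (t * norm ((1/t) *\<^sub>R fst w + x0)) - snd w"
        using 2 by (simp add: right_diff_distrib mult.left_commute)
      also have "t * norm ((1/t) *\<^sub>R fst w + x0) = norm (t *\<^sub>R ((1/t) *\<^sub>R fst w + x0))"
        using 2 by simp
      also have "t *\<^sub>R ((1/t) *\<^sub>R fst w + x0) = fst z" using 2 zw by (simp add: scaleR_right_distrib)
      finally show ?thesis using zw by simp
    next
      case 3
      define s where "s = - t"
      have s: "s > 0" using 3 by (simp add: s_def)
      have "(1/s) *\<^sub>R w \<in> M" using M(1) w by (rule subspace_scale)
      note l = lo [OF this]
      define v where "v = (1/s) *\<^sub>R fst w - x0"
      have "fst z = s *\<^sub>R v" using s zw by (simp add: v_def scaleR_right_diff_distrib s_def)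
      then have nz: "norm (fst z) = s * norm v" using s by simp
      have "(1/s) * snd w - c * norm v \<le> \<xi>" using l by (simp add: v_def)
      then have "s * ((1/s) * snd w - c * norm v) \<le> s * \<xi>" using s by (intro mult_left_mono) auto
      moreover have "s * ((1/s) * snd w - c * norm v) = snd w - c * norm (fst z)"
        using s by (simp add: nz right_diff_distrib mult.left_commute)
      ultimately have "snd w - c * norm (fst z) \<le> s * \<xi>" by simp
      then show ?thesis using zw(2) by (simp add: s_def)
    qed
  qed
  then show ?thesis using that by blast
qed

text \<open>Zorn's lemma on graphs that satisfy the bound. Applied to a pair over 0 and to its
  negative, the bound forces a graph to be single-valued; the extension step makes a maximal one
  total.\<close>

lemma hahn_banach_graph:
  fixes G :: "('a::real_normed_vector \<times> real) set"
  assumes G: "subspace G" "\<And>z. z \<in> G \<Longrightarrow> snd z \<le> c * norm (fst z)" and c: "0 \<le> c"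
  obtains f :: "'a \<Rightarrow>\<^sub>L real" where "\<And>x a. (x, a) \<in> G \<Longrightarrow> f x = a"
proof -
  define A where "A = {M. subspace M \<and> G \<subseteq> M \<and> (\<forall>z\<in>M. snd z \<le> c * norm (fst z))}"
  have "\<exists>M\<in>A. \<forall>X\<in>A. M \<subseteq> X \<longrightarrow> X = M"
  proof (rule subset_Zorn_nonempty)
    show "A \<noteq> {}" using G by (auto simp: A_def)
    fix \<C> assume ne: "\<C> \<noteq> {}" and ch: "subset.chain A \<C>"
    have CA: "\<C> \<subseteq> A" using ch by (simp add: subset_chain_def)
    have "subspace (\<Union>\<C>)"
      unfolding subspace_def
    proof (intro conjI ballI allI)
      obtain X where "X \<in> \<C>" using ne by blast
      moreover have "0 \<in> X" using calculation CA by (auto simp: A_def intro: subspace_0)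
      ultimately show "0 \<in> \<Union>\<C>" by blast
      fix x y assume "x \<in> \<Union>\<C>" "y \<in> \<Union>\<C>"
      then obtain X Y where "X \<in> \<C>" "Y \<in> \<C>" "x \<in> X" "y \<in> Y" by blast
      then obtain Z where "Z \<in> \<C>" "x \<in> Z" "y \<in> Z" using ch unfolding subset_chain_def by blast
      then show "x + y \<in> \<Union>\<C>" using CA by (auto simp: A_def intro: subspace_add)
    next
      fix r :: real and x assume "x \<in> \<Union>\<C>"
      then show "r *\<^sub>R x \<in> \<Union>\<C>" using CA by (auto simp: A_def intro: subspace_scale)
    qed
    then show "\<Union>\<C> \<in> A" using ne CA by (auto simp: A_def)
  qed
  then obtain M where MA: "M \<in> A" and max: "\<And>X. X \<in> A \<Longrightarrow> M \<subseteq> X \<Longrightarrow> X = M" by blast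
  have M: "subspace M" "G \<subseteq> M" and Mb: "\<And>z. z \<in> M \<Longrightarrow> snd z \<le> c * norm (fst z)" using MA by (auto simp: A_def)
  have uniq: "a = a'" if "(x, a) \<in> M" "(x, a') \<in> M" for x a a'
  proof -
    have "(x, a) - (x, a') \<in> M" "(x, a') - (x, a) \<in> M" 
      using subspace_diff [OF M(1) that] subspace_diff [OF M(1) that(2,1)] by blast+
    from Mb [OF this(1)] Mb [OF this(2)] show ?thesis by simp
  qed
  have total: "\<exists>a. (x, a) \<in> M" for x
  proof -
    obtain \<xi> where \<xi>: "\<And>z. z \<in> span (insert (x, \<xi>) M) \<Longrightarrow> snd z \<le> c * norm (fst z)"
      using functional_extension_step [OF M(1) Mb c] by blast
    have sub: "M \<subseteq> span (insert (x, \<xi>) M)" by (rule order_trans [OF subset_insertI span_superset])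
    then have "span (insert (x, \<xi>) M) \<in> A" using \<xi> M by (auto simp: A_def)
    then have "span (insert (x, \<xi>) M) = M" using max sub by blast
    then have "(x, \<xi>) \<in> M" using span_base [of "(x, \<xi>)" "insert (x, \<xi>) M"] by auto
    then show ?thesis by blast
  qed
  define g where "g x = (SOME a. (x, a) \<in> M)" for x
  have g: "(x, g x) \<in> M" for x unfolding g_def using total [of x] by (rule someI_ex)
  have "bounded_linear g"
  proof (rule bounded_linear_intro [where K = c])
    show "g (x + y) = g x + g y" for x y
      using uniq [OF g [of "x + y"]] subspace_add [OF M(1) g [of x] g [of y]] by simp
    show "g (r *\<^sub>R x) = r *\<^sub>R g x" for r x
      using uniq [OF g [of "r *\<^sub>R x"]] subspace_scale [OF M(1) g [of x], of r] by simp
    show "norm (g x) \<le> norm x * c" for x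
      using Mb [OF g [of x]] Mb [OF subspace_neg [OF M(1) g [of x]]] by (simp add: abs_le_iff mult.commute)
  qed
  then show ?thesis
    using that [of "Blinfun g"] uniq [OF g] M(2) by (auto simp: bounded_linear_Blinfun_apply)
qed

lemma dual_functional:
  fixes b :: "nat \<Rightarrow> 'a::banach"
  assumes b: "basis_seq b p" and i: "i \<le> p"
  obtains f :: "'a \<Rightarrow>\<^sub>L real" where "\<And>x. f (lin_comb b p x) = x i"
proof -
  obtain c where c: "c > 0" "\<And>x i. i \<le> p \<Longrightarrow> \<bar>x i\<bar> \<le> c * norm (lin_comb b p x)"
    using coords_bound [OF b] by blast
  define G where "G = range (\<lambda>x. (lin_comb b p x, x i))"
  have "subspace G"
    unfolding subspace_def G_def
  proof (intro conjI ballI allI)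
    show "0 \<in> range (\<lambda>x. (lin_comb b p x, x i))"
      by (rule range_eqI [of _ _ "\<lambda>_. 0"]) (simp add: lin_comb_def zero_prod_def)
    fix u v assume "u \<in> range (\<lambda>x. (lin_comb b p x, x i))" "v \<in> range (\<lambda>x. (lin_comb b p x, x i))"
    then obtain x y where "u = (lin_comb b p x, x i)" "v = (lin_comb b p y, y i)" by auto
    then show "u + v \<in> range (\<lambda>x. (lin_comb b p x, x i))"
      by (intro range_eqI [of _ _ "\<lambda>j. x j + y j"]) (simp add: lin_comb_add)
  next
    fix r :: real and u assume "u \<in> range (\<lambda>x. (lin_comb b p x, x i))"
    then obtain x where "u = (lin_comb b p x, x i)" by auto
    then show "r *\<^sub>R u \<in> range (\<lambda>x. (lin_comb b p x, x i))"
      by (intro range_eqI [of _ _ "\<lambda>j. r * x j"]) (simp add: lin_comb_scale)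
  qed
  moreover have "snd z \<le> c * norm (fst z)" if "z \<in> G" for z
    using that c(2) [OF i] by (force simp: G_def abs_le_iff)
  moreover have "0 \<le> c" using c(1) by simp
  ultimately obtain f :: "'a \<Rightarrow>\<^sub>L real" where f: "\<And>x a. (x, a) \<in> G \<Longrightarrow> f x = a"
    using hahn_banach_graph by blast
  show ?thesis by (rule that [of f], rule f) (auto simp: G_def)
qed

text \<open>Solving up to half of the norm and repeating with the residual gives a series for the
  solution; the geometric sum is the factor 2 in the bound.\<close>

lemma almost_open_imp_solvable:
  fixes T :: "'a::banach \<Rightarrow>\<^sub>L 'b::banach"
  assumes K: "0 \<le> K" and approx: "\<And>y. \<exists>x. norm x \<le> K * norm y \<and> norm (y - T x) \<le> norm y / 2"
  obtains x where "T x = y" "norm x \<le> 2 * K * norm y"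
proof -
  obtain g where g: "\<And>y. norm (g y) \<le> K * norm y" "\<And>y. norm (y - T (g y)) \<le> norm y / 2"
    using approx by metis
  define z where "z n = ((\<lambda>y. y - T (g y)) ^^ n) y" for n
  have z0: "z 0 = y" and zS: "z (Suc n) = z n - T (g (z n))" for n by (simp_all add: z_def)
  have zn: "norm (z n) \<le> norm y * (1/2)^n" for n
  proof (induction n)
    case (Suc n)
    have "norm (z (Suc n)) \<le> norm (z n) / 2" unfolding zS by (rule g(2))
    then show ?case using Suc by simp
  qed (simp add: z0)
  have gn: "norm (g (z n)) \<le> K * norm y * (1/2)^n" for n
    using order_trans [OF g(1) mult_left_mono [OF zn K]] by (simp add: mult.assoc)
  have geo: "summable (\<lambda>n. K * norm y * (1/2)^n)" by (intro summable_mult summable_geometric) simp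
  have summ: "summable (\<lambda>n. g (z n))"
    by (rule summable_comparison_test' [OF geo, of 0]) (use gn in auto)
  define x where "x = suminf (\<lambda>n. g (z n))"
  have "norm x \<le> suminf (\<lambda>n. K * norm y * (1/2)^n)"
    unfolding x_def by (rule norm_suminf_le [OF gn geo])
  also have "\<dots> = K * norm y * suminf (\<lambda>n. (1/2)^n)" by (rule suminf_mult) (rule summable_geometric, simp)
  also have "suminf (\<lambda>n. (1/2::real)^n) = 2" by (subst suminf_geometric) auto
  finally have nx: "norm x \<le> 2 * K * norm y" by simp
  have "(\<lambda>n. T (g (z n))) sums T x"
    unfolding x_def by (rule bounded_linear.sums [OF blinfun.bounded_linear_right summable_sums [OF summ]])
  moreover have "(\<lambda>n. T (g (z n))) sums (z 0 - 0)"
  proof -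
    have "z \<longlonglongrightarrow> 0"
    proof (rule tendsto_norm_zero_cancel, rule Lim_null_comparison)
      show "\<forall>\<^sub>F n in sequentially. norm (norm (z n)) \<le> norm y * (1/2)^n" using zn by simp
      show "(\<lambda>n. norm y * (1/2)^n) \<longlonglongrightarrow> 0" by (intro tendsto_mult_right_zero LIMSEQ_power_zero) simp
    qed
    then have "(\<lambda>n. z n - z (Suc n)) sums (z 0 - 0)" by (rule telescope_sums')
    then show ?thesis by (simp add: zS)
  qed
  ultimately have "T x = y" using sums_unique2 z0 by fastforce
  then show ?thesis using that nx by blast
qed

text \<open>The open mapping argument: by Baire some closure \<open>C n\<close> has an interior
  point, and differences of approximate preimages of points near it solve \<open>T x = y\<close> up
  to \<open>norm y / 2\<close>.\<close>

lemma bounded_inverse: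
  fixes T :: "'a::banach \<Rightarrow>\<^sub>L 'b::banach"
  assumes inj: "\<And>x. T x = 0 \<Longrightarrow> x = 0" and surj: "\<And>y. \<exists>x. T x = y"
  shows "T \<in> GL"
proof -
  define C where "C n = closure (blinfun_apply T ` ball 0 (real n))" for n
  have "\<exists>n. interior (C n) \<noteq> {}"
  proof (rule ccontr)
    assume "\<not> (\<exists>n. interior (C n) \<noteq> {})"
    then have e: "interior (C n) = {}" for n by blast
    have "euclidean interior_of \<Union>(range C) = {}"
    proof (rule Baire_category_alt)
      show "completely_metrizable_space (euclidean :: 'b topology) \<or>
         locally_compact_space (euclidean :: 'b topology) \<and> regular_space (euclidean :: 'b topology)"
        using completely_metrizable_space_euclidean by blast
    qed (use e in \<open>auto simp: C_def\<close>)
    moreover have "\<Union>(range C) = UNIV"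
    proof -
      have "y \<in> \<Union>(range C)" for y
      proof -
        obtain x where x: "T x = y" using surj by blast
        obtain n where "norm x < real n" using reals_Archimedean2 by blast
        then have "y \<in> blinfun_apply T ` ball 0 (real n)" using x by auto
        then have "y \<in> C n" unfolding C_def by (rule subsetD [OF closure_subset])
        then show ?thesis by (rule UnionI [OF rangeI])
      qed
      then show ?thesis by blast
    qed
    ultimately show False by simp
  qed
  then obtain n y0 where "y0 \<in> interior (C n)" by blast
  then obtain r where r: "0 < r" "ball y0 r \<subseteq> C n" by (meson mem_interior)
  have "\<exists>x. norm x \<le> (4 * real n / r) * norm y \<and> norm (y - T x) \<le> norm y / 2" for y
  proof (cases "y = 0")
    case False
    \<comment> \<open>Scales \<open>y\<close> to length \<open>r / 2\<close>, so that
      \<open>y0 + s *\<^sub>R y\<close> stays in the ball.\<close>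
    define s where "s = r / (2 * norm y)"
    have s: "0 < s" using False r by (simp add: s_def)
    define e where "e = s * norm y / 4"
    have e: "0 < e" using s False by (simp add: e_def)
    have "y0 + s *\<^sub>R y \<in> ball y0 r" using r False by (simp add: dist_norm s_def)
    then have "y0 + s *\<^sub>R y \<in> C n" "y0 \<in> C n" using r by auto
    then obtain u v where u: "norm u < n" "dist (T u) (y0 + s *\<^sub>R y) < e" and v: "norm v < n" "dist (T v) y0 < e"
      unfolding C_def closure_approachable using e by (metis (no_types, lifting) imageE mem_ball_0)
    have "s *\<^sub>R y - T (u - v) = - (T u - (y0 + s *\<^sub>R y)) + (T v - y0)" by (simp add: blinfun.diff_right)
    then have "norm (s *\<^sub>R y - T (u - v)) \<le> dist (T u) (y0 + s *\<^sub>R y) + dist (T v) y0"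
      by (metis dist_norm norm_minus_cancel norm_triangle_ineq)
    then have 1: "norm (s *\<^sub>R y - T (u - v)) \<le> s * norm y / 2" using u v by (simp add: e_def)
    define x where "x = (1 / s) *\<^sub>R (u - v)"
    have "y - T x = (1 / s) *\<^sub>R (s *\<^sub>R y - T (u - v))"
      using s by (simp add: x_def blinfun.scaleR_right blinfun.diff_right scaleR_right_diff_distrib)
    then have "norm (y - T x) = norm (s *\<^sub>R y - T (u - v)) / s" using s by simp
    also have "\<dots> \<le> norm y / 2" using 1 s by (simp add: field_simps)
    finally have "norm (y - T x) \<le> norm y / 2" .
    moreover have "norm x \<le> (4 * real n / r) * norm y"
    proof -
      have "norm (u - v) \<le> 2 * real n" using u v norm_triangle_ineq4 [of u v] by simp
      then have "norm x \<le> 2 * real n / s" using s by (simp add: x_def divide_right_mono)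
      also have "\<dots> = (4 * real n / r) * norm y" using r False by (simp add: s_def field_simps)
      finally show ?thesis .
    qed
    ultimately show ?thesis by blast
  qed (intro exI [of _ 0], simp)
  moreover define K where "K = 4 * real n / r"
  ultimately have ap: "\<exists>x. norm x \<le> K * norm y \<and> norm (y - T x) \<le> norm y / 2" for y by blast
  have K: "0 \<le> K" using r by (simp add: K_def)
  have "norm x \<le> (2 * K + 1) * norm (T x)" for x
  proof -
    obtain w where w: "T w = T x" "norm w \<le> 2 * K * norm (T x)" using almost_open_imp_solvable [OF K ap] by blast
    then have "T (w - x) = 0" by (simp add: blinfun.diff_right)
    then have "w = x" using inj by fastforce
    then have "norm x \<le> 2 * K * norm (T x)" using w(2) by simp
    also have "\<dots> \<le> (2 * K + 1) * norm (T x)" by (intro mult_right_mono) auto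
    finally show ?thesis .
  qed
  then have "1 / (2 * K + 1) * norm x \<le> norm (T x)" for x
    using K by (simp add: divide_le_eq mult.commute add_nonneg_pos)
  then show ?thesis using K surj by (intro GL_I [of "1 / (2 * K + 1)"]) (auto simp: add_nonneg_pos)
qed

definition finite_rank :: "('a::banach \<Rightarrow>\<^sub>L 'b::banach) \<Rightarrow> bool" where
  "finite_rank B \<longleftrightarrow> (\<exists>G. finite G \<and> range (blinfun_apply B) \<subseteq> span G)"

text \<open>\<open>R\<close> sends a basis of the kernel to a smallest spanning set \<open>C\<close>
  modulo the range; index zero makes the two equally large. Bounded functionals dual to the kernel
  basis make \<open>R\<close> a bounded operator on the whole space.\<close>

lemma fredholm0_corrector:
  fixes T :: "'a::banach \<Rightarrow>\<^sub>L 'b::banach"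
  assumes T: "T \<in> Fredholm0"
  obtains R where "finite_rank R" "T + R \<in> GL"
proof -
  let ?r = "range (blinfun_apply T)"
  obtain B where B: "finite B" "span B = ker_op T"
    using T by (auto simp: Fredholm0_def fredholm_def finite_dimensional_def)
  have ex: "\<exists>n. \<exists>C. finite C \<and> card C = n \<and> span (?r \<union> C) = UNIV"
    using T by (auto simp: Fredholm0_def fredholm_def finite_codimensional_def)
  obtain C where C: "finite C" "card C = codim ?r" "span (?r \<union> C) = UNIV"
    using LeastI_ex [OF ex] unfolding codim_def by blast
  have min: "card C \<le> card D" if "finite D" "span (?r \<union> D) = UNIV" for D
    using that unfolding C(2) codim_def by (intro Least_le) blast
  have dk: "dim (ker_op T) = card C" using T C(2) by (simp add: Fredholm0_def fredholm_index_def)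
  have sr: "subspace ?r"
    by (rule linear_subspace_image [of "blinfun_apply T" UNIV, simplified])
       (simp add: blinfun.bounded_linear_right bounded_linear.linear)
  show ?thesis
  proof (cases "ker_op T = {0}")
    case True
    moreover have "dim {0::'a} = 0" 
      using dim_span_eq_card_independent [OF independent_empty] by simp
    ultimately have "C = {}" using dk C(1) by simp
    then have "?r = UNIV" using C(3) sr by (simp add: span_eq_iff [THEN iffD2])
    then have "\<exists>x. T x = y" for y by (metis UNIV_I imageE)
    then have "T \<in> GL" using True by (intro bounded_inverse) (auto simp: ker_op_def)
    moreover have "finite_rank (0 :: 'a \<Rightarrow>\<^sub>L 'b)" by (auto simp: finite_rank_def intro!: exI [of _ "{}"])
    ultimately show ?thesis using that [of 0] by simp
  next
    case False
    obtain b p where b: "basis_seq b p" "span (b ` {..p}) = ker_op T"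
      using basis_seq_of_span [OF B(1)] B(2) False by auto
    have "card C = Suc p"
      using dk b dim_span_eq_card_independent [of "b ` {..p}"] by (auto simp: basis_seq_def card_image)
    then obtain c where c: "bij_betw c {..p} C"
      using ex_bij_betw_nat_finite [OF C(1)] by (auto simp: atLeast0LessThan lessThan_Suc_atMost)
    have cC: "c ` {..p} = C" and cinj: "inj_on c {..p}" using c by (auto simp: bij_betw_def)
    have "\<forall>i. \<exists>f :: 'a \<Rightarrow>\<^sub>L real. i \<le> p \<longrightarrow> (\<forall>x. f (lin_comb b p x) = x i)"
      using dual_functional [OF b(1)] by meson
    then obtain f :: "nat \<Rightarrow> 'a \<Rightarrow>\<^sub>L real" where f: "\<And>i x. i \<le> p \<Longrightarrow> f i (lin_comb b p x) = x i"
      by metis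
    define R where "R = (\<Sum>i\<le>p. blinfun_scaleR_left (c i) o\<^sub>L f i)"
    have R: "R x = (\<Sum>i\<le>p. f i x *\<^sub>R c i)" for x
      by (simp add: R_def blinfun.sum_left)
    have kerb: "T (lin_comb b p s) = 0" for s
      using lin_comb_in_span [of b p s] b(2) by (auto simp: ker_op_def)
    have "finite_rank R"
      unfolding finite_rank_def
    proof (intro exI [of _ C] conjI C(1) image_subsetI)
      show "R x \<in> span C" for x
        unfolding R by (intro span_sum span_scale span_base) (use cC in auto)
    qed
    moreover have "T + R \<in> GL"
    proof (rule bounded_inverse)
      fix x assume x: "(T + R) x = 0"
      \<comment> \<open>A nonzero coefficient would express \<open>c i\<close> through the range and
        the other elements of \<open>C\<close>, against the minimality of \<open>C\<close>.\<close>
      have fz: "f i x = 0" if i: "i \<le> p" for i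
      proof (rule ccontr)
        assume nz: "f i x \<noteq> 0"
        let ?D = "C - {c i}"
        let ?S = "span (?r \<union> ?D)"
        have "T x + (\<Sum>j\<le>p. f j x *\<^sub>R c j) = 0" using x by (simp add: blinfun.add_left R)
        then have "T x + (f i x *\<^sub>R c i + (\<Sum>j\<in>{..p}-{i}. f j x *\<^sub>R c j)) = 0"
          using i by (simp add: sum.remove)
        then have "f i x *\<^sub>R c i = - (T x + (\<Sum>j\<in>{..p}-{i}. f j x *\<^sub>R c j))"
          by (simp add: algebra_simps eq_neg_iff_add_eq_0)
        moreover have "c i = (1 / f i x) *\<^sub>R (f i x *\<^sub>R c i)" using nz by simp
        moreover have "T x + (\<Sum>j\<in>{..p}-{i}. f j x *\<^sub>R c j) \<in> ?S"
        proof (intro span_add span_sum span_scale span_base)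
          show "T x \<in> ?r \<union> ?D" by simp
          fix j assume "j \<in> {..p} - {i}"
          then have "c j \<in> C" "c j \<noteq> c i" using cC cinj i by (auto simp: inj_on_def)
          then show "c j \<in> ?r \<union> ?D" by simp
        qed
        ultimately have ci: "c i \<in> ?S" using span_scale span_neg by metis
        have "?r \<union> C \<subseteq> ?S" using ci span_superset [of "?r \<union> ?D"] by auto
        then have "UNIV \<subseteq> ?S" using C(3) span_minimal [OF _ subspace_span] by metis
        then have "card C \<le> card ?D" using C(1) by (intro min) auto
        moreover have "c i \<in> C" using cC i by auto
        ultimately show False using C(1) by (metis card_Diff1_less not_less)
      qed
      then have "R x = 0" by (simp add: R)
      then have "T x = 0" using x by (simp add: blinfun.add_left)
      then have "x \<in> span (b ` {..p})" using b(2) by (simp add: ker_op_def)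
      then have xc: "lin_comb b p (coords b p x) = x" by (rule lin_comb_coords [OF b(1)])
      have "coords b p x i = 0" if "i \<le> p" for i using f [OF that, of "coords b p x"] fz [OF that] xc by simp
      then have "lin_comb b p (coords b p x) = 0" by (simp add: lin_comb_def)
      then show "x = 0" using xc by simp
    next
      fix y
      have "y \<in> span (?r \<union> C)" using C(3) by simp
      then obtain w v where wv: "y = w + v" "w \<in> span ?r" "v \<in> span C" by (auto simp: span_Un)
      obtain u where u: "w = T u" using wv(2) sr by (auto simp: span_eq_iff [THEN iffD2])
      obtain t where t: "v = (\<Sum>i\<le>p. t i *\<^sub>R c i)"
      proof -
        obtain q where "v = (\<Sum>d\<in>C. q d *\<^sub>R d)" using wv(3) C(1) by (auto simp: span_finite)
        then have "v = (\<Sum>i\<le>p. q (c i) *\<^sub>R c i)" using cinj by (simp add: cC [symmetric] sum.reindex)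
        then show thesis by (rule that)
      qed
      define x where "x = u + lin_comb b p (\<lambda>i. t i - f i u)"
      have "T x = T u" by (simp add: x_def blinfun.add_right kerb)
      moreover have "f i x = t i" if "i \<le> p" for i using f [OF that] by (simp add: x_def blinfun.add_right)
      then have "R x = v" by (simp add: R t)
      ultimately show "\<exists>x. (T + R) x = y" using wv(1) u by (intro exI [of _ x]) (simp add: blinfun.add_left)
    qed
    ultimately show ?thesis using that by blast
  qed
qed

lemma finite_rank_zero: "finite_rank 0"
  by (auto simp: finite_rank_def intro!: exI [of _ "{}"])

lemma finite_rank_add:
  assumes "finite_rank A" "finite_rank B" shows "finite_rank (A + B)"
proof -
  obtain G H where GH: "finite G" "range (blinfun_apply A) \<subseteq> span G" "finite H" "range (blinfun_apply B) \<subseteq> span H"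
    using assms unfolding finite_rank_def by blast
  have sub: "span G \<subseteq> span (G \<union> H)" "span H \<subseteq> span (G \<union> H)" by (auto intro!: span_mono)
  have "range (blinfun_apply (A + B)) \<subseteq> span (G \<union> H)"
  proof (rule image_subsetI)
    fix x
    have "A x \<in> span (G \<union> H)" "B x \<in> span (G \<union> H)" using GH sub by blast+
    then show "(A + B) x \<in> span (G \<union> H)" by (simp add: blinfun.add_left span_add)
  qed
  then show ?thesis unfolding finite_rank_def using GH by blast
qed

lemma finite_rank_compose_left:
  assumes "finite_rank B" shows "finite_rank (T o\<^sub>L B)"
proof -
  obtain G where G: "finite G" "range (blinfun_apply B) \<subseteq> span G" using assms unfolding finite_rank_def by blast
  have "linear (blinfun_apply T)" by (simp add: blinfun.bounded_linear_right bounded_linear.linear)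
  then have "span (blinfun_apply T ` G) = blinfun_apply T ` span G" by (rule linear_span_image)
  then have "range (blinfun_apply (T o\<^sub>L B)) \<subseteq> span (blinfun_apply T ` G)" using G by auto
  then show ?thesis unfolding finite_rank_def using G(1) by blast
qed

lemma finite_rank_scaleR:
  assumes "finite_rank B" shows "finite_rank (c *\<^sub>R B)"
proof -
  obtain G where "finite G" "range (blinfun_apply B) \<subseteq> span G" using assms unfolding finite_rank_def by blast
  then show ?thesis unfolding finite_rank_def by (intro exI [of _ G]) (auto simp: blinfun.scaleR_left intro!: span_scale)
qed

lemma finite_rank_minus: "finite_rank B \<Longrightarrow> finite_rank (- B)"
  using finite_rank_scaleR [of B "-1"] by simp

lemma finite_rank_diff: "finite_rank A \<Longrightarrow> finite_rank B \<Longrightarrow> finite_rank (A - B)"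
  using finite_rank_add [of A "- B"] finite_rank_minus [of B] by simp

lemma finite_rank_sum: "(\<And>i. i \<in> I \<Longrightarrow> finite_rank (B i)) \<Longrightarrow> finite_rank (\<Sum>i\<in>I. B i)"
  by (induction I rule: infinite_finite_induct) (auto simp: finite_rank_zero finite_rank_add)

lemma compact_op_finite_rank:
  fixes B :: "'a::banach \<Rightarrow>\<^sub>L 'b::banach"
  assumes "finite_rank B" shows "compact_op B"
proof (rule compact_op_subset)
  fix S :: "'a set" assume "bounded S"
  obtain G where G: "finite G" "range (blinfun_apply B) \<subseteq> span G" using assms unfolding finite_rank_def by blast
  have "bounded (blinfun_apply B ` S)"
    using \<open>bounded S\<close> by (rule bounded_linear_image) (rule blinfun.bounded_linear_right)
  then obtain R where "\<forall>y\<in>blinfun_apply B ` S. norm y \<le> R" unfolding bounded_iff by blast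
  then have R: "blinfun_apply B ` S \<subseteq> cball 0 R" by auto
  show "\<exists>C. compact C \<and> blinfun_apply B ` S \<subseteq> C"
  proof (cases "span G = {0}")
    case True
    then show ?thesis using G(2) by (intro exI [of _ "{0}"]) auto
  next
    case False
    obtain b p where b: "basis_seq b p" "span (b ` {..p}) = span G" using basis_seq_of_span [OF G(1) False] by blast
    have "compact (span G \<inter> cball 0 R)"
      using closed_span_basis_seq [OF b(1)] b by (intro compact_in_span [OF b(1)]) auto
    then show ?thesis using G(2) R by blast
  qed
qed

text \<open>On \<open>U\<close> both \<open>T0 + R\<close> and \<open>T1 + R\<close> are invertible,
  so \<open>A\<close> can be multiplied by the transition operator between them; this turns a
  finite-rank deviation from \<open>T0\<close> into one from \<open>T1\<close>. Off \<open>C\<close>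
  the transition operator is the identity, so the two pieces of \<open>A'\<close> fit
  together.\<close>

lemma corrector_step:
  fixes T :: "'x::metric_space \<Rightarrow> ('a::banach \<Rightarrow>\<^sub>L 'b::banach)"
  assumes A: "continuous_on K A" "\<And>x. x \<in> K \<Longrightarrow> A x \<in> GL" "\<And>x. x \<in> K \<Longrightarrow> finite_rank (A x - T0 x)"
    and T0: "continuous_on K T0" and T1: "continuous_on K T1"
    and R: "finite_rank R" and U: "open U" and C: "closed C" "C \<subseteq> U"
    and GL: "\<And>x. x \<in> K \<inter> U \<Longrightarrow> T0 x + R \<in> GL" "\<And>x. x \<in> K \<inter> U \<Longrightarrow> T1 x + R \<in> GL"
    and eq: "\<And>x. x \<in> K - C \<Longrightarrow> T1 x = T0 x"
  shows "\<exists>A'. continuous_on K A' \<and> (\<forall>x\<in>K. A' x \<in> GL \<and> finite_rank (A' x - T1 x))"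
proof -
  define A' where "A' x = (if x \<in> U then ((T1 x + R) o\<^sub>L inv_op (T0 x + R)) o\<^sub>L A x else A x)" for x
  have AA: "A' x = A x" if x: "x \<in> K - C" for x
  proof (cases "x \<in> U")
    case True
    then have "(T1 x + R) o\<^sub>L inv_op (T0 x + R) = id_blinfun" using GL(1) eq x inv_op(2) by auto
    then show ?thesis using True by (auto simp: A'_def intro!: blinfun_eqI)
  qed (simp add: A'_def)
  have c1: "continuous_on (K \<inter> U) A'"
  proof (rule continuous_on_eq)
    have "continuous_on (K \<inter> U) (\<lambda>x. inv_op (T0 x + R))"
      by (rule continuous_on_compose2 [OF continuous_on_inv_op])
         (use GL in \<open>auto intro!: continuous_intros continuous_on_subset [OF T0]\<close>)
    then show "continuous_on (K \<inter> U) (\<lambda>x. ((T1 x + R) o\<^sub>L inv_op (T0 x + R)) o\<^sub>L A x)"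
      by (intro bounded_bilinear.continuous_on [OF bounded_bilinear_blinfun_compose] continuous_intros
          continuous_on_subset [OF T1] continuous_on_subset [OF A(1)]) auto
  qed (simp add: A'_def)
  have c2: "continuous_on (K - C) A'"
    by (rule continuous_on_eq [OF continuous_on_subset [OF A(1)]]) (auto simp: AA)
  have un: "(K \<inter> U) \<union> (K - C) = K" using C by blast
  have "continuous_on ((K \<inter> U) \<union> (K - C)) A'"
  proof (rule continuous_on_Un_local_open [OF _ _ c1 c2])
    show "openin (top_of_set ((K \<inter> U) \<union> (K - C))) (K \<inter> U)" unfolding un using U by (rule openin_open_Int)
    have "openin (top_of_set K) (K \<inter> (- C))" using C(1) by (intro openin_open_Int) auto
    then show "openin (top_of_set ((K \<inter> U) \<union> (K - C))) (K - C)" unfolding un by (simp add: Diff_eq)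
  qed
  then have "continuous_on K A'" unfolding un .
  moreover have "A' x \<in> GL \<and> finite_rank (A' x - T1 x)" if x: "x \<in> K" for x
  proof (cases "x \<in> U")
    case True
    then have G: "T0 x + R \<in> GL" "T1 x + R \<in> GL" using GL x by auto
    have "A' x \<in> GL" using True G A(2) [OF x] by (simp add: A'_def GL_compose inv_op_GL)
    moreover have "finite_rank (A' x - T1 x)"
    proof -
      define Q where "Q = (T1 x + R) o\<^sub>L inv_op (T0 x + R)"
      \<comment> \<open>Obtained by applying \<open>Q\<close> to
        \<open>A x = (T0 x + R) + ((A x - T0 x) - R)\<close>.\<close>
      have "A' x - T1 x = (Q o\<^sub>L ((A x - T0 x) - R)) + R"
      proof (rule blinfun_eqI)
        fix i
        define w where "w = (T0 x + R) i"
        have "Q w = (T1 x + R) i"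
          by (simp only: w_def Q_def blinfun_apply_blinfun_compose inv_op_apply(1) [OF G(1)])
        moreover have "((A x - T0 x) - R) i = A x i - w" by (simp add: w_def blinfun.diff_left blinfun.add_left)
        moreover have "A' x i = Q (A x i)" using True by (simp add: A'_def Q_def)
        ultimately show "(A' x - T1 x) i = ((Q o\<^sub>L ((A x - T0 x) - R)) + R) i"
          by (simp add: blinfun.diff_left [of "A' x"] blinfun.add_left blinfun.diff_right)
      qed
      then show ?thesis
        using A(3) [OF x] R by (simp add: finite_rank_add finite_rank_compose_left finite_rank_diff)
    qed
    ultimately show ?thesis ..
  next
    case False
    then have "A' x = A x" "T1 x = T0 x" using eq [of x] x C by (auto simp: A'_def)
    then show ?thesis using A x by simp
  qed
  ultimately show ?thesis by blast
qed

text \<open>The cone over \<open>K\<close> is contractible: correctors are transported along \<open>T (s *\<^sub>R x)\<close> from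
  \<open>s = 0\<close>, where a constant one works, to \<open>s = 1\<close>, raising the height \<open>s\<close> on one small piece of
  \<open>K\<close> at a time.\<close>

lemma global_corrector:
  fixes T :: "'x::real_normed_vector \<Rightarrow> ('a::banach \<Rightarrow>\<^sub>L 'b::banach)"
  assumes T: "continuous_on UNIV T" "\<And>x. T x \<in> Fredholm0" and K: "compact K"
  obtains A where "continuous_on K A" "\<And>x. x \<in> K \<Longrightarrow> A x \<in> GL" "\<And>x. x \<in> K \<Longrightarrow> finite_rank (A x - T x)"
proof -
  define X where "X = (\<lambda>z. fst z *\<^sub>R snd z) ` ({0..1::real} \<times> K)"
  have X: "compact X"
    unfolding X_def by (intro compact_continuous_image continuous_intros compact_Times K compact_Icc)
  define \<G> where "\<G> = {{y. T y + R \<in> GL} | R. finite_rank R}"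
  have cov: "X \<subseteq> \<Union>\<G>"
  proof
    fix x
    obtain R where "finite_rank R" "T x + R \<in> GL" using fredholm0_corrector [OF T(2)] by blast
    then show "x \<in> \<Union>\<G>" by (auto simp: \<G>_def)
  qed
  have op: "open G" if "G \<in> \<G>" for G
  proof -
    obtain R where G: "G = (\<lambda>y. T y + R) -` GL" using \<open>G \<in> \<G>\<close> by (auto simp: \<G>_def)
    show ?thesis unfolding G by (rule open_vimage [OF open_GL]) (intro continuous_intros T(1))
  qed
  obtain e where e: "e > 0" "\<And>x. x \<in> X \<Longrightarrow> \<exists>G\<in>\<G>. ball x e \<subseteq> G"
    using Heine_Borel_lemma [OF X cov op] by blast
  \<comment> \<open>A Lebesgue number: around each point of the cone a single finite-rank operator
    corrects \<open>T\<close> on the whole ball of radius \<open>e\<close>.\<close>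
  have near: "\<exists>R. finite_rank R \<and> (\<forall>y. dist x y < e \<longrightarrow> T y + R \<in> GL)" if "x \<in> X" for x
    using e(2) [OF that] unfolding \<G>_def by (fastforce simp: subset_iff)
  obtain M where M: "0 < M" "\<And>x. x \<in> K \<Longrightarrow> norm x \<le> M"
    using compact_imp_bounded [OF K] by (auto simp: bounded_pos)
  \<comment> \<open>With \<open>m\<close> levels, raising a point by one level moves it by less than
    \<open>e / 2\<close>; the other half of \<open>e\<close> is reserved for the size of the pieces
    of \<open>K\<close>.\<close>
  obtain m where m: "0 < m" "M / real m < e / 2"
  proof -
    obtain n where "M / (e / 2) < real n" using reals_Archimedean2 by blast
    then have "M / real (Suc n) < e / 2" using e(1) M(1) by (simp add: field_simps)
    then show thesis by (intro that [of "Suc n"]) auto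
  qed
  obtain J where J: "J \<subseteq> K" "finite J" "K \<subseteq> (\<Union>c\<in>J. ball c (e / 4))"
  proof -
    have "K \<subseteq> (\<Union>c\<in>K. ball c (e / 4))" using e(1) by force
    then show thesis by (rule compactE_image [OF K, rotated]) (auto intro: that)
  qed
  obtain cs where cs: "set cs = J" using finite_list [OF J(2)] by blast
  define q where "q = length cs"
  define w where "w j x = max 0 (e / 4 - dist x (cs ! j))" for j x
  define \<Psi> where "\<Psi> x = (\<Sum>j<q. w j x)" for x
  have w0: "0 \<le> w j x" for j x by (simp add: w_def)
  have \<Psi>: "0 < \<Psi> x" if x: "x \<in> K" for x
  proof -
    obtain c where "c \<in> J" "dist x c < e / 4" using J(3) x by (auto simp: dist_commute)
    then obtain j where "j < q" "0 < w j x" using cs by (auto simp: q_def w_def in_set_conv_nth)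
    then show ?thesis unfolding \<Psi>_def by (intro sum_pos2 [of _ j]) (auto simp: w0)
  qed
  \<comment> \<open>Partial sums of a partition of unity: passing from \<open>\<sigma> j\<close> to
    \<open>\<sigma> (Suc j)\<close> changes the height only near the \<open>j\<close>-th centre, and
    \<open>\<sigma> q = 1\<close> on \<open>K\<close> completes a level.\<close>
  define \<sigma> where "\<sigma> j x = (\<Sum>l<j. w l x) / \<Psi> x" for j x
  have \<sigma>: "0 \<le> \<sigma> j x" "\<sigma> j x \<le> 1" if "x \<in> K" "j \<le> q" for j x
  proof -
    have "(\<Sum>l<j. w l x) \<le> \<Psi> x" unfolding \<Psi>_def using that(2) w0 by (intro sum_mono2) auto
    then show "0 \<le> \<sigma> j x" "\<sigma> j x \<le> 1" using \<Psi> [OF that(1)] w0 by (auto simp: \<sigma>_def sum_nonneg)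
  qed
  define \<tau> where "\<tau> i j x = (real i + \<sigma> j x) / real m" for i j x
  define Pr where "Pr t \<longleftrightarrow> (\<exists>A. continuous_on K A \<and> (\<forall>x\<in>K. A x \<in> GL \<and> finite_rank (A x - T (t x *\<^sub>R x))))"
    for t :: "'x \<Rightarrow> real"
  have contT: "continuous_on K (\<lambda>x. T (\<tau> i j x *\<^sub>R x))" for i j
  proof (rule continuous_on_compose2 [OF T(1)])
    have "continuous_on K \<Psi>" "continuous_on K (\<lambda>x. \<Sum>l<j. w l x)"
      unfolding \<Psi>_def w_def by (intro continuous_intros)+
    then have "continuous_on K (\<sigma> j)"
      unfolding \<sigma>_def using \<Psi> by (intro continuous_on_divide) (auto simp: less_imp_neq [symmetric])
    then show "continuous_on K (\<lambda>x. \<tau> i j x *\<^sub>R x)" unfolding \<tau>_def using m by (intro continuous_intros) auto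
  qed simp
  have step: "Pr (\<tau> i (Suc j))" if pr: "Pr (\<tau> i j)" and im': "i < m" and jq: "j < q" for i j
  proof -
    obtain A where A: "continuous_on K A" "\<And>x. x \<in> K \<Longrightarrow> A x \<in> GL" "\<And>x. x \<in> K \<Longrightarrow> finite_rank (A x - T (\<tau> i j x *\<^sub>R x))"
      using pr unfolding Pr_def by blast
    let ?c = "cs ! j"
    have cK: "?c \<in> K" using J(1) cs jq by (auto simp: q_def)
    have im: "real i / real m \<in> {0..1}" using im' m by auto
    then have "(real i / real m) *\<^sub>R ?c \<in> X" unfolding X_def using cK by (intro image_eqI [of _ _ "(real i / real m, ?c)"]) auto
    then obtain R where R: "finite_rank R" "\<And>y. dist ((real i / real m) *\<^sub>R ?c) y < e \<Longrightarrow> T y + R \<in> GL"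
      using near by blast
    have GL: "T (\<tau> i j' x *\<^sub>R x) + R \<in> GL" if x: "x \<in> K \<inter> ball ?c (e / 2)" and j': "j' \<le> q" for x j'
    proof (rule R(2))
      have "(real i / real m) *\<^sub>R ?c - \<tau> i j' x *\<^sub>R x = (real i / real m) *\<^sub>R (?c - x) + (- \<sigma> j' x / real m) *\<^sub>R x"
        by (simp add: \<tau>_def scaleR_right_diff_distrib add_divide_distrib scaleR_left_distrib)
      then have "dist ((real i / real m) *\<^sub>R ?c) (\<tau> i j' x *\<^sub>R x) \<le> norm ((real i / real m) *\<^sub>R (?c - x)) + norm ((- \<sigma> j' x / real m) *\<^sub>R x)"
        unfolding dist_norm by (metis norm_triangle_ineq)
      also have "norm ((real i / real m) *\<^sub>R (?c - x)) \<le> 1 * norm (?c - x)"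
        using im unfolding norm_scaleR by (intro mult_right_mono) auto
      also have "\<dots> < e / 2" using x by (simp add: dist_norm)
      also have "norm ((- \<sigma> j' x / real m) *\<^sub>R x) \<le> (1 / real m) * M"
        using \<sigma> [of x j'] M(2) [of x] x j' m unfolding norm_scaleR by (intro mult_mono) (auto simp: divide_right_mono)
      also have "\<dots> < e / 2" using m by simp
      finally show "dist ((real i / real m) *\<^sub>R ?c) (\<tau> i j' x *\<^sub>R x) < e" by simp
    qed
    show ?thesis
      unfolding Pr_def
    proof (rule corrector_step [OF A contT contT R(1), of "ball ?c (e / 2)" "cball ?c (e / 4)"])
      fix x assume x: "x \<in> K - cball ?c (e / 4)"
      then have "w j x = 0" by (simp add: w_def dist_commute)
      then have "\<tau> i (Suc j) x = \<tau> i j x" by (simp add: \<tau>_def \<sigma>_def)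
      then show "T (\<tau> i (Suc j) x *\<^sub>R x) = T (\<tau> i j x *\<^sub>R x)" by simp
    qed (use GL jq e(1) in auto)
  qed
  have cong: "Pr t'" if "Pr t" "\<And>x. x \<in> K \<Longrightarrow> t x = t' x" for t t'
    using that unfolding Pr_def by (metis (no_types, lifting))
  have "Pr (\<tau> 0 0)"
  proof -
    obtain R where "finite_rank R" "T 0 + R \<in> GL" using fredholm0_corrector [OF T(2)] by blast
    then have "Pr (\<lambda>_. 0)" unfolding Pr_def by (intro exI [of _ "\<lambda>_. T 0 + R"]) auto
    then show ?thesis by (rule cong) (simp add: \<tau>_def \<sigma>_def)
  qed
  have "Pr (\<tau> i 0)" if "i \<le> m" for i
    using that
  proof (induction i)
    case (Suc i)
    have "Pr (\<tau> i j)" if "j \<le> q" for j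
      using that
    proof (induction j)
      case 0
      show ?case using Suc by simp
    next
      case (Suc j)
      then show ?case using step \<open>Suc i \<le> m\<close> by simp
    qed
    then have "Pr (\<tau> i q)" by simp
    moreover have "\<tau> i q x = \<tau> (Suc i) 0 x" if "x \<in> K" for x
      using \<Psi> [OF that] by (simp add: \<tau>_def \<sigma>_def flip: \<Psi>_def)
    ultimately show ?case by (rule cong)
  qed (use \<open>Pr (\<tau> 0 0)\<close> in simp)
  from this [of m] have "Pr (\<lambda>_. 1)" by (rule cong [OF _]) (use m in \<open>auto simp: \<tau>_def \<sigma>_def\<close>)
  then show ?thesis unfolding Pr_def using that by auto
qed

text \<open>The correction must be continuous off \<open>K\<close> as well and use finitely many
  fixed operators, since compactness will be drawn from these. The family \<open>A - T\<close> is
  therefore replaced by an interpolation between finitely many of its values, so fine that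
  invertibility survives on \<open>K\<close>.\<close>

lemma global_corrector_sum:
  fixes T :: "'x::real_normed_vector \<Rightarrow> ('a::banach \<Rightarrow>\<^sub>L 'b::banach)"
  assumes T: "continuous_on UNIV T" "\<And>x. T x \<in> Fredholm0" and K: "compact K"
  obtains n :: nat and \<psi> :: "nat \<Rightarrow> 'x \<Rightarrow> real" and B :: "nat \<Rightarrow> ('a \<Rightarrow>\<^sub>L 'b)"
  where "\<And>j. continuous_on UNIV (\<psi> j)" "\<And>j. finite_rank (B j)"
    "\<And>j x. 0 \<le> \<psi> j x \<and> \<psi> j x \<le> 1"
    "\<And>x. x \<in> K \<Longrightarrow> T x + (\<Sum>j<n. \<psi> j x *\<^sub>R B j) \<in> GL"
proof -
  obtain A where A: "continuous_on K A" "\<And>x. x \<in> K \<Longrightarrow> A x \<in> GL" "\<And>x. x \<in> K \<Longrightarrow> finite_rank (A x - T x)"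
    using global_corrector [OF T K] by blast
  define D where "D x = A x - T x" for x
  have D: "continuous_on K D" unfolding D_def by (intro continuous_intros A(1) continuous_on_subset [OF T(1)]) auto
  have "compact ((\<lambda>x. inv_op (A x)) ` K)"
    by (rule compact_continuous_image [OF continuous_on_compose2 [OF continuous_on_inv_op A(1)] K]) (use A(2) in auto)
  then obtain M where M: "0 < M" "\<And>x. x \<in> K \<Longrightarrow> norm (inv_op (A x)) \<le> M"
    using compact_imp_bounded bounded_pos by (metis image_eqI)
  have lb: "1 / M * norm v \<le> norm (A x v)" if "x \<in> K" for x v
  proof -
    have "norm v = norm (inv_op (A x) (A x v))" using A(2) [OF that] by simp
    also have "\<dots> \<le> norm (inv_op (A x)) * norm (A x v)" by (rule norm_blinfun)
    also have "\<dots> \<le> M * norm (A x v)" using M(2) [OF that] by (intro mult_right_mono) auto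
    finally show ?thesis using M(1) by (simp add: field_simps)
  qed
  have "uniformly_continuous_on K D" using D K by (rule compact_uniformly_continuous)
  then obtain \<delta> where \<delta>: "0 < \<delta>" "\<And>x y. x \<in> K \<Longrightarrow> y \<in> K \<Longrightarrow> dist y x < \<delta> \<Longrightarrow> dist (D y) (D x) < 1 / M"
    unfolding uniformly_continuous_on_def using M(1) by (metis zero_less_divide_1_iff)
  obtain J where J: "J \<subseteq> K" "finite J" "K \<subseteq> (\<Union>c\<in>J. ball c \<delta>)"
  proof -
    have "K \<subseteq> (\<Union>c\<in>K. ball c \<delta>)" using \<delta>(1) by force
    then show thesis by (rule compactE_image [OF K, rotated]) (auto intro: that)
  qed
  obtain cs where cs: "set cs = J" using finite_list [OF J(2)] by blast
  define n where "n = length cs"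
  have csK: "cs ! j \<in> K" if "j < n" for j using J(1) cs that by (auto simp: n_def)
  define w where "w j x = max 0 (\<delta> - dist x (cs ! j))" for j x
  define \<Psi> where "\<Psi> x = (\<Sum>j<n. w j x)" for x
  have w0: "0 \<le> w j x" for j x by (simp add: w_def)
  have cont\<Psi>: "continuous_on UNIV \<Psi>" and contw: "continuous_on UNIV (w j)" for j
    unfolding \<Psi>_def w_def by (auto intro!: continuous_intros)
  have \<Psi>: "0 < \<Psi> x" if x: "x \<in> K" for x
  proof -
    obtain c where "c \<in> J" "dist x c < \<delta>" using J(3) x by (auto simp: dist_commute)
    then obtain j where "j < n" "0 < w j x" using cs by (auto simp: n_def w_def in_set_conv_nth)
    then show ?thesis unfolding \<Psi>_def by (intro sum_pos2 [of _ j]) (auto simp: w0)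
  qed
  \<comment> \<open>Off \<open>K\<close> the sum \<open>\<Psi>\<close> may vanish. A positive lower
    bound on \<open>K\<close> serves as a floor for the denominator and leaves the weights on
    \<open>K\<close> unchanged.\<close>
  obtain \<kappa> where \<kappa>: "0 < \<kappa>" "\<And>x. x \<in> K \<Longrightarrow> \<kappa> \<le> \<Psi> x"
  proof (cases "K = {}")
    case True
    then show ?thesis using that [of 1] by simp
  next
    case False
    obtain x where "x \<in> K" "\<And>y. y \<in> K \<Longrightarrow> \<Psi> x \<le> \<Psi> y"
      using continuous_attains_inf [OF K False continuous_on_subset [OF cont\<Psi>]] by blast
    then show ?thesis using that [of "\<Psi> x"] \<Psi> by blast
  qed
  define \<psi> where "\<psi> j x = (if j < n then w j x / max \<kappa> (\<Psi> x) else 0)" for j x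
  have m0: "0 < max \<kappa> (\<Psi> x)" for x using \<kappa>(1) by simp
  have "continuous_on UNIV (\<psi> j)" for j
  proof (cases "j < n")
    case True
    have "max \<kappa> (\<Psi> x) \<noteq> 0" for x using m0 [of x] by simp
    then show ?thesis unfolding \<psi>_def using True by (auto intro!: continuous_intros contw cont\<Psi>)
  qed (simp add: \<psi>_def)
  moreover have "0 \<le> \<psi> j x \<and> \<psi> j x \<le> 1" for j x
  proof (cases "j < n")
    case True
    have "w j x \<le> \<Psi> x" unfolding \<Psi>_def using True w0 by (intro member_le_sum) auto
    then show ?thesis using True w0 m0 [of x] by (simp add: \<psi>_def divide_le_eq)
  qed (simp add: \<psi>_def)
  moreover define B where "B j = (if j < n then D (cs ! j) else 0)" for j
  have "finite_rank (B j)" for j using A(3) csK by (auto simp: B_def D_def finite_rank_zero)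
  moreover have "T x + (\<Sum>j<n. \<psi> j x *\<^sub>R B j) \<in> GL" if x: "x \<in> K" for x
  proof -
    have mx: "max \<kappa> (\<Psi> x) = \<Psi> x" using \<kappa>(2) [OF x] by simp
    have s1: "(\<Sum>j<n. \<psi> j x) = 1"
      using \<Psi> [OF x] by (simp add: \<psi>_def mx flip: sum_divide_distrib \<Psi>_def)
    have "(T x + (\<Sum>j<n. \<psi> j x *\<^sub>R B j)) - A x = (\<Sum>j<n. \<psi> j x *\<^sub>R B j) - (\<Sum>j<n. \<psi> j x) *\<^sub>R D x"
      unfolding s1 by (simp add: D_def)
    also have "\<dots> = (\<Sum>j<n. \<psi> j x *\<^sub>R (B j - D x))"
      by (simp add: scaleR_left.sum sum_subtractf scaleR_right_diff_distrib)
    finally have eq: "(T x + (\<Sum>j<n. \<psi> j x *\<^sub>R B j)) - A x = (\<Sum>j<n. \<psi> j x *\<^sub>R (B j - D x))" .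
    have p0: "0 \<le> \<psi> j x" for j using w0 m0 [of x] by (simp add: \<psi>_def)
    have each: "\<psi> j x * norm (B j - D x) \<le> \<psi> j x * (1 / M)" if "j < n" for j
    proof (cases "\<psi> j x = 0")
      case False
      then have "dist x (cs ! j) < \<delta>" using that by (auto simp: \<psi>_def w_def max_def split: if_splits)
      then have "dist (D (cs ! j)) (D x) < 1 / M" using \<delta>(2) [OF x csK [OF that]] by (simp add: dist_commute)
      then show ?thesis using p0 that by (intro mult_left_mono) (auto simp: B_def dist_norm)
    qed simp
    have "norm (\<Sum>j<n. \<psi> j x *\<^sub>R (B j - D x)) \<le> (\<Sum>j<n. \<psi> j x * norm (B j - D x))"
      using p0 by (intro order_trans [OF norm_sum]) (simp add: sum_mono)
    also have "\<dots> < (\<Sum>j<n. \<psi> j x * (1 / M))"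
    proof (rule sum_strict_mono_ex1)
      obtain j where j: "j < n" "\<psi> j x \<noteq> 0" using s1 by (metis lessThan_iff sum.neutral zero_neq_one)
      then have "dist x (cs ! j) < \<delta>" by (auto simp: \<psi>_def w_def max_def split: if_splits)
      then have "dist (D (cs ! j)) (D x) < 1 / M" using \<delta>(2) [OF x csK [OF j(1)]] by (simp add: dist_commute)
      then have "\<psi> j x * norm (B j - D x) < \<psi> j x * (1 / M)"
        using p0 [of j] j by (intro mult_strict_left_mono) (auto simp: B_def dist_norm)
      then show "\<exists>j\<in>{..<n}. \<psi> j x * norm (B j - D x) < \<psi> j x * (1 / M)" using j by blast
    qed (use each in auto)
    also have "\<dots> = 1 / M" by (simp add: s1 flip: sum_divide_distrib)
    finally have "norm ((T x + (\<Sum>j<n. \<psi> j x *\<^sub>R B j)) - A x) < 1 / M" unfolding eq .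
    then show ?thesis using M(1) by (intro GL_perturb(1) [OF A(2) [OF x] _ lb [OF x]]) auto
  qed
  ultimately show ?thesis using that by blast
qed

subsection \<open>A combinatorial degree on grids\<close>

definition grid_pt :: "(nat \<Rightarrow> 'a::real_vector) \<Rightarrow> nat \<Rightarrow> nat \<Rightarrow> (nat \<Rightarrow> int) \<Rightarrow> 'a" where
  "grid_pt b p m z = lin_comb b p (\<lambda>i. real_of_int (z i) / real m)"

text \<open>Zero counts as nonnegative. The label records an orthant, so where a coordinate of
  \<open>q\<close> keeps its sign, that label coordinate is constant.\<close>

definition grid_label :: "(nat \<Rightarrow> 'a::real_vector) \<Rightarrow> nat \<Rightarrow> nat \<Rightarrow> ('a \<Rightarrow> 'a) \<Rightarrow> (nat \<Rightarrow> int) \<Rightarrow> nat \<Rightarrow> int" where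
  "grid_label b p m q z i = (if 0 \<le> coords b p (q (grid_pt b p m z)) i then 1 else 0)"

definition grid_set :: "(nat \<Rightarrow> 'a::real_vector) \<Rightarrow> nat \<Rightarrow> nat \<Rightarrow> 'a set \<Rightarrow> (nat \<Rightarrow> int) set" where
  "grid_set b p m S = {z \<in> int_lattice (Suc p). grid_pt b p m z \<in> S}"

text \<open>For fine grids this is the Brouwer degree at \<open>0\<close> of \<open>q\<close> on \<open>S \<inter> span (b ` {..p})\<close>.\<close>

definition grid_degree :: "(nat \<Rightarrow> 'a::real_vector) \<Rightarrow> nat \<Rightarrow> nat \<Rightarrow> ('a \<Rightarrow> 'a) \<Rightarrow> 'a set \<Rightarrow> int" where
  "grid_degree b p m q S = lattice_degree (Suc p) (grid_label b p m q) (grid_set b p m S)"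

lemma finite_grid_set:
  fixes b :: "nat \<Rightarrow> 'a::banach"
  assumes b: "basis_seq b p" and S: "bounded S" and m: "0 < m"
  shows "finite (grid_set b p m S)"
proof -
  obtain c where c: "c > 0" "\<And>x i. i \<le> p \<Longrightarrow> \<bar>x i\<bar> \<le> c * norm (lin_comb b p x)"
    using coords_bound [OF b] by blast
  obtain R where R: "\<And>v. v \<in> S \<Longrightarrow> norm v \<le> R" using S by (auto simp: bounded_iff)
  have "grid_set b p m S \<subseteq> {z \<in> int_lattice (Suc p). \<forall>i<Suc p. \<bar>z i\<bar> \<le> \<lceil>real m * (c * R)\<rceil>}"
  proof
    fix z assume z: "z \<in> grid_set b p m S"
    have "\<bar>z i\<bar> \<le> \<lceil>real m * (c * R)\<rceil>" if "i < Suc p" for i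
    proof -
      have "\<bar>real_of_int (z i) / real m\<bar> \<le> c * norm (grid_pt b p m z)"
        unfolding grid_pt_def using c(2) [of i "\<lambda>i. real_of_int (z i) / real m"] that by simp
      also have "\<dots> \<le> c * R" using R z c(1) by (intro mult_left_mono) (auto simp: grid_set_def)
      finally have "\<bar>real_of_int (z i)\<bar> \<le> real m * (c * R)" using m by (simp add: abs_divide field_simps)
      then have "real_of_int \<bar>z i\<bar> \<le> real m * (c * R)" by simp
      then show ?thesis by linarith
    qed
    then show "z \<in> {z \<in> int_lattice (Suc p). \<forall>i<Suc p. \<bar>z i\<bar> \<le> \<lceil>real m * (c * R)\<rceil>}"
      using z by (auto simp: grid_set_def)
  qed
  then show ?thesis using finite_lattice_box finite_subset by blast
qed

text \<open>Each simplex is attributed to its first vertex, so additivity is exact for every mesh,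
  even if simplices meet both sets.\<close>

lemma grid_degree_Un:
  fixes b :: "nat \<Rightarrow> 'a::banach"
  assumes b: "basis_seq b p" and "bounded S" "bounded S'" "0 < m" "S \<inter> S' = {}"
  shows "grid_degree b p m q (S \<union> S') = grid_degree b p m q S + grid_degree b p m q S'"
proof -
  have "grid_set b p m (S \<union> S') = grid_set b p m S \<union> grid_set b p m S'"
    "grid_set b p m S \<inter> grid_set b p m S' = {}" using assms(5) by (auto simp: grid_set_def)
  then have "sum g (grid_set b p m (S \<union> S')) = sum g (grid_set b p m S) + sum g (grid_set b p m S')"
    for g :: "_ \<Rightarrow> int"
    using sum.union_disjoint [OF finite_grid_set [OF b assms(2,4)] finite_grid_set [OF b assms(3,4)]] by simp
  then show ?thesis unfolding grid_degree_def lattice_degree_def by blast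
qed

lemma grid_degree_empty: "grid_degree b p m q {} = 0"
  by (simp add: grid_degree_def lattice_degree_def grid_set_def)

lemma grid_pt_kuhn_dist:
  fixes b :: "nat \<Rightarrow> 'a::real_normed_vector"
  shows "norm (grid_pt b p m (kuhn_vertex z \<pi> k) - grid_pt b p m z) \<le> (\<Sum>i\<le>p. norm (b i)) / real m"
proof -
  have "grid_pt b p m (kuhn_vertex z \<pi> k) - grid_pt b p m z =
      (\<Sum>i\<le>p. ((if \<exists>j<k. \<pi> j = i then 1 else 0) / real m) *\<^sub>R b i)"
    unfolding grid_pt_def lin_comb_diff [symmetric] unfolding lin_comb_def
    by (intro sum.cong) (auto simp: kuhn_vertex_def add_divide_distrib)
  also have "norm \<dots> \<le> (\<Sum>i\<le>p. norm (((if \<exists>j<k. \<pi> j = i then 1 else 0) / real m) *\<^sub>R b i))"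
    by (rule norm_sum)
  also have "\<dots> \<le> (\<Sum>i\<le>p. norm (b i) / real m)" by (intro sum_mono) auto
  finally show ?thesis by (simp add: sum_divide_distrib)
qed

text \<open>The two levels of a slab carry two nearby parameter values. A simplex cut by
  \<open>\<Theta>\<close> is close to the frontier, where some coordinate of \<open>q\<close> keeps
  its sign. Only the behaviour at the frontier enters, which is why continuity is asked for there
  and the domain may vary with the parameter.\<close>

lemma grid_degree_homotopy:
  fixes b :: "nat \<Rightarrow> 'a::banach" and \<Theta> :: "(real \<times> 'a) set"
  assumes b: "basis_seq b p" and ts: "s \<le> t" and bdd: "bounded \<Theta>"
  defines "D \<equiv> {s..t} \<times> span (b ` {..p})"
  assumes into: "\<And>\<theta>. \<theta> \<in> D \<Longrightarrow> q \<theta> \<in> span (b ` {..p})"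
    and cont: "\<And>\<theta>. \<theta> \<in> frontier \<Theta> \<inter> D \<Longrightarrow> continuous (at \<theta> within D) q"
    and nz: "\<And>\<theta>. \<theta> \<in> frontier \<Theta> \<inter> D \<Longrightarrow> q \<theta> \<noteq> 0"
  shows "\<forall>\<^sub>F m in sequentially.
     grid_degree b p m (\<lambda>x. q (s, x)) {x. (s, x) \<in> \<Theta>} = grid_degree b p m (\<lambda>x. q (t, x)) {x. (t, x) \<in> \<Theta>}"
proof -
  let ?E = "span (b ` {..p})"
  have Ecl: "closed ?E" by (rule closed_span_basis_seq [OF b])
  have D: "closed D" "convex D"
    unfolding D_def
    by (intro closed_Times Ecl closed_atLeastAtMost convex_Times convex_real_interval
        subspace_imp_convex subspace_span)+
  obtain R where R: "\<And>\<theta>. \<theta> \<in> \<Theta> \<Longrightarrow> norm \<theta> \<le> R" using bdd by (auto simp: bounded_iff)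
  have "compact (frontier \<Theta> \<inter> D)"
  proof -
    have "compact ({s..t} \<times> (?E \<inter> cball 0 R))"
      by (intro compact_Times compact_Icc compact_in_span [OF b]) (auto intro: closed_Int Ecl)
    moreover have "frontier \<Theta> \<inter> D \<subseteq> {s..t} \<times> (?E \<inter> cball 0 R)"
    proof
      fix \<theta> assume th: "\<theta> \<in> frontier \<Theta> \<inter> D"
      have "\<Theta> \<subseteq> cball 0 R" using R by auto
      then have "closure \<Theta> \<subseteq> cball 0 R" by (simp add: closure_minimal)
      then have "norm \<theta> \<le> R" using th by (auto simp: frontier_def)
      then have "norm (snd \<theta>) \<le> R" using norm_snd_le [of "snd \<theta>" "fst \<theta>"] by simp
      then show "\<theta> \<in> {s..t} \<times> (?E \<inter> cball 0 R)" using th by (auto simp: D_def)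
    qed
    moreover have "closed (frontier \<Theta> \<inter> D)" using D by auto
    ultimately show ?thesis by (metis compact_Int_closed inf.absorb_iff2)
  qed
  note comp = this
  let ?lab = "\<lambda>\<theta> i. if 0 \<le> coords b p (q \<theta>) i then 1 else 0 :: int"
  \<comment> \<open>A nonzero coordinate at a frontier point keeps its sign nearby; compactness of
    the frontier over the interval then yields one radius \<open>d\<close>.\<close>
  have "\<exists>e>0. \<exists>i\<le>p. \<exists>l. \<forall>\<theta>\<in>D. dist \<theta> \<theta>\<^sub>0 < e \<longrightarrow> ?lab \<theta> i = l" if th: "\<theta>\<^sub>0 \<in> frontier \<Theta> \<inter> D" for \<theta>\<^sub>0
  proof -
    have thD: "\<theta>\<^sub>0 \<in> D" using th by simp
    obtain i where i: "i \<le> p" "coords b p (q \<theta>\<^sub>0) i \<noteq> 0"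
      using coords_nonzero [OF b into [OF thD] nz [OF th]] by blast
    have "q ` D \<subseteq> ?E" using into by blast
    then have "continuous (at (q \<theta>\<^sub>0) within q ` D) (\<lambda>v. coords b p v i)"
      using continuous_on_subset [OF continuous_on_coords [OF b, of i]] thD
      by (simp add: continuous_on_eq_continuous_within)
    then have "continuous (at \<theta>\<^sub>0 within D) (\<lambda>\<theta>. coords b p (q \<theta>) i)"
      by (rule continuous_within_compose2 [OF cont [OF th]])
    then obtain e where e: "0 < e" "\<And>\<theta>. \<theta> \<in> D \<Longrightarrow> dist \<theta> \<theta>\<^sub>0 < e \<Longrightarrow>
        dist (coords b p (q \<theta>) i) (coords b p (q \<theta>\<^sub>0) i) < \<bar>coords b p (q \<theta>\<^sub>0) i\<bar>"
      unfolding continuous_within_eps_delta using i(2) by (metis zero_less_abs_iff)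
    have "?lab \<theta> i = ?lab \<theta>\<^sub>0 i" if "\<theta> \<in> D" "dist \<theta> \<theta>\<^sub>0 < e" for \<theta>
      using e(2) [OF that] by (auto simp: dist_real_def)
    then show ?thesis using e(1) i(1) by blast
  qed
  then obtain ee where ee: "\<And>\<theta>\<^sub>0. \<theta>\<^sub>0 \<in> frontier \<Theta> \<inter> D \<Longrightarrow> ee \<theta>\<^sub>0 > 0 \<and> (\<exists>i\<le>p. \<exists>l. \<forall>\<theta>\<in>D. dist \<theta> \<theta>\<^sub>0 < ee \<theta>\<^sub>0 \<longrightarrow> ?lab \<theta> i = l)"
    by metis
  have cov: "frontier \<Theta> \<inter> D \<subseteq> \<Union>((\<lambda>\<theta>. ball \<theta> (ee \<theta>)) ` (frontier \<Theta> \<inter> D))"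
  proof
    fix \<theta> assume th: "\<theta> \<in> frontier \<Theta> \<inter> D"
    then have "\<theta> \<in> ball \<theta> (ee \<theta>)" using ee [OF th] by simp
    then show "\<theta> \<in> \<Union>((\<lambda>\<theta>. ball \<theta> (ee \<theta>)) ` (frontier \<Theta> \<inter> D))" using th by blast
  qed
  have op: "open G" if "G \<in> (\<lambda>\<theta>. ball \<theta> (ee \<theta>)) ` (frontier \<Theta> \<inter> D)" for G
    using that by auto
  obtain d where d: "0 < d" "\<And>\<theta>. \<theta> \<in> frontier \<Theta> \<inter> D \<Longrightarrow> \<exists>G\<in>(\<lambda>\<theta>. ball \<theta> (ee \<theta>)) ` (frontier \<Theta> \<inter> D). ball \<theta> d \<subseteq> G"
    using Heine_Borel_lemma [OF comp cov op] by blast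
  have lab: "\<exists>i\<le>p. \<exists>l. \<forall>\<theta>\<in>D. dist \<theta> \<theta>\<^sub>0 < d \<longrightarrow> ?lab \<theta> i = l" if th: "\<theta>\<^sub>0 \<in> frontier \<Theta> \<inter> D" for \<theta>\<^sub>0
  proof -
    obtain \<theta>\<^sub>1 where "\<theta>\<^sub>1 \<in> frontier \<Theta> \<inter> D" and sub: "ball \<theta>\<^sub>0 d \<subseteq> ball \<theta>\<^sub>1 (ee \<theta>\<^sub>1)" using d(2) [OF th] by blast
    then obtain i l where i: "i \<le> p" "\<And>\<theta>. \<theta> \<in> D \<Longrightarrow> dist \<theta> \<theta>\<^sub>1 < ee \<theta>\<^sub>1 \<Longrightarrow> ?lab \<theta> i = l" using ee by metis
    have "dist \<theta> \<theta>\<^sub>1 < ee \<theta>\<^sub>1" if "dist \<theta> \<theta>\<^sub>0 < d" for \<theta> using sub that by (metis dist_commute mem_ball subsetD)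
    then show ?thesis using i(2) by (intro exI [of _ i] conjI i(1) exI [of _ l]) auto
  qed
  define B where "B = (\<Sum>i\<le>p. norm (b i))"
  have B: "0 \<le> B" by (simp add: B_def sum_nonneg)
  \<comment> \<open>With eighths, two vertices of a simplex differ by less than \<open>d / 4\<close>
    in space and \<open>d / 8\<close> in the parameter, hence by less than \<open>d / 2\<close>; all
    vertices are then within \<open>d\<close> of a frontier point on the segment between a vertex
    inside and one outside.\<close>
  have step: "grid_degree b p m (\<lambda>x. q (u, x)) {x. (u, x) \<in> \<Theta>} = grid_degree b p m (\<lambda>x. q (u', x)) {x. (u', x) \<in> \<Theta>}"
    if u: "u \<in> {s..t}" "u' \<in> {s..t}" "\<bar>u' - u\<bar> < d / 8" and m: "0 < m" "B / real m < d / 8" for u u' m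
  proof -
    let ?N = "Suc p"
    have bd: "bounded {x. (u, x) \<in> \<Theta>}" for u
    proof -
      have "norm x \<le> R" if "(u, x) \<in> \<Theta>" for x using R [OF that] norm_snd_le [of x u] by linarith
      then show ?thesis unfolding bounded_iff by (intro exI [of _ R]) simp
    qed
    define Z0 where "Z0 = grid_set b p m {x. (u, x) \<in> \<Theta>}"
    define Z1 where "Z1 = grid_set b p m {x. (u', x) \<in> \<Theta>}"
    define \<theta> where "\<theta> w = (if w ?N = 0 then u else u', grid_pt b p m w)" for w
    have gp: "grid_pt b p m (w(?N := 0)) = grid_pt b p m w" for w
      unfolding grid_pt_def by (rule lin_comb_cong) simp
    show ?thesis
      unfolding grid_degree_def Z0_def [symmetric] Z1_def [symmetric]
    proof (rule lattice_degree_slab)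
      show "finite Z0" "finite Z1" unfolding Z0_def Z1_def using finite_grid_set [OF b bd m(1)] by auto
      show "Z0 \<subseteq> int_lattice ?N" "Z1 \<subseteq> int_lattice ?N" by (auto simp: Z0_def Z1_def grid_set_def)
      fix z \<pi> k l
      assume z: "z \<in> int_lattice ?N" and pi: "\<pi> permutes {..<Suc ?N}" and kl: "k \<le> Suc ?N" "l \<le> Suc ?N"
      let ?v = "kuhn_vertex z \<pi>"
      assume Xk: "if ?v k ?N = 0 then (?v k)(?N := 0) \<in> Z0 else (?v k)(?N := 0) \<in> Z1"
        and Xl: "\<not> (if ?v l ?N = 0 then (?v l)(?N := 0) \<in> Z0 else (?v l)(?N := 0) \<in> Z1)"
      have lat: "(?v j)(?N := 0) \<in> int_lattice ?N" if "j \<le> Suc ?N" for j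
      proof -
        have nex: "\<not> (\<exists>j'<j. \<pi> j' = i)" if "i > ?N" for i
        proof
          assume "\<exists>j'<j. \<pi> j' = i"
          then obtain j' where j': "j' < j" "\<pi> j' = i" by blast
          then have "\<pi> j' \<in> {..<Suc ?N}" using pi permutes_in_image [OF pi, of j'] \<open>j \<le> Suc ?N\<close> by simp
          then show False using j' that by simp
        qed
        have "((?v j)(?N := 0)) i = 0" if "?N \<le> i" for i
          using that nex [of i] z by (cases "i = ?N") (simp_all add: int_lattice_def kuhn_vertex_def)
        then show ?thesis by (simp add: int_lattice_def)
      qed
      have thk: "\<theta> (?v k) \<in> \<Theta>" using Xk by (auto simp: \<theta>_def Z0_def Z1_def grid_set_def gp split: if_splits)
      have thl: "\<theta> (?v l) \<notin> \<Theta>" using Xl lat [OF kl(2)] by (auto simp: \<theta>_def Z0_def Z1_def grid_set_def gp split: if_splits)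
      have thD: "\<theta> w \<in> D" for w using u by (auto simp: \<theta>_def D_def grid_pt_def lin_comb_in_span)
      have near: "dist (\<theta> (?v j)) (\<theta> (?v j')) < d / 2" for j j'
      proof -
        have g: "norm (grid_pt b p m (?v j) - grid_pt b p m z) < d / 8" for j
          by (rule le_less_trans [OF grid_pt_kuhn_dist m(2) [unfolded B_def]])
        have "dist (grid_pt b p m (?v j)) (grid_pt b p m (?v j')) < d / 8 + d / 8"
          using g [of j] g [of j'] dist_triangle2 [of "grid_pt b p m (?v j)" "grid_pt b p m (?v j')" "grid_pt b p m z"]
          by (simp add: dist_norm)
        moreover have "dist (fst (\<theta> (?v j))) (fst (\<theta> (?v j'))) < d / 8"
          using u(3) d(1) by (auto simp: \<theta>_def dist_real_def abs_minus_commute)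
        moreover have "dist (\<theta> (?v j)) (\<theta> (?v j')) \<le> dist (fst (\<theta> (?v j))) (fst (\<theta> (?v j'))) + dist (snd (\<theta> (?v j))) (snd (\<theta> (?v j')))"
          unfolding dist_prod_def by (rule order_trans [OF sqrt_sum_squares_le_sum]) auto
        ultimately show ?thesis using d(1) by (simp add: \<theta>_def)
      qed
      let ?seg = "closed_segment (\<theta> (?v k)) (\<theta> (?v l))"
      have "?seg \<inter> frontier \<Theta> \<noteq> {}"
        by (rule connected_Int_frontier) (use thk thl in auto)
      then obtain \<theta>\<^sub>0 where th0: "\<theta>\<^sub>0 \<in> ?seg" "\<theta>\<^sub>0 \<in> frontier \<Theta>" by blast
      have "?seg \<subseteq> D" using D(2) thD by (simp add: closed_segment_subset)
      then have "\<theta>\<^sub>0 \<in> frontier \<Theta> \<inter> D" using th0 by blast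
      from lab [OF this] obtain i lv where i1: "i \<le> p" and i2: "\<forall>\<theta>\<in>D. dist \<theta> \<theta>\<^sub>0 < d \<longrightarrow> ?lab \<theta> i = lv"
        by (elim exE conjE)
      have "dist (\<theta> (?v j)) \<theta>\<^sub>0 < d" for j
      proof -
        have sb: "?seg \<subseteq> ball (\<theta> (?v k)) (d / 2)"
          using near [of k l] near [of k k] d(1) by (intro closed_segment_subset) auto
        have "dist (\<theta> (?v k)) \<theta>\<^sub>0 < d / 2" using subsetD [OF sb th0(1)] by simp
        then show ?thesis using near [of j k] near [of k l] dist_triangle [of "\<theta> (?v j)" \<theta>\<^sub>0 "\<theta> (?v k)"] by simp
      qed
      then have L: "?lab (\<theta> (?v j)) i = lv" for j using bspec [OF i2 thD] by simp
      have Slab: "(if w ?N = 0 then grid_label b p m (\<lambda>x. q (u, x)) (w(?N := 0)) else grid_label b p m (\<lambda>x. q (u', x)) (w(?N := 0))) i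
          = ?lab (\<theta> w) i" for w
        by (simp add: grid_label_def \<theta>_def gp)
      show "\<exists>i<?N. \<forall>k\<le>Suc ?N. (if ?v k ?N = 0 then grid_label b p m (\<lambda>x. q (u, x)) ((?v k)(?N := 0)) else grid_label b p m (\<lambda>x. q (u', x)) ((?v k)(?N := 0))) i
          = (if z ?N = 0 then grid_label b p m (\<lambda>x. q (u, x)) (z(?N := 0)) else grid_label b p m (\<lambda>x. q (u', x)) (z(?N := 0))) i"
      proof (intro exI [of _ i] conjI allI impI)
        show "i < ?N" using i1 by simp
        show "(if ?v k ?N = 0 then grid_label b p m (\<lambda>x. q (u, x)) ((?v k)(?N := 0)) else grid_label b p m (\<lambda>x. q (u', x)) ((?v k)(?N := 0))) i
          = (if z ?N = 0 then grid_label b p m (\<lambda>x. q (u, x)) (z(?N := 0)) else grid_label b p m (\<lambda>x. q (u', x)) (z(?N := 0))) i" for k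
          unfolding Slab using L [of k] L [of 0] by simp
      qed
    qed
  qed
  obtain n where n: "0 < n" "(t - s) / real n < d / 8"
  proof -
    obtain n where "(t - s) / (d / 8) < real n" using reals_Archimedean2 by blast
    then have "(t - s) / real (Suc n) < d / 8" using d(1) ts by (simp add: field_simps)
    then show thesis by (intro that [of "Suc n"]) auto
  qed
  have "\<forall>\<^sub>F m in sequentially. 0 < m \<and> B / real m < d / 8"
  proof -
    have "(\<lambda>m. B / real m) \<longlonglongrightarrow> 0" by (rule lim_const_over_n)
    then have "\<forall>\<^sub>F m in sequentially. B / real m < d / 8" using d(1) by (intro order_tendstoD) auto
    then show ?thesis using eventually_gt_at_top [of 0] by eventually_elim simp
  qed
  then show ?thesis
  proof eventually_elim
    case (elim m)
    define \<tau> where "\<tau> j = s + real j * ((t - s) / real n)" for j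
    have tau: "\<tau> j \<in> {s..t}" if "j \<le> n" for j
    proof -
      have "real j * ((t - s) / real n) \<le> real n * ((t - s) / real n)"
        using that ts by (intro mult_right_mono) auto
      then show ?thesis using ts n(1) by (simp add: \<tau>_def)
    qed
    have "grid_degree b p m (\<lambda>x. q (s, x)) {x. (s, x) \<in> \<Theta>} = grid_degree b p m (\<lambda>x. q (\<tau> j, x)) {x. (\<tau> j, x) \<in> \<Theta>}"
      if "j \<le> n" for j
      using that
    proof (induction j)
      case (Suc j)
      have "\<tau> (Suc j) - \<tau> j = (t - s) / real n" by (simp add: \<tau>_def distrib_right add_divide_distrib)
      then have "\<bar>\<tau> (Suc j) - \<tau> j\<bar> < d / 8" using n ts by simp
      then show ?case using step [OF tau tau, of j "Suc j" m] Suc elim by simp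
    qed (simp add: \<tau>_def)
    from this [of n] show ?case using n(1) by (simp add: \<tau>_def)
  qed
qed

text \<open>Only one simplex contributes. Factor \<open>i\<close> sees coordinate \<open>i\<close>
  change only if the order takes direction \<open>i\<close> at step \<open>i\<close>, so the order
  is \<open>id\<close>. The step must also cross the jump of the label: from -1 to 0 for an entry 1,
  and from 0 to 1 for the entry -1, where the label drops and gives the factor -1.\<close>

lemma lattice_degree_diag:
  fixes s :: real
  assumes s: "s \<in> {1, -1}" and Z: "finite Z" "Z \<subseteq> int_lattice (Suc p)"
    and zZ: "(\<lambda>i. if i < Suc p then if i = 0 \<and> s = -1 then 0 else -1 else 0) \<in> Z"
  shows "lattice_degree (Suc p) (\<lambda>z i. if 0 \<le> (if i = 0 then s else 1) * real_of_int (z i) then 1 else 0) Z = (if s = 1 then 1 else -1)"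
proof -
  define S :: "(nat \<Rightarrow> int) \<Rightarrow> nat \<Rightarrow> int" where
    "S = (\<lambda>z i. if 0 \<le> (if i = 0 then s else 1) * real_of_int (z i) then 1 else 0)"
  define z0 :: "nat \<Rightarrow> int" where "z0 = (\<lambda>i. if i < Suc p then if i = 0 \<and> s = -1 then 0 else -1 else 0)"
  let ?P = "{\<pi>. \<pi> permutes {..<Suc p}}"
  have step: "kuhn_vertex z \<pi> (Suc i) i = kuhn_vertex z \<pi> i i" if "inj \<pi>" "\<pi> i \<noteq> i" for z \<pi> i
    using that by (auto simp: kuhn_vertex_def less_Suc_eq)
  have idv: "kuhn_vertex z id i i = z i" "kuhn_vertex z id (Suc i) i = z i + 1" for z i
    by (auto simp: kuhn_vertex_def)
  have fac: "S (kuhn_vertex z id (Suc i)) i - S (kuhn_vertex z id i) i =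
      (if i = 0 \<and> s = -1 then if z i = 0 then -1 else 0 else if z i = -1 then 1 else 0)" for z i
    using s by (auto simp: S_def idv)
  have zero: "label_cochain (Suc p) S (kuhn_vertex z \<pi>) = 0"
    if z: "z \<in> int_lattice (Suc p)" and pi: "\<pi> permutes {..<Suc p}" and ne: "\<not> (z = z0 \<and> \<pi> = id)" for z \<pi>
  proof (cases "\<pi> = id")
    case False
    then obtain i where i: "\<pi> i \<noteq> i" by (auto simp: fun_eq_iff)
    then have "i < Suc p" using pi by (metis lessThan_iff permutes_not_in)
    then show ?thesis
      unfolding label_cochain_def using step [OF permutes_inj [OF pi] i] i
      by (intro prod_zero bexI [of _ i]) (auto simp: S_def)
  next
    case True
    then have "z \<noteq> z0" using ne by simp
    then obtain i where i: "z i \<noteq> z0 i" by (auto simp: fun_eq_iff)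
    then have ip: "i < Suc p" using z by (auto simp: z0_def int_lattice_def split: if_splits)
    then show ?thesis
      unfolding label_cochain_def using True i ip
      by (intro prod_zero bexI [of _ i]) (auto simp: fac z0_def split: if_splits)
  qed
  have one: "label_cochain (Suc p) S (kuhn_vertex z0 id) = (if s = 1 then 1 else -1)"
  proof -
    have "label_cochain (Suc p) S (kuhn_vertex z0 id) = (\<Prod>i<Suc p. if i = 0 \<and> s = -1 then -1 else 1)"
      unfolding label_cochain_def by (intro prod.cong) (auto simp: fac z0_def)
    also have "\<dots> = (if s = 1 then 1 else -1)" using s by (auto simp: prod.lessThan_Suc_shift)
    finally show ?thesis .
  qed
  have "lattice_degree (Suc p) S Z = (\<Sum>z\<in>{z0}. \<Sum>\<pi>\<in>?P. sign \<pi> * label_cochain (Suc p) S (kuhn_vertex z \<pi>))"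
    unfolding lattice_degree_def
  proof (rule sum.mono_neutral_right [OF Z(1)])
    show "{z0} \<subseteq> Z" using zZ by (simp add: z0_def)
    show "\<forall>z\<in>Z - {z0}. (\<Sum>\<pi>\<in>?P. sign \<pi> * label_cochain (Suc p) S (kuhn_vertex z \<pi>)) = 0"
      using zero Z(2) by (auto intro!: sum.neutral)
  qed
  also have "\<dots> = (\<Sum>\<pi>\<in>{id}. sign \<pi> * label_cochain (Suc p) S (kuhn_vertex z0 \<pi>))"
  proof -
    have "(\<Sum>\<pi>\<in>?P. sign \<pi> * label_cochain (Suc p) S (kuhn_vertex z0 \<pi>)) = (\<Sum>\<pi>\<in>{id}. sign \<pi> * label_cochain (Suc p) S (kuhn_vertex z0 \<pi>))"
      by (rule sum.mono_neutral_right)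
         (use zero zZ Z(2) in \<open>auto simp: finite_permutations permutes_id z0_def [symmetric]\<close>)
    then show ?thesis by simp
  qed
  finally show ?thesis using one by (simp add: S_def sign_id)
qed


text \<open>Both degrees are invariant along a path of nonsingular matrices to
  \<open>diag_sign s\<close>. There each is found directly: one simplex on the grid side, the
  identity or a reflection on the sphere side.\<close>

lemma grid_degree_linear:
  fixes b :: "nat \<Rightarrow> 'a::banach"
  assumes b: "basis_seq b p" and E: "span (b ` {..p}) = E" and M: "linear M"
    and into: "\<And>x. x \<in> E \<Longrightarrow> M x \<in> E" and inj: "\<And>x. x \<in> E \<Longrightarrow> M x = 0 \<Longrightarrow> x = 0" and eta: "0 < \<eta>"
  shows "\<forall>\<^sub>F m in sequentially. grid_degree b p m M (ball 0 \<eta>) = Brouwer_degree2 p (sphere_map b b p 1 M)"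
proof -
  define a where "a i j = coords b p (M (b j)) i" for i j
  have bE: "b j \<in> E" if "j \<le> p" for j using that E by (auto intro: span_base)
  have Mlc: "M (lin_comb b p x) = lin_comb b p (\<lambda>i. \<Sum>j<Suc p. a i j * x j)" for x
  proof -
    have "M (lin_comb b p x) = (\<Sum>j\<le>p. x j *\<^sub>R M (b j))"
      unfolding lin_comb_def using M by (simp add: linear_sum linear_cmul)
    also have "\<dots> = (\<Sum>j\<le>p. x j *\<^sub>R lin_comb b p (\<lambda>i. a i j))"
      using lin_comb_coords [OF b] into bE E by (intro sum.cong) (auto simp: a_def)
    also have "\<dots> = (\<Sum>i\<le>p. (\<Sum>j\<le>p. a i j * x j) *\<^sub>R b i)"
      unfolding lin_comb_def scaleR_sum_right scaleR_left.sum
      by (subst sum.swap) (simp add: mult.commute)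
    finally show ?thesis by (simp add: lin_comb_def lessThan_Suc_atMost)
  qed
  have ns: "nonsing (Suc p) a"
    unfolding nonsing_def
  proof (rule allI, rule impI)
    fix x assume "\<forall>i<Suc p. (\<Sum>j<Suc p. a i j * x j) = 0"
    then have "M (lin_comb b p x) = 0" unfolding Mlc by (simp add: lin_comb_def)
    then have "lin_comb b p x = lin_comb b p (\<lambda>_. 0)"
      using inj [of "lin_comb b p x"] lin_comb_in_span [of b p x] E by (simp add: lin_comb_def)
    then show "\<forall>i<Suc p. x i = 0" using lin_comb_inj [OF b, of x "\<lambda>_. 0"] by (simp add: less_Suc_eq_le)
  qed
  obtain s where s: "s \<in> {1, -1}" and path: "nonsing_path (Suc p) a (diag_sign s)"
    using nonsing_path_diag_sign [OF ns] by blast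
  obtain \<gamma> where \<gamma>: "\<And>i j. i < Suc p \<Longrightarrow> j < Suc p \<Longrightarrow> continuous_on {0..1::real} (\<lambda>t. \<gamma> t i j)"
    "\<And>t. t \<in> {0..1} \<Longrightarrow> nonsing (Suc p) (\<gamma> t)"
    "\<And>i j. i < Suc p \<Longrightarrow> j < Suc p \<Longrightarrow> \<gamma> 0 i j = a i j \<and> \<gamma> 1 i j = diag_sign s i j"
    using path unfolding nonsing_path_def by blast
  define Q where "Q \<theta> = lin_comb b p (\<lambda>i. \<Sum>j<Suc p. \<gamma> (fst \<theta>) i j * coords b p (snd \<theta>) j)" for \<theta>
  have Qin: "Q \<theta> \<in> E" for \<theta> unfolding Q_def using lin_comb_in_span E by blast
  have Qnz: "Q (t, x) \<noteq> 0" if t: "t \<in> {0..1}" and x: "x \<in> E" "x \<noteq> 0" for t x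
  proof
    assume "Q (t, x) = 0"
    then have eq: "lin_comb b p (\<lambda>i. \<Sum>j<Suc p. \<gamma> t i j * coords b p x j) = lin_comb b p (\<lambda>_. 0)"
      by (simp add: Q_def lin_comb_def)
    have "\<forall>i<Suc p. (\<Sum>j<Suc p. \<gamma> t i j * coords b p x j) = 0"
      using lin_comb_inj [OF b eq] by (simp add: less_Suc_eq_le del: sum.lessThan_Suc)
    then have "\<forall>i<Suc p. coords b p x i = 0" using \<gamma>(2) [OF t] unfolding nonsing_def by blast
    moreover obtain i where "i \<le> p" "coords b p x i \<noteq> 0" using coords_nonzero [OF b] x E by blast
    ultimately show False using le_imp_less_Suc by blast
  qed
  have Qc: "continuous_on ({0..1} \<times> E) Q"
    unfolding Q_def lin_comb_def
  proof (intro continuous_on_sum continuous_on_scaleR continuous_on_const continuous_on_mult)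
    fix i j assume "i \<in> {..p}" "j \<in> {..<Suc p}"
    then have ij: "i < Suc p" "j < Suc p" by auto
    show "continuous_on ({0..1} \<times> E) (\<lambda>z. \<gamma> (fst z) i j)"
      by (rule continuous_on_compose2 [OF \<gamma>(1) [OF ij] continuous_on_fst [OF continuous_on_id]]) auto
    show "continuous_on ({0..1} \<times> E) (\<lambda>z. coords b p (snd z) j)"
      by (rule continuous_on_compose2 [OF continuous_on_coords [OF b] continuous_on_snd [OF continuous_on_id]]) (use E in auto)
  qed
  have Qlc: "coords b p (Q (t, lin_comb b p x)) i = (\<Sum>j<Suc p. \<gamma> t i j * x j)" if "i \<le> p" for t x i
    unfolding Q_def using coords_lin_comb [OF b] that by (simp add: less_Suc_eq_le)
  have Q0: "Q (0, x) = M x" if "x \<in> E" for x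
  proof -
    have "Q (0, x) = lin_comb b p (\<lambda>i. \<Sum>j<Suc p. a i j * coords b p x j)"
      unfolding Q_def by (rule lin_comb_cong) (use \<gamma>(3) in \<open>auto intro!: sum.cong simp del: sum.lessThan_Suc\<close>)
    also have "\<dots> = M (lin_comb b p (coords b p x))" by (simp only: Mlc)
    also have "lin_comb b p (coords b p x) = x" using lin_comb_coords [OF b] that E by blast
    finally show ?thesis .
  qed
  have Q1: "coords b p (Q (1, lin_comb b p x)) i = (if i = 0 then s else 1) * x i" if "i \<le> p" for x i
  proof -
    have "coords b p (Q (1, lin_comb b p x)) i = (\<Sum>j<Suc p. diag_sign s i j * x j)"
      unfolding Qlc [OF that] using \<gamma>(3) that by (intro sum.cong) auto
    also have "\<dots> = (\<Sum>j<Suc p. if j = i then (if i = 0 then s else 1) * x i else 0)"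
      by (intro sum.cong) (auto simp: diag_sign_def)
    also have "\<dots> = (if i = 0 then s else 1) * x i" using that by (simp del: sum.lessThan_Suc)
    finally show ?thesis .
  qed
  \<comment> \<open>The open interval exceeds [0, 1], so that over [0, 1] the frontier consists of
    the lateral sphere only.\<close>
  let ?\<Theta> = "{-1<..<2} \<times> ball 0 \<eta> :: (real \<times> 'a) set"
  have fr: "snd \<theta> \<noteq> 0" if "\<theta> \<in> frontier ?\<Theta>" "fst \<theta> \<in> {0..1}" for \<theta>
  proof -
    have "open ?\<Theta>" by (intro open_Times) auto
    then have "\<theta> \<notin> ?\<Theta>" using that(1) by (simp add: frontier_def interior_open)
    then show ?thesis using that(2) eta by (cases \<theta>) auto
  qed
  have "\<forall>\<^sub>F m in sequentially. grid_degree b p m (\<lambda>x. Q (0, x)) {x. (0, x) \<in> ?\<Theta>} = grid_degree b p m (\<lambda>x. Q (1, x)) {x. (1, x) \<in> ?\<Theta>}"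
  proof (rule grid_degree_homotopy [OF b])
    show "bounded ?\<Theta>" by (intro bounded_Times) auto
    fix \<theta> assume th: "\<theta> \<in> frontier ?\<Theta> \<inter> ({0..1} \<times> span (b ` {..p}))"
    then have th': "\<theta> \<in> {0..1} \<times> E" using E by simp
    then show "continuous (at \<theta> within {0..1} \<times> span (b ` {..p})) Q"
      using bspec [OF Qc [unfolded continuous_on_eq_continuous_within] th'] unfolding E by simp
    show "Q \<theta> \<noteq> 0" using Qnz [of "fst \<theta>" "snd \<theta>"] fr [of \<theta>] th th' by auto
  qed (use Qin E in auto)
  then have ev: "\<forall>\<^sub>F m in sequentially. grid_degree b p m (\<lambda>x. Q (0, x)) (ball 0 \<eta>) = grid_degree b p m (\<lambda>x. Q (1, x)) (ball 0 \<eta>)"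
    by (simp add: ball_def)
  have gM: "grid_degree b p m (\<lambda>x. Q (0, x)) S = grid_degree b p m M S" for m S
  proof -
    have "grid_pt b p m z \<in> E" for z unfolding grid_pt_def using lin_comb_in_span E by blast
    then have "grid_label b p m (\<lambda>x. Q (0, x)) = grid_label b p m M"
      by (auto simp: fun_eq_iff grid_label_def Q0)
    then show ?thesis by (simp add: grid_degree_def)
  qed
  define z0 :: "nat \<Rightarrow> int" where "z0 = (\<lambda>i. if i < Suc p then if i = 0 \<and> s = -1 then 0 else -1 else 0)"
  define Bn where "Bn = (\<Sum>i\<le>p. norm (b i))"
  have z0n: "norm (grid_pt b p m z0) \<le> Bn / real m" for m
  proof -
    have "norm (grid_pt b p m z0) \<le> (\<Sum>i\<le>p. norm ((real_of_int (z0 i) / real m) *\<^sub>R b i))"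
      unfolding grid_pt_def lin_comb_def by (rule norm_sum)
    also have "\<dots> \<le> (\<Sum>i\<le>p. norm (b i) / real m)" by (intro sum_mono) (auto simp: z0_def)
    finally show ?thesis by (simp add: Bn_def sum_divide_distrib)
  qed
  have "(\<lambda>m. Bn / real m) \<longlonglongrightarrow> 0" by (rule lim_const_over_n)
  then have evB: "\<forall>\<^sub>F m in sequentially. Bn / real m < \<eta>" using eta by (intro order_tendstoD) auto
  have diag: "grid_degree b p m (\<lambda>x. Q (1, x)) (ball 0 \<eta>) = (if s = 1 then 1 else -1)"
    if m: "0 < m" "Bn / real m < \<eta>" for m
  proof -
    have lab: "grid_label b p m (\<lambda>x. Q (1, x)) z i = (if 0 \<le> (if i = 0 then s else 1) * real_of_int (z i) then 1 else 0)"
      if "i < Suc p" for z i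
    proof -
      have "coords b p (Q (1, grid_pt b p m z)) i = ((if i = 0 then s else 1) * real_of_int (z i)) / real m"
        unfolding grid_pt_def using Q1 that by (simp add: less_Suc_eq_le)
      then show ?thesis using m(1) by (simp add: grid_label_def zero_le_divide_iff)
    qed
    have "grid_degree b p m (\<lambda>x. Q (1, x)) (ball 0 \<eta>) =
       lattice_degree (Suc p) (\<lambda>z i. if 0 \<le> (if i = 0 then s else 1) * real_of_int (z i) then 1 else 0) (grid_set b p m (ball 0 \<eta>))"
      unfolding grid_degree_def lattice_degree_def label_cochain_def
      by (intro sum.cong refl arg_cong2 [where f = times] prod.cong arg_cong2 [where f = minus] lab) auto
    also have "\<dots> = (if s = 1 then 1 else -1)"
    proof (rule lattice_degree_diag [OF s])
      show "finite (grid_set b p m (ball 0 \<eta>))" by (rule finite_grid_set [OF b _ m(1)]) simp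
      show "grid_set b p m (ball 0 \<eta>) \<subseteq> int_lattice (Suc p)" by (auto simp: grid_set_def)
      have "z0 \<in> grid_set b p m (ball 0 \<eta>)"
        using z0n [of m] m(2) by (auto simp: grid_set_def int_lattice_def z0_def [abs_def] simp del: if_split)
      then show "(\<lambda>i. if i < Suc p then if i = 0 \<and> s = -1 then 0 else -1 else 0) \<in> grid_set b p m (ball 0 \<eta>)"
        by (simp add: z0_def)
    qed
    finally show ?thesis .
  qed
  have sph: "Brouwer_degree2 p (sphere_map b b p 1 M) = (if s = 1 then 1 else -1)"
  proof -
    have "Brouwer_degree2 p (sphere_map b b p 1 M) = Brouwer_degree2 p (sphere_map b b p 1 (\<lambda>x. Q (0, x)))"
    proof (rule Brouwer_degree2_eq)
      fix x assume "x \<in> topspace (nsphere p)"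
      then have "radial b p 1 x \<in> E" using radial_in [OF b, of x 1] E by (simp add: nsphere_nsph)
      then show "sphere_map b b p 1 M x = sphere_map b b p 1 (\<lambda>x. Q (0, x)) x" by (simp add: sphere_map_def Q0)
    qed
    also have "\<dots> = Brouwer_degree2 p (sphere_map b b p 1 (\<lambda>x. Q (1, x)))"
    proof (rule Brouwer_degree2_homotopic, rule sphere_map_homotopic [OF b b E E zero_less_one, of "\<lambda>t x. Q (t, x)"])
      show "continuous_on ({0..1} \<times> (E \<inter> sphere 0 1)) (\<lambda>(t, x). Q (t, x))"
        using continuous_on_subset [OF Qc, of "{0..1} \<times> (E \<inter> sphere 0 1)"] by auto
      show "Q (t, x) \<in> E - {0}" if "t \<in> {0..1}" "x \<in> E \<inter> sphere 0 1" for t x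
        using Qin [of "(t, x)"] Qnz [of t x] that by (cases "x = 0") auto
    qed
    also have "\<dots> = Brouwer_degree2 p (\<lambda>x i. (if i = 0 then s else 1) * x i)"
    proof (rule Brouwer_degree2_eq)
      fix x assume "x \<in> topspace (nsphere p)"
      then have x: "x \<in> nsph p" by (simp add: nsphere_nsph)
      let ?y = "\<lambda>i. (if i = 0 then s else 1) * x i"
      have "?y \<in> nsph p"
      proof -
        have "(?y i)\<^sup>2 = (x i)\<^sup>2" for i using s by auto
        then show ?thesis using x by (simp add: nsph_def)
      qed
      moreover have "coords b p (Q (1, radial b p 1 x)) = (\<lambda>i. (1 / norm (lin_comb b p x)) * ?y i)"
      proof
        fix i
        show "coords b p (Q (1, radial b p 1 x)) i = (1 / norm (lin_comb b p x)) * ?y i"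
        proof (cases "i \<le> p")
          case True
          then show ?thesis unfolding radial_def lin_comb_scale [symmetric] by (subst Q1) auto
        qed (use x in \<open>simp add: coords_beyond nsph_def\<close>)
      qed
      ultimately show "sphere_map b b p 1 (\<lambda>x. Q (1, x)) x = ?y"
        unfolding sphere_map_def using lin_comb_nonzero [OF b x]
        by (simp only:) (subst normalize_vec_scale, simp, rule normalize_vec_nsph)
    qed
    also have "\<dots> = (if s = 1 then 1 else -1)"
    proof (cases "s = 1")
      case True
      then have "(\<lambda>x i. (if i = 0 then s else 1) * x i) = (id :: (nat \<Rightarrow> real) \<Rightarrow> _)" by (auto simp: fun_eq_iff)
      then show ?thesis using True by simp
    next
      case False
      then have "(\<lambda>x i. (if i = 0 then s else 1) * x i) = (\<lambda>(x :: nat \<Rightarrow> real) i. if i = 0 then - x i else x i)"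
        using s by (auto simp: fun_eq_iff)
      from this show ?thesis using False by (simp only: Brouwer_degree2_reflection if_False)
    qed
    finally show ?thesis .
  qed
  show ?thesis
    using ev evB eventually_gt_at_top [of 0]
    by eventually_elim (use diag gM sph in simp)
qed

subsection \<open>Reduction to compact perturbations of the identity\<close>

lemma has_derivative_D_u:
  fixes F :: "real \<times> 'u::banach \<Rightarrow> 'v::banach"
  assumes "C1_map F"
  shows "((\<lambda>w. F (t, w)) has_derivative blinfun_apply (D_u F (t, u))) (at u)"
    and "continuous_on UNIV (D_u F)"
proof -
  obtain F' :: "real \<times> 'u \<Rightarrow> ((real \<times> 'u) \<Rightarrow>\<^sub>L 'v)" where
    F': "continuous_on UNIV F'" "\<And>x. (F has_derivative blinfun_apply (F' x)) (at x)"
    using assms unfolding C1_map_def by blast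
  define j :: "'u \<Rightarrow>\<^sub>L (real \<times> 'u)" where "j = Blinfun (\<lambda>h. (0, h))"
  have bl: "bounded_linear (\<lambda>h::'u. (0::real, h))"
    by (intro bounded_linear_Pair bounded_linear_zero bounded_linear_ident)
  have j: "blinfun_apply j h = (0, h)" for h
    unfolding j_def by (subst bounded_linear_Blinfun_apply [OF bl]) simp
  have der: "((\<lambda>w. F (t, w)) has_derivative blinfun_apply (F' (t, u) o\<^sub>L j)) (at u)" for t u
  proof -
    have "((\<lambda>w::'u. (t, w)) has_derivative (\<lambda>h. (0, h))) (at u)"
      by (intro has_derivative_Pair has_derivative_const has_derivative_ident)
    moreover have "blinfun_apply (F' (t, u) o\<^sub>L j) = (\<lambda>x. F' (t, u) (0, x))" by (auto simp: j)
    ultimately show ?thesis using has_derivative_compose [OF _ F'(2)] by metis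
  qed
  have eq: "D_u F (t, u) = F' (t, u) o\<^sub>L j" for t u
    unfolding D_u_def prod.case
  proof (rule the_equality, rule der)
    fix D assume "((\<lambda>w. F (t, w)) has_derivative blinfun_apply D) (at u)"
    from has_derivative_unique [OF this der [of t u]] show "D = F' (t, u) o\<^sub>L j"
      by (intro blinfun_eqI) metis
  qed
  show "((\<lambda>w. F (t, w)) has_derivative blinfun_apply (D_u F (t, u))) (at u)" unfolding eq by (rule der)
  have "D_u F = (\<lambda>p. F' p o\<^sub>L j)" using eq by auto
  then show "continuous_on UNIV (D_u F)"
    by (simp add: bounded_bilinear.continuous_on [OF bounded_bilinear_blinfun_compose F'(1) continuous_on_const])
qed

lemma continuous_on_C1_map: "C1_map F \<Longrightarrow> continuous_on UNIV F"
  unfolding C1_map_def by (meson continuous_at_imp_continuous_on has_derivative_continuous)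

text \<open>The operator is frozen at \<open>\<theta>\<close> and applied to
  \<open>u - snd \<theta>\<close>, so \<open>u = snd \<theta>\<close> solves the corrected equation
  exactly when it solves the original one.\<close>

definition corrected_map ::
  "(real \<times> 'u::banach \<Rightarrow> 'v::banach) \<Rightarrow> (real \<times> 'u \<Rightarrow> ('u \<Rightarrow>\<^sub>L 'v)) \<Rightarrow> real \<times> 'u \<Rightarrow> 'u \<Rightarrow> 'v" where
  "corrected_map F B \<theta> u = F (fst \<theta>, u) + B \<theta> (u - snd \<theta>)"

lemma corrected_map_increment:
  fixes F :: "real \<times> 'u::banach \<Rightarrow> 'v::banach"
  assumes C1: "C1_map F" and B: "continuous_on UNIV B" and e: "0 < e"
  obtains \<rho> where "0 < \<rho>" "\<And>\<theta> u u'. dist \<theta> p < \<rho> \<Longrightarrow> dist u (snd p) \<le> \<rho> \<Longrightarrow> dist u' (snd p) \<le> \<rho> \<Longrightarrow>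
    norm (corrected_map F B \<theta> u - corrected_map F B \<theta> u' - (D_u F p + B p) (u - u')) \<le> e * norm (u - u')"
proof -
  let ?T = "D_u F"
  have e2: "0 < e / 2" using e by simp
  obtain d1 where d1: "0 < d1" "\<And>q. dist q p < d1 \<Longrightarrow> dist (?T q) (?T p) < e / 2"
    using has_derivative_D_u(2) [OF C1] e2 unfolding continuous_on_iff by blast
  obtain d2 where d2: "0 < d2" "\<And>q. dist q p < d2 \<Longrightarrow> dist (B q) (B p) < e / 2"
    using B e2 unfolding continuous_on_iff by blast
  \<comment> \<open>A third, because \<open>(fst \<theta>, w)\<close> may differ from
    \<open>p\<close> by \<open>\<rho>\<close> in each factor and must stay strictly within
    \<open>d1\<close>.\<close>
  define \<rho> where "\<rho> = min d1 d2 / 3"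
  show thesis
  proof (rule that [of \<rho>])
    show "0 < \<rho>" using d1 d2 by (simp add: \<rho>_def)
    fix \<theta> u u' assume \<theta>: "dist \<theta> p < \<rho>" and u: "dist u (snd p) \<le> \<rho>" and u': "dist u' (snd p) \<le> \<rho>"
    define f where "f w = F (fst \<theta>, w) - ?T p w" for w
    have bd: "norm (f u - f u') \<le> (e / 2) * norm (u - u')"
    proof (rule differentiable_bound [of "cball (snd p) \<rho>" f "\<lambda>w. blinfun_apply (?T (fst \<theta>, w) - ?T p)"])
      fix w assume w: "w \<in> cball (snd p) \<rho>"
      have "(f has_derivative (\<lambda>h. ?T (fst \<theta>, w) h - ?T p h)) (at w)" unfolding f_def
        by (intro has_derivative_diff has_derivative_D_u(1) [OF C1] bounded_linear_imp_has_derivative blinfun.bounded_linear_right)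
      then show "(f has_derivative blinfun_apply (?T (fst \<theta>, w) - ?T p)) (at w within cball (snd p) \<rho>)"
        unfolding minus_blinfun.rep_eq by (rule has_derivative_at_withinI)
      have "dist (fst \<theta>, w) p \<le> dist (fst \<theta>) (fst p) + dist w (snd p)"
        unfolding dist_prod_def by (rule order_trans [OF sqrt_sum_squares_le_sum]) auto
      also have "\<dots> < d1" using \<theta> dist_fst_le [of \<theta> p] w d1 d2 by (auto simp: \<rho>_def dist_commute)
      finally have "norm (?T (fst \<theta>, w) - ?T p) < e / 2" using d1(2) by (simp add: dist_norm)
      then show "onorm (blinfun_apply (?T (fst \<theta>, w) - ?T p)) \<le> e / 2" by (simp add: norm_blinfun.rep_eq)
    qed (use u u' in \<open>auto simp: dist_commute\<close>)
    have "dist \<theta> p < d2" using \<theta> d1 d2 by (auto simp: \<rho>_def)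
    then have B2: "norm (B \<theta> - B p) \<le> e / 2" using d2(2) by (simp add: dist_norm less_imp_le)
    have "norm ((B \<theta> - B p) (u - u')) \<le> (e / 2) * norm (u - u')"
      using norm_blinfun [of "B \<theta> - B p" "u - u'"] mult_right_mono [OF B2, of "norm (u - u')"] by simp
    moreover have "corrected_map F B \<theta> u - corrected_map F B \<theta> u' - (?T p + B p) (u - u')
        = (f u - f u') + (B \<theta> - B p) (u - u')"
      by (simp add: corrected_map_def f_def blinfun.diff_left blinfun.diff_right blinfun.add_left)
    ultimately show "norm (corrected_map F B \<theta> u - corrected_map F B \<theta> u' - (?T p + B p) (u - u')) \<le> e * norm (u - u')"
      using bd norm_triangle_ineq [of "f u - f u'" "(B \<theta> - B p) (u - u')"] by simp
  qed
qed

text \<open>A Lebesgue number for properties that are inherited by smaller radii.\<close>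

lemma compact_uniform_radius:
  fixes K :: "'a::metric_space set"
  assumes K: "compact K" and loc: "\<And>p. p \<in> K \<Longrightarrow> \<exists>r>0. \<forall>\<theta>. dist \<theta> p < r \<longrightarrow> Q r \<theta>"
    and anti: "\<And>r r' \<theta>. 0 < r' \<Longrightarrow> r' \<le> r \<Longrightarrow> Q r \<theta> \<Longrightarrow> Q r' \<theta>"
  obtains r where "0 < r" "\<And>p \<theta>. p \<in> K \<Longrightarrow> dist \<theta> p < r \<Longrightarrow> Q r \<theta>"
proof -
  obtain R where R: "\<And>p. p \<in> K \<Longrightarrow> 0 < R p" "\<And>p \<theta>. p \<in> K \<Longrightarrow> dist \<theta> p < R p \<Longrightarrow> Q (R p) \<theta>"
    using loc by metis
  have cov: "K \<subseteq> (\<Union>p\<in>K. ball p (R p / 2))" using R(1) by fastforce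
  obtain D where D: "finite D" "D \<subseteq> K" "K \<subseteq> (\<Union>p\<in>D. ball p (R p / 2))"
    by (rule compactE_image [OF K _ cov]) auto
  define r where "r = Min (insert 1 ((\<lambda>p. R p / 2) ` D))"
  show thesis
  proof (rule that [of r])
    show "0 < r" unfolding r_def using D R(1) by (subst Min_gr_iff) auto
    fix p \<theta> assume p: "p \<in> K" "dist \<theta> p < r"
    then obtain q where q: "q \<in> D" "dist q p < R q / 2" using D(3) by auto
    have rq: "r \<le> R q / 2" unfolding r_def using q D(1) by (intro Min_le) auto
    have qK: "q \<in> K" using q D by blast
    have "dist \<theta> q < R q" using p q rq dist_triangle [of \<theta> q p] by (simp add: dist_commute)
    from R(2) [OF qK this] show "Q r \<theta>"
      by (rule anti [OF \<open>0 < r\<close>, rotated]) (use rq R(1) [OF qK] in simp)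
  qed
qed

text \<open>At points of \<open>K\<close> the partial derivative of the corrected map is invertible,
  so the corrected equation can be solved for \<open>u\<close> near \<open>snd \<theta>\<close>.
  Compactness of \<open>K\<close> makes all radii uniform and yields a tube \<open>Y \<eta>\<close>
  on which one continuous \<open>k\<close> is defined.\<close>

lemma nonlinear_reduction:
  fixes F :: "real \<times> 'u::banach \<Rightarrow> 'v::banach"
  assumes C1: "C1_map F" and F2: "\<And>t. F (t, 0) = 0" and F3: "\<And>p. D_u F p \<in> Fredholm0"
    and F4: "proper_on_bounded_closed F" and K: "compact K" "K \<subseteq> F -` {0}"
  defines "Y \<equiv> \<lambda>\<eta>. {\<theta>. \<exists>p\<in>K. dist \<theta> p < \<eta>}"
  obtains \<eta> k P Z where "0 < \<eta>" "continuous_on (Y \<eta>) k" "compact Z" "k ` Y \<eta> \<subseteq> Z"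
    "\<And>t x. (t, x) \<in> Y \<eta> \<Longrightarrow> k (t, x) = x \<longleftrightarrow> F (t, x) = 0"
    "continuous_on {t. (t, 0) \<in> K} P" "\<And>t. (t, 0) \<in> K \<Longrightarrow> P t \<in> GL"
    "\<And>t. (t, 0) \<in> K \<Longrightarrow> finite_rank (id_blinfun - (P t o\<^sub>L D_u F (t, 0)))"
    "\<And>t e. (t, 0) \<in> K \<Longrightarrow> 0 < e \<Longrightarrow>
       \<exists>d>0. \<forall>x. norm x \<le> d \<longrightarrow> norm (k (t, x) - (x - P t (D_u F (t, 0) x))) \<le> e * norm x"
proof -
  let ?T = "D_u F"
  note Tc = has_derivative_D_u(2) [OF C1] and Fc = continuous_on_C1_map [OF C1]
  obtain n :: nat and \<psi> :: "nat \<Rightarrow> real \<times> 'u \<Rightarrow> real" and Bj :: "nat \<Rightarrow> ('u \<Rightarrow>\<^sub>L 'v)" where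
    psi: "\<And>j. continuous_on UNIV (\<psi> j)" "\<And>j. finite_rank (Bj j)" "\<And>j x. 0 \<le> \<psi> j x \<and> \<psi> j x \<le> 1"
    and GL: "\<And>x. x \<in> K \<Longrightarrow> ?T x + (\<Sum>j<n. \<psi> j x *\<^sub>R Bj j) \<in> GL"
    by (rule global_corrector_sum [OF Tc F3 K(1)]) (rule that, assumption+)
  define B where "B \<theta> = (\<Sum>j<n. \<psi> j \<theta> *\<^sub>R Bj j)" for \<theta>
  define A where "A \<theta> = ?T \<theta> + B \<theta>" for \<theta>
  have Bc: "continuous_on UNIV B" unfolding B_def by (intro continuous_intros psi(1))
  have Ac: "continuous_on UNIV A" unfolding A_def by (intro continuous_intros Bc Tc)
  have AGL: "A p \<in> GL" if "p \<in> K" for p using GL [OF that] by (simp add: A_def B_def)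
  let ?\<Phi> = "corrected_map F B"
  have \<Phi>c: "continuous_on UNIV (\<lambda>z. ?\<Phi> (fst z) (snd z))"
    unfolding corrected_map_def
    by (intro continuous_intros continuous_on_compose2 [OF Fc] continuous_on_compose2 [OF Bc]
        bounded_bilinear.continuous_on [OF bounded_bilinear_blinfun_apply]) auto

  \<comment> \<open>Uniform injectivity of the corrected map\<close>
  obtain e where e: "0 < e" and low: "\<And>p \<theta>. p \<in> K \<Longrightarrow> dist \<theta> p < e \<Longrightarrow>
      \<forall>u u'. dist u (snd \<theta>) < e \<and> dist u' (snd \<theta>) < e \<longrightarrow> e * norm (u - u') \<le> norm (?\<Phi> \<theta> u - ?\<Phi> \<theta> u')"
  proof (rule compact_uniform_radius [OF K(1), where Q = "\<lambda>e \<theta>. \<forall>u u'. dist u (snd \<theta>) < e \<and> dist u' (snd \<theta>) < e \<longrightarrow> e * norm (u - u') \<le> norm (?\<Phi> \<theta> u - ?\<Phi> \<theta> u')"])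
    fix p assume p: "p \<in> K"
    obtain m where m: "m > 0" "\<And>x. m * norm x \<le> norm (A p x)" using GL_lower_bound [OF AGL [OF p]] by blast
    obtain \<rho> where \<rho>: "0 < \<rho>" "\<And>\<theta> u u'. dist \<theta> p < \<rho> \<Longrightarrow> dist u (snd p) \<le> \<rho> \<Longrightarrow> dist u' (snd p) \<le> \<rho> \<Longrightarrow>
      norm (?\<Phi> \<theta> u - ?\<Phi> \<theta> u' - A p (u - u')) \<le> (m / 2) * norm (u - u')"
      using corrected_map_increment [OF C1 Bc, of "m / 2" p] m(1) unfolding A_def by auto
    define r where "r = min (\<rho> / 2) (m / 2)"
    show "\<exists>r>0. \<forall>\<theta>. dist \<theta> p < r \<longrightarrow> (\<forall>u u'. dist u (snd \<theta>) < r \<and> dist u' (snd \<theta>) < r \<longrightarrow> r * norm (u - u') \<le> norm (?\<Phi> \<theta> u - ?\<Phi> \<theta> u'))"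
    proof (intro exI [of _ r] conjI allI impI)
      show "0 < r" using \<rho> m by (simp add: r_def)
      fix \<theta> u u' assume \<theta>: "dist \<theta> p < r" and u: "dist u (snd \<theta>) < r \<and> dist u' (snd \<theta>) < r"
      have s: "dist (snd \<theta>) (snd p) < r" using dist_snd_le [of \<theta> p] \<theta> by simp
      have "norm (?\<Phi> \<theta> u - ?\<Phi> \<theta> u' - A p (u - u')) \<le> (m / 2) * norm (u - u')"
        using \<rho>(1) \<theta> u s dist_triangle [of u "snd p" "snd \<theta>"] dist_triangle [of u' "snd p" "snd \<theta>"]
        by (intro \<rho>(2)) (auto simp: r_def)
      then have "m * norm (u - u') \<le> (m / 2) * norm (u - u') + norm (?\<Phi> \<theta> u - ?\<Phi> \<theta> u')"
        using m(2) [of "u - u'"] norm_triangle_ineq4 [of "?\<Phi> \<theta> u - ?\<Phi> \<theta> u'" "?\<Phi> \<theta> u - ?\<Phi> \<theta> u' - A p (u - u')"] by simp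
      moreover have "r * norm (u - u') \<le> (m / 2) * norm (u - u')" by (intro mult_right_mono) (auto simp: r_def)
      ultimately show "r * norm (u - u') \<le> norm (?\<Phi> \<theta> u - ?\<Phi> \<theta> u')" by (simp add: field_simps)
    qed
  next
    fix r r' :: real and \<theta> :: "real \<times> 'u"
    assume r: "0 < r'" "r' \<le> r" and Q: "\<forall>u u'. dist u (snd \<theta>) < r \<and> dist u' (snd \<theta>) < r \<longrightarrow> r * norm (u - u') \<le> norm (?\<Phi> \<theta> u - ?\<Phi> \<theta> u')"
    show "\<forall>u u'. dist u (snd \<theta>) < r' \<and> dist u' (snd \<theta>) < r' \<longrightarrow> r' * norm (u - u') \<le> norm (?\<Phi> \<theta> u - ?\<Phi> \<theta> u')"
    proof (intro allI impI)
      fix u u' assume "dist u (snd \<theta>) < r' \<and> dist u' (snd \<theta>) < r'"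
      then have "r * norm (u - u') \<le> norm (?\<Phi> \<theta> u - ?\<Phi> \<theta> u')" using Q r by auto
      moreover have "r' * norm (u - u') \<le> r * norm (u - u')" using r by (intro mult_right_mono) auto
      ultimately show "r' * norm (u - u') \<le> norm (?\<Phi> \<theta> u - ?\<Phi> \<theta> u')" by simp
    qed
  qed (auto intro: that)

  \<comment> \<open>Solvability by contraction\<close>
  obtain \<eta>' where eta': "0 < \<eta>'" and ex: "\<And>p \<theta>. p \<in> K \<Longrightarrow> dist \<theta> p < \<eta>' \<Longrightarrow> \<exists>u. dist u (snd \<theta>) < e / 2 \<and> ?\<Phi> \<theta> u = 0"
  proof (rule compact_uniform_radius [OF K(1), where Q = "\<lambda>r \<theta>. \<exists>u. dist u (snd \<theta>) < e / 2 \<and> ?\<Phi> \<theta> u = 0"])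
    fix p assume p: "p \<in> K"
    define N where "N = norm (inv_op (A p)) + 1"
    have N: "0 < N" by (simp add: N_def add_nonneg_pos)
    have iN: "norm (inv_op (A p) y) \<le> N * norm y" for y
      using norm_blinfun [of "inv_op (A p)" y] norm_ge_zero [of y] unfolding N_def distrib_right by linarith
    obtain \<rho>' where \<rho>': "0 < \<rho>'" "\<And>\<theta> u u'. dist \<theta> p < \<rho>' \<Longrightarrow> dist u (snd p) \<le> \<rho>' \<Longrightarrow> dist u' (snd p) \<le> \<rho>' \<Longrightarrow>
      norm (?\<Phi> \<theta> u - ?\<Phi> \<theta> u' - A p (u - u')) \<le> (1 / (2 * N)) * norm (u - u')"
      using corrected_map_increment [OF C1 Bc, of "1 / (2 * N)" p] N unfolding A_def by auto
    \<comment> \<open>The bound \<open>e / 8\<close> puts the solution within \<open>e / 2\<close>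
      of \<open>snd \<theta>\<close>, well inside the radius of injectivity.\<close>
    define \<rho> where "\<rho> = min \<rho>' (e / 8)"
    have \<rho>: "0 < \<rho>" using \<rho>' e by (simp add: \<rho>_def)
    have "continuous_on UNIV (\<lambda>\<theta>. ?\<Phi> \<theta> (snd p))"
      using continuous_on_compose2 [OF \<Phi>c, of UNIV "\<lambda>\<theta>. (\<theta>, snd p)"] by (simp add: continuous_on_Pair continuous_on_id)
    moreover have "0 < \<rho> / (2 * N)" using \<rho> N by simp
    ultimately obtain d where d: "0 < d" "\<And>\<theta>. dist \<theta> p < d \<Longrightarrow> dist (?\<Phi> \<theta> (snd p)) (?\<Phi> p (snd p)) < \<rho> / (2 * N)"
      unfolding continuous_on_iff by blast
    have zero: "?\<Phi> p (snd p) = 0" using p K(2) by (auto simp: corrected_map_def)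
    define r where "r = min d \<rho>"
    show "\<exists>r>0. \<forall>\<theta>. dist \<theta> p < r \<longrightarrow> (\<exists>u. dist u (snd \<theta>) < e / 2 \<and> ?\<Phi> \<theta> u = 0)"
    proof (intro exI [of _ r] conjI allI impI)
      show "0 < r" using d \<rho> by (simp add: r_def)
      fix \<theta> assume \<theta>: "dist \<theta> p < r"
      \<comment> \<open>Newton iteration with the derivative frozen at \<open>p\<close>; the
        increment bound \<open>1 / (2 * N)\<close> makes it a contraction with factor 1/2.\<close>
      define g where "g u = u - inv_op (A p) (?\<Phi> \<theta> u)" for u
      have lip: "dist (g u) (g u') \<le> (1 / 2) * dist u u'" if "u \<in> cball (snd p) \<rho>" "u' \<in> cball (snd p) \<rho>" for u u'
      proof -
        have "g u - g u' = - inv_op (A p) (?\<Phi> \<theta> u - ?\<Phi> \<theta> u' - A p (u - u'))"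
          unfolding g_def blinfun.diff_right [of "inv_op (A p)"] inv_op_apply(1) [OF AGL [OF p]] by simp
        then have "norm (g u - g u') \<le> N * norm (?\<Phi> \<theta> u - ?\<Phi> \<theta> u' - A p (u - u'))" using iN by simp
        also have "\<dots> \<le> N * ((1 / (2 * N)) * norm (u - u'))"
          using that \<theta> N by (intro mult_left_mono \<rho>'(2)) (auto simp: r_def \<rho>_def dist_commute)
        finally show ?thesis using N by (simp add: dist_norm)
      qed
      have "dist (g (snd p)) (snd p) \<le> \<rho> / 2"
      proof -
        have "norm (inv_op (A p) (?\<Phi> \<theta> (snd p))) \<le> N * norm (?\<Phi> \<theta> (snd p))" by (rule iN)
        also have "\<dots> \<le> N * (\<rho> / (2 * N))" using d(2) [of \<theta>] \<theta> zero N by (intro mult_left_mono) (auto simp: r_def)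
        finally show ?thesis using N by (simp add: g_def dist_norm)
      qed
      then have "g ` cball (snd p) \<rho> \<subseteq> cball (snd p) \<rho>"
      proof -
        have "dist (snd p) (g u) \<le> \<rho>" if "dist (snd p) u \<le> \<rho>" for u
          using lip [of u "snd p"] that \<rho> \<open>dist (g (snd p)) (snd p) \<le> \<rho> / 2\<close> dist_triangle [of "g u" "snd p" "g (snd p)"]
          by (simp add: dist_commute)
        then show ?thesis by auto
      qed
      then have "\<exists>!u. u \<in> cball (snd p) \<rho> \<and> g u = u"
        by (rule Banach_fix [OF _ _ _ _ _ lip, rotated 4]) (use \<rho> in \<open>auto simp: complete_eq_closed\<close>)
      then obtain u where u: "u \<in> cball (snd p) \<rho>" "g u = u" by blast
      have "inv_op (A p) (?\<Phi> \<theta> u) = 0" using u(2) by (simp add: g_def)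
      then have "?\<Phi> \<theta> u = 0" using inv_op_apply(2) [OF AGL [OF p], of "?\<Phi> \<theta> u"] by simp
      moreover have "dist u (snd \<theta>) < e / 2"
        using u(1) \<theta> e dist_snd_le [of \<theta> p] dist_triangle [of u "snd \<theta>" "snd p"] by (auto simp: r_def \<rho>_def dist_commute)
      ultimately show "\<exists>u. dist u (snd \<theta>) < e / 2 \<and> ?\<Phi> \<theta> u = 0" by blast
    qed
  qed (auto intro: that)

  \<comment> \<open>The solution map and its fixed points\<close>
  define \<eta> where "\<eta> = min e \<eta>'"
  have eta: "0 < \<eta>" using e eta' by (simp add: \<eta>_def)
  \<comment> \<open>On \<open>Y \<eta>\<close> the choice is unique, since by \<open>low\<close> two
    solutions within \<open>e\<close> of \<open>snd \<theta>\<close> coincide; this is what makes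
    \<open>k\<close> continuous.\<close>
  define k where "k \<theta> = (SOME u. dist u (snd \<theta>) < e / 2 \<and> ?\<Phi> \<theta> u = 0)" for \<theta>
  have k: "dist (k \<theta>) (snd \<theta>) < e / 2" "?\<Phi> \<theta> (k \<theta>) = 0" if Y\<theta>: "\<theta> \<in> Y \<eta>" for \<theta>
  proof -
    obtain p where p: "p \<in> K" "dist \<theta> p < \<eta>'" using Y\<theta> unfolding Y_def \<eta>_def min_less_iff_conj by blast
    note ex [OF p]
    from someI_ex [OF this, folded k_def] show "dist (k \<theta>) (snd \<theta>) < e / 2" "?\<Phi> \<theta> (k \<theta>) = 0" by auto
  qed
  have lowY: "e * norm (k \<theta> - u) \<le> norm (?\<Phi> \<theta> u)" if Y\<theta>: "\<theta> \<in> Y \<eta>" "dist u (snd \<theta>) < e" for \<theta> u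
  proof -
    obtain p where p: "p \<in> K" "dist \<theta> p < e" using Y\<theta> unfolding Y_def \<eta>_def min_less_iff_conj by blast
    have "dist (k \<theta>) (snd \<theta>) < e" using k(1) [OF that(1)] e by simp
    then have "e * norm (k \<theta> - u) \<le> norm (?\<Phi> \<theta> (k \<theta>) - ?\<Phi> \<theta> u)" using low [OF p] that(2) by blast
    then show ?thesis using k(2) [OF that(1)] by simp
  qed
  have YK: "K \<subseteq> Y \<eta>"
  proof
    fix p assume "p \<in> K"
    then show "p \<in> Y \<eta>" unfolding Y_def using eta by (intro CollectI bexI [of _ p]) auto
  qed
  have kc: "continuous_on (Y \<eta>) k"
    unfolding continuous_on_iff
  proof (intro ballI allI impI)
    fix \<theta> and \<epsilon> :: real assume \<theta>: "\<theta> \<in> Y \<eta>" and \<epsilon>: "0 < \<epsilon>"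
    have "continuous_on UNIV (\<lambda>\<theta>'. ?\<Phi> \<theta>' (k \<theta>))"
      using continuous_on_compose2 [OF \<Phi>c, of UNIV "\<lambda>\<theta>'. (\<theta>', k \<theta>)"] by (simp add: continuous_on_Pair continuous_on_id)
    moreover have "0 < e * \<epsilon>" using e \<epsilon> by simp
    ultimately obtain d where d: "0 < d" "\<And>\<theta>'. dist \<theta>' \<theta> < d \<Longrightarrow> dist (?\<Phi> \<theta>' (k \<theta>)) (?\<Phi> \<theta> (k \<theta>)) < e * \<epsilon>"
      unfolding continuous_on_iff by blast
    show "\<exists>d>0. \<forall>x'\<in>Y \<eta>. dist x' \<theta> < d \<longrightarrow> dist (k x') (k \<theta>) < \<epsilon>"
    proof (intro exI [of _ "min d (e / 2)"] conjI ballI impI)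
      show "0 < min d (e / 2)" using d e by simp
      fix \<theta>' assume \<theta>': "\<theta>' \<in> Y \<eta>" "dist \<theta>' \<theta> < min d (e / 2)"
      have "dist (k \<theta>) (snd \<theta>') < e"
        using k(1) [OF \<theta>] \<theta>'(2) dist_snd_le [of \<theta>' \<theta>] dist_triangle [of "k \<theta>" "snd \<theta>'" "snd \<theta>"] by (simp add: dist_commute)
      from lowY [OF \<theta>'(1) this] have "e * norm (k \<theta>' - k \<theta>) < e * \<epsilon>" using d(2) [of \<theta>'] \<theta>'(2) k(2) [OF \<theta>] by simp
      then show "dist (k \<theta>') (k \<theta>) < \<epsilon>" using e by (simp add: dist_norm)
    qed
  qed
  have fix_iff: "k (t, x) = x \<longleftrightarrow> F (t, x) = 0" if "(t, x) \<in> Y \<eta>" for t x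
  proof
    assume "k (t, x) = x"
    then show "F (t, x) = 0" using k(2) [OF that] by (simp add: corrected_map_def)
  next
    assume "F (t, x) = 0"
    then have "e * norm (k (t, x) - x) \<le> 0" using lowY [OF that, of x] e by (simp add: corrected_map_def)
    then show "k (t, x) = x" using e by (simp add: mult_le_0_iff)
  qed

  \<comment> \<open>Compactness of the values of \<open>k\<close>\<close>
  obtain R where R: "\<And>\<theta>. \<theta> \<in> Y \<eta> \<Longrightarrow> norm \<theta> \<le> R"
  proof -
    obtain R where R: "\<And>p. p \<in> K \<Longrightarrow> norm p \<le> R" using compact_imp_bounded [OF K(1)] by (auto simp: bounded_iff)
    have "norm \<theta> \<le> R + \<eta>" if Y\<theta>: "\<theta> \<in> Y \<eta>" for \<theta>
    proof -
      obtain p where "p \<in> K" "dist \<theta> p < \<eta>" using Y\<theta> unfolding Y_def by blast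
      then show ?thesis using R [of p] norm_triangle_sub [of \<theta> p] by (simp add: dist_norm)
    qed
    then show thesis using that by blast
  qed
  define M where "M = cball (0 :: real \<times> 'u) (2 * R + e)"
  define Kj where "Kj j = closure (blinfun_apply (Bj j) ` cball 0 (2 * R + e))" for j
  have Kjc: "compact (Kj j)" for j
    using compact_op_finite_rank [OF psi(2)] unfolding compact_op_def Kj_def by blast
  \<comment> \<open>The coefficients will be \<open>- \<psi> j \<theta>\<close>, because the
    correction is moved to the other side of the equation; hence the interval from -1 to 0.\<close>
  define S where "S j = (\<lambda>(c, v). c *\<^sub>R v) ` ({-1..0::real} \<times> Kj j)" for j
  have Sc: "compact (S j)" for j unfolding S_def
    by (rule compact_continuous_image) (auto simp: case_prod_beta intro!: continuous_intros compact_Times Kjc)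
  have Sum: "\<exists>Q. compact Q \<and> (\<forall>f. (\<forall>j<i. f j \<in> S j) \<longrightarrow> (\<Sum>j<i. f j) \<in> Q)" for i
  proof (induction i)
    case (Suc i)
    then obtain Q where Q: "compact Q" "\<And>f. (\<forall>j<i. f j \<in> S j) \<Longrightarrow> (\<Sum>j<i. f j) \<in> Q" by blast
    have "(\<Sum>j<Suc i. f j) \<in> {x + y | x y. x \<in> Q \<and> y \<in> S i}" if "\<forall>j<Suc i. f j \<in> S j" for f
      using Q(2) [of f] that by auto
    then show ?case using compact_sums [OF Q(1) Sc [of i]] by blast
  qed (auto intro!: exI [of _ "{0}"])
  then obtain Q where Q: "compact Q" "\<And>f. (\<forall>j<n. f j \<in> S j) \<Longrightarrow> (\<Sum>j<n. f j) \<in> Q" by blast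
  have kM: "(fst \<theta>, k \<theta>) \<in> {z \<in> M. F z \<in> Q}" if \<theta>: "\<theta> \<in> Y \<eta>" for \<theta>
  proof -
    have x: "norm (snd \<theta>) \<le> R" "\<bar>fst \<theta>\<bar> \<le> R"
      using R [OF \<theta>] norm_snd_le [of "snd \<theta>" "fst \<theta>"] norm_fst_le [of "fst \<theta>" "snd \<theta>"] by auto
    have kx: "norm (k \<theta> - snd \<theta>) < e / 2" using k(1) [OF \<theta>] by (simp add: dist_norm)
    then have "norm (k \<theta>) \<le> R + e" using x e norm_triangle_sub [of "k \<theta>" "snd \<theta>"] by simp
    then have "(fst \<theta>, k \<theta>) \<in> M" using x norm_Pair_le [of "fst \<theta>" "k \<theta>"] by (simp add: M_def)
    moreover have "F (fst \<theta>, k \<theta>) = (\<Sum>j<n. (- \<psi> j \<theta>) *\<^sub>R Bj j (k \<theta> - snd \<theta>))"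
      using k(2) [OF \<theta>] by (simp add: corrected_map_def B_def blinfun.sum_left blinfun.scaleR_left sum_negf eq_neg_iff_add_eq_0)
    moreover have "(\<Sum>j<n. (- \<psi> j \<theta>) *\<^sub>R Bj j (k \<theta> - snd \<theta>)) \<in> Q"
    proof (intro Q(2) allI impI)
      fix j
      have "0 \<le> R" using x by (meson norm_ge_zero order_trans)
      then have "k \<theta> - snd \<theta> \<in> cball 0 (2 * R + e)" using kx e by simp
      then have "Bj j (k \<theta> - snd \<theta>) \<in> Kj j" unfolding Kj_def by (intro subsetD [OF closure_subset] imageI)
      then show "(- \<psi> j \<theta>) *\<^sub>R Bj j (k \<theta> - snd \<theta>) \<in> S j"
        using psi(3) [of j \<theta>] unfolding S_def by (intro image_eqI [of _ _ "(- \<psi> j \<theta>, Bj j (k \<theta> - snd \<theta>))"]) auto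
    qed
    ultimately show ?thesis by simp
  qed
  have "compact {z \<in> M. F z \<in> Q}" using F4 Q(1) unfolding proper_on_bounded_closed_def M_def by blast
  then have Zc: "compact (snd ` {z \<in> M. F z \<in> Q})" by (intro compact_continuous_image continuous_intros)
  have kZ: "k ` Y \<eta> \<subseteq> snd ` {z \<in> M. F z \<in> Q}"
  proof
    fix u assume "u \<in> k ` Y \<eta>"
    then obtain \<theta> where "\<theta> \<in> Y \<eta>" "u = k \<theta>" by blast
    then show "u \<in> snd ` {z \<in> M. F z \<in> Q}" using kM [of \<theta>] by force
  qed

  \<comment> \<open>The parametrix and the linearisation on the axis\<close>
  define P where "P t = inv_op (A (t, 0))" for t
  have Pc: "continuous_on {t. (t, 0) \<in> K} P"
    unfolding P_def
  proof (rule continuous_on_compose2 [OF continuous_on_inv_op])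
    show "continuous_on {t. (t, 0) \<in> K} (\<lambda>t. A (t, 0))"
      by (rule continuous_on_compose2 [OF Ac]) (auto intro!: continuous_intros)
  qed (use AGL in auto)
  have PA: "id_blinfun - (P t o\<^sub>L ?T (t, 0)) = P t o\<^sub>L B (t, 0)" if "(t, 0) \<in> K" for t
  proof (rule blinfun_eqI)
    fix x
    have "x = P t (?T (t, 0) x) + P t (B (t, 0) x)"
      using inv_op_apply(1) [OF AGL [OF that], of x] by (simp add: P_def A_def blinfun.add_left blinfun.add_right)
    then show "(id_blinfun - (P t o\<^sub>L ?T (t, 0))) x = (P t o\<^sub>L B (t, 0)) x"
      by (simp add: blinfun.diff_left algebra_simps)
  qed
  have lin: "\<exists>d>0. \<forall>x. norm x \<le> d \<longrightarrow> norm (k (t, x) - (x - P t (?T (t, 0) x))) \<le> \<epsilon> * norm x"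
    if tK: "(t, 0) \<in> K" and \<epsilon>: "0 < \<epsilon>" for t \<epsilon>
  proof -
    let ?p = "(t, 0 :: 'u)"
    define N where "N = norm (P t) + 1"
    have N: "0 < N" by (simp add: N_def add_nonneg_pos)
    have PN: "norm (P t y) \<le> N * norm y" for y
      using norm_blinfun [of "P t" y] norm_ge_zero [of y] unfolding N_def distrib_right by linarith
    define b where "b = norm (B ?p) + 1"
    have b: "1 \<le> b" by (simp add: b_def)
    \<comment> \<open>As \<open>e * norm (k (t, x)) \<le> b * norm x\<close>, an increment error
      \<open>\<delta>'\<close> per unit of \<open>k (t, x)\<close> is an error
      \<open>\<delta>\<close> per unit of \<open>x\<close>. The variation of \<open>B\<close>
      contributes another \<open>\<delta>\<close>, and \<open>P t\<close> multiplies by at most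
      \<open>N\<close>; hence \<open>2 * N\<close>. The bound 1 gives
      \<open>norm (B (t, x)) \<le> b\<close>.\<close>
    define \<delta> where "\<delta> = min 1 (\<epsilon> / (2 * N))"
    have \<delta>: "0 < \<delta>" using \<epsilon> N by (simp add: \<delta>_def)
    define \<delta>' where "\<delta>' = \<delta> * e / b"
    have \<delta>': "0 < \<delta>'" using \<delta> e b by (simp add: \<delta>'_def)
    obtain \<rho> where \<rho>: "0 < \<rho>" "\<And>\<theta> u u'. dist \<theta> ?p < \<rho> \<Longrightarrow> dist u (snd ?p) \<le> \<rho> \<Longrightarrow> dist u' (snd ?p) \<le> \<rho> \<Longrightarrow>
      norm (?\<Phi> \<theta> u - ?\<Phi> \<theta> u' - A ?p (u - u')) \<le> \<delta>' * norm (u - u')"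
      using corrected_map_increment [OF C1 Bc \<delta>', of ?p] unfolding A_def by auto
    obtain d1 where d1: "0 < d1" "\<And>\<theta>. dist \<theta> ?p < d1 \<Longrightarrow> dist (B \<theta>) (B ?p) < \<delta>"
      using Bc \<delta> unfolding continuous_on_iff by blast
    have pY: "?p \<in> Y \<eta>" using YK tK by blast
    obtain d2 where d2: "0 < d2" "\<And>\<theta>. \<theta> \<in> Y \<eta> \<Longrightarrow> dist \<theta> ?p < d2 \<Longrightarrow> dist (k \<theta>) (k ?p) < \<rho>"
      using kc pY \<rho>(1) unfolding continuous_on_iff by blast
    have k0: "k ?p = 0" using fix_iff [OF pY] F2 by simp
    define d where "d = Min {\<rho>, d1, d2, \<eta>, e} / 2"
    have d: "0 < d" "d < \<rho>" "d < d1" "d < d2" "d < \<eta>" "d < e"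
      using \<rho>(1) d1(1) d2(1) eta e by (auto simp: d_def min_def)
    show ?thesis
    proof (intro exI [of _ d] conjI allI impI d(1))
      fix x :: 'u assume x: "norm x \<le> d"
      have dx: "dist (t, x) ?p = norm x" by (simp add: dist_Pair_Pair dist_norm)
      have xY: "(t, x) \<in> Y \<eta>" using tK dx x d by (auto simp: Y_def intro!: bexI [of _ ?p])
      let ?k = "k (t, x)"
      have Bx: "norm (B (t, x) - B ?p) < \<delta>" using d1(2) [of "(t, x)"] dx x d by (simp add: dist_norm)
      then have "norm (B (t, x)) \<le> b"
        using norm_triangle_sub [of "B (t, x)" "B ?p"] by (simp add: b_def \<delta>_def)
      then have "norm (B (t, x) x) \<le> b * norm x"
        using norm_blinfun [of "B (t, x)" x] mult_right_mono [of "norm (B (t, x))" b "norm x"] by simp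
      moreover have "?\<Phi> (t, x) 0 = - B (t, x) x" by (simp add: corrected_map_def F2 blinfun.minus_right)
      ultimately have ek: "e * norm ?k \<le> b * norm x"
        using lowY [OF xY, of 0] x d by simp
      have "norm (?\<Phi> (t, x) ?k - ?\<Phi> (t, x) 0 - A ?p (?k - 0)) \<le> \<delta>' * norm (?k - 0)"
        using dx x d d2(2) [OF xY] k0 \<rho>(1) by (intro \<rho>(2)) auto
      then have "norm (B (t, x) x - A ?p ?k) \<le> \<delta>' * norm ?k"
        using k(2) [OF xY] \<open>?\<Phi> (t, x) 0 = - B (t, x) x\<close> by simp
      also have "\<dots> = (\<delta> / b) * (e * norm ?k)" by (simp add: \<delta>'_def)
      also have "\<dots> \<le> (\<delta> / b) * (b * norm x)" using \<delta> b by (intro mult_left_mono ek) auto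
      also have "\<dots> = \<delta> * norm x" using b by simp
      finally have 1: "norm (B (t, x) x - A ?p ?k) \<le> \<delta> * norm x" .
      have 2: "norm ((B (t, x) - B ?p) x) \<le> \<delta> * norm x"
        using norm_blinfun [of "B (t, x) - B ?p" x] mult_right_mono [OF less_imp_le [OF Bx], of "norm x"] by simp
      have "?k - (x - P t (?T ?p x)) = P t (A ?p ?k - B ?p x)"
      proof -
        have "x - P t (?T ?p x) = P t (B ?p x)"
          using arg_cong [OF PA [OF tK], of "\<lambda>f. blinfun_apply f x"] by (simp add: blinfun.diff_left)
        moreover have "P t (A ?p ?k) = ?k" using AGL [OF tK] by (simp add: P_def)
        ultimately show ?thesis by (simp add: blinfun.diff_right)
      qed
      also have "norm \<dots> \<le> N * norm (A ?p ?k - B ?p x)" by (rule PN)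
      also have "A ?p ?k - B ?p x = - (B (t, x) x - A ?p ?k) + (B (t, x) - B ?p) x" by (simp add: blinfun.diff_left)
      also have "N * norm \<dots> \<le> N * (2 * \<delta> * norm x)"
        using 1 2 N norm_triangle_ineq [of "- (B (t, x) x - A ?p ?k)" "(B (t, x) - B ?p) x"]
        by (intro mult_left_mono) (auto simp: norm_minus_commute)
      also have "\<dots> = (N * 2 * \<delta>) * norm x" by simp
      also have "\<dots> \<le> \<epsilon> * norm x"
      proof (rule mult_right_mono)
        have "N * 2 * \<delta> \<le> N * 2 * (\<epsilon> / (2 * N))" using N by (intro mult_left_mono) (auto simp: \<delta>_def)
        then show "N * 2 * \<delta> \<le> \<epsilon>" using N by simp
      qed simp
      finally show "norm (?k - (x - P t (?T ?p x))) \<le> \<epsilon> * norm x" .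
    qed
  qed
  have finr: "finite_rank (id_blinfun - (P t o\<^sub>L ?T (t, 0)))" if "(t, 0) \<in> K" for t
    unfolding PA [OF that] by (intro finite_rank_compose_left) (simp add: B_def finite_rank_sum finite_rank_scaleR psi(2))
  show thesis
  proof (rule that [OF eta kc Zc kZ fix_iff Pc _ finr lin])
    show "P t \<in> GL" if "(t, 0) \<in> K" for t using inv_op_GL [OF AGL [OF that]] by (simp add: P_def)
  qed
qed

subsection \<open>Degree of slices\<close>

text \<open>In a compact Hausdorff space two disjoint closed sets that no connected set joins can be
  separated by a clopen set. This is applied to the part of \<open>S\<close> in the closure of a
  bounded open \<open>V\<close>, with \<open>C\<close> and the part outside \<open>V\<close>. As
  \<open>A\<close> stays inside \<open>V\<close>, it is relatively open in all of
  \<open>S\<close>.\<close>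

lemma compact_open_component_neighbourhood:
  fixes S :: "'a::real_normed_vector set"
  assumes S: "closed S" "\<And>R. compact (S \<inter> cball 0 R)" and C: "C \<in> components S" "bounded C"
    and W: "open W" "C \<subseteq> W"
  obtains A where "compact A" "C \<subseteq> A" "A \<subseteq> W" "A \<subseteq> S" "closed (S - A)"
proof -
  obtain R where R: "C \<subseteq> ball 0 R" using C(2) bounded_subset_ballD by blast
  define V where "V = W \<inter> ball 0 R"
  have V: "open V" "C \<subseteq> V" using W R by (auto simp: V_def)
  define X where "X = S \<inter> closure V"
  have "closure V \<subseteq> cball 0 R"
    by (rule closure_minimal) (auto simp: V_def)
  then have Xe: "X = (S \<inter> cball 0 R) \<inter> closure V" by (auto simp: X_def)
  have X: "compact X" unfolding Xe by (intro compact_Int_closed S(2) closed_closure)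
  have CS: "C \<subseteq> S" using C(1) in_components_subset by blast
  have CX: "C \<subseteq> X" using CS V(2) closure_subset by (auto simp: X_def)
  have "separated_between (top_of_set X) C (X - V)"
  proof (rule cut_wire_fence_theorem)
    show "compact_space (top_of_set X)" using X by (simp add: compact_space_subtopology)
    show "Hausdorff_space (top_of_set X)" by (simp add: Hausdorff_space_subtopology)
    show "closedin (top_of_set X) C"
      using closed_components [OF S(1) C(1)] CX by (metis closed_subset)
    show "closedin (top_of_set X) (X - V)"
      using compact_imp_closed [OF X] V(1) by (intro closed_subset closed_Diff) auto
    fix D assume "connectedin (top_of_set X) D"
    then have D: "connected D" "D \<subseteq> X" by (auto simp: connectedin_subtopology)
    show "disjnt D C \<or> disjnt D (X - V)"
    proof (cases "D \<inter> C = {}")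
      case False
      have "D \<subseteq> C" by (rule components_maximal [OF C(1) D(1)]) (use D False in \<open>auto simp: X_def\<close>)
      then show ?thesis using V(2) by (auto simp: disjnt_def)
    qed (auto simp: disjnt_def)
  qed
  then obtain A B where AB: "closedin (top_of_set X) A" "closedin (top_of_set X) B" "A \<union> B = X" "disjnt A B" "C \<subseteq> A" "X - V \<subseteq> B"
    unfolding separated_between_alt by auto
  have cl: "closed A" "closed B" using AB(1,2) compact_imp_closed [OF X] closedin_closed_trans by blast+
  have AV: "A \<subseteq> V" using AB(3,4,6) by (auto simp: disjnt_def)
  have "S - A = (S - V) \<union> B"
  proof
    show "S - A \<subseteq> (S - V) \<union> B" using AB(3) closure_subset [of V] by (auto simp: X_def)
    show "(S - V) \<union> B \<subseteq> S - A" using AB(3,4) AV by (auto simp: X_def disjnt_def)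
  qed
  then have "closed (S - A)" using cl(2) S(1) V(1) by (auto intro!: closed_Un closed_Diff)
  moreover have "compact A" using AB(3) X cl(1) by (metis compact_Int_closed inf.absorb_iff2 sup_ge1)
  ultimately show thesis using that [of A] AB(3,5) AV by (auto simp: V_def X_def)
qed

text \<open>Almost fixed points have a convergent subsequence, because the values of
  \<open>k\<close> lie in a compact set and the parameters are bounded; the limit would be a fixed
  point in \<open>Q\<close>.\<close>

lemma fixed_point_gap:
  fixes k :: "real \<times> 'u::banach \<Rightarrow> 'u"
  assumes Q: "closed Q" "bounded Q" and k: "continuous_on Q k" "compact Z" "k ` Q \<subseteq> Z"
    and free: "\<And>t x. (t, x) \<in> Q \<Longrightarrow> k (t, x) \<noteq> x"
  obtains e where "0 < e" "\<And>t x. (t, x) \<in> Q \<Longrightarrow> e \<le> norm (x - k (t, x))"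
proof (rule ccontr)
  assume no: "\<not> thesis"
  have "\<exists>\<theta>\<in>Q. norm (snd \<theta> - k \<theta>) < 1 / real (Suc n)" for n
  proof (rule ccontr)
    assume "\<not> (\<exists>\<theta>\<in>Q. norm (snd \<theta> - k \<theta>) < 1 / real (Suc n))"
    then have "\<And>t x. (t, x) \<in> Q \<Longrightarrow> 1 / real (Suc n) \<le> norm (x - k (t, x))" by force
    then show False using no that [of "1 / real (Suc n)"] by simp
  qed
  then obtain \<theta> where \<theta>: "\<And>n. \<theta> n \<in> Q" "\<And>n. norm (snd (\<theta> n) - k (\<theta> n)) < 1 / real (Suc n)" by metis
  obtain R where R: "\<And>\<theta>. \<theta> \<in> Q \<Longrightarrow> norm \<theta> \<le> R" using Q(2) by (auto simp: bounded_iff)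
  have "compact ({-R..R} \<times> Z)" by (intro compact_Times k(2)) auto
  moreover have "(fst (\<theta> n), k (\<theta> n)) \<in> {-R..R} \<times> Z" for n
    using R [OF \<theta>(1), of n] norm_fst_le [of "fst (\<theta> n)" "snd (\<theta> n)"] k(3) \<theta>(1) [of n] by auto
  ultimately obtain l r where l: "l \<in> {-R..R} \<times> Z" "strict_mono r" "((\<lambda>n. (fst (\<theta> n), k (\<theta> n))) \<circ> r) \<longlonglongrightarrow> l"
    unfolding compact_def by (metis (no_types, lifting))
  have l1: "(\<lambda>n. fst (\<theta> (r n))) \<longlonglongrightarrow> fst l" and l2: "(\<lambda>n. k (\<theta> (r n))) \<longlonglongrightarrow> snd l"
    using tendsto_fst [OF l(3)] tendsto_snd [OF l(3)] by (auto simp: o_def)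
  have "(\<lambda>n. snd (\<theta> n) - k (\<theta> n)) \<longlonglongrightarrow> 0"
  proof (rule Lim_null_comparison)
    show "(\<lambda>n. 1 / real (Suc n)) \<longlonglongrightarrow> 0" using LIMSEQ_inverse_real_of_nat by (simp add: inverse_eq_divide)
    show "\<forall>\<^sub>F n in sequentially. norm (snd (\<theta> n) - k (\<theta> n)) \<le> 1 / real (Suc n)"
      using \<theta>(2) less_imp_le by (intro always_eventually allI) blast
  qed
  from LIMSEQ_subseq_LIMSEQ [OF this l(2)] have "(\<lambda>n. snd (\<theta> (r n)) - k (\<theta> (r n))) \<longlonglongrightarrow> 0" by (simp add: o_def)
  from tendsto_add [OF this l2] have "(\<lambda>n. snd (\<theta> (r n))) \<longlonglongrightarrow> snd l" by simp
  from tendsto_Pair [OF l1 this] have lim: "(\<lambda>n. \<theta> (r n)) \<longlonglongrightarrow> l" by simp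
  then have lQ: "l \<in> Q" by (rule closed_sequentially [OF Q(1) \<theta>(1)])
  have "(k \<circ> (\<lambda>n. \<theta> (r n))) \<longlonglongrightarrow> k l"
    using k(1) [unfolded continuous_on_sequentially, rule_format, OF lQ, of "\<lambda>n. \<theta> (r n)"] \<theta>(1) lim by blast
  then have "(\<lambda>n. k (\<theta> (r n))) \<longlonglongrightarrow> k l" by (simp only: o_def)
  then have "k l = snd l" by (rule LIMSEQ_unique [OF _ l2])
  then show False using free [of "fst l" "snd l"] lQ by simp
qed

lemma sum_telescope_int:
  fixes f :: "int \<Rightarrow> 'a::ab_group_add"
  assumes "a \<le> c" shows "(\<Sum>n\<in>{a..c}. f n - f (n - 1)) = f c - f (a - 1)"
  using assms
proof (induction c rule: int_ge_induct)
  case (step i)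
  have "{a..i + 1} = insert (i + 1) {a..i}" using step by auto
  then show ?case using step by simp
qed simp

text \<open>Leaving the ball of radius \<open>\<eta>\<close> in or out changes the degree of the slices by the index
  of the trivial solution. With the ball the degree is constant across the gaps in \<open>B\<close>,
  without it across all other gaps and to both ends, where the slices are empty.\<close>

lemma index_sum_zero:
  fixes k :: "real \<times> 'u::banach \<Rightarrow> 'u" and M :: "int \<Rightarrow> ('u \<Rightarrow>\<^sub>L 'u)" and \<mu> :: "int \<Rightarrow> real"
  assumes \<Omega>: "open \<Omega>" "bounded \<Omega>" and Y: "open Y" "closure \<Omega> \<subseteq> Y"
    and k: "continuous_on Y k" "compact Z" "k ` Y \<subseteq> Z"
    and n: "n\<^sub>0 \<le> n\<^sub>1" and B: "B \<subseteq> {n\<^sub>0..n\<^sub>1}"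
    and mono: "\<And>m n. n\<^sub>0 - 1 \<le> m \<Longrightarrow> m \<le> n \<Longrightarrow> n \<le> n\<^sub>1 \<Longrightarrow> \<mu> m \<le> \<mu> n"
    and eta: "0 < \<eta>" and axis: "\<And>n t x. n \<in> B \<Longrightarrow> t \<in> {\<mu> (n - 1)..\<mu> n} \<Longrightarrow> norm x \<le> \<eta> \<Longrightarrow> (t, x) \<in> \<Omega>"
    and zeros: "\<And>t x. (t, x) \<in> closure \<Omega> \<Longrightarrow> k (t, x) = x \<Longrightarrow> x \<noteq> 0 \<Longrightarrow>
      (t, x) \<in> \<Omega> \<and> (\<eta> < norm x \<or> (\<exists>n\<in>B. t \<in> {\<mu> (n - 1)<..<\<mu> n}))"
    and M: "\<And>n. n \<in> {n\<^sub>0 - 1..n\<^sub>1} \<Longrightarrow> M n \<in> GL" "\<And>n. n \<in> {n\<^sub>0 - 1..n\<^sub>1} \<Longrightarrow> finite_rank (id_blinfun - M n)"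
    and lin: "\<And>n x. n \<in> {n\<^sub>0 - 1..n\<^sub>1} \<Longrightarrow> norm x \<le> \<eta> \<Longrightarrow> norm (k (\<mu> n, x) - (x - M n x)) \<le> norm (M n x) / 2"
  shows "(\<Sum>n\<in>B. deg_LS (M n) - deg_LS (M (n - 1))) = 0"
proof -
  let ?N = "{n\<^sub>0 - 1..n\<^sub>1}"

  \<comment> \<open>Position of the base points relative to the gaps in \<open>B\<close>\<close>
  have finB: "finite B" using B finite_subset by blast
  define G where "G = (\<Union>n\<in>B. {\<mu> (n - 1)<..<\<mu> n})"
  define H where "H = (\<Union>n\<in>B. {\<mu> (n - 1)..\<mu> n})"
  have G: "open G" unfolding G_def by auto
  have H: "closed H" unfolding H_def using finB by auto
  have muG: "t \<notin> G" if "t \<in> {\<mu> (n - 1)..\<mu> n}" "n \<in> {n\<^sub>0..n\<^sub>1}" "n \<notin> B" for t n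
  proof
    assume "t \<in> G"
    then obtain m where m: "m \<in> B" "\<mu> (m - 1) < t" "t < \<mu> m" by (auto simp: G_def)
    have mN: "m \<in> {n\<^sub>0..n\<^sub>1}" using m B by blast
    have "m \<noteq> n" using m(1) that(3) by blast
    then consider "m \<le> n - 1" | "n \<le> m - 1" by linarith
    then show False
    proof cases
      case 1 then show False using mono [of m "n - 1"] m that mN by auto
    next
      case 2 then show False using mono [of n "m - 1"] m that mN by auto
    qed
  qed
  have muG': "\<mu> n \<notin> G" if "n \<in> ?N" for n
  proof
    assume "\<mu> n \<in> G"
    then obtain m where m: "m \<in> B" "\<mu> (m - 1) < \<mu> n" "\<mu> n < \<mu> m" by (auto simp: G_def)
    have mN: "m \<in> {n\<^sub>0..n\<^sub>1}" using m B by blast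
    show False
    proof (cases "m \<le> n")
      case True then show False using mono [of m n] m that mN by auto
    next
      case False then show False using mono [of n "m - 1"] m that mN by auto
    qed
  qed
  have leftG: "t \<notin> G" if "t \<le> \<mu> (n\<^sub>0 - 1)" for t
  proof
    assume "t \<in> G"
    then obtain m where m: "m \<in> B" "\<mu> (m - 1) < t" by (auto simp: G_def)
    then have "m \<in> {n\<^sub>0..n\<^sub>1}" using B by blast
    then show False using mono [of "n\<^sub>0 - 1" "m - 1"] m that by auto
  qed
  have rightG: "t \<notin> G" if "\<mu> n\<^sub>1 \<le> t" for t
  proof
    assume "t \<in> G"
    then obtain m where m: "m \<in> B" "t < \<mu> m" by (auto simp: G_def)
    then have "m \<in> {n\<^sub>0..n\<^sub>1}" using B by blast
    then show False using mono [of m "n\<^sub>1"] m that by auto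
  qed
  \<comment> \<open>All places where a fixed point would spoil a homotopy: points of the frontier of
    \<open>\<Omega>\<close> that are away from the axis or over \<open>H\<close>, and the lateral
    surface of the removed tube outside \<open>G\<close>. With \<open>G\<close> open and
    \<open>H\<close> closed, \<open>Q\<close> is closed.\<close>
  define Q where "Q = {\<theta> \<in> closure \<Omega>. (\<theta> \<notin> \<Omega> \<and> (\<eta> \<le> norm (snd \<theta>) \<or> fst \<theta> \<in> H)) \<or> (norm (snd \<theta>) = \<eta> \<and> fst \<theta> \<notin> G)}"
  have Qeq: "Q = closure \<Omega> \<inter> ((- \<Omega> \<inter> ({\<theta>. \<eta> \<le> norm (snd \<theta>)} \<union> fst -` H)) \<union> ({\<theta>. norm (snd \<theta>) = \<eta>} \<inter> fst -` (- G)))"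
    by (auto simp: Q_def)
  have Qcl: "closed Q" unfolding Qeq
    by (intro closed_Int closed_Un closed_closure closed_Collect_le closed_Collect_eq continuous_intros closed_vimage)
      (use \<Omega>(1) G H in \<open>auto simp: closed_Compl\<close>)
  have Qb: "bounded Q" by (rule bounded_subset [OF bounded_closure [OF \<Omega>(2)]]) (auto simp: Q_def)
  have QY: "Q \<subseteq> Y" using Y(2) by (auto simp: Q_def)
  have Qfree: "k (t, x) \<noteq> x" if tx: "(t, x) \<in> Q" for t x
  proof
    assume kx: "k (t, x) = x"
    have cl: "(t, x) \<in> closure \<Omega>" using tx by (simp add: Q_def)
    show False
    proof (cases "x = 0")
      case True
      then have "t \<in> H" "(t, x) \<notin> \<Omega>" using tx eta by (auto simp: Q_def)
      then show False using axis [of _ t x] True eta by (auto simp: H_def)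
    next
      case False
      then show False using zeros [OF cl kx] tx by (auto simp: Q_def G_def)
    qed
  qed
  obtain e where e: "0 < e" "\<And>t x. (t, x) \<in> Q \<Longrightarrow> e \<le> norm (x - k (t, x))"
    by (rule fixed_point_gap [OF Qcl Qb continuous_on_subset [OF k(1) QY] k(2) _ Qfree])
      (use k(3) QY in auto)
  have "\<exists>m>0. \<forall>x. m * norm x \<le> norm (M n x)" if "n \<in> ?N" for n
    using GL_lower_bound [OF M(1) [OF that]] by metis
  then obtain lo where lo: "\<And>n. n \<in> ?N \<Longrightarrow> 0 < lo n" "\<And>n x. n \<in> ?N \<Longrightarrow> lo n * norm x \<le> norm (M n x)"
    by metis
  \<comment> \<open>Besides the gap \<open>e\<close>, the approximation has to respect half of the
    lower bound of \<open>M n\<close> on the sphere of radius \<open>\<eta>\<close>; the other half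
    is taken by \<open>lin\<close>.\<close>
  define e' where "e' = Min (insert e ((\<lambda>n. lo n * \<eta> / 2) ` ?N))"
  have e': "0 < e'" "e' \<le> e" "\<And>n. n \<in> ?N \<Longrightarrow> e' \<le> lo n * \<eta> / 2"
  proof -
    show "0 < e'" unfolding e'_def using e(1) lo(1) eta by (subst Min_gr_iff) auto
    show "e' \<le> e" unfolding e'_def by (rule Min_le) auto
    show "e' \<le> lo n * \<eta> / 2" if "n \<in> ?N" for n unfolding e'_def by (rule Min_le) (use that in auto)
  qed

  \<comment> \<open>Passage to finite dimension\<close>
  obtain Gs sp where sp: "finite Gs" "continuous_on Z sp" "\<And>z. z \<in> Z \<Longrightarrow> sp z \<in> span Gs \<and> norm (z - sp z) < e'"
    by (rule schauder_projection [OF k(2) e'(1)]) (rule that, assumption+)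
  have "\<exists>Gn. finite Gn \<and> range (blinfun_apply (id_blinfun - M n)) \<subseteq> span Gn" if "n \<in> ?N" for n
    using M(2) [OF that] by (simp add: finite_rank_def)
  then obtain Gn where Gn: "\<And>n. n \<in> ?N \<Longrightarrow> finite (Gn n)" "\<And>n. n \<in> ?N \<Longrightarrow> range (blinfun_apply (id_blinfun - M n)) \<subseteq> span (Gn n)"
    by metis
  \<comment> \<open>One space that contains the approximating values and is invariant under every
    \<open>M n\<close>.\<close>
  define GG where "GG = Gs \<union> (\<Union>n\<in>?N. Gn n)"
  have finGG: "finite GG" using sp(1) Gn(1) by (auto simp: GG_def)
  define E where "E = span GG"
  have spE: "sp z \<in> E" if "z \<in> Z" for z
    using sp(3) [OF that] span_mono [of Gs GG] by (auto simp: E_def GG_def)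
  have ME: "x - M n x \<in> E" if "n \<in> ?N" for n x
  proof -
    have "(id_blinfun - M n) x \<in> span (Gn n)" using Gn(2) [OF that] by blast
    moreover have "span (Gn n) \<subseteq> E" unfolding E_def using that by (intro span_mono) (auto simp: GG_def)
    ultimately show ?thesis by (auto simp: blinfun.diff_left)
  qed
  show ?thesis
  proof (cases "E = {0}")
    case True
    have "M n = id_blinfun" if "n \<in> ?N" for n
      by (rule blinfun_eqI) (use ME [OF that] True in auto)
    then have "deg_LS (M n) = 1" if "n \<in> ?N" for n using that by (simp add: deg_LS_id)
    then show ?thesis using B by (intro sum.neutral) fastforce
  next
    case False
    obtain b p where b: "basis_seq b p" and bE: "span (b ` {..p}) = E"
      using basis_seq_of_span [OF finGG] False unfolding E_def by blast
    have E0: "0 \<in> E" "subspace E" by (auto simp: E_def span_zero)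
    \<comment> \<open>The value 0 off \<open>Y\<close> only keeps \<open>kt\<close> inside
      \<open>E\<close>; continuity is used on the open set \<open>Y\<close>, which contains all the
      relevant frontier points.\<close>
    define kt where "kt \<theta> = (if \<theta> \<in> Y then sp (k \<theta>) else 0)" for \<theta>
    define q where "q \<theta> = snd \<theta> - kt \<theta>" for \<theta>
    have ktE: "kt \<theta> \<in> E" for \<theta> using spE k(3) E0(1) by (auto simp: kt_def)
    have qE: "q \<theta> \<in> E" if "snd \<theta> \<in> E" for \<theta> unfolding q_def using ktE that E0(2) by (intro subspace_diff)
    have "continuous_on Y (\<lambda>\<theta>. sp (k \<theta>))"
      by (rule continuous_on_compose2 [OF sp(2) k(1) k(3)])
    then have "continuous_on Y kt" by (simp add: kt_def cong: continuous_on_cong)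
    then have ktc: "isCont kt \<theta>" if "\<theta> \<in> Y" for \<theta> using that Y(1) continuous_on_eq_continuous_at by blast
    then have qc: "isCont q \<theta>" if "\<theta> \<in> Y" for \<theta> unfolding q_def using that by (intro continuous_intros)
    have near: "norm (k \<theta> - kt \<theta>) < e'" if "\<theta> \<in> Y" for \<theta>
      using sp(3) [of "k \<theta>"] k(3) that by (auto simp: kt_def)
    have qnz: "q \<theta> \<noteq> 0" if "\<theta> \<in> Q" for \<theta>
    proof
      assume "q \<theta> = 0"
      then have "norm (snd \<theta> - k \<theta>) < e'" using near [of \<theta>] that QY by (auto simp: q_def norm_minus_commute)
      then show False using e(2) [of "fst \<theta>" "snd \<theta>"] that e'(2) by simp
    qed
    define \<Omega>1 where "\<Omega>1 = \<Omega> - UNIV \<times> ball 0 \<eta>"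
    have fr2: "\<theta> \<in> Q" if "\<theta> \<in> frontier \<Omega>" "fst \<theta> \<in> H" for \<theta>
      using that \<Omega>(1) by (auto simp: Q_def frontier_def interior_open)
    have fr1: "\<theta> \<in> Q" if \<theta>: "\<theta> \<in> frontier \<Omega>1" "fst \<theta> \<notin> G" for \<theta>
    proof -
      have "\<Omega>1 \<subseteq> closure \<Omega> \<inter> {\<theta>. \<eta> \<le> norm (snd \<theta>)}" using closure_subset [of \<Omega>] by (auto simp: \<Omega>1_def)
      then have "closure \<Omega>1 \<subseteq> closure \<Omega> \<inter> {\<theta>. \<eta> \<le> norm (snd \<theta>)}"
        by (rule closure_minimal) (intro closed_Int closed_closure closed_Collect_le continuous_intros)
      then have c: "\<theta> \<in> closure \<Omega>" "\<eta> \<le> norm (snd \<theta>)" using \<theta>(1) by (auto simp: frontier_def)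
      have "\<Omega> \<inter> {\<theta>. \<eta> < norm (snd \<theta>)} \<subseteq> interior \<Omega>1"
      proof (rule interior_maximal)
        show "open (\<Omega> \<inter> {\<theta>. \<eta> < norm (snd \<theta>)})" by (intro open_Int \<Omega>(1) open_Collect_less continuous_intros)
      qed (auto simp: \<Omega>1_def)
      then have "\<not> (\<theta> \<in> \<Omega> \<and> \<eta> < norm (snd \<theta>))" using \<theta>(1) by (auto simp: frontier_def)
      then show ?thesis using c \<theta>(2) by (auto simp: Q_def)
    qed
    have b1: "bounded \<Omega>1" using \<Omega>(2) by (rule bounded_subset) (auto simp: \<Omega>1_def)
    have hom2: "\<forall>\<^sub>F m in sequentially. grid_degree b p m (\<lambda>x. q (s, x)) {x. (s, x) \<in> \<Omega>} = grid_degree b p m (\<lambda>x. q (t, x)) {x. (t, x) \<in> \<Omega>}"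
      if st: "s \<le> t" "{s..t} \<subseteq> H" for s t
    proof (rule grid_degree_homotopy [OF b st(1) \<Omega>(2)])
      fix \<theta>
      show "q \<theta> \<in> span (b ` {..p})" if "\<theta> \<in> {s..t} \<times> span (b ` {..p})"
        unfolding bE by (rule qE) (use that bE in auto)
      assume th: "\<theta> \<in> frontier \<Omega> \<inter> {s..t} \<times> span (b ` {..p})"
      have Q\<theta>: "\<theta> \<in> Q" by (rule fr2) (use th st(2) in auto)
      then show "q \<theta> \<noteq> 0" by (rule qnz)
      show "continuous (at \<theta> within {s..t} \<times> span (b ` {..p})) q"
        by (rule continuous_at_imp_continuous_at_within, rule qc) (use Q\<theta> QY in blast)
    qed
    have hom1: "\<forall>\<^sub>F m in sequentially. grid_degree b p m (\<lambda>x. q (s, x)) {x. (s, x) \<in> \<Omega>1} = grid_degree b p m (\<lambda>x. q (t, x)) {x. (t, x) \<in> \<Omega>1}"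
      if st: "s \<le> t" "{s..t} \<inter> G = {}" for s t
    proof (rule grid_degree_homotopy [OF b st(1) b1])
      fix \<theta>
      show "q \<theta> \<in> span (b ` {..p})" if "\<theta> \<in> {s..t} \<times> span (b ` {..p})"
        unfolding bE by (rule qE) (use that bE in auto)
      assume th: "\<theta> \<in> frontier \<Omega>1 \<inter> {s..t} \<times> span (b ` {..p})"
      have Q\<theta>: "\<theta> \<in> Q" by (rule fr1) (use th st(2) in auto)
      then show "q \<theta> \<noteq> 0" by (rule qnz)
      show "continuous (at \<theta> within {s..t} \<times> span (b ` {..p})) q"
        by (rule continuous_at_imp_continuous_at_within, rule qc) (use Q\<theta> QY in blast)
    qed

    \<comment> \<open>Comparison of the degrees of the slices\<close>
    define D1 where "D1 m n = grid_degree b p m (\<lambda>x. q (\<mu> n, x)) {x. (\<mu> n, x) \<in> \<Omega>1}" for m n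
    define D2 where "D2 m n = grid_degree b p m (\<lambda>x. q (\<mu> n, x)) {x. (\<mu> n, x) \<in> \<Omega>}" for m n
    obtain R where R: "\<And>\<theta>. \<theta> \<in> \<Omega> \<Longrightarrow> norm \<theta> \<le> R" using \<Omega>(2) by (auto simp: bounded_iff)
    have far: "{x. (t, x) \<in> \<Omega>1} = {}" if "R < \<bar>t\<bar>" for t
    proof -
      have "(t, x) \<notin> \<Omega>" for x using R [of "(t, x)"] norm_fst_le [of t x] that by force
      then show ?thesis by (auto simp: \<Omega>1_def)
    qed
    have ev2: "\<forall>\<^sub>F m in sequentially. D2 m (n - 1) = D2 m n" if nB: "n \<in> B" for n
      unfolding D2_def
      by (rule hom2) (use mono [of "n - 1" n] nB B in \<open>auto simp: H_def\<close>)
    have ev1: "\<forall>\<^sub>F m in sequentially. D1 m (n - 1) = D1 m n" if nB: "n \<in> {n\<^sub>0..n\<^sub>1} - B" for n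
      unfolding D1_def
      by (rule hom1) (use mono [of "n - 1" n] muG [of _ n] nB in auto)
    have evl: "\<forall>\<^sub>F m in sequentially. D1 m (n\<^sub>0 - 1) = 0"
    proof -
      \<comment> \<open>Beyond the bound \<open>R\<close> of \<open>\<Omega>\<close> the slice is
        empty and has degree 0; \<open>G\<close> contains no parameter on the way there.\<close>
      define t where "t = - \<bar>R\<bar> - 1 - \<bar>\<mu> (n\<^sub>0 - 1)\<bar>"
      have t: "t \<le> \<mu> (n\<^sub>0 - 1)" "R < \<bar>t\<bar>" unfolding t_def by arith+
      have "\<forall>\<^sub>F m in sequentially. grid_degree b p m (\<lambda>x. q (t, x)) {x. (t, x) \<in> \<Omega>1} = D1 m (n\<^sub>0 - 1)"
        unfolding D1_def by (rule hom1 [OF t(1)]) (use leftG in auto)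
      then show ?thesis unfolding far [OF t(2)] grid_degree_empty by eventually_elim simp
    qed
    have evr: "\<forall>\<^sub>F m in sequentially. D1 m n\<^sub>1 = 0"
    proof -
      define t where "t = \<bar>R\<bar> + 1 + \<bar>\<mu> n\<^sub>1\<bar>"
      have t: "\<mu> n\<^sub>1 \<le> t" "R < \<bar>t\<bar>" unfolding t_def by arith+
      have "\<forall>\<^sub>F m in sequentially. D1 m n\<^sub>1 = grid_degree b p m (\<lambda>x. q (t, x)) {x. (t, x) \<in> \<Omega>1}"
        unfolding D1_def by (rule hom1 [OF t(1)]) (use rightG in auto)
      then show ?thesis unfolding far [OF t(2)] grid_degree_empty .
    qed
    have ball\<Omega>: "(\<mu> n, x) \<in> \<Omega>" if "n \<in> B \<or> n + 1 \<in> B" "norm x \<le> \<eta>" for n x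
      using that axis [of n "\<mu> n" x] axis [of "n + 1" "\<mu> n" x] mono [of "n - 1" n] mono [of n "n + 1"] B
      by auto
    have evM: "\<forall>\<^sub>F m in sequentially. D2 m n = D1 m n + deg_LS (M n)" if nB: "n \<in> B \<or> n + 1 \<in> B" for n
    proof -
      have nN: "n \<in> ?N" using nB B by auto
      have dec: "{x. (\<mu> n, x) \<in> \<Omega>} = {x. (\<mu> n, x) \<in> \<Omega>1} \<union> ball 0 \<eta>"
        using ball\<Omega> [OF nB] by (auto simp: \<Omega>1_def)
      have bs: "bounded {x. (\<mu> n, x) \<in> \<Omega>1}"
        by (rule boundedI [of _ R]) (use R norm_snd_le order_trans in \<open>fastforce simp: \<Omega>1_def\<close>)
      have Un: "D2 m n = D1 m n + grid_degree b p m (\<lambda>x. q (\<mu> n, x)) (ball 0 \<eta>)" if "0 < m" for m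
        unfolding D2_def D1_def dec
        by (rule grid_degree_Un [OF b bs _ that]) (auto simp: \<Omega>1_def)
      \<comment> \<open>The segment from the approximated map to the linear map \<open>M n\<close>;
        by \<open>lin\<close> and the choice of \<open>e'\<close> it has no zeros on the sphere of
        radius \<open>\<eta>\<close>.\<close>
      define h where "h \<theta> = snd \<theta> - ((1 - fst \<theta>) *\<^sub>R kt (\<mu> n, snd \<theta>) + fst \<theta> *\<^sub>R (snd \<theta> - M n (snd \<theta>)))" for \<theta> :: "real \<times> 'u"
      let ?\<Theta> = "{-1<..<2::real} \<times> ball (0::'u) \<eta>"
      have fr: "norm (snd \<theta>) = \<eta>" if \<theta>: "\<theta> \<in> frontier ?\<Theta>" "fst \<theta> \<in> {0..1}" for \<theta>
      proof -
        have "open ?\<Theta>" by (intro open_Times) auto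
        then have "\<theta> \<notin> ?\<Theta>" using \<theta>(1) by (simp add: frontier_def interior_open)
        moreover have "closure ?\<Theta> \<subseteq> UNIV \<times> cball 0 \<eta>"
          by (rule closure_minimal) (auto intro: closed_Times)
        ultimately show ?thesis using \<theta> by (cases \<theta>) (auto simp: frontier_def)
      qed
      have "\<forall>\<^sub>F m in sequentially. grid_degree b p m (\<lambda>x. h (0, x)) {x. (0, x) \<in> ?\<Theta>} = grid_degree b p m (\<lambda>x. h (1, x)) {x. (1, x) \<in> ?\<Theta>}"
      proof (rule grid_degree_homotopy [OF b])
        show "bounded ?\<Theta>" by (intro bounded_Times) auto
        fix \<theta>
        show "h \<theta> \<in> span (b ` {..p})" if "\<theta> \<in> {0..1} \<times> span (b ` {..p})"
          unfolding h_def bE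
          by (rule subspace_diff [OF E0(2) _ subspace_add [OF E0(2) subspace_scale [OF E0(2) ktE] subspace_scale [OF E0(2) ME [OF nN]]]])
            (use that bE in auto)
        assume th: "\<theta> \<in> frontier ?\<Theta> \<inter> {0..1} \<times> span (b ` {..p})"
        define s x where "s = fst \<theta>" and "x = snd \<theta>"
        have s: "0 \<le> s" "s \<le> 1" using th by (auto simp: s_def)
        have x: "norm x = \<eta>" using fr [of \<theta>] th by (auto simp: x_def)
        have xY: "(\<mu> n, x) \<in> Y" using ball\<Omega> [OF nB, of x] x Y(2) closure_subset by blast
        have "isCont (\<lambda>\<theta>. kt (\<mu> n, snd \<theta>)) \<theta>"
          by (rule isCont_o2 [where g = kt]) (use ktc xY in \<open>auto simp: x_def intro!: continuous_intros\<close>)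
        then have "isCont h \<theta>" unfolding h_def by (intro continuous_intros)
        then show "continuous (at \<theta> within {0..1} \<times> span (b ` {..p})) h"
          by (rule continuous_at_imp_continuous_at_within)
        show "h \<theta> \<noteq> 0"
        proof
          assume "h \<theta> = 0"
          then have "M n x = (1 - s) *\<^sub>R (kt (\<mu> n, x) - (x - M n x))"
            by (simp add: h_def s_def x_def algebra_simps)
          then have "norm (M n x) = norm ((1 - s) *\<^sub>R (kt (\<mu> n, x) - (x - M n x)))" by (rule arg_cong)
          also have "\<dots> \<le> norm (kt (\<mu> n, x) - (x - M n x))"
            using s mult_right_mono [of "1 - s" 1 "norm (kt (\<mu> n, x) - (x - M n x))"] by simp
          also have "\<dots> \<le> norm (kt (\<mu> n, x) - k (\<mu> n, x)) + norm (k (\<mu> n, x) - (x - M n x))"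
            using dist_triangle [of "kt (\<mu> n, x)" "x - M n x" "k (\<mu> n, x)"] by (simp only: dist_norm)
          also have "\<dots> < e' + norm (M n x) / 2"
            using near [OF xY] lin [OF nN, of x] x by (simp add: norm_minus_commute)
          finally have "norm (M n x) / 2 < e'" by simp
          then show False using lo(2) [OF nN, of x] e'(3) [OF nN] x by simp
        qed
      qed simp
      then have h: "\<forall>\<^sub>F m in sequentially. grid_degree b p m (\<lambda>x. q (\<mu> n, x)) (ball 0 \<eta>) = grid_degree b p m (M n) (ball 0 \<eta>)"
        by (simp add: h_def q_def ball_def)
      have inj: "x = 0" if "M n x = 0" for x
        using lo(2) [OF nN, of x] lo(1) [OF nN] that by (simp add: mult_le_0_iff)
      have intoE: "M n x \<in> E" if "x \<in> E" for x
        using subspace_diff [OF E0(2) that ME [OF nN, of x]] by simp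
      have g: "\<forall>\<^sub>F m in sequentially. grid_degree b p m (M n) (ball 0 \<eta>) = Brouwer_degree2 p (sphere_map b b p 1 (M n))"
        by (rule grid_degree_linear [OF b bE _ intoE inj eta])
          (auto intro: bounded_linear.linear blinfun.bounded_linear_right)
      have "deg_LS (M n) = brouwer_degree_ball E 1 (M n)"
        by (rule deg_LS_finite_rank [OF M(1) [OF nN] _ ME [OF nN]])
          (use finGG in \<open>auto simp: finite_dimensional_def E_def\<close>)
      also have "\<dots> = Brouwer_degree2 p (sphere_map b b p 1 (M n))"
      proof (rule brouwer_degree_ball_eq [OF b bE])
        show "M n x \<in> E - {0}" if "x \<in> E \<inter> sphere 0 1" for x using intoE [of x] inj [of x] that by auto
      qed (auto intro!: continuous_intros)
      finally have deg: "deg_LS (M n) = Brouwer_degree2 p (sphere_map b b p 1 (M n))" .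
      show ?thesis using h g eventually_gt_at_top [of 0]
        by eventually_elim (use Un deg in simp)
    qed
    have "\<forall>\<^sub>F m in sequentially. (\<forall>n\<in>B. D2 m (n - 1) = D2 m n) \<and> (\<forall>n\<in>{n\<^sub>0..n\<^sub>1} - B. D1 m (n - 1) = D1 m n) \<and>
       D1 m (n\<^sub>0 - 1) = 0 \<and> D1 m n\<^sub>1 = 0 \<and> (\<forall>n\<in>{n \<in> ?N. n \<in> B \<or> n + 1 \<in> B}. D2 m n = D1 m n + deg_LS (M n))"
    proof -
      \<comment> \<open>Each equality holds only on fine grids; there are finitely many of them, so
        one mesh \<open>m\<close> serves all.\<close>
      have "finite {n \<in> ?N. n \<in> B \<or> n + 1 \<in> B}" by (rule finite_subset [of _ ?N]) auto
      then show ?thesis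
        by (intro eventually_conj eventually_ball_finite ballI finB ev2 ev1 evl evr evM) auto
    qed
    from eventually_happens' [OF sequentially_bot this]
    obtain m where m: "\<forall>n\<in>B. D2 m (n - 1) = D2 m n" "\<forall>n\<in>{n\<^sub>0..n\<^sub>1} - B. D1 m (n - 1) = D1 m n"
       "D1 m (n\<^sub>0 - 1) = 0" "D1 m n\<^sub>1 = 0" "\<forall>n\<in>{n \<in> ?N. n \<in> B \<or> n + 1 \<in> B}. D2 m n = D1 m n + deg_LS (M n)"
      by (elim exE conjE)
    have "deg_LS (M n) - deg_LS (M (n - 1)) = D1 m (n - 1) - D1 m n" if nB: "n \<in> B" for n
    proof -
      have "n \<in> {n \<in> ?N. n \<in> B \<or> n + 1 \<in> B}" "n - 1 \<in> {n \<in> ?N. n \<in> B \<or> n + 1 \<in> B}" using nB B by auto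
      then have "D2 m n = D1 m n + deg_LS (M n)" "D2 m (n - 1) = D1 m (n - 1) + deg_LS (M (n - 1))" using m(5) by blast+
      then show ?thesis using m(1) nB by auto
    qed
    then have "(\<Sum>n\<in>B. deg_LS (M n) - deg_LS (M (n - 1))) = (\<Sum>n\<in>B. - (D1 m n - D1 m (n - 1)))"
      by (intro sum.cong) auto
    also have "\<dots> = - (\<Sum>n\<in>B. D1 m n - D1 m (n - 1))" by (rule sum_negf)
    also have "(\<Sum>n\<in>B. D1 m n - D1 m (n - 1)) = (\<Sum>n\<in>{n\<^sub>0..n\<^sub>1}. D1 m n - D1 m (n - 1))"
      by (rule sum.mono_neutral_left) (use B m(2) in auto)
    also have "\<dots> = 0" using sum_telescope_int [OF n, of "D1 m"] m(3,4) by simp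
    finally show ?thesis by simp
  qed
qed

subsection \<open>Families of intervals and the main result\<close>

lemma indices_interval:
  assumes "m \<in> indices r s" "n \<in> indices r s" "m \<le> i" "i \<le> n" shows "i \<in> indices r s"
  using assms by (cases r; cases s) (auto simp: indices_def)

lemma indices_succI:
  assumes "n \<in> indices r s" "n - 1 \<in> indices r s" shows "n \<in> indices (r + 1) s"
  using assms by (cases r; cases s) (auto simp: indices_def one_extended_def)

lemma open_real_between:
  fixes x :: real
  assumes "open S" "x \<in> S" obtains y z where "y \<in> S" "z \<in> S" "y < x" "x < z"
proof -
  obtain e where e: "0 < e" "ball x e \<subseteq> S" using assms open_contains_ball by metis
  have "x - e / 2 \<in> S" "x + e / 2 \<in> S" using e by (auto intro!: subsetD [OF e(2)] simp: dist_real_def)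
  then show thesis using that e(1) by auto
qed

text \<open>The intervals are open, so \<open>Sup\<close> and \<open>Inf\<close> are not attained.
  This makes the first inclusion strict and keeps the gap off the whole family, even when it is a
  single point.\<close>

lemma gap_properties:
  assumes adm: "admissible_family L r s J" and n: "n \<in> indices (r + 1) s" and x: "x \<in> J (n - 1)" and y: "y \<in> J n"
  shows "gap J n \<subseteq> {x<..<y}" "gap J n \<inter> (\<Union>m\<in>indices r s. J m) = {}"
    "{x..y} - (\<Union>m\<in>indices r s. J m) \<subseteq> gap J n"
proof -
  have I: "n \<in> indices r s" "n - 1 \<in> indices r s" using indices_succ [OF n] by auto
  have J: "open (J m)" "is_interval (J m)" "J m \<noteq> {}" if "m \<in> indices r s" for m
    using adm that by (auto simp: admissible_family_def)
  have less: "u < v" if "u \<in> J m" "v \<in> J m'" "m < m'" "m \<in> indices r s" "m' \<in> indices r s" for u v m m'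
    using admissible_family_less [OF adm that(4,5,3,1,2)] .
  have bda: "bdd_above (J (n - 1))" by (rule bdd_aboveI [of _ y]) (use less [OF _ y] I in force)
  have bdb: "bdd_below (J n)" by (rule bdd_belowI [of _ x]) (use less [OF x] I in force)
  have Sup: "u < Sup (J (n - 1))" if u: "u \<in> J (n - 1)" for u
  proof -
    obtain v z where "z \<in> J (n - 1)" "u < z" by (rule open_real_between [OF J(1) [OF I(2)] u])
    then show ?thesis using cSup_upper [OF _ bda] by fastforce
  qed
  have Inf: "Inf (J n) < u" if u: "u \<in> J n" for u
  proof -
    obtain v z where "v \<in> J n" "v < u" by (rule open_real_between [OF J(1) [OF I(1)] u])
    then show ?thesis using cInf_lower [OF _ bdb] by fastforce
  qed
  show "gap J n \<subseteq> {x<..<y}" using Sup [OF x] Inf [OF y] by (auto simp: gap_def)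
  show "gap J n \<inter> (\<Union>m\<in>indices r s. J m) = {}"
  proof (rule ccontr)
    assume "gap J n \<inter> (\<Union>m\<in>indices r s. J m) \<noteq> {}"
    then obtain t m where t: "Sup (J (n - 1)) \<le> t" "t \<le> Inf (J n)" and m: "m \<in> indices r s" "t \<in> J m"
      by (auto simp: gap_def)
    consider "m < n - 1" | "m = n - 1" | "m = n" | "n < m" by linarith
    then show False
    proof cases
      case 1 then show False using less [OF m(2) x] m I Sup [OF x] t by auto
    next
      case 2 then show False using Sup [of t] m t by auto
    next
      case 3 then show False using Inf [of t] m t by auto
    next
      case 4 then show False using less [OF y m(2)] m I Inf [OF y] t by auto
    qed
  qed
  show "{x..y} - (\<Union>m\<in>indices r s. J m) \<subseteq> gap J n"
  proof
    fix t assume t: "t \<in> {x..y} - (\<Union>m\<in>indices r s. J m)"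
    then have nt: "t \<notin> J n" "t \<notin> J (n - 1)" using I by auto
    have le: "v \<le> t" if v: "v \<in> J (n - 1)" for v
    proof (rule ccontr)
      assume "\<not> v \<le> t"
      then have "t \<in> J (n - 1)" by (intro mem_is_interval_1_I [OF J(2) [OF I(2)] x v]) (use t in auto)
      then show False using nt by blast
    qed
    have ge: "t \<le> v" if v: "v \<in> J n" for v
    proof (rule ccontr)
      assume "\<not> t \<le> v"
      then have "t \<in> J n" by (intro mem_is_interval_1_I [OF J(2) [OF I(1)] v y]) (use t in auto)
      then show False using nt by blast
    qed
    show "t \<in> gap J n"
      unfolding gap_def atLeastAtMost_iff
      by (intro conjI cSup_least [OF J(3) [OF I(2)] le] cInf_greatest [OF J(3) [OF I(1)] ge])
  qed
qed

text \<open>Each interval lies entirely on one side of \<open>t\<close>. If both sides occur, a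
  discrete intermediate value argument finds consecutive indices where the side changes.\<close>

lemma outside_family_cases:
  assumes adm: "admissible_family L r s J" and t: "t \<notin> (\<Union>m\<in>indices r s. J m)"
  obtains n where "n \<in> indices (r + 1) s" "t \<in> gap J n"
  | "\<And>n y. n \<in> indices r s \<Longrightarrow> y \<in> J n \<Longrightarrow> t < y"
  | "\<And>n y. n \<in> indices r s \<Longrightarrow> y \<in> J n \<Longrightarrow> y < t"
proof -
  define above where "above n \<longleftrightarrow> (\<forall>y\<in>J n. t < y)" for n
  have J: "is_interval (J m)" "J m \<noteq> {}" if "m \<in> indices r s" for m
    using adm that by (auto simp: admissible_family_def)
  have below: "y < t" if n: "n \<in> indices r s" "\<not> above n" "y \<in> J n" for n y
  proof (rule ccontr)
    assume y: "\<not> y < t"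
    obtain x where x: "x \<in> J n" "x \<le> t" using n(2) by (auto simp: above_def)
    have "t \<in> J n" by (rule mem_is_interval_1_I [OF J(1) [OF n(1)] x(1) n(3) x(2)]) (use y in simp)
    then show False using t n(1) by blast
  qed
  show thesis
  proof (cases "(\<exists>a\<in>indices r s. \<not> above a) \<and> (\<exists>c\<in>indices r s. above c)")
    case False
    then show thesis
    proof (cases "\<exists>a\<in>indices r s. \<not> above a")
      case True
      then have "\<And>n. n \<in> indices r s \<Longrightarrow> \<not> above n" using False by blast
      then show thesis using that(3) below by blast
    next
      case False
      then show thesis using that(2) by (auto simp: above_def)
    qed
  next
    case True
    then obtain a c where ac: "a \<in> indices r s" "\<not> above a" "c \<in> indices r s" "above c" by blast
    have "a < c"
    proof (rule ccontr)
      assume "\<not> a < c"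
      moreover have "a \<noteq> c" using ac by blast
      ultimately have "c < a" by simp
      obtain x y where xy: "x \<in> J a" "y \<in> J c" using J(2) ac by blast
      have "y < x" using admissible_family_less [OF adm ac(3,1) \<open>c < a\<close> xy(2,1)] .
      then show False using below [OF ac(1,2) xy(1)] ac(4) xy(2) by (force simp: above_def)
    qed
    then have "above c \<longrightarrow> (\<exists>n. a < n \<and> n \<le> c \<and> \<not> above (n - 1) \<and> above n)"
    proof (induction c rule: int_gr_induct)
      case base
      then show ?case using ac(2) by (intro impI exI [of _ "a + 1"]) auto
    next
      case (step i)
      show ?case
      proof (cases "above i")
        case True
        then obtain n where "a < n \<and> n \<le> i \<and> \<not> above (n - 1) \<and> above n" using step by blast
        then show ?thesis by (intro impI exI [of _ n]) auto
      next
        case False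
        then show ?thesis using step by (intro impI exI [of _ "i + 1"]) auto
      qed
    qed
    then obtain n where n: "a < n" "n \<le> c" "\<not> above (n - 1)" "above n" using ac(4) by blast
    have I: "n \<in> indices r s" "n - 1 \<in> indices r s"
      using indices_interval [OF ac(1,3), of n] indices_interval [OF ac(1,3), of "n - 1"] n by auto
    have "t \<in> gap J n"
      unfolding gap_def atLeastAtMost_iff
    proof
      show "Sup (J (n - 1)) \<le> t" by (rule cSup_least [OF J(2) [OF I(2)] less_imp_le [OF below [OF I(2) n(3)]]])
      show "t \<le> Inf (J n)" by (rule cInf_greatest [OF J(2) [OF I(1)]]) (use n(4) in \<open>simp add: above_def less_imp_le\<close>)
    qed
    then show thesis by (rule that(1) [OF indices_succI [OF I]])
  qed
qed

lemma nontrivial_solutions_eq: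
  assumes "\<And>t. F (t, 0) = 0"
  shows "nontrivial_solutions F r s J = {\<theta>. F \<theta> = 0} - (\<Union>n\<in>indices r s. J n) \<times> {0}"
  using assms by (auto simp: nontrivial_solutions_def)

text \<open>At an axis point inside some \<open>J n\<close> the derivative is invertible; the
  increment estimate with correction 0 then shows that all zeros of \<open>F\<close> nearby lie on
  the axis, over \<open>J n\<close>, where they are not counted. At other points of the complement
  \<open>F\<close> does not vanish.\<close>

lemma closed_nontrivial_solutions:
  fixes F :: "real \<times> 'u::banach \<Rightarrow> 'v::banach"
  assumes C1: "C1_map F" and F2: "\<And>t. F (t, 0) = 0" and adm: "admissible_family (\<lambda>t. D_u F (t, 0)) r s J"
  shows "closed (nontrivial_solutions F r s J)"
proof -
  let ?S = "nontrivial_solutions F r s J"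
  note S = nontrivial_solutions_eq [of F, OF F2]
  have nbhd: "\<exists>T. open T \<and> \<theta> \<in> T \<and> T \<subseteq> - ?S" if \<theta>: "\<theta> \<in> - ?S" for \<theta>
  proof (cases "F \<theta> = 0")
    case False
    have "open {\<theta>. F \<theta> \<noteq> 0}" by (intro open_Collect_neq continuous_on_C1_map [OF C1] continuous_on_const)
    then show ?thesis using False by (intro exI [of _ "{\<theta>. F \<theta> \<noteq> 0}"]) (auto simp: S)
  next
    case True
    then obtain t n where tn: "\<theta> = (t, 0)" "n \<in> indices r s" "t \<in> J n" using \<theta> by (auto simp: S)
    have "D_u F \<theta> \<in> GL" using adm tn by (auto simp: admissible_family_def spectrum_family_def)
    then obtain m where m: "m > 0" "\<And>x. m * norm x \<le> norm (D_u F \<theta> x)" using GL_lower_bound by metis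
    have m2: "0 < m / 2" using m by simp
    obtain \<rho> where \<rho>: "0 < \<rho>" "\<And>\<theta>' u u'. dist \<theta>' \<theta> < \<rho> \<Longrightarrow> dist u (snd \<theta>) \<le> \<rho> \<Longrightarrow> dist u' (snd \<theta>) \<le> \<rho> \<Longrightarrow>
      norm (corrected_map F (\<lambda>_. 0) \<theta>' u - corrected_map F (\<lambda>_. 0) \<theta>' u' - (D_u F \<theta> + 0) (u - u')) \<le> m / 2 * norm (u - u')"
      by (rule corrected_map_increment [OF C1 continuous_on_const m2]) (rule that, assumption+)
    have inj: "u = 0" if u: "dist (t', u) \<theta> < \<rho>" "F (t', u) = 0" for t' u
    proof -
      have d: "dist u (snd \<theta>) < \<rho>" using u(1) dist_snd_le [of "(t', u)" \<theta>] by simp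
      then have "norm (D_u F \<theta> u) \<le> m / 2 * norm u"
        using \<rho>(2) [OF u(1), of u 0] u(2) tn(1) \<rho>(1) F2 by (simp add: corrected_map_def)
      then have "m * norm u \<le> m / 2 * norm u" using m(2) [of u] by simp
      then have "m * norm u \<le> 0" by simp
      then show ?thesis using m(1) by (simp add: mult_le_0_iff)
    qed
    have opJ: "open (J n)" using adm tn(2) by (auto simp: admissible_family_def)
    show ?thesis
    proof (intro exI [of _ "ball \<theta> \<rho> \<inter> J n \<times> UNIV"] conjI)
      show "open (ball \<theta> \<rho> \<inter> J n \<times> UNIV)" by (intro open_Int open_Times opJ) auto
      show "\<theta> \<in> ball \<theta> \<rho> \<inter> J n \<times> UNIV" using tn \<rho>(1) by auto
      show "ball \<theta> \<rho> \<inter> J n \<times> UNIV \<subseteq> - ?S"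
      proof
        fix z assume z: "z \<in> ball \<theta> \<rho> \<inter> J n \<times> UNIV"
        then have "snd z = 0" if "F z = 0" using inj [of "fst z" "snd z"] that by (auto simp: dist_commute)
        then show "z \<in> - ?S" using z tn(2) by (auto simp: S)
      qed
    qed
  qed
  have "open (- ?S)" by (subst open_subopen) (rule ballI, rule nbhd)
  then show ?thesis by (simp add: closed_def)
qed

lemma compact_closed_separated:
  fixes K T :: "'a::metric_space set"
  assumes K: "compact K" and T: "closed T" "K \<inter> T = {}"
  obtains r where "0 < r" "\<And>p \<theta>. p \<in> K \<Longrightarrow> \<theta> \<in> T \<Longrightarrow> r \<le> dist \<theta> p"
proof -
  obtain r where r: "0 < r" "\<And>p \<theta>. p \<in> K \<Longrightarrow> dist \<theta> p < r \<Longrightarrow> \<theta> \<notin> T"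
  proof (rule compact_uniform_radius [OF K, where Q = "\<lambda>r \<theta>. \<theta> \<notin> T"])
    fix p assume "p \<in> K"
    then have "p \<in> - T" using T(2) by blast
    moreover have "open (- T)" using T(1) by (rule open_Compl)
    ultimately obtain r where "0 < r" "ball p r \<subseteq> - T" using open_contains_ball by metis
    then show "\<exists>r>0. \<forall>\<theta>. dist \<theta> p < r \<longrightarrow> \<theta> \<notin> T" by (intro exI [of _ r]) (auto simp: dist_commute subset_iff)
  qed (auto intro: that)
  show thesis by (rule that [OF r(1)]) (use r(2) in force)
qed

theorem theorem5p9:
  fixes F :: "real \<times> 'u::banach \<Rightarrow> 'v::banach"
    and L :: "real \<Rightarrow> ('u \<Rightarrow>\<^sub>L 'v)"
    and r s :: "int extended"
    and J :: "int \<Rightarrow> real set"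
    and \<mu> :: "int \<Rightarrow> real"
    and a :: "int \<Rightarrow> int"
    and C :: "(real \<times> 'u) set"
  assumes C1: "C1_map F"
    and F1: "orientable_on UNIV (D_u F)"
    and F2: "\<forall>t. F (t, 0) = 0"
    and F3: "\<forall>t u. D_u F (t, u) \<in> Fredholm0"
    and F4: "proper_on_bounded_closed F"
    and L: "\<forall>t. L t = D_u F (t, 0)"
    and J: "admissible_family L r s J"
    and signs: "parity_signs L r s J \<mu> a"
    and C: "C \<in> components (nontrivial_solutions F r s J)"
    and bdd: "bounded C"
  shows "(\<Sum>n\<in>bifurcation_indices r s J C. parity_map a n) = 0"
proof (cases "bifurcation_indices r s J C = {}")
  case False

  \<comment> \<open>The component and the base points\<close>
  define S where "S = nontrivial_solutions F r s J"
  define B where "B = bifurcation_indices r s J C"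
  have zero: "F (t, 0) = 0" for t using F2 by blast
  have Leq: "L = (\<lambda>t. D_u F (t, 0))" using L by blast
  have Seq: "S = {\<theta>. F \<theta> = 0} - (\<Union>n\<in>indices r s. J n) \<times> {0}"
    unfolding S_def by (rule nontrivial_solutions_eq [of F, OF zero])
  have CS: "C \<in> components S" using C by (simp add: S_def)
  have Ssub: "C \<subseteq> S" using CS in_components_subset by blast
  have Scl: "closed S" unfolding S_def using closed_nontrivial_solutions [OF C1 zero] J by (simp add: Leq)
  have Sco: "compact (S \<inter> cball 0 R)" for R
  proof -
    have "compact {\<theta> \<in> cball 0 R. F \<theta> \<in> {0}}" 
      using F4 [unfolded proper_on_bounded_closed_def, rule_format, of "cball 0 R" "{0}"] by simp
    then have "compact (S \<inter> {\<theta> \<in> cball 0 R. F \<theta> \<in> {0}})" using Scl by (intro closed_Int_compact)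
    moreover have "S \<inter> {\<theta> \<in> cball 0 R. F \<theta> \<in> {0}} = S \<inter> cball 0 R" by (auto simp: Seq)
    ultimately show ?thesis by simp
  qed
  have finB: "finite B" unfolding B_def by (rule finite_bifurcation_indices [OF J bdd])
  have neB: "B \<noteq> {}" using False by (simp add: B_def)
  define n0 n1 where "n0 = Min B" and "n1 = Max B"
  have B01: "B \<subseteq> {n0..n1}" using finB by (auto simp: n0_def n1_def)
  have n01: "n0 \<le> n1" "n0 \<in> B" "n1 \<in> B" using finB neB by (auto simp: n0_def n1_def)
  have BI: "n \<in> indices (r + 1) s" if "n \<in> B" for n using that by (simp add: B_def bifurcation_indices_def)
  have I: "n \<in> indices r s" if "n \<in> {n0 - 1..n1}" for n
    using indices_interval [of "n0 - 1" r s n1 n] indices_succ [OF BI [OF n01(2)]] indices_succ [OF BI [OF n01(3)]] that by auto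
  have I': "n \<in> indices (r + 1) s" if "n \<in> {n0..n1}" for n
    using that by (intro indices_succI I) auto
  have mu: "\<mu> n \<in> J n" if "n \<in> {n0 - 1..n1}" for n using signs I [OF that] by (simp add: parity_signs_def)
  have LGL: "L (\<mu> n) \<in> GL" if "n \<in> {n0 - 1..n1}" for n
    using J mu [OF that] I [OF that] by (auto simp: admissible_family_def spectrum_family_def)
  have mono: "\<mu> m \<le> \<mu> n" if "n0 - 1 \<le> m" "m \<le> n" "n \<le> n1" for m n
  proof (cases "m = n")
    case False
    have "\<mu> m < \<mu> n"
      by (rule admissible_family_less [OF J I I _ mu mu]) (use that False in auto)
    then show ?thesis by simp
  qed simp
  have gapn: "gap J n \<subseteq> {\<mu> (n - 1)<..<\<mu> n}" "gap J n \<inter> (\<Union>m\<in>indices r s. J m) = {}"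
    "{\<mu> (n - 1)..\<mu> n} - (\<Union>m\<in>indices r s. J m) \<subseteq> gap J n" if n: "n \<in> {n0..n1}" for n
    using gap_properties [OF J I' [OF n] mu mu] n by auto
  \<comment> \<open>A gap is connected and consists of points of \<open>S\<close>, so a component
    that touches it contains it.\<close>
  have gapC: "gap J n \<times> {0} \<subseteq> C" if n: "n \<in> B" for n
  proof (rule components_maximal [OF CS])
    show "connected (gap J n \<times> {0::'u})" by (intro connected_Times) (auto simp: gap_def)
    have nI: "n \<in> {n0..n1}" using n B01 by blast
    show "gap J n \<times> {0} \<subseteq> S" using gapn(2) [OF nI] by (auto simp: Seq zero)
    have "(gap J n \<times> {0}) \<inter> C \<noteq> {}" using n unfolding B_def bifurcation_indices_def by simp
    then show "C \<inter> gap J n \<times> {0} \<noteq> {}" by (subst Int_commute)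
  qed

  \<comment> \<open>The component on the axis\<close>
  obtain R where R: "\<And>p. p \<in> C \<Longrightarrow> norm p \<le> R" using bdd by (auto simp: bounded_iff)
  define G where "G = (\<Union>n\<in>B. {\<mu> (n - 1)<..<\<mu> n})"
  have axisC: "t \<in> G" if tC: "(t, 0) \<in> C" for t
  proof -
    have tJ: "t \<notin> (\<Union>m\<in>indices r s. J m)" using tC Ssub by (auto simp: Seq)
    \<comment> \<open>An unbounded half-line of axis points outside the family would belong to
      \<open>C\<close> together with \<open>t\<close>, against boundedness. This excludes the ends
      and leaves only gaps.\<close>
    have half: False if T: "connected T" "t \<in> T" "T \<inter> (\<Union>m\<in>indices r s. J m) = {}" "t' \<in> T" "R < \<bar>t'\<bar>" for T t'
    proof -
      have "T \<times> {0::'u} \<subseteq> C"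
      proof (rule components_maximal [OF CS])
        show "connected (T \<times> {0::'u})" by (intro connected_Times T(1)) auto
        show "T \<times> {0} \<subseteq> S" using T(3) by (auto simp: Seq zero)
        show "C \<inter> T \<times> {0} \<noteq> {}" using T(2) tC by blast
      qed
      then have "norm (t', 0::'u) \<le> R" using R T(4) by blast
      then show False using T(5) by (simp add: norm_Pair)
    qed
    show ?thesis
    proof (rule outside_family_cases [OF J tJ])
      fix n assume n: "n \<in> indices (r + 1) s" "t \<in> gap J n"
      then have nB: "n \<in> B" using tC unfolding B_def bifurcation_indices_def by blast
      then have nI: "n \<in> {n0..n1}" using B01 by blast
      show "t \<in> G" using gapn(1) [OF nI] n(2) nB unfolding G_def by blast
    next
      assume lt: "\<And>n y. n \<in> indices r s \<Longrightarrow> y \<in> J n \<Longrightarrow> t < y"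
      have dis: "{..t} \<inter> (\<Union>m\<in>indices r s. J m) = {}" using lt by fastforce
      have "R < \<bar>min t (- \<bar>R\<bar> - 1)\<bar>" by arith
      then show "t \<in> G" using half [OF _ _ dis, of "min t (- \<bar>R\<bar> - 1)"] by (auto intro: convex_connected)
    next
      assume lt: "\<And>n y. n \<in> indices r s \<Longrightarrow> y \<in> J n \<Longrightarrow> y < t"
      have dis: "{t..} \<inter> (\<Union>m\<in>indices r s. J m) = {}" using lt by fastforce
      have "R < \<bar>max t (\<bar>R\<bar> + 1)\<bar>" by arith
      then show "t \<in> G" using half [OF _ _ dis, of "max t (\<bar>R\<bar> + 1)"] by (auto intro: convex_connected)
    qed
  qed
  have Gop: "open G" unfolding G_def by auto
  \<comment> \<open>\<open>W\<close> excludes exactly the axis points outside \<open>G\<close>, so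
    any neighbourhood \<open>A\<close> inside \<open>W\<close> meets the axis over \<open>G\<close>
    only.\<close>
  define W where "W = - ((- G) \<times> {0::'u})"
  have Wop: "open W" unfolding W_def using Gop by (intro open_Compl closed_Times) (auto simp: closed_Compl)
  have CW: "C \<subseteq> W" using axisC by (auto simp: W_def)
  obtain A where A: "compact A" "C \<subseteq> A" "A \<subseteq> W" "A \<subseteq> S" "closed (S - A)"
    by (rule compact_open_component_neighbourhood [OF Scl Sco CS bdd Wop CW]) (rule that, assumption+)
  \<comment> \<open>By compactness the same holds for all points of \<open>A\<close> that are close
    to the axis.\<close>
  obtain \<eta>1 where eta1: "0 < \<eta>1" "\<And>t x. (t, x) \<in> A \<Longrightarrow> norm x < \<eta>1 \<Longrightarrow> t \<in> G"
  proof -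
    have c: "compact (A \<inter> (- G) \<times> UNIV)"
      using Gop by (intro compact_Int_closed A(1) closed_Times) (auto simp: closed_Compl)
    have d: "A \<inter> (- G) \<times> UNIV \<inter> UNIV \<times> {0} = {}" using A(3) by (auto simp: W_def)
    have cl: "closed (UNIV \<times> {0::'u} :: (real \<times> 'u) set)" by (intro closed_Times) auto
    obtain e where e: "0 < e" "\<And>p \<theta>. p \<in> A \<inter> (- G) \<times> UNIV \<Longrightarrow> \<theta> \<in> UNIV \<times> {0} \<Longrightarrow> e \<le> dist \<theta> p"
      by (rule compact_closed_separated [OF c cl d]) (rule that, assumption+)
    have "t \<in> G" if tx: "(t, x) \<in> A" "norm x < e" for t x
    proof (rule ccontr)
      assume "t \<notin> G"
      then have "e \<le> dist (t, 0) (t, x)" using tx by (intro e(2)) auto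
      then show False using tx(2) by (simp add: dist_Pair_Pair dist_norm)
    qed
    then show thesis using that e(1) by blast
  qed

  \<comment> \<open>Reduction near the neighbourhood and the axis segment\<close>
  define H where "H = (\<Union>n\<in>B. {\<mu> (n - 1)..\<mu> n})"
  \<comment> \<open>The whole axis segment from the first to the last base point is included, also
    where it runs through indices outside \<open>B\<close>, so that a single \<open>P\<close>
    relates the signs at all base points.\<close>
  define K where "K = A \<union> {\<mu> (n0 - 1)..\<mu> n1} \<times> {0}"
  \<comment> \<open>\<open>\<Omega>\<close> has to contain a tube around the axis over
    \<open>H\<close>, including the parts of \<open>H\<close> that lie in the intervals of the
    family and hence outside \<open>S\<close>.\<close>
  define A' where "A' = A \<union> H \<times> {0}"
  have Kc: "compact K" unfolding K_def by (intro compact_Un A(1) compact_Times) auto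
  have Hc: "compact H" unfolding H_def using finB by (intro compact_UN) auto
  have A'c: "compact A'" unfolding A'_def by (intro compact_Un A(1) compact_Times Hc) auto
  have Kzero: "K \<subseteq> F -` {0}" using A(4) by (auto simp: K_def Seq zero)
  have HI: "H \<subseteq> {\<mu> (n0 - 1)..\<mu> n1}"
  proof
    fix t assume "t \<in> H"
    then obtain n where n: "n \<in> B" "t \<in> {\<mu> (n - 1)..\<mu> n}" by (auto simp: H_def)
    then show "t \<in> {\<mu> (n0 - 1)..\<mu> n1}" using mono [of "n0 - 1" "n - 1"] mono [of n n1] B01 by fastforce
  qed
  have A'K: "A' \<subseteq> K" using HI by (auto simp: A'_def K_def)
  have F3': "D_u F p \<in> Fredholm0" for p using F3 by (cases p) auto
  obtain \<eta>0 k P Z where eta0: "0 < \<eta>0" and kc: "continuous_on {\<theta>. \<exists>p\<in>K. dist \<theta> p < \<eta>0} k"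
    and Z: "compact Z" "k ` {\<theta>. \<exists>p\<in>K. dist \<theta> p < \<eta>0} \<subseteq> Z"
    and kfix: "\<And>t x. (t, x) \<in> {\<theta>. \<exists>p\<in>K. dist \<theta> p < \<eta>0} \<Longrightarrow> k (t, x) = x \<longleftrightarrow> F (t, x) = 0"
    and P: "continuous_on {t. (t, 0) \<in> K} P" "\<And>t. (t, 0) \<in> K \<Longrightarrow> P t \<in> GL"
      "\<And>t. (t, 0) \<in> K \<Longrightarrow> finite_rank (id_blinfun - (P t o\<^sub>L D_u F (t, 0)))"
    and klin: "\<And>t e. (t, 0) \<in> K \<Longrightarrow> 0 < e \<Longrightarrow>
       \<exists>d>0. \<forall>x. norm x \<le> d \<longrightarrow> norm (k (t, x) - (x - P t (D_u F (t, 0) x))) \<le> e * norm x"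
    by (rule nonlinear_reduction [OF C1 zero F3' F4 Kc Kzero]) (rule that, assumption+)
  define Y where "Y = {\<theta>. \<exists>p\<in>K. dist \<theta> p < \<eta>0}"
  have "Y = (\<Union>p\<in>K. ball p \<eta>0)" by (auto simp: Y_def dist_commute)
  then have Yop: "open Y" by auto
  \<comment> \<open>A point of \<open>S\<close> on the axis over \<open>H\<close> lies in a gap of
    \<open>B\<close>, hence in \<open>C\<close> and in \<open>A\<close>.\<close>
  have sepd: "A' \<inter> (S - A) = {}"
  proof (rule ccontr)
    assume "A' \<inter> (S - A) \<noteq> {}"
    then obtain t where t: "t \<in> H" "(t, 0) \<in> S" "(t, 0) \<notin> A" by (auto simp: A'_def)
    then obtain n where n: "n \<in> B" "t \<in> {\<mu> (n - 1)..\<mu> n}" by (auto simp: H_def)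
    have "t \<notin> (\<Union>m\<in>indices r s. J m)" using t(2) by (auto simp: Seq)
    then have "t \<in> gap J n" using gapn(3) [of n] n B01 by blast
    then show False using gapC [OF n(1)] t(3) A(2) by blast
  qed
  obtain d where d: "0 < d" "\<And>p \<theta>. p \<in> A' \<Longrightarrow> \<theta> \<in> S - A \<Longrightarrow> d \<le> dist \<theta> p"
    by (rule compact_closed_separated [OF A'c A(5) sepd]) (rule that, assumption+)
  \<comment> \<open>Below \<open>d\<close> the neighbourhood meets no point of \<open>S\<close>
    outside \<open>A\<close>; below \<open>\<eta>0\<close> the reduction is available.\<close>
  define \<delta> where "\<delta> = min d \<eta>0 / 2"
  have \<delta>: "0 < \<delta>" "\<delta> < d" "\<delta> < \<eta>0" using d(1) eta0 by (auto simp: \<delta>_def)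
  have neA': "A' \<noteq> {}"
  proof -
    have "\<mu> n0 \<in> H" using n01 mono [of "n0 - 1" n0] by (auto simp: H_def)
    then show ?thesis by (auto simp: A'_def)
  qed
  define \<Omega> where "\<Omega> = {\<theta>. infdist \<theta> A' < \<delta>}"
  have \<Omega>op: "open \<Omega>" unfolding \<Omega>_def by (intro open_Collect_less continuous_intros)
  have "closure \<Omega> \<subseteq> {\<theta>. infdist \<theta> A' \<le> \<delta>}"
    by (rule closure_minimal) (auto simp: \<Omega>_def intro!: closed_Collect_le continuous_intros)
  then have cl\<Omega>: "\<exists>p\<in>A'. dist \<theta> p < c" if \<theta>: "\<theta> \<in> closure \<Omega>" and c: "\<delta> < c" for \<theta> c
  proof -
    have "infdist \<theta> A' < c" using \<theta> c \<open>closure \<Omega> \<subseteq> _\<close> by fastforce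
    then have "(INF p\<in>A'. dist \<theta> p) < c" using neA' by (simp add: infdist_notempty)
    then show ?thesis using neA' by (subst (asm) cInf_less_iff) (auto intro!: bdd_belowI [of _ 0])
  qed
  have \<Omega>b: "bounded \<Omega>"
  proof -
    obtain R' where R': "\<And>p. p \<in> A' \<Longrightarrow> norm p \<le> R'" using compact_imp_bounded [OF A'c] by (auto simp: bounded_iff)
    show ?thesis
    proof (rule boundedI)
      fix \<theta> assume "\<theta> \<in> \<Omega>"
      then obtain p where "p \<in> A'" "dist \<theta> p < d" using cl\<Omega> [of \<theta> d] closure_subset \<delta>(2) by blast
      then show "norm \<theta> \<le> R' + d" using R' [of p] norm_triangle_sub [of \<theta> p] by (simp add: dist_norm)
    qed
  qed
  have \<Omega>Y: "closure \<Omega> \<subseteq> Y" using cl\<Omega> [OF _ \<delta>(3)] A'K unfolding Y_def by blast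

  \<comment> \<open>Indices of the trivial solution at the base points\<close>
  define M where "M n = P (\<mu> n) o\<^sub>L L (\<mu> n)" for n
  have muK: "(\<mu> n, 0) \<in> K" if "n \<in> {n0 - 1..n1}" for n
    using mono [of "n0 - 1" n] mono [of n n1] that by (auto simp: K_def)
  have MGL: "M n \<in> GL" if "n \<in> {n0 - 1..n1}" for n
    unfolding M_def by (intro GL_compose P(2) muK LGL that)
  have Mfr: "finite_rank (id_blinfun - M n)" if "n \<in> {n0 - 1..n1}" for n
    unfolding M_def Leq by (rule P(3) [OF muK [OF that]])
  have "\<exists>d>0. \<forall>x. norm x \<le> d \<longrightarrow> norm (k (\<mu> n, x) - (x - M n x)) \<le> norm (M n x) / 2" if n: "n \<in> {n0 - 1..n1}" for n
  proof -
    obtain m where m: "m > 0" "\<And>x. m * norm x \<le> norm (M n x)" using GL_lower_bound [OF MGL [OF n]] by blast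
    have "0 < m / 2" using m by simp
    from klin [OF muK [OF n] this] obtain d where d: "0 < d"
      "\<And>x. norm x \<le> d \<Longrightarrow> norm (k (\<mu> n, x) - (x - M n x)) \<le> m / 2 * norm x"
      by (auto simp: M_def Leq)
    have "norm (k (\<mu> n, x) - (x - M n x)) \<le> norm (M n x) / 2" if "norm x \<le> d" for x
      using d(2) [OF that] m(2) [of x] by simp
    then show ?thesis using d(1) by blast
  qed
  then obtain dn where dn: "\<And>n. n \<in> {n0 - 1..n1} \<Longrightarrow> 0 < dn n"
    "\<And>n x. n \<in> {n0 - 1..n1} \<Longrightarrow> norm x \<le> dn n \<Longrightarrow> norm (k (\<mu> n, x) - (x - M n x)) \<le> norm (M n x) / 2"
    by metis
  \<comment> \<open>Below \<open>\<delta>\<close> the tube over \<open>H\<close> stays in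
    \<open>\<Omega>\<close>; below \<open>\<eta>1\<close> points of \<open>A\<close> near the axis
    lie over \<open>G\<close>; below \<open>dn n\<close> the linear part dominates at
    \<open>\<mu> n\<close>.\<close>
  define \<eta> where "\<eta> = Min (insert (\<delta> / 2) (insert (\<eta>1 / 2) (dn ` {n0 - 1..n1})))"
  have eta: "0 < \<eta>" unfolding \<eta>_def using \<delta>(1) eta1(1) dn(1) by (subst Min_gr_iff) auto
  have "\<eta> \<le> \<delta> / 2" "\<eta> \<le> \<eta>1 / 2" unfolding \<eta>_def by (rule Min_le; simp)+
  then have eta_lt: "\<eta> < \<delta>" "\<eta> < \<eta>1" using \<delta>(1) eta1(1) by auto
  have eta_dn: "\<eta> \<le> dn n" if "n \<in> {n0 - 1..n1}" for n
    unfolding \<eta>_def by (rule Min_le) (use that in auto)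
  have A\<Omega>: "A \<subseteq> \<Omega>" using \<delta>(1) by (auto simp: \<Omega>_def A'_def)
  define \<sigma> where "\<sigma> n = deg_LS (M n)" for n
  have "(\<Sum>n\<in>B. deg_LS (M n) - deg_LS (M (n - 1))) = 0"
  proof (rule index_sum_zero [OF \<Omega>op \<Omega>b Yop \<Omega>Y kc [folded Y_def] Z(1) Z(2) [folded Y_def] n01(1) B01 mono eta _ _ MGL Mfr])
    fix n t and x :: 'u assume n: "n \<in> B" "t \<in> {\<mu> (n - 1)..\<mu> n}" "norm x \<le> \<eta>"
    then have "(t, 0) \<in> A'" by (auto simp: A'_def H_def)
    then have "infdist (t, x) A' \<le> norm x" by (rule infdist_le2) (simp add: dist_Pair_Pair dist_norm)
    then show "(t, x) \<in> \<Omega>" using n(3) eta_lt by (simp add: \<Omega>_def)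
  next
    fix t and x :: 'u assume tx: "(t, x) \<in> closure \<Omega>" "k (t, x) = x" "x \<noteq> 0"
    have "F (t, x) = 0" using kfix [of t x] tx \<Omega>Y unfolding Y_def by blast
    then have txS: "(t, x) \<in> S" using tx(3) by (simp add: Seq)
    obtain p where p: "p \<in> A'" "dist (t, x) p < d" using cl\<Omega> [OF tx(1) \<delta>(2)] by blast
    have txA: "(t, x) \<in> A"
    proof (rule ccontr)
      assume "(t, x) \<notin> A"
      then show False using d(2) [OF p(1), of "(t, x)"] txS p(2) by simp
    qed
    then have "t \<in> G" if "\<not> \<eta> < norm x" using eta1(2) [OF txA] that eta_lt by simp
    then show "(t, x) \<in> \<Omega> \<and> (\<eta> < norm x \<or> (\<exists>n\<in>B. t \<in> {\<mu> (n - 1)<..<\<mu> n}))"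
      using txA A\<Omega> by (auto simp: G_def)
  next
    fix n and x :: 'u assume "n \<in> {n0 - 1..n1}" "norm x \<le> \<eta>"
    then show "norm (k (\<mu> n, x) - (x - M n x)) \<le> norm (M n x) / 2" using eta_dn [of n] dn(2) [of n x] by simp
  qed
  then have sum0: "(\<Sum>n\<in>B. \<sigma> n - \<sigma> (n - 1)) = 0" by (simp add: \<sigma>_def)

  \<comment> \<open>From the indices to the parity signs\<close>
  have \<sigma>: "\<sigma> n \<in> {-1, 1}" if n: "n \<in> {n0 - 1..n1}" for n
  proof -
    have "compact_op (- (id_blinfun - M n))" by (intro compact_op_uminus compact_op_finite_rank Mfr n)
    then have "M n \<in> GLc" using MGL [OF n] by (simp add: GLc_def)
    then show ?thesis unfolding \<sigma>_def by (rule deg_LS_sign)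
  qed
  have a_step: "a n = a (n - 1) * (\<sigma> (n - 1) * \<sigma> n)" if n: "n \<in> {n0..n1}" for n
  proof -
    have le: "\<mu> (n - 1) \<le> \<mu> n" by (rule mono) (use n in auto)
    have sub: "{\<mu> (n - 1)..\<mu> n} \<subseteq> {t. (t, 0) \<in> K}"
      using mono [of "n0 - 1" "n - 1"] mono [of n n1] n by (auto simp: K_def)
    have "parametrix L (\<mu> (n - 1)) (\<mu> n) P"
      unfolding parametrix_def
    proof (intro conjI ballI)
      show "continuous_on {\<mu> (n - 1)..\<mu> n} P" by (rule continuous_on_subset [OF P(1) sub])
      fix t assume "t \<in> {\<mu> (n - 1)..\<mu> n}"
      then have tK: "(t, 0) \<in> K" using sub by blast
      show "P t \<in> GL" by (rule P(2) [OF tK])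
      have "compact_op (- (id_blinfun - (P t o\<^sub>L L t)))"
        unfolding Leq by (intro compact_op_uminus compact_op_finite_rank P(3) tK)
      then show "compact_op ((P t o\<^sub>L L t) - id_blinfun)" by simp
    qed
    then have "path_parity L (\<mu> (n - 1)) (\<mu> n) = \<sigma> (n - 1) * \<sigma> n"
      unfolding \<sigma>_def M_def by (rule path_parity_eq [OF le]) (use LGL n in auto)
    then show ?thesis using signs I' [OF n] by (simp add: parity_signs_def)
  qed
  \<comment> \<open>\<open>a\<close> and \<open>\<sigma>\<close> obey the same recursion, so they
    differ by this constant sign, which also absorbs the normalisation of \<open>a\<close>.\<close>
  define c where "c = a (n0 - 1) * \<sigma> (n0 - 1)"
  have ac: "a n = c * \<sigma> n" if "n0 - 1 \<le> n" "n \<le> n1" for n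
    using that
  proof (induction n rule: int_ge_induct)
    case base
    then show ?case using \<sigma> [of "n0 - 1"] by (auto simp: c_def)
  next
    case (step i)
    then have "a (i + 1) = c * \<sigma> i * (\<sigma> i * \<sigma> (i + 1))" using a_step [of "i + 1"] by simp
    then show ?case using \<sigma> [of i] step by auto
  qed
  have "(\<Sum>n\<in>B. parity_map a n) = (\<Sum>n\<in>B. real_of_int (c * (\<sigma> n - \<sigma> (n - 1))) / 2)"
    using B01 by (intro sum.cong) (auto simp: parity_map_def ac right_diff_distrib)
  also have "\<dots> = real_of_int (\<Sum>n\<in>B. c * (\<sigma> n - \<sigma> (n - 1))) / 2" by (simp add: sum_divide_distrib)
  also have "\<dots> = 0" using sum0 by (simp only: sum_distrib_left [symmetric])
  finally show ?thesis by (simp add: B_def)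
qed simp

end
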